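(* Let $\tau\in\mathbb{H}$ and $\mathbf n=(n_0,n_1,n_2,n_3)$ with $n_k\in\mathbb Z_{\ge 0}$. Then the addition map $\sigma_{\mathbf n}(\cdot|\tau):\overline{\Gamma_{\mathbf n}(\tau)}\to E_\tau$ has degree $$\deg\sigma_{\mathbf n}(\cdot|\tau)=\sum_{k=0}^{3}\frac{n_k(n_k+1)}{2}.$$
   Context: $\mathbb H$ is the upper half plane; $\Lambda_\tau=\mathbb Z+\mathbb Z\tau$, $E_\tau=\mathbb C/\Lambda_\tau$, $[z]$ is the class of $z$ in $E_\tau$; $\omega_0=0$, $\omega_1=1$, $\omega_2=\tau$, $\omega_3=1+\tau$; $\wp,\zeta,\sigma$ are the Weierstrass functions of $\Lambda_\tau$ ($\zeta'=-\wp$, $\sigma'/\sigma=\zeta$). Consider the generalized Lamé equation $H(\mathbf n,B,\tau)$: $y''(z)=I_{\mathbf n}(z;B,\tau)y(z)$, where $I_{\mathbf n}(z;B,\tau)=\sum_{k=0}^3 n_k(n_k+1)\wp(z+\frac{\omega_k}{2}|\tau)+B$ and $B\in\mathbb C$. All its solutions are meromorphic in $\mathbb C$. Its second symmetric product equation $\Phi'''-4I_{\mathbf n}\Phi'-2I_{\mathbf n}'\Phi=0$ has, up to constants, a unique even elliptic solution, normalized as $$\hat\Phi_e(z;B)=\hat C_0(B)+\sum_{k=0}^3\sum_{j=0}^{n_k-1}\hat b^{(k)}_j(B)\,\wp(z+\tfrac{\omega_k}{2})^{n_k-j},$$ where $\hat C_0,\hat b_j^{(k)}$ are polynomials in $B$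 without common zeros, $\deg\hat C_0>\max\deg\hat b_j^{(k)}$, and the leading coefficient of $\hat C_0$ is $\frac12$. The expression $$Q_{\mathbf n}(B;\tau):=\hat\Phi_e'^2-2\hat\Phi_e\hat\Phi_e''+4I_{\mathbf n}\hat\Phi_e^2$$ is independent of $z$ and is a polynomial in $B$ of odd degree (the spectral polynomial). The spectral curve is $\Gamma_{\mathbf n}(\tau)=\{(B,\hat W)\in\mathbb C^2 : \hat W^2=Q_{\mathbf n}(B;\tau)\}$, and $\overline{\Gamma_{\mathbf n}(\tau)}=\Gamma_{\mathbf n}(\tau)\cup\{\infty\}$ is its completion by one point at infinity; the paper regards it as an irreducible (possibly singular) curve. For $(B,\hat W)\in\Gamma_{\mathbf n}(\tau)$ there is a solution $\hat y_1(z;B,\hat W)$ of $H(\mathbf n,B,\tau)$, unique up to sign, which is a common eigenfunction of the monodromy (translations by $\omega_1,\omega_2$), satisfies $\hat y_1(z)\hat y_1(-z)=\hat\Phi_e(z;B)$, and is such that the Wronskian of $\hat y_1(z)$ and $\hat y_1(-z)$ equals $\hat W$. Up to a constant $$\hat y_1(z;B,\hat W)=\frac{e^{cz}\prod_{i=1}^{\hat N}\sigma(z-a_i)}{\prod_{k=0}^3\sigma(z-\frac{\omega_k}{2})^{n_k}},\qquad \hat N=\sum_{k=0}^3 n_k,$$ for some $c\in\mathbb C$ and a multiset $\{[a_1],\dots,[a_{\hat N}]\}$ in $E_\tau$ that is uniquely determined by $(B,\hat W)$. The addition map is $$\sigma_{\mathbf n}(B,\hat W)=\sum_{i=1}^{\hat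 N}[a_i]-\sum_{k=1}^3[\tfrac{n_k\omega_k}{2}]\in E_\tau .$$ It extends to a morphism $\overline{\Gamma_{\mathbf n}(\tau)}\to E_\tau$ with $\sigma_{\mathbf n}(\infty)=0$. Its degree is $\#\sigma_{\mathbf n}^{-1}(z)$ for $z\in E_\tau$, counted with multiplicity (i.e. the number of preimages of a generic point). *)

theory Defs
  imports
    "HOL-Complex_Analysis.Complex_Analysis"
    "HOL-Complex_Analysis.Weierstrass_Factorization"
    "HOL-Computational_Algebra.Polynomial"
    "HOL-Library.Multiset"
begin

section \<open>Lattice, torus and Weierstrass functions\<close>

definition period_lattice :: "complex \<Rightarrow> complex set" where
  "period_lattice \<tau> = {of_int a + of_int b * \<tau> | a b. True}"

definition omega :: "complex \<Rightarrow> nat \<Rightarrow> complex" where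
  "omega \<tau> k = [0, 1, \<tau>, 1 + \<tau>] ! k"

text \<open>The points congruent to some \<open>\<omega>\<^sub>k/2\<close>, \<open>k = 0,\<dots>,3\<close>. The values that the functions below
  take there (some of which have poles) are arbitrary; all identities between functions of \<open>z\<close> are
  imposed off this discrete set only.\<close>
definition half_lattice :: "complex \<Rightarrow> complex set" where
  "half_lattice \<tau> = {z. 2 * z \<in> period_lattice \<tau>}"

definition lattice_rel :: "complex \<Rightarrow> (complex \<times> complex) set" where
  "lattice_rel \<tau> = {(z, w). z - w \<in> period_lattice \<tau>}"

definition torus :: "complex \<Rightarrow> complex set set" where
  "torus \<tau> = UNIV // lattice_rel \<tau>"

definition torus_class :: "complex \<Rightarrow> complex \<Rightarrow> complex set" where
  "torus_class \<tau> z = lattice_rel \<tau> `` {z}"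

definition wp :: "complex \<Rightarrow> complex \<Rightarrow> complex" where
  "wp \<tau> z = 1 / z ^ 2 + (\<Sum>\<^sub>\<infinity>\<omega>\<in>period_lattice \<tau> - {0}. 1 / (z - \<omega>) ^ 2 - 1 / \<omega> ^ 2)"

text \<open>The unordered product of the factors
  \<open>(1 - z/\<omega>) exp (z/\<omega> + (z/\<omega>)\<^sup>2/2)\<close> over the nonzero lattice points.\<close>
definition wsigma :: "complex \<Rightarrow> complex \<Rightarrow> complex" where
  "wsigma \<tau> z = z * Lim (finite_subsets_at_top (period_lattice \<tau> - {0}))
                       (\<lambda>F. \<Prod>\<omega>\<in>F. weierstrass_factor 2 (z / \<omega>))"

section \<open>The generalized Lame equation\<close>

text \<open>The tuple \<open>(n\<^sub>0, n\<^sub>1, n\<^sub>2, n\<^sub>3)\<close> is represented by a function \<open>n :: nat \<Rightarrow> nat\<close>, of which only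
  the values at \<open>k \<le> 3\<close> are used.\<close>

definition lame_potential :: "(nat \<Rightarrow> nat) \<Rightarrow> complex \<Rightarrow> complex \<Rightarrow> complex \<Rightarrow> complex" where
  "lame_potential n \<tau> B z =
     (\<Sum>k\<le>3. of_nat (n k * (n k + 1)) * wp \<tau> (z + omega \<tau> k / 2)) + B"

definition lame_solution ::
  "(nat \<Rightarrow> nat) \<Rightarrow> complex \<Rightarrow> complex \<Rightarrow> (complex \<Rightarrow> complex) \<Rightarrow> bool" where
  "lame_solution n \<tau> B y \<longleftrightarrow>
     y meromorphic_on UNIV \<and> y holomorphic_on - half_lattice \<tau> \<and>
     (\<forall>z. z \<notin> half_lattice \<tau> \<longrightarrow> deriv (deriv y) z = lame_potential n \<tau> B z * y z)"

section \<open>The normalized even elliptic solution and the spectral polynomial\<close>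

definition sym_product_solution ::
  "(nat \<Rightarrow> nat) \<Rightarrow> complex \<Rightarrow> complex \<Rightarrow> (complex \<Rightarrow> complex) \<Rightarrow> bool" where
  "sym_product_solution n \<tau> B \<phi> \<longleftrightarrow>
     \<phi> meromorphic_on UNIV \<and> \<phi> holomorphic_on - half_lattice \<tau> \<and>
     (\<forall>z. z \<notin> half_lattice \<tau> \<longrightarrow>
        (deriv ^^ 3) \<phi> z - 4 * lame_potential n \<tau> B z * deriv \<phi> z
          - 2 * deriv (lame_potential n \<tau> B) z * \<phi> z = 0)"

definition even_elliptic :: "complex \<Rightarrow> (complex \<Rightarrow> complex) \<Rightarrow> bool" where
  "even_elliptic \<tau> \<phi> \<longleftrightarrow> \<phi> meromorphic_on UNIV \<and>
     (\<forall>z. z \<notin> half_lattice \<tau> \<longrightarrow>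
        \<phi> (- z) = \<phi> z \<and> \<phi> (z + 1) = \<phi> z \<and> \<phi> (z + \<tau>) = \<phi> z)"

definition Phi_normalized ::
  "(nat \<Rightarrow> nat) \<Rightarrow> complex \<Rightarrow> (complex \<Rightarrow> complex \<Rightarrow> complex) \<Rightarrow> bool" where
  "Phi_normalized n \<tau> \<Phi> \<longleftrightarrow>
     (\<exists>(C :: complex poly) (b :: nat \<Rightarrow> nat \<Rightarrow> complex poly).
        \<Phi> = (\<lambda>B z. poly C B +
               (\<Sum>k\<le>3. \<Sum>j<n k. poly (b k j) B * wp \<tau> (z + omega \<tau> k / 2) ^ (n k - j))) \<and>
        (\<forall>B. sym_product_solution n \<tau> B (\<Phi> B) \<and> even_elliptic \<tau> (\<Phi> B)) \<and>
        (\<nexists>B. poly C B = 0 \<and> (\<forall>k\<le>3. \<forall>j<n k. poly (b k j) B = 0)) \<and>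
        (\<forall>k\<le>3. \<forall>j<n k. degree (b k j) < degree C) \<and>
        lead_coeff C = 1 / 2)"

definition Phi_e :: "(nat \<Rightarrow> nat) \<Rightarrow> complex \<Rightarrow> complex \<Rightarrow> complex \<Rightarrow> complex" where
  "Phi_e n \<tau> = (THE \<Phi>. Phi_normalized n \<tau> \<Phi>)"

definition spectral_poly :: "(nat \<Rightarrow> nat) \<Rightarrow> complex \<Rightarrow> complex poly" where
  "spectral_poly n \<tau> = (THE Q. \<forall>B z. z \<notin> half_lattice \<tau> \<longrightarrow>
     poly Q B = deriv (Phi_e n \<tau> B) z ^ 2
                - 2 * Phi_e n \<tau> B z * deriv (deriv (Phi_e n \<tau> B)) z
                + 4 * lame_potential n \<tau> B z * Phi_e n \<tau> B z ^ 2)"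

definition spectral_curve :: "(nat \<Rightarrow> nat) \<Rightarrow> complex \<Rightarrow> (complex \<times> complex) set" where
  "spectral_curve n \<tau> = {(B, W). W ^ 2 = poly (spectral_poly n \<tau>) B}"

text \<open>\<open>None\<close> is the point at infinity.\<close>
definition spectral_curve_closure ::
  "(nat \<Rightarrow> nat) \<Rightarrow> complex \<Rightarrow> (complex \<times> complex) option set" where
  "spectral_curve_closure n \<tau> = insert None (Some ` spectral_curve n \<tau>)"

section \<open>The addition map\<close>

definition wronskian :: "(complex \<Rightarrow> complex) \<Rightarrow> (complex \<Rightarrow> complex) \<Rightarrow> complex \<Rightarrow> complex" where
  "wronskian f g z = f z * deriv g z - deriv f z * g z"

definition monodromy_eigenfunction :: "complex \<Rightarrow> (complex \<Rightarrow> complex) \<Rightarrow> bool" where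
  "monodromy_eigenfunction \<tau> y \<longleftrightarrow> (\<exists>\<mu>\<^sub>1 \<mu>\<^sub>2. \<forall>z. z \<notin> half_lattice \<tau> \<longrightarrow>
     y (z + 1) = \<mu>\<^sub>1 * y z \<and> y (z + \<tau>) = \<mu>\<^sub>2 * y z)"

text \<open>\<open>y\<close> is one of the two functions \<open>\<plusminus>y\<^sub>1(\<cdot>; B, W)\<close>.\<close>
definition is_y1 ::
  "(nat \<Rightarrow> nat) \<Rightarrow> complex \<Rightarrow> complex \<Rightarrow> complex \<Rightarrow> (complex \<Rightarrow> complex) \<Rightarrow> bool" where
  "is_y1 n \<tau> B W y \<longleftrightarrow>
     lame_solution n \<tau> B y \<and> monodromy_eigenfunction \<tau> y \<and>
     (\<forall>z. z \<notin> half_lattice \<tau> \<longrightarrow>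
        y z * y (- z) = Phi_e n \<tau> B z \<and> wronskian y (\<lambda>u. y (- u)) z = W)"

text \<open>The multiset \<open>A\<close> consists of representatives \<open>a\<^sub>i\<close> of the classes \<open>[a\<^sub>i]\<close>; replacing a
  representative by a congruent one only changes \<open>c\<close> and the constant \<open>d\<close>.\<close>
definition sigma_factorization ::
  "(nat \<Rightarrow> nat) \<Rightarrow> complex \<Rightarrow> (complex \<Rightarrow> complex) \<Rightarrow> complex multiset \<Rightarrow> bool" where
  "sigma_factorization n \<tau> y A \<longleftrightarrow>
     size A = (\<Sum>k\<le>3. n k) \<and>
     (\<exists>c d. d \<noteq> 0 \<and> (\<forall>z. z \<notin> half_lattice \<tau> \<longrightarrow>
        y z = d * (exp (c * z) * (\<Prod>a\<in>#A. wsigma \<tau> (z - a))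
                    / (\<Prod>k\<le>3. wsigma \<tau> (z - omega \<tau> k / 2) ^ n k))))"

definition finite_addition_map ::
  "(nat \<Rightarrow> nat) \<Rightarrow> complex \<Rightarrow> complex \<Rightarrow> complex \<Rightarrow> complex set" where
  "finite_addition_map n \<tau> B W =
     (THE p. \<exists>y A. is_y1 n \<tau> B W y \<and> sigma_factorization n \<tau> y A \<and>
        p = torus_class \<tau> (\<Sum>\<^sub># A - (\<Sum>k=1..3. of_nat (n k) * omega \<tau> k / 2)))"

fun addition_map ::
  "(nat \<Rightarrow> nat) \<Rightarrow> complex \<Rightarrow> (complex \<times> complex) option \<Rightarrow> complex set" where
  "addition_map n \<tau> None = torus_class \<tau> 0"
| "addition_map n \<tau> (Some (B, W)) = finite_addition_map n \<tau> B W"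

section \<open>Degree\<close>

text \<open>The degree of a map between (complex algebraic) curves as the number of preimages of a generic
  point, that is, of all but finitely many points of the target. For a constant map it is \<open>0\<close>.\<close>
definition has_degree :: "('a \<Rightarrow> 'b) \<Rightarrow> 'a set \<Rightarrow> 'b set \<Rightarrow> nat \<Rightarrow> bool" where
  "has_degree f X Y d \<longleftrightarrow> f \<in> X \<rightarrow> Y \<and>
     finite {p \<in> Y. \<not> (finite {x \<in> X. f x = p} \<and> card {x \<in> X. f x = p} = d)}"

lemma has_degree_unique:
  assumes "has_degree f X Y d" "has_degree f X Y e" "infinite Y"
  shows "d = e"
proof (rule ccontr)
  assume "d \<noteq> e"
  let ?bad = "\<lambda>d. {p \<in> Y. \<not> (finite {x \<in> X. f x = p} \<and> card {x \<in> X. f x = p} = d)}"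
  have "Y \<subseteq> ?bad d \<union> ?bad e" using \<open>d \<noteq> e\<close> by auto
  moreover have "finite (?bad d \<union> ?bad e)"
    using assms(1,2) unfolding has_degree_def by blast
  ultimately show False using assms(3) finite_subset by blast
qed

end

theory Submission
 imports Defs "HOL-Computational_Algebra.Fundamental_Theorem_Algebra"
begin

text \<open>
 Let \<open>N = \<Sum> n\<^sub>k(n\<^sub>k + 1)/2\<close>. The logarithmic derivative of \<open>y\<^sub>1\<close> is \<open>(\<Phi>' - W)/(2\<Phi>)\<close>, and also \<open>c + \<Sum> \<zeta>(z - a\<^sub>i) - \<Sum> n\<^sub>k\<zeta>(z - \<omega>\<^sub>k/2)\<close>.
 Modulo \<open>2\<pi>i\<close>, its integrals over the periods \<open>1\<close> and \<open>\<tau>\<close> are therefore \<open>c - \<eta>\<^sub>1s\<close> and \<open>c\<tau> - \<eta>\<^sub>2s\<close>, where \<open>s\<close> represents the image of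
 \<open>(B, W)\<close>, and Legendre's relation recovers \<open>(s, c)\<close> up to the lattice (\<open>lift_congruent\<close>). But these integrals are also multiples
 of \<open>\<pi>i\<close> minus \<open>W\<close> times the half periods of \<open>1/\<Phi>\<close>. Hence locally \<open>s = s\<^sub>0 - W H(B)\<close> and \<open>c = c\<^sub>0 - W K(B)\<close> with a half period \<open>s\<^sub>0\<close>.
 Differentiating the definition of \<open>Q\<close> with respect to \<open>B\<close> yields \<open>Q'H/2 + QH' = A\<close>, where \<open>A\<close> is a combination of the periods of
 \<open>\<Phi>\<close> and so a polynomial, with leading term \<open>-N B\<^sup>g\<^sup>-\<^sup>1/2\<close> for \<open>g = deg C\<^sub>0\<close>; that is, \<open>ds = - A dB/W\<close> (\<open>chart\<close>, \<open>Ap_degree\<close>).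

 As \<open>s\<close> is odd in \<open>W\<close> modulo the lattice, the degree of the map is the number of solutions \<open>B\<close> of \<open>R(B) = v\<close> for generic \<open>v\<close>, where
 \<open>R(B) = \<wp>(s)\<close>. This function is meromorphic, and it is rational because \<open>R(B)/B \<rightarrow> 1/N\<^sup>2\<close> at infinity. To count its poles, consider
 \<open>T = -(c - \<zeta>(s)) A/W\<close>, which is \<open>KA - g'/(2g)\<close> for a holomorphic local denominator \<open>g\<close> of \<open>R\<close>: its residues are minus half the pole
 orders (\<open>local_orders\<close>). Since \<open>B T(B) \<rightarrow> -(N - 1)/2\<close> at infinity (\<open>behaviour_at_infinity\<close>), \<open>R\<close> has \<open>N - 1\<close> finite poles, and with the
 simple pole at infinity its degree is \<open>N\<close> (\<open>rational_from_local_orders\<close>).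

 The polynomial family \<open>\<Phi>\<close> itself is obtained from the formal solution of its equation in powers of \<open>1/B\<close>: the coefficients lie
 in a space of finite dimension, and a linear relation between them truncates the series (\<open>Sol_exists\<close>).
\<close>

section \<open>Sums over the lattice\<close>

text \<open>The finite partial sums converge locally uniformly, so their derivatives converge as well.\<close>
lemma infsum_holomorphic:
 fixes f :: "'i => complex => complex"
 assumes "open S" and holo: "\<And>i. i \<in> I ==> f i holomorphic_on S"
  and bound: "\<And>i z. i \<in> I ==> z \<in> S ==> norm (f i z) \<le> M i" and "M summable_on I"
  and "z \<in> S"
 shows "\<exists>D. DERIV (\<lambda>z. \<Sum>\<^sub>\<infinity>i\<in>I. f i z) z :> D \<and> ((\<lambda>i. deriv (f i) z) has_sum D) I"
proof -
 obtain r where r: "r > 0" "cball z r \<subseteq> S"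
  using \<open>open S\<close> \<open>z \<in> S\<close> open_contains_cball by blast
 have cont: "\<forall>\<^sub>F X in finite_subsets_at_top I. continuous_on (cball z r) (\<lambda>w. \<Sum>i\<in>X. f i w) \<and>
    (\<forall>w\<in>ball z r. DERIV (\<lambda>w. \<Sum>i\<in>X. f i w) w :> (\<Sum>i\<in>X. deriv (f i) w))"
 proof (rule eventually_finite_subsets_at_top_weakI)
  fix X assume X: "finite X" "X \<subseteq> I"
  have h: "f i holomorphic_on S" if "i \<in> X" for i using that X holo by auto
  have "(\<lambda>w. \<Sum>i\<in>X. f i w) holomorphic_on S" using h by (intro holomorphic_on_sum) auto
  hence "continuous_on (cball z r) (\<lambda>w. \<Sum>i\<in>X. f i w)"
   using r(2) holomorphic_on_imp_continuous_on continuous_on_subset by blast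
  moreover have "DERIV (\<lambda>w. \<Sum>i\<in>X. f i w) w :> (\<Sum>i\<in>X. deriv (f i) w)"
   if "w \<in> ball z r" for w
  proof (rule DERIV_sum)
   fix i assume "i \<in> X"
   have "w \<in> S" using that r(2) by auto
   thus "DERIV (f i) w :> deriv (f i) w"
    using h[OF \<open>i \<in> X\<close>] \<open>open S\<close> by (simp add: holomorphic_derivI)
  qed
  ultimately show "continuous_on (cball z r) (\<lambda>w. \<Sum>i\<in>X. f i w) \<and>
    (\<forall>w\<in>ball z r. DERIV (\<lambda>w. \<Sum>i\<in>X. f i w) w :> (\<Sum>i\<in>X. deriv (f i) w))"
   by blast
 qed
 have ulim: "uniform_limit (cball z r) (\<lambda>X w. \<Sum>i\<in>X. f i w) (\<lambda>w. \<Sum>\<^sub>\<infinity>i\<in>I. f i w) (finite_subsets_at_top I)"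
  by (rule Weierstrass_m_test_general[where M = M]) (use bound r(2) assms(4) in auto)
 obtain g' where g': "\<And>w. w \<in> ball z r ==> DERIV (\<lambda>w. \<Sum>\<^sub>\<infinity>i\<in>I. f i w) w :> g' w \<and>
    ((\<lambda>X. \<Sum>i\<in>X. deriv (f i) w) \<longlongrightarrow> g' w) (finite_subsets_at_top I)"
  using has_complex_derivative_uniform_limit[OF cont ulim _ r(1)] by auto
 have "z \<in> ball z r" using r by simp
 from g'[OF this] show ?thesis unfolding has_sum_def by blast
qed

lemma summable_int_powr:
 "(\<lambda>a::int. (1 + \<bar>of_int a\<bar>) powr (-3/2) :: real) summable_on UNIV"
proof -
 have n: "(\<lambda>k::nat. (1 + real k) powr (-3/2)) summable_on UNIV"
 proof -
  have "summable (\<lambda>k. real (Suc k) powr (-3/2))"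
   by (subst summable_Suc_iff) (simp add: summable_real_powr_iff)
  hence "summable (\<lambda>k. norm ((1 + real k) powr (-3/2)))" by (simp add: add.commute)
  thus ?thesis by (rule norm_summable_imp_summable_on)
 qed
 have 1: "(\<lambda>a::int. (1 + \<bar>of_int a\<bar>) powr (-3/2) :: real) summable_on {0..}"
 proof (subst summable_on_reindex_bij_betw[symmetric, where g = int and A = UNIV])
  show "bij_betw int UNIV {0..}"
   by (rule bij_betwI[where g = nat]) auto
 qed (use n in simp)
 have 2: "(\<lambda>a::int. (1 + \<bar>of_int a\<bar>) powr (-3/2) :: real) summable_on {..0}"
 proof (subst summable_on_reindex_bij_betw[symmetric, where g = uminus and A = "{0..}"])
  show "bij_betw uminus {0..} {..0::int}"
   by (rule bij_betwI[where g = uminus]) auto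
 qed (use 1 in simp)
 have "(UNIV::int set) = {0..} \<union> {..0}" by auto
 thus ?thesis using summable_on_union[OF 1 2] by simp
qed

text \<open>As \<open>max(|a|, |b|)\<^sup>2\<close> is at least a quarter of \<open>(1 + |a|)(1 + |b|)\<close>, the sum is dominated by a product of two simple sums.\<close>
lemma summable_int_pair:
 "(\<lambda>(a::int,b::int). 1 / max \<bar>of_int a\<bar> \<bar>of_int b\<bar> ^ 3 :: real) summable_on (UNIV - {(0,0)})"
proof -
 define g where "g = (\<lambda>a::int. (1 + \<bar>of_int a\<bar>) powr (-3/2) :: real)"
 have g: "g summable_on UNIV" using summable_int_powr by (simp add: g_def)
 have gpos: "g a \<ge> 0" for a by (simp add: g_def)
 have "(\<lambda>(a,b). g a * g b) summable_on (UNIV \<times> UNIV)"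
 proof (rule summable_on_SigmaI[where g = "\<lambda>a. g a * infsum g UNIV"])
  show "((\<lambda>y. case (x, y) of (a, b) => g a * g b) has_sum g x * infsum g UNIV) UNIV" for x
   using g by (auto intro!: has_sum_cmult_right)
  show "(\<lambda>a. g a * infsum g UNIV) summable_on UNIV" using g by (rule summable_on_cmult_left)
 qed (use gpos in auto)
 hence "(\<lambda>(a,b). 8 * (g a * g b)) summable_on (UNIV \<times> UNIV)"
  by (simp add: case_prod_unfold summable_on_cmult_right)
 hence "(\<lambda>(a,b). 8 * (g a * g b)) summable_on (UNIV - {(0,0)})"
  by (rule summable_on_subset_banach) auto
 thus ?thesis
 proof (rule summable_on_comparison_test)
  fix x :: "int \<times> int" assume x: "x \<in> UNIV - {(0,0)}"
  obtain a b where ab: "x = (a,b)" by (cases x)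
  define m where "m = max \<bar>real_of_int a\<bar> \<bar>real_of_int b\<bar>"
  have m1: "m \<ge> 1" using x ab unfolding m_def by (auto simp: max_def)
  have "(1 + \<bar>real_of_int a\<bar>) * (1 + \<bar>real_of_int b\<bar>) \<le> (2*m) * (2*m)"
   using m1 by (intro mult_mono) (auto simp: m_def)
  hence "((1 + \<bar>real_of_int a\<bar>) * (1 + \<bar>real_of_int b\<bar>)) powr (3/2) \<le> ((2*m)*(2*m)) powr (3/2)"
   by (intro powr_mono2) auto
  also have "(2*m)*(2*m) = (2*m) powr 2" using m1 by (simp add: power2_eq_square)
  also have "((2*m) powr 2) powr (3/2) = (2*m) powr 3" by (subst powr_powr) simp
  also have "\<dots> = (2*m)^3" using m1 by simp
  finally have le: "((1 + \<bar>real_of_int a\<bar>) * (1 + \<bar>real_of_int b\<bar>)) powr (3/2) \<le> 8 * m^3"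
   by (simp add: power_mult_distrib)
  have "g a * g b = 1 / ((1 + \<bar>real_of_int a\<bar>) * (1 + \<bar>real_of_int b\<bar>)) powr (3/2)"
   unfolding g_def by (simp add: powr_mult[symmetric] powr_minus_divide)
  also have "\<dots> \<ge> 1 / (8 * m^3)"
   using le m1 by (intro divide_left_mono mult_pos_pos) auto
  finally have "1 / m^3 \<le> 8 * (g a * g b)" using m1 by (simp add: field_simps)
  thus "(case x of (a, b) => 1 / max \<bar>real_of_int a\<bar> \<bar>real_of_int b\<bar> ^ 3) \<le> (case x of (a, b) => 8 * (g a * g b))"
   by (simp add: ab m_def)
 qed (auto)
qed

locale half_plane =
 fixes \<tau> :: complex
 assumes Im_tau: "Im \<tau> > 0"
begin

abbreviation "L \<equiv> period_lattice \<tau>"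
abbreviation "HL \<equiv> half_lattice \<tau>"
abbreviation lat :: "int => int => complex" where "lat a b \<equiv> of_int a + of_int b * \<tau>"
abbreviation pnt :: "real => real => complex" where "pnt x y \<equiv> of_real x + of_real y * \<tau>"

lemma lattice_I [intro]: "lat a b \<in> L"
 unfolding period_lattice_def by blast

lemma lattice_E: assumes "z \<in> L" obtains a b where "z = lat a b"
 using assms unfolding period_lattice_def by blast

lemma lattice_0 [simp]: "0 \<in> L" using lattice_I[of 0 0] by simp
lemma lattice_1 [simp]: "1 \<in> L" using lattice_I[of 1 0] by simp
lemma lattice_tau [simp]: "\<tau> \<in> L" using lattice_I[of 0 1] by simp

lemma lattice_add [intro]: assumes "z \<in> L" "w \<in> L" shows "z + w \<in> L"
proof -
 obtain a b where "z = lat a b" using lattice_E[OF assms(1)] .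
 moreover obtain c d where "w = lat c d" using lattice_E[OF assms(2)] .
 ultimately have "z + w = lat (a+c) (b+d)" by (simp add: algebra_simps)
 thus ?thesis by (simp only: lattice_I)
qed

lemma lattice_uminus [intro]: assumes "z \<in> L" shows "- z \<in> L"
proof -
 obtain a b where "z = lat a b" using lattice_E[OF assms(1)] .
 hence "- z = lat (-a) (-b)" by (simp add: algebra_simps)
 thus ?thesis by (simp only: lattice_I)
qed

lemma lattice_uminus_iff [simp]: "- z \<in> L \<longleftrightarrow> z \<in> L"
 using lattice_uminus[of z] lattice_uminus[of "-z"] by auto

lemma lattice_diff [intro]: "z \<in> L ==> w \<in> L ==> z - w \<in> L"
 using lattice_add[of z "-w"] lattice_uminus by simp

lemma lattice_add_iff: "w \<in> L ==> z + w \<in> L \<longleftrightarrow> z \<in> L"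
 using lattice_add[of z w] lattice_diff[of "z+w" w] by auto

lemma lattice_diff_commute: "z - w \<in> L \<longleftrightarrow> w - z \<in> L"
 using lattice_uminus_iff[of "z - w"] by simp

text \<open>The imaginary part bounds \<open>y\<close>, and then \<open>x\<close> is bounded unless it is already small in comparison with \<open>y\<close>.\<close>
lemma coord_bound:
 obtains \<delta> where "\<delta> > 0" "\<And>x y :: real. \<delta> * max \<bar>x\<bar> \<bar>y\<bar> \<le> norm (pnt x y)"
proof -
 have t: "norm \<tau> > 0" "norm \<tau> \<ge> Im \<tau>" using Im_tau abs_Im_le_cmod[of \<tau>] by auto
 define \<delta> where "\<delta> = min (min (1/2) (Im \<tau>)) (Im \<tau> / (2 * norm \<tau>))"
 have "\<delta> > 0" unfolding \<delta>_def using t Im_tau by auto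
 moreover have "\<delta> * max \<bar>x\<bar> \<bar>y\<bar> \<le> norm (pnt x y)" for x y :: real
 proof -
  let ?z = "pnt x y :: complex"
  have "\<bar>Im ?z\<bar> \<le> norm ?z" by (rule abs_Im_le_cmod)
  hence b1: "\<bar>y\<bar> * Im \<tau> \<le> norm ?z" using Im_tau by (simp add: abs_mult)
  have b2: "norm ?z \<ge> \<bar>x\<bar> - \<bar>y\<bar> * norm \<tau>"
   using norm_triangle_ineq2[of "of_real x :: complex" "- (of_real y * \<tau>)"] by (simp add: norm_mult)
  have y: "\<delta> * \<bar>y\<bar> \<le> norm ?z"
  proof -
   have "\<delta> * \<bar>y\<bar> \<le> Im \<tau> * \<bar>y\<bar>" unfolding \<delta>_def by (intro mult_right_mono) auto
   thus ?thesis using b1 by (simp add: mult.commute)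
  qed
  have x: "\<delta> * \<bar>x\<bar> \<le> norm ?z"
  proof (cases "\<bar>x\<bar> \<ge> 2 * (\<bar>y\<bar> * norm \<tau>)")
   case True
   have "\<delta> * \<bar>x\<bar> \<le> 1/2 * \<bar>x\<bar>" unfolding \<delta>_def by (intro mult_right_mono) auto
   thus ?thesis using True b2 by linarith
  next
   case False
   have "\<delta> * \<bar>x\<bar> \<le> Im \<tau> / (2 * norm \<tau>) * (2 * (\<bar>y\<bar> * norm \<tau>))"
    unfolding \<delta>_def using False Im_tau t by (intro mult_mono) auto
   also have "\<dots> = \<bar>y\<bar> * Im \<tau>" using t by (simp add: field_simps)
   finally show ?thesis using b1 by linarith
  qed
  show ?thesis using x y by (auto simp: max_def)
 qed
 ultimately show thesis using that by blast
qed

lemma coord_unique: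
 fixes x y x' y' :: real
 assumes "pnt x y = pnt x' y'"
 shows "x = x'" "y = y'"
proof -
 have "Im (pnt x y) = Im (pnt x' y')" using assms by simp
 thus y: "y = y'" using Im_tau by simp
 show "x = x'" using assms y by simp
qed

lemma coord_exists: obtains x y :: real where "z = pnt x y"
proof -
 define y where "y = Im z / Im \<tau>"
 define x where "x = Re z - y * Re \<tau>"
 have "z = pnt x y"
  by (rule complex_eqI) (use Im_tau in \<open>auto simp: x_def y_def\<close>)
 thus thesis using that by blast
qed

lemma lattice_cube_summable: "(\<lambda>l. 1 / norm l ^ 3) summable_on (L - {0})"
proof -
 define h :: "int \<times> int => complex" where "h = (\<lambda>(a,b). lat a b)"
 have inj: "inj h"
 proof (rule injI)
  fix x y assume "h x = h y"
  moreover obtain a b where x: "x = (a,b)" by (cases x)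
  moreover obtain c d where y: "y = (c,d)" by (cases y)
  ultimately have "pnt (of_int a) (of_int b) = pnt (of_int c) (of_int d)"
   by (simp add: h_def)
  from coord_unique[OF this] show "x = y" using x y by simp
 qed
 have h0: "h (0,0) = 0" by (simp add: h_def)
 have bij: "bij_betw h (UNIV - {(0,0)}) (L - {0})"
 proof -
  have "h ` UNIV = L" unfolding h_def period_lattice_def by auto
  hence "h ` (UNIV - {(0,0)}) = L - {0}"
   using image_set_diff[OF inj, of UNIV "{(0,0)}"] h0 by simp
  thus ?thesis using inj by (auto simp: bij_betw_def intro: inj_on_subset)
 qed
 obtain \<delta> where d: "\<delta> > 0" "\<And>x y :: real. \<delta> * max \<bar>x\<bar> \<bar>y\<bar> \<le> norm (pnt x y)"
  by (metis coord_bound)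
 have "(\<lambda>x. 1 / norm (h x) ^ 3) summable_on (UNIV - {(0,0)})"
 proof (rule summable_on_comparison_test)
  show "(\<lambda>x. (1/\<delta>^3) * (case x of (a,b) => 1 / max \<bar>real_of_int a\<bar> \<bar>real_of_int b\<bar> ^ 3)) summable_on (UNIV - {(0,0)})"
   by (intro summable_on_cmult_right summable_int_pair)
  fix x :: "int \<times> int" assume x: "x \<in> UNIV - {(0,0)}"
  obtain a b where ab: "x = (a,b)" by (cases x)
  define m where "m = max \<bar>real_of_int a\<bar> \<bar>real_of_int b\<bar>"
  have m1: "m > 0" using x ab unfolding m_def by (auto simp: max_def)
  have "\<delta> * m \<le> norm (h x)" using d(2)[of "of_int a" "of_int b"] by (simp add: m_def h_def ab)
  moreover have "\<delta> * m > 0" using d(1) m1 by simp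
  ultimately have pos: "\<delta> * m > 0" "norm (h x) > 0" and "\<delta> * m \<le> norm (h x)" by linarith+
  hence "(\<delta> * m)^3 \<le> norm (h x)^3" using d m1 by (intro power_mono) auto
  hence "1 / norm (h x)^3 \<le> 1 / (\<delta> * m)^3" using pos by (intro divide_left_mono mult_pos_pos[OF zero_less_power zero_less_power]) auto
  thus "1 / norm (h x)^3 \<le> (1/\<delta>^3) * (case x of (a,b) => 1 / max \<bar>real_of_int a\<bar> \<bar>real_of_int b\<bar> ^ 3)"
   by (simp add: ab m_def power_mult_distrib)
 qed auto
 thus ?thesis using summable_on_reindex_bij_betw[OF bij, of "\<lambda>l. 1 / norm l ^ 3"] by simp
qed

lemma finite_lattice_ball: "finite {l \<in> L. norm l \<le> r}"
proof -
 obtain \<delta> where d: "\<delta> > 0" "\<And>x y :: real. \<delta> * max \<bar>x\<bar> \<bar>y\<bar> \<le> norm (pnt x y)"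
  by (metis coord_bound)
 define N where "N = \<lceil>r / \<delta>\<rceil>"
 have "{l \<in> L. norm l \<le> r} \<subseteq> (\<lambda>(a,b). lat a b) ` ({-N..N} \<times> {-N..N})"
 proof
  fix l assume w: "l \<in> {l \<in> L. norm l \<le> r}"
  then obtain a b where ab: "l = lat a b" using lattice_E by blast
  have "\<delta> * max \<bar>of_int a\<bar> \<bar>of_int b\<bar> \<le> r" using d(2)[of "of_int a" "of_int b"] w ab by simp
  hence "max \<bar>real_of_int a\<bar> \<bar>of_int b\<bar> \<le> r / \<delta>" using d(1) by (metis mult.commute pos_le_divide_eq)
  hence "max \<bar>real_of_int a\<bar> \<bar>of_int b\<bar> \<le> of_int N" unfolding N_def by linarith
  hence "\<bar>real_of_int a\<bar> \<le> of_int N" "\<bar>real_of_int b\<bar> \<le> of_int N" by auto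
  hence "a \<in> {-N..N}" "b \<in> {-N..N}" by auto
  thus "l \<in> (\<lambda>(a,b). lat a b) ` ({-N..N} \<times> {-N..N})" using ab by auto
 qed
 thus ?thesis using finite_subset by blast
qed

end

section \<open>Products and series for the Weierstrass functions\<close>

lemma has_field_derivative_prod_log:
 fixes f :: "'i => complex => complex"
 assumes "finite N" "\<And>i. i \<in> N ==> DERIV (f i) z :> (f i z * d i)"
 shows "DERIV (\<lambda>z. \<Prod>i\<in>N. f i z) z :> (\<Prod>i\<in>N. f i z) * (\<Sum>i\<in>N. d i)"
 using assms
proof (induction N rule: finite_induct)
 case (insert x N)
 have "DERIV (\<lambda>z. f x z * (\<Prod>i\<in>N. f i z)) z :>
   (f x z * d x) * (\<Prod>i\<in>N. f i z) + ((\<Prod>i\<in>N. f i z) * (\<Sum>i\<in>N. d i)) * f x z"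
  by (rule DERIV_mult) (use insert in auto)
 thus ?case using insert.hyps by (simp add: algebra_simps)
qed auto

lemma DERIV_transfer_ev:
 assumes "DERIV f z :> d" "eventually (\<lambda>z. f z = g z) (nhds z)"
 shows "DERIV g z :> d"
 using DERIV_cong_ev[OF refl assms(2) refl] assms(1) by simp

lemma holomorphic_onI_deriv:
 assumes "open S" "\<And>z. z \<in> S ==> DERIV f z :> f' z"
 shows "f holomorphic_on S"
 using assms by (meson holomorphic_on_open)

context half_plane begin

abbreviation "zterm l z \<equiv> z^2 / (l^2 * (z - l :: complex))"
abbreviation "pterm l z \<equiv> 1 / (z - l :: complex)^2 - 1 / l^2"

text \<open>Uniform estimates for \<open>z\<close> in a disc and lattice points outside the disc with the same centre and twice the radius.\<close>
lemma far_bounds: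
 fixes z l :: complex
 assumes "norm z < R" "2 * R \<le> norm l"
 shows "norm (zterm l z) \<le> 2 * R^2 / norm l^3" "z \<noteq> l" "l \<noteq> 0"
  "norm (pterm l z) \<le> 10 * R / norm l^3"
proof -
 have R: "R > 0" using assms(1) norm_ge_zero le_less_trans by blast
 show nz: "l \<noteq> 0" "z \<noteq> l" using assms R by auto
 have d: "norm (z - l) \<ge> norm l / 2"
  using norm_triangle_ineq2[of l z] assms by (simp add: norm_minus_commute)
 have w: "norm l > 0" using nz by simp
 have "norm (zterm l z) = norm z^2 / (norm l^2 * norm (z - l))"
  by (simp add: norm_divide norm_mult norm_power)
 also have "\<dots> \<le> R^2 / (norm l^2 * (norm l / 2))"
  using assms(1) d w by (intro frac_le mult_left_mono power_mono mult_pos_pos) auto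
 also have "\<dots> = 2 * R^2 / norm l^3" by (simp add: power3_eq_cube power2_eq_square)
 finally show "norm (zterm l z) \<le> 2 * R^2 / norm l^3" .
 have "pterm l z = z * (2 * l - z) / (l^2 * (z - l)^2)"
 proof -
  define d where "d = z - l"
  have "d \<noteq> 0" using nz by (simp add: d_def)
  hence "1/d^2 - 1/l^2 = (l^2 - d^2) / (d^2 * l^2)" using nz by (subst diff_frac_eq) auto
  also have "l^2 - d^2 = z * (2 * l - z)" by (simp add: d_def algebra_simps power2_eq_square)
  finally show ?thesis by (simp add: d_def mult.commute)
 qed
 also have "norm \<dots> = norm z * norm (2 * l - z) / (norm l^2 * norm (z - l)^2)"
  by (simp add: norm_divide norm_mult norm_power)
 also have "\<dots> \<le> R * (5/2 * norm l) / (norm l^2 * (norm l / 2)^2)"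
 proof (intro frac_le mult_mono power_mono mult_pos_pos)
  show "norm (2 * l - z) \<le> 5/2 * norm l"
   using norm_triangle_ineq4[of "2*l" z] assms by (simp add: norm_mult)
 qed (use assms R d w in auto)
 also have "\<dots> = 10 * R / norm l^3" using w by (simp add: field_simps power3_eq_cube power2_eq_square)
 finally show "norm (pterm l z) \<le> 10 * R / norm l^3" .
qed

definition near :: "real => complex set" where "near R = {l \<in> L - {0}. norm l < 2 * R}"
definition far :: "real => complex set" where "far R = {l \<in> L - {0}. \<not> norm l < 2 * R}"

lemma near_far: "finite (near R)" "near R \<union> far R = L - {0}" "near R \<inter> far R = {}"
proof -
 show "finite (near R)"
  by (rule finite_subset[OF _ finite_lattice_ball[of "2*R"]]) (auto simp: near_def)
qed (auto simp: near_def far_def)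

lemma far_summable: "(\<lambda>l. C / norm l ^ 3) summable_on (far R)"
proof -
 have "(\<lambda>l. 1 / norm l ^ 3) summable_on (far R)"
  by (rule summable_on_subset_banach[OF lattice_cube_summable]) (auto simp: far_def)
 from summable_on_cmult_right[OF this, of C] show ?thesis by simp
qed

text \<open>A logarithm of the Weierstrass factor. On a disc it exists for the far lattice points; the near ones contribute a finite
 product.\<close>
definition sg :: "complex => complex => complex" where
 "sg l z = Ln (1 - z/l) + z/l + (z/l)^2/2"

lemma sg_props:
 assumes "norm z < R" "2 * R \<le> norm l"
 shows "DERIV (sg l) z :> (zterm l z)"
  "exp (sg l z) = weierstrass_factor 2 (z / l)"
  "norm (sg l z) \<le> 2 * R^3 / norm l^3"
proof -
 note b = far_bounds[OF assms]
 have R: "R > 0" using assms(1) norm_ge_zero le_less_trans by blast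
 have half: "norm (x / l) < 1" if "norm x < R" for x
  using that assms(2) R b(3) by (simp add: norm_divide field_simps)
 have nonpos: "1 - x / l \<notin> \<real>\<^sub>\<le>\<^sub>0" if "norm x < R" for x
 proof
  assume "1 - x / l \<in> \<real>\<^sub>\<le>\<^sub>0"
  hence "Re (1 - x/l) \<le> 0" by (simp add: complex_nonpos_Reals_iff)
  moreover have "Re (x/l) \<le> norm (x/l)" by (rule complex_Re_le_cmod)
  ultimately show False using half[OF that] by simp
 qed
 have d: "DERIV (sg l) x :> (x^2 / (l^2 * (x - l)))" if "norm x < R" for x
 proof -
  have xw: "x \<noteq> l" using far_bounds(2)[OF that assms(2)] .
  have dv: "DERIV (\<lambda>z. z/l) x :> 1/l"
   by (rule DERIV_cdivide[OF DERIV_ident])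
  have "DERIV (\<lambda>z. Ln (1 - z/l)) x :> inverse (1 - x/l) * (0 - 1/l)"
   by (rule DERIV_chain2[OF has_field_derivative_Ln[OF nonpos[OF that]] DERIV_diff[OF DERIV_const dv]])
  moreover have "DERIV (\<lambda>z. (z/l)^2/2) x :> (2 * (x/l) * (1/l))/2"
   by (rule DERIV_cdivide) (use DERIV_power[OF dv, of 2] in simp)
  ultimately have "DERIV (\<lambda>z. Ln (1 - z/l) + z/l + (z/l)^2/2) x :>
   inverse (1 - x/l) * (0 - 1/l) + 1/l + (2 * (x/l) * (1/l))/2"
   by (intro DERIV_add dv)
  moreover have "sg l = (\<lambda>z. Ln (1 - z/l) + z/l + (z/l)^2/2)" by (auto simp: sg_def)
  moreover have e: "inverse (1 - x/l) * (0 - 1/l) = (- 1/l) / (1 - x/l)" by (simp add: divide_inverse)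
  ultimately have "DERIV (sg l) x :> (- 1/l) / (1 - x/l) + 1/l + (2 * (x/l) * (1/l))/2"
   unfolding e by metis
  also have "(- 1/l) / (1 - x/l) + 1/l + (2 * (x/l) * (1/l))/2 = x^2 / (l^2 * (x - l))"
  proof -
   define d where "d = x - l"
   have d0: "d \<noteq> 0" using xw by (simp add: d_def)
   have "1 - x/l = - d/l" using b(3) by (simp add: field_simps d_def)
   hence 1: "(- 1/l) / (1 - x/l) = 1/d" using b(3) d0 by simp
   have "1/d + 1/l + x/l^2 = (l^2 + d*l + x*d) / (l^2 * d)"
    using b(3) d0 by (simp add: add_divide_distrib power2_eq_square)
   also have "l^2 + d*l + x*d = x^2" by (simp add: d_def algebra_simps power2_eq_square)
   finally show ?thesis unfolding 1 by (simp add: d_def power2_eq_square)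
  qed
  finally show ?thesis .
 qed
 show "DERIV (sg l) z :> (zterm l z)" using d assms(1) .
 show "exp (sg l z) = weierstrass_factor 2 (z / l)"
 proof -
  have "1 - z/l \<noteq> 0" using nonpos[OF assms(1)] by auto
  moreover have "(\<Sum>k=1..2. (z/l)^k / of_nat k) = z/l + (z/l)^2/2"
   by (simp add: numeral_2_eq_2)
  ultimately show ?thesis unfolding sg_def weierstrass_factor_def
   by (simp add: exp_add)
 qed
 have "norm (sg l z - sg l 0) \<le> (2 * R^2 / norm l^3) * norm (z - 0)"
 proof (rule field_differentiable_bound[of "ball 0 R"])
  fix x :: complex assume "x \<in> ball 0 R"
  hence x: "norm x < R" by simp
  show "(sg l has_field_derivative x^2 / (l^2 * (x - l))) (at x within ball 0 R)"
   using d[OF x] by (rule has_field_derivative_at_within)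
  show "norm (x^2 / (l^2 * (x - l))) \<le> 2 * R^2 / norm l^3" using far_bounds(1)[OF x assms(2)] .
 qed (use assms R in auto)
 also have "\<dots> \<le> (2 * R^2 / norm l^3) * R" using assms(1) by (intro mult_left_mono) auto
 finally show "norm (sg l z) \<le> 2 * R^3 / norm l^3" by (simp add: sg_def power3_eq_cube power2_eq_square mult_ac)
qed

definition Gfar :: "real => complex => complex" where
 "Gfar R z = (\<Sum>\<^sub>\<infinity>l\<in>far R. sg l z)"
definition Gfar' :: "real => complex => complex" where
 "Gfar' R z = (\<Sum>\<^sub>\<infinity>l\<in>far R. zterm l z)"

lemma far_D: "l \<in> far R ==> 2 * R \<le> norm l" "l \<in> far R ==> l \<in> L" "l \<in> far R ==> l \<noteq> 0"
 by (auto simp: far_def)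

lemma Gfar_deriv:
 assumes "norm z < R"
 shows "DERIV (Gfar R) z :> Gfar' R z"
proof -
 have "\<exists>D. DERIV (\<lambda>z. \<Sum>\<^sub>\<infinity>l\<in>far R. sg l z) z :> D \<and> ((\<lambda>l. deriv (sg l) z) has_sum D) (far R)"
 proof (rule infsum_holomorphic[where S = "ball 0 R" and M = "\<lambda>l. 2 * R^3 / norm l^3"])
  fix l assume w: "l \<in> far R"
  show "sg l holomorphic_on ball 0 R"
   by (rule holomorphic_onI_deriv[OF open_ball sg_props(1)[OF _ far_D(1)[OF w]]]) auto
  show "norm (sg l z) \<le> 2 * R^3 / norm l^3" if "z \<in> ball 0 R" for z
   using sg_props(3)[OF _ far_D(1)[OF w]] that by auto
 qed (use assms far_summable in auto)
 then obtain D where D: "DERIV (Gfar R) z :> D" "((\<lambda>l. deriv (sg l) z) has_sum D) (far R)"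
  unfolding Gfar_def by blast
 have "D = Gfar' R z" unfolding Gfar'_def infsumI[OF D(2), symmetric]
  by (rule infsum_cong) (use sg_props(1)[OF assms far_D(1)] in \<open>simp add: DERIV_imp_deriv\<close>)
 thus ?thesis using D by simp
qed

lemma zeta_term_deriv:
 assumes "l \<noteq> 0" "x \<noteq> l"
 shows "DERIV (\<lambda>z. zterm l z) x :> - (1 / (x - l)^2 - 1/l^2)"
proof -
 have x: "x - l \<noteq> 0" using assms by auto
 have "DERIV (\<lambda>z. zterm l z) x :>
  (2 * x * (l^2 * (x - l)) - x^2 * l^2) / ((l^2 * (x - l)) * (l^2 * (x - l)))"
  using assms x by (auto intro!: derivative_eq_intros)
 also have "(2 * x * (l^2 * (x - l)) - x^2 * l^2) / ((l^2 * (x - l)) * (l^2 * (x - l))) = - (1 / (x - l)^2 - 1/l^2)"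
  using assms(1) x by (simp add: divide_simps) (simp add: algebra_simps power2_eq_square)
 finally show ?thesis .
qed

lemma Gfar'_deriv:
 assumes "norm z < R"
 shows "DERIV (Gfar' R) z :> - (\<Sum>\<^sub>\<infinity>l\<in>far R. pterm l z)"
  "(\<lambda>l. pterm l z) summable_on far R"
proof -
 have dg: "DERIV (\<lambda>z. zterm l z) x :> - (1 / (x - l)^2 - 1/l^2)"
  if "norm x < R" "l \<in> far R" for x l
  using zeta_term_deriv far_bounds[OF that(1) far_D(1)[OF that(2)]] by blast
 have "\<exists>D. DERIV (\<lambda>z. \<Sum>\<^sub>\<infinity>l\<in>far R. zterm l z) z :> D \<and>
  ((\<lambda>l. deriv (\<lambda>z. zterm l z) z) has_sum D) (far R)"
 proof (rule infsum_holomorphic[where S = "ball 0 R" and M = "\<lambda>l. 2 * R^2 / norm l^3"])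
  fix l assume w: "l \<in> far R"
  show "(\<lambda>z. zterm l z) holomorphic_on ball 0 R"
by (rule holomorphic_onI_deriv[OF open_ball dg[OF _ w]]) auto
  show "norm (zterm l z) \<le> 2 * R^2 / norm l^3" if "z \<in> ball 0 R" for z
   using far_bounds(1)[OF _ far_D(1)[OF w]] that by auto
 qed (use assms far_summable in auto)
 then obtain D where D: "DERIV (Gfar' R) z :> D"
  "((\<lambda>l. deriv (\<lambda>z. zterm l z) z) has_sum D) (far R)"
  unfolding Gfar'_def by blast
 have "((\<lambda>l. - (pterm l z)) has_sum D) (far R)"
  using D(2) by (rule has_sum_cong[THEN iffD1, rotated]) (use DERIV_imp_deriv[OF dg[OF assms]] in simp)
 hence *: "((\<lambda>l. pterm l z) has_sum (-D)) (far R)"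
  using has_sum_uminusI by fastforce
 thus "(\<lambda>l. pterm l z) summable_on far R" unfolding summable_on_def by blast
 show "DERIV (Gfar' R) z :> - (\<Sum>\<^sub>\<infinity>l\<in>far R. pterm l z)"
  using infsumI[OF *] D(1) by simp
qed

text \<open>The near factors split off from the unordered product; what remains is the exponential of an absolutely convergent sum.\<close>
lemma wsigma_local:
 assumes "norm z < R"
 shows "wsigma \<tau> z = z * ((\<Prod>l\<in>near R. weierstrass_factor 2 (z/l)) * exp (Gfar R z))"
proof -
 let ?f = "\<lambda>l. weierstrass_factor 2 (z/l)"
 define h where "h = (\<lambda>l. if l \<in> far R then sg l z else 0)"
 have "(\<lambda>l. norm (sg l z)) summable_on (far R)"
  by (rule summable_on_comparison_test[OF far_summable[of "2 * R^3" R]])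
   (use sg_props(3)[OF assms far_D(1)] in auto)
 hence "(\<lambda>l. sg l z) summable_on (far R)" by (rule abs_summable_summable)
 hence "((\<lambda>l. sg l z) has_sum Gfar R z) (far R)"
  unfolding Gfar_def by (rule has_sum_infsum)
 hence "(h has_sum Gfar R z) (L - {0})"
  by (rule has_sum_cong_neutral[THEN iffD1, rotated -1]) (use near_far in \<open>auto simp: h_def\<close>)
 hence lim: "((\<lambda>F. \<Sum>l\<in>F. h l) \<longlongrightarrow> Gfar R z) (finite_subsets_at_top (L - {0}))"
  by (simp add: has_sum_def)
 have "eventually (\<lambda>F. finite F \<and> near R \<subseteq> F \<and> F \<subseteq> L - {0}) (finite_subsets_at_top (L - {0}))"
  using near_far by (intro eventually_finite_subsets_at_top[THEN iffD2]) (auto intro!: exI[of _ "near R"])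
 hence ev: "eventually (\<lambda>F. (\<Prod>l\<in>near R. ?f l) * exp (\<Sum>l\<in>F. h l) = (\<Prod>l\<in>F. ?f l)) (finite_subsets_at_top (L - {0}))"
 proof eventually_elim
  case (elim F)
  have sub: "F - near R \<subseteq> far R" using elim near_far(2)[of R] by blast
  have "(\<Prod>l\<in>F. ?f l) = (\<Prod>l\<in>F - near R. ?f l) * (\<Prod>l\<in>near R. ?f l)"
   using elim by (intro prod.subset_diff) auto
  also have "(\<Prod>l\<in>F - near R. ?f l) = (\<Prod>l\<in>F - near R. exp (h l))"
   using sub sg_props(2)[OF assms far_D(1)] by (intro prod.cong) (auto simp: h_def)
  also have "\<dots> = exp (\<Sum>l\<in>F - near R. h l)" using elim by (simp add: exp_sum)
  also have "(\<Sum>l\<in>F - near R. h l) = (\<Sum>l\<in>F. h l)"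
   using elim near_far(3)[of R] by (intro sum.mono_neutral_left) (auto simp: h_def)
  finally show ?case by (simp add: mult.commute)
 qed
 have "((\<lambda>F. (\<Prod>l\<in>near R. ?f l) * exp (\<Sum>l\<in>F. h l)) \<longlongrightarrow> (\<Prod>l\<in>near R. ?f l) * exp (Gfar R z)) (finite_subsets_at_top (L - {0}))"
  by (intro tendsto_intros lim)
 hence "((\<lambda>F. \<Prod>l\<in>F. ?f l) \<longlongrightarrow> (\<Prod>l\<in>near R. ?f l) * exp (Gfar R z)) (finite_subsets_at_top (L - {0}))"
  using ev by (rule Lim_transform_eventually)
 hence "Lim (finite_subsets_at_top (L - {0})) (\<lambda>F. \<Prod>l\<in>F. ?f l) = (\<Prod>l\<in>near R. ?f l) * exp (Gfar R z)"
  by (intro tendsto_Lim) auto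
 thus ?thesis unfolding wsigma_def by simp
qed

lemma wsigma_zero_iff: "wsigma \<tau> z = 0 \<longleftrightarrow> z \<in> L"
proof -
 define R where "R = norm z + 1"
 have z: "norm z < R" "R > 0" by (auto simp: R_def add_nonneg_pos)
 have "wsigma \<tau> z = 0 \<longleftrightarrow> z = 0 \<or> (\<exists>l\<in>near R. z/l = 1)"
  unfolding wsigma_local[OF z(1)] using near_far(1) by simp
 also have "\<dots> \<longleftrightarrow> z \<in> L"
  using z by (auto simp: near_def divide_eq_1_iff)
 finally show ?thesis .
qed

lemma wsigma_entire: "wsigma \<tau> holomorphic_on UNIV"
proof -
 have "wsigma \<tau> holomorphic_on ball 0 R" for R
 proof -
  have "Gfar R holomorphic_on ball 0 R"
   by (rule holomorphic_onI_deriv[OF open_ball Gfar_deriv]) auto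
  hence "(\<lambda>z. z * ((\<Prod>l\<in>near R. weierstrass_factor 2 (z/l)) * exp (Gfar R z))) holomorphic_on ball 0 R"
   by (intro holomorphic_intros) (auto simp: near_def)
  thus ?thesis by (rule holomorphic_transform) (use wsigma_local in auto)
 qed
 hence "wsigma \<tau> field_differentiable (at z)" for z
  using holomorphic_on_imp_differentiable_at[of "wsigma \<tau>" "ball 0 (norm z + 1)" z] by simp
 thus ?thesis by (simp add: holomorphic_on_def field_differentiable_at_within)
qed

lemma wsigma_deriv [derivative_intros]:
 "(f has_field_derivative f') (at z within A) ==>
 ((\<lambda>z. wsigma \<tau> (f z)) has_field_derivative deriv (wsigma \<tau>) (f z) * f') (at z within A)"
 by (rule DERIV_chain2[where f = "wsigma \<tau>"]) (use wsigma_entire in \<open>auto intro!: holomorphic_derivI\<close>)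

lemma wsigma_holo [holomorphic_intros]: "f holomorphic_on A ==> (\<lambda>z. wsigma \<tau> (f z)) holomorphic_on A"
 using holomorphic_on_compose_gen[OF _ wsigma_entire, of f A] by (auto simp: o_def)

lemma wsigma_deriv_0: "deriv (wsigma \<tau>) 0 = 1"
proof -
 define u where "u = (\<lambda>z. (\<Prod>l\<in>near 1. weierstrass_factor 2 (z/l)) * exp (Gfar 1 z))"
 have "Gfar 1 holomorphic_on ball 0 1" by (rule holomorphic_onI_deriv[OF open_ball Gfar_deriv]) auto
 hence u: "u holomorphic_on ball 0 1" unfolding u_def by (intro holomorphic_intros) (auto simp: near_def)
 hence "DERIV u 0 :> deriv u 0" by (rule holomorphic_derivI) auto
 hence "DERIV (\<lambda>z. z * u z) 0 :> 1 * u 0 + deriv u 0 * 0"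
  by (intro DERIV_mult DERIV_ident)
 moreover have "u 0 = 1"
 proof -
  have "Gfar 1 0 = (\<Sum>\<^sub>\<infinity>l\<in>far 1. 0)" unfolding Gfar_def by (rule infsum_cong) (simp add: sg_def)
  thus ?thesis by (simp add: u_def)
 qed
 ultimately have "DERIV (\<lambda>z. z * u z) 0 :> 1" by simp
 moreover have "eventually (\<lambda>z. z \<in> ball 0 1) (nhds (0::complex))" by (intro eventually_nhds_in_open) auto
 hence "eventually (\<lambda>z. z * u z = wsigma \<tau> z) (nhds 0)"
  by eventually_elim (use wsigma_local[of _ 1] in \<open>auto simp: u_def\<close>)
 ultimately have "DERIV (wsigma \<tau>) 0 :> 1" by (rule DERIV_transfer_ev)
 thus ?thesis by (rule DERIV_imp_deriv)
qed

definition wzeta :: "complex => complex" where "wzeta z = deriv (wsigma \<tau>) z / wsigma \<tau> z"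

lemma wzeta_local:
 assumes "norm z < R" "z \<notin> L"
 shows "wzeta z = 1/z + (\<Sum>l\<in>near R. zterm l z) + Gfar' R z"
proof -
 have z0: "z \<noteq> 0" using assms by auto
 let ?P = "\<lambda>z. \<Prod>l\<in>near R. weierstrass_factor 2 (z/l)"
 have wf: "DERIV (\<lambda>z. weierstrass_factor 2 (z/l)) z :>
   weierstrass_factor 2 (z/l) * (zterm l z)" if "l \<in> near R" for l
 proof -
  have w: "l \<noteq> 0" "z - l \<noteq> 0" using that assms(2) by (auto simp: near_def)
  have alg: "a * e + (e * c) * d = (a + d * c) * e" for a c d e :: complex by (simp add: algebra_simps)
  have e: "weierstrass_factor 2 u = (1 - u) * exp (u + u^2/2)" for u
   by (simp add: weierstrass_factor_def numeral_2_eq_2)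
  have dv: "DERIV (\<lambda>z. z/l) z :> 1/l"
   by (rule DERIV_cdivide[OF DERIV_ident])
  have d2: "DERIV (\<lambda>z. (z/l)^2/2) z :> (z/l)/l"
   using DERIV_cdivide[OF DERIV_power[OF dv, of 2], of 2] by simp
  have d1: "DERIV (\<lambda>z. 1 - z/l) z :> (-1/l)"
   using DERIV_diff[OF DERIV_const dv, of 1] by simp
  have "DERIV (\<lambda>z. (1 - z/l) * exp (z/l + (z/l)^2/2)) z :>
    (-1/l) * exp (z/l + (z/l)^2/2) + (exp (z/l + (z/l)^2/2) * (1/l + (z/l)/l)) * (1 - z/l)"
   by (rule DERIV_mult[OF d1 DERIV_fun_exp[OF DERIV_add[OF dv d2]]])
  also have "(-1/l) * exp (z/l + (z/l)^2/2) + (exp (z/l + (z/l)^2/2) * (1/l + (z/l)/l)) * (1 - z/l)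
   = ((-1/l) + (1 - z/l) * (1/l + (z/l)/l)) * exp (z/l + (z/l)^2/2)"
   by (rule alg)
  also have "(-1/l) + (1 - z/l) * (1/l + (z/l)/l) = (1 - z/l) * (zterm l z)"
   using w by (simp add: divide_simps) (simp add: algebra_simps power2_eq_square)
  finally show ?thesis by (simp add: e mult_ac)
 qed
 have "DERIV (\<lambda>z. z * (?P z * exp (Gfar R z))) z :>
  1 * (?P z * exp (Gfar R z)) + ((?P z * (\<Sum>l\<in>near R. zterm l z)) * exp (Gfar R z) + (exp (Gfar R z) * Gfar' R z) * ?P z) * z"
  by (intro DERIV_mult DERIV_ident has_field_derivative_prod_log near_far wf DERIV_fun_exp Gfar_deriv assms)
 also have "1 * (?P z * exp (Gfar R z)) + ((?P z * (\<Sum>l\<in>near R. zterm l z)) * exp (Gfar R z) + (exp (Gfar R z) * Gfar' R z) * ?P z) * z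
  = z * (?P z * exp (Gfar R z)) * (1/z + (\<Sum>l\<in>near R. zterm l z) + Gfar' R z)"
  using z0 by (simp add: algebra_simps)
 finally have D: "DERIV (\<lambda>z. z * (?P z * exp (Gfar R z))) z :>
   wsigma \<tau> z * (1/z + (\<Sum>l\<in>near R. zterm l z) + Gfar' R z)"
  using wsigma_local[OF assms(1)] by simp
 have "eventually (\<lambda>z. z \<in> ball 0 R) (nhds z)" using assms by (intro eventually_nhds_in_open) auto
 hence "eventually (\<lambda>z. z * (?P z * exp (Gfar R z)) = wsigma \<tau> z) (nhds z)"
  by eventually_elim (use wsigma_local[of _ R] in auto)
 hence "deriv (wsigma \<tau>) z = wsigma \<tau> z * (1/z + (\<Sum>l\<in>near R. zterm l z) + Gfar' R z)"
  using DERIV_imp_deriv[OF DERIV_transfer_ev[OF D]] by simp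
 thus ?thesis unfolding wzeta_def using wsigma_zero_iff assms(2) by simp
qed

lemma lattice_sparse: "L sparse_in UNIV"
proof (subst sparse_in_open[OF open_UNIV], intro ballI)
 fix y assume "y \<in> (UNIV::complex set)"
 have "\<not> y islimpt {l \<in> L. norm l \<le> norm y + 1}"
  using finite_lattice_ball by (rule islimpt_finite)
 moreover have "y islimpt {l \<in> L. norm l \<le> norm y + 1}" if lim: "y islimpt L"
 proof (rule islimptI)
  fix T assume T: "y \<in> T" "open T"
  hence y: "y \<in> T \<inter> ball y 1" "open (T \<inter> ball y 1)" by auto
  obtain x where x: "x \<in> L" "x \<in> T \<inter> ball y 1" "x \<noteq> y" by (rule islimptE[OF lim y])
  have "norm (x - y) < 1" using x(2) by (simp add: dist_norm norm_minus_commute)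
  hence "norm x \<le> norm y + 1" using norm_triangle_ineq2[of x y] by simp
  thus "\<exists>x\<in>{l \<in> L. norm l \<le> norm y + 1}. x \<in> T \<and> x \<noteq> y" using x by blast
 qed
 ultimately show "\<not> y islimpt L" by blast
qed

lemma lattice_closed: "closed L" using lattice_sparse by (rule sparse_in_UNIV_imp_closed)

lemma near_far_infsum:
 assumes "norm z < R"
 shows "wp \<tau> z = 1/z^2 + (\<Sum>l\<in>near R. pterm l z) + (\<Sum>\<^sub>\<infinity>l\<in>far R. pterm l z)"
proof -
 have "(\<Sum>\<^sub>\<infinity>l\<in>near R \<union> far R. pterm l z) = (\<Sum>\<^sub>\<infinity>l\<in>near R. pterm l z) + (\<Sum>\<^sub>\<infinity>l\<in>far R. pterm l z)"
  by (rule infsum_Un_disjoint) (use near_far Gfar'_deriv(2)[OF assms(1)] in auto)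
 thus ?thesis unfolding wp_def near_far(2) by (simp add: infsum_finite near_far)
qed

lemma wzeta_deriv:
 assumes "z \<notin> L"
 shows "DERIV wzeta z :> - wp \<tau> z"
proof -
 define R where "R = norm z + 1"
 have z: "norm z < R" by (simp add: R_def)
 have z0: "z \<noteq> 0" using assms by auto
 have w: "DERIV (\<lambda>z. zterm l z) z :> - (pterm l z)"
  if "l \<in> near R" for l
  by (rule zeta_term_deriv) (use that assms in \<open>auto simp: near_def\<close>)
 have "DERIV (\<lambda>z. 1/z + (\<Sum>l\<in>near R. zterm l z) + Gfar' R z) z :>
  (- 1/z^2) + (\<Sum>l\<in>near R. - (pterm l z)) + - (\<Sum>\<^sub>\<infinity>l\<in>far R. pterm l z)"
 proof (rule DERIV_add[OF DERIV_add[OF _ DERIV_sum[OF w]] Gfar'_deriv(1)[OF z]])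
  show "DERIV (\<lambda>z. 1/z) z :> - 1/z^2"
   using z0 by (auto intro!: derivative_eq_intros simp: power2_eq_square)
 qed
 also have "(- 1/z^2) + (\<Sum>l\<in>near R. - (pterm l z)) + - (\<Sum>\<^sub>\<infinity>l\<in>far R. pterm l z) = - wp \<tau> z"
  unfolding near_far_infsum[OF z] sum_negf by simp
 finally have D: "DERIV (\<lambda>z. 1/z + (\<Sum>l\<in>near R. zterm l z) + Gfar' R z) z :> - wp \<tau> z" .
 have "eventually (\<lambda>z. z \<in> ball 0 R - L) (nhds z)"
  using z assms lattice_closed by (intro eventually_nhds_in_open open_Diff) auto
 hence "eventually (\<lambda>z. 1/z + (\<Sum>l\<in>near R. zterm l z) + Gfar' R z = wzeta z) (nhds z)"
  by eventually_elim (use wzeta_local[of _ R] in auto)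
 thus ?thesis using D by (rule DERIV_transfer_ev[rotated])
qed

lemma wzeta_holo: "wzeta holomorphic_on (-L)"
 by (rule holomorphic_onI_deriv[OF _ wzeta_deriv]) (use lattice_closed in \<open>auto simp: open_Compl\<close>)

lemma wp_holo: "wp \<tau> holomorphic_on (- L)"
proof -
 have "wzeta holomorphic_on (-L)"
  by (rule wzeta_holo)
 hence "deriv wzeta holomorphic_on (-L)"
  using lattice_closed by (intro holomorphic_deriv) (auto simp: open_Compl)
 hence "(\<lambda>z. - deriv wzeta z) holomorphic_on (-L)" by (rule holomorphic_on_minus)
 thus ?thesis by (rule holomorphic_transform) (simp add: DERIV_imp_deriv[OF wzeta_deriv])
qed

end

section \<open>Periods and quasi-periods\<close>

lemma zero_deriv_imp_const:
 fixes f :: "complex => complex"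
 assumes "open S" "connected S" "\<And>z. z \<in> S ==> DERIV f z :> 0" "z \<in> S" "w \<in> S"
 shows "f z = f w"
proof -
 have "f constant_on S" by (rule has_field_derivative_0_imp_constant_on[OF assms(3,2,1)])
 thus ?thesis using assms(4,5) by (auto simp: constant_on_def)
qed

lemma entire_extension:
 assumes "\<And>a. \<exists>h. h analytic_on {a} \<and> eventually (\<lambda>z. f z = h z) (at a)"
 obtains g where "g holomorphic_on UNIV" "\<And>a. f analytic_on {a} ==> g a = f a"
  "\<And>a. eventually (\<lambda>z. g z = f z) (at a)"
proof -
 have *: "remove_sings f analytic_on {a} \<and> isolated_singularity_at f a" for a
 proof -
  obtain h where h: "h analytic_on {a}" "eventually (\<lambda>z. f z = h z) (at a)" using assms by blast
  have "isolated_singularity_at h a" using h(1) by (simp add: isolated_singularity_at_analytic)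
  hence iso: "isolated_singularity_at f a" using isolated_singularity_at_cong[OF h(2) refl] by simp
  have "h \<midarrow>a\<rightarrow> h a" using h(1) by (simp add: analytic_at_imp_isCont isContD)
  hence "f \<midarrow>a\<rightarrow> h a" using tendsto_cong[OF h(2)] by simp
  thus ?thesis using remove_sings_analytic_at[OF iso] iso by blast
 qed
 show thesis
 proof (rule that[of "remove_sings f"])
  have "remove_sings f analytic_on UNIV" using * by (subst analytic_on_analytic_at) auto
  thus "remove_sings f holomorphic_on UNIV" by (rule analytic_imp_holomorphic)
  show "eventually (\<lambda>z. remove_sings f z = f z) (at a)" for a
   using * eventually_remove_sings_eq_at by blast
 qed auto
qed

lemma entire_eq_sparse:
 assumes "S sparse_in UNIV" "f holomorphic_on UNIV" "g holomorphic_on UNIV" "\<And>z. z \<notin> S ==> f z = g z"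
 shows "f = g"
proof
 fix z
 have "eventually (\<lambda>w. w \<notin> S) (at z)" using assms(1) sparse_in_eventually_iff[OF open_UNIV] by blast
 hence ev: "eventually (\<lambda>w. f w = g w) (at z)" by eventually_elim (use assms in auto)
 have "f \<midarrow>z\<rightarrow> f z" "g \<midarrow>z\<rightarrow> g z"
  using holomorphic_on_imp_continuous_on[OF assms(2)] holomorphic_on_imp_continuous_on[OF assms(3)]
  by (auto simp: continuous_on_eq_continuous_at isCont_def)
 thus "f z = g z" using tendsto_cong[OF ev] tendsto_unique[OF at_neq_bot, of g] by blast
qed

lemma laurent_pole_part:
 assumes "(\<lambda>w. q (a + w)) has_laurent_expansion F" "fls_subdegree F \<ge> -1 \<or> F = 0"
 shows "\<exists>h. h analytic_on {a} \<and> eventually (\<lambda>z. q z = fls_nth F (-1) / (z - a) + h z) (at a)"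
proof -
 let ?c = "fls_nth F (-1)"
 define G where "G = F - fls_const ?c * inverse fls_X"
 have "(\<lambda>w::complex. w) has_laurent_expansion fls_X" by (rule has_laurent_expansion_fps_X)
 hence "(\<lambda>w. q (a + w) - ?c * inverse w) has_laurent_expansion G"
  unfolding G_def by (intro laurent_expansion_intros assms)
 hence G: "fls_conv_radius G > 0" "eventually (\<lambda>w. eval_fls G w = q (a + w) - ?c * inverse w) (at 0)"
  by (auto simp: has_laurent_expansion_def)
 have n: "fls_nth G k = 0" if "k < 0" for k
 proof -
  have "fls_nth F k = 0" if "k < -1" using assms(2) that by auto
  thus ?thesis using that unfolding G_def by (cases "k = -1") (auto simp: fls_X_inv_conv_shift_1 fls_inverse_X fls_X_inv_def)
 qed
 have sd: "fls_subdegree G \<ge> 0"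
 proof (rule ccontr)
  assume "\<not> ?thesis"
  hence "fls_nth G (fls_subdegree G) = 0" "G \<noteq> 0" using n by auto
  thus False by simp
 qed
 have "eval_fls G analytic_on {0}" by (rule analytic_on_eval_fls) (use G(1) sd in \<open>auto simp flip: zero_ereal_def\<close>)
 hence "(eval_fls G \<circ> (\<lambda>z. z - a)) analytic_on {a}"
  by (intro analytic_on_compose[OF analytic_on_diff[OF analytic_on_ident analytic_on_const]]) simp
 moreover have "eventually (\<lambda>z. q z = ?c / (z - a) + (eval_fls G \<circ> (\<lambda>z. z - a)) z) (at a)"
  using G(2) unfolding at_to_0[of a] eventually_filtermap
  by eventually_elim (simp add: divide_inverse add.commute)
 ultimately show ?thesis by blast
qed

lemma analytic_cong_at:
 assumes "h analytic_on {a}" "eventually (\<lambda>z. f z = h z) (nhds a)"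
 shows "f analytic_on {a}"
 using analytic_at_cong[OF assms(2) refl] assms(1) by simp

context half_plane begin

lemma lattice_int_mult: "w \<in> L ==> of_int k * w \<in> L"
proof -
 assume "w \<in> L"
 then obtain a b where "w = lat a b" using lattice_E by blast
 hence "of_int k * w = lat (k*a) (k*b)" by (simp add: algebra_simps)
 thus ?thesis by (simp only: lattice_I)
qed

lemma lattice_induct:
 assumes inv: "\<And>z w. z \<notin> S ==> w \<in> L ==> z + w \<notin> S"
  and f1: "\<And>z. z \<notin> S ==> f (z + 1) = f z + (e1::complex)" and f2: "\<And>z. z \<notin> S ==> f (z + \<tau>) = f z + e2"
  and z: "z \<notin> S"
 shows "f (z + lat a b) = f z + (of_int a * e1 + of_int b * e2)"
proof -
 have step: "f (z + of_int k * w) = f z + of_int k * e"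
  if g: "\<And>z. z \<notin> S ==> f (z + w) = f z + e" and w: "w \<in> L" and z: "z \<notin> S" for k w e z
 proof (induction k rule: int_induct[where k = 0])
  case base show ?case by simp
 next
  case (step1 i)
  have "z + of_int i * w \<notin> S" using inv[OF z lattice_int_mult[OF w]] .
  from g[OF this] step1 show ?case by (simp add: algebra_simps)
 next
  case (step2 i)
  have "z + of_int (i - 1) * w \<notin> S" using inv[OF z lattice_int_mult[OF w]] .
  from g[OF this] step2 show ?case by (simp add: algebra_simps)
 qed
 have "z + of_int a * 1 \<notin> S" using inv[OF z lattice_int_mult[OF lattice_1]] .
 from step[OF f2 lattice_tau this, of b] step[OF f1 lattice_1 z, of a] show ?thesis
  by (simp add: algebra_simps)
qed

lemma open_connected_Compl: fixes S :: "complex set" assumes "S sparse_in UNIV" shows "open (- S)" "connected (- S)"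
proof -
 show "open (- S)" using sparse_in_UNIV_imp_closed[OF assms] by (simp add: open_Compl)
 have "connected (UNIV - S)" by (rule sparse_imp_connected) (use assms in \<open>auto simp: DIM_complex\<close>)
 thus "connected (- S)" by (simp add: Compl_eq_Diff_UNIV)
qed

lemma wp_even: "wp \<tau> (- z) = wp \<tau> z"
proof -
 have "bij_betw uminus (L - {0}) (L - {0})"
  by (rule bij_betwI[where g = uminus]) auto
 from infsum_reindex_bij_betw[OF this, of "\<lambda>l. 1 / (- z - l)^2 - 1 / l^2"]
 have "(\<Sum>\<^sub>\<infinity>l\<in>L - {0}. 1 / (- z - l)^2 - 1 / l^2) = (\<Sum>\<^sub>\<infinity>l\<in>L - {0}. 1 / (- z + l)^2 - 1 / l^2)"
  by simp
 also have "\<dots> = (\<Sum>\<^sub>\<infinity>l\<in>L - {0}. pterm l z)"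
  by (rule infsum_cong) (simp add: power2_commute)
 finally show ?thesis by (simp add: wp_def)
qed

text \<open>The series of \<open>\<wp>'\<close>, which is visibly periodic, unlike that of \<open>\<wp>\<close>.\<close>
definition S3 :: "complex => complex" where "S3 z = (\<Sum>\<^sub>\<infinity>l\<in>L. - 2 / (z - l)^3)"

lemma wp_deriv:
 assumes "z \<notin> L"
 shows "DERIV (wp \<tau>) z :> S3 z"
proof -
 define R where "R = norm z + 1"
 have z: "norm z < R" by (simp add: R_def)
 have z0: "z \<noteq> 0" using assms by auto
 have w: "DERIV (\<lambda>z. 1 / (z - l)^2 - c) x :> - 2 / (x - l)^3"
  if "x \<noteq> l" for l x c :: complex
 proof -
  define d where "d = x - l"
  have d: "d \<noteq> 0" using that by (simp add: d_def)
  have "DERIV (\<lambda>z. (z - l)^2) x :> 2 * d"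
   by (auto intro!: derivative_eq_intros simp: d_def)
  hence "DERIV (\<lambda>z. 1 / (z - l)^2 - c) x :> (0 * (x-l)^2 - 1 * (2 * d)) / ((x-l)^2 * (x-l)^2) - 0"
   by (intro DERIV_diff DERIV_divide DERIV_const) (use that in auto)
  also have "(0 * (x-l)^2 - 1 * (2 * d)) / ((x-l)^2 * (x-l)^2) - 0 = - 2 / (x - l)^3"
   unfolding d_def[symmetric] using d by (simp add: field_simps power2_eq_square power3_eq_cube)
  finally show ?thesis .
 qed
 have "\<exists>D. DERIV (\<lambda>z. \<Sum>\<^sub>\<infinity>l\<in>far R. pterm l z) z :> D \<and>
  ((\<lambda>l. deriv (\<lambda>z. pterm l z) z) has_sum D) (far R)"
 proof (rule infsum_holomorphic[where S = "ball 0 R" and M = "\<lambda>l. 10 * R / norm l^3"])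
  fix l assume wf: "l \<in> far R"
  show "(\<lambda>z. pterm l z) holomorphic_on ball 0 R"
   by (rule holomorphic_onI_deriv[OF open_ball w]) (use far_bounds(2)[OF _ far_D(1)[OF wf]] in auto)
  show "norm (pterm l z) \<le> 10 * R / norm l^3" if "z \<in> ball 0 R" for z
   using far_bounds(4)[OF _ far_D(1)[OF wf]] that by auto
 qed (use z far_summable in auto)
 then obtain D where D: "DERIV (\<lambda>z. \<Sum>\<^sub>\<infinity>l\<in>far R. pterm l z) z :> D"
  "((\<lambda>l. deriv (\<lambda>z. pterm l z) z) has_sum D) (far R)" by blast
 have D2: "((\<lambda>l. - 2 / (z - l)^3) has_sum D) (far R)"
  using D(2) by (rule has_sum_cong[THEN iffD1, rotated])
   (use DERIV_imp_deriv[OF w] far_bounds(2)[OF z far_D(1)] in auto)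
 have "((\<lambda>l. - 2 / (z - l)^3) has_sum ((\<Sum>l\<in>insert 0 (near R). - 2 / (z - l)^3) + D)) (insert 0 (near R) \<union> far R)"
  by (rule has_sum_Un_disjoint[OF has_sum_finite D2]) (use near_far in \<open>auto simp: near_def far_def\<close>)
 moreover have "insert 0 (near R) \<union> far R = L"
  using insert_Diff[OF lattice_0] by (simp only: Un_insert_left near_far(2))
 ultimately have S3: "S3 z = (\<Sum>l\<in>insert 0 (near R). - 2 / (z - l)^3) + D"
  unfolding S3_def using infsumI by metis
 have "DERIV (\<lambda>z. 1/z^2 + (\<Sum>l\<in>near R. pterm l z) + (\<Sum>\<^sub>\<infinity>l\<in>far R. pterm l z)) z :>
  - 2 / (z - 0)^3 + (\<Sum>l\<in>near R. - 2 / (z - l)^3) + D"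
 proof (rule DERIV_add[OF DERIV_add[OF _ DERIV_sum[OF w]] D(1)])
  show "DERIV (\<lambda>z. 1/z^2) z :> - 2 / (z - 0)^3" using w[OF z0, of 0] by simp
 qed (use assms near_def in auto)
 also have "- 2 / (z - 0)^3 + (\<Sum>l\<in>near R. - 2 / (z - l)^3) + D = S3 z"
  unfolding S3 by (subst sum.insert) (use near_far in \<open>auto simp: near_def\<close>)
 finally have "DERIV (\<lambda>z. 1/z^2 + (\<Sum>l\<in>near R. pterm l z) + (\<Sum>\<^sub>\<infinity>l\<in>far R. pterm l z)) z :> S3 z" .
 moreover have "eventually (\<lambda>z. z \<in> ball 0 R) (nhds z)" using z by (intro eventually_nhds_in_open) auto
 hence "eventually (\<lambda>z. 1/z^2 + (\<Sum>l\<in>near R. pterm l z) + (\<Sum>\<^sub>\<infinity>l\<in>far R. pterm l z) = wp \<tau> z) (nhds z)"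
  by eventually_elim (use near_far_infsum[of _ R] in auto)
 ultimately show ?thesis by (rule DERIV_transfer_ev)
qed

lemma S3_periodic: assumes "w \<in> L" shows "S3 (z + w) = S3 z"
proof -
 have "bij_betw (\<lambda>l. l + w) L L"
  by (rule bij_betwI[where g = "\<lambda>l. l - w"]) (use assms in auto)
 from infsum_reindex_bij_betw[OF this, of "\<lambda>l. - 2 / (z + w - l)^3"]
 show ?thesis by (simp add: S3_def)
qed

lemma half_not_lattice: "1/2 \<notin> L" "\<tau>/2 \<notin> L" "(1+\<tau>)/2 \<notin> L"
proof -
 have "pnt x y \<notin> L" if "x = 1/2 \<or> y = 1/2" for x y :: real
 proof
  assume "pnt x y \<in> L"
  then obtain a b where "pnt x y = lat a b" using lattice_E by blast
  hence "pnt x y = pnt (of_int a) (of_int b)" by simp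
  from coord_unique[OF this] have "x = of_int a" "y = of_int b" .
  with that have "\<exists>k::int. (1/2::real) = of_int k" by metis
  then obtain k :: int where "(1/2::real) = of_int k" by blast
  hence "real_of_int (2 * k) = real_of_int 1" by simp
  hence "2 * k = 1" by (simp only: of_int_eq_iff)
  thus False by presburger
 qed
 from this[of "1/2" 0] this[of 0 "1/2"] this[of "1/2" "1/2"]
 show "1/2 \<notin> L" "\<tau>/2 \<notin> L" "(1+\<tau>)/2 \<notin> L" by (auto simp: add_divide_distrib)
qed

text \<open>By the periodicity of \<open>\<wp>'\<close>, \<open>\<wp>(z + w) - \<wp>(z)\<close> is constant; if \<open>w/2\<close> is not a period, evenness makes it vanish at
 \<open>z = -w/2\<close>. The generators \<open>1\<close> and \<open>\<tau>\<close> are such periods.\<close>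
lemma wp_periodic: assumes "w \<in> L" "z \<notin> L" shows "wp \<tau> (z + w) = wp \<tau> z"
proof -
 have per: "wp \<tau> (z + w) = wp \<tau> z" if "w \<in> L" "w/2 \<notin> L" "z \<notin> L" for z w
 proof -
  have "wp \<tau> (z + w) - wp \<tau> z = wp \<tau> (-w/2 + w) - wp \<tau> (-w/2)"
  proof (rule zero_deriv_imp_const[where f = "\<lambda>z. wp \<tau> (z + w) - wp \<tau> z", OF open_connected_Compl[OF lattice_sparse]])
   fix x assume "x \<in> - L"
   hence x: "x \<notin> L" "x + w \<notin> L" using lattice_add_iff[OF that(1)] by auto
   have "DERIV (\<lambda>z. wp \<tau> (z + w)) x :> S3 (x + w)"
    using wp_deriv[OF x(2)] by (simp add: DERIV_shift)
   from DERIV_diff[OF this wp_deriv[OF x(1)]]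
   show "DERIV (\<lambda>z. wp \<tau> (z + w) - wp \<tau> z) x :> 0"
    by (simp add: S3_periodic[OF that(1)])
  qed (use that in auto)
  also have "-w/2 + w = w/2" by (simp add: field_simps)
  also have "wp \<tau> (w/2) - wp \<tau> (-w/2) = 0" using wp_even[of "w/2"] by simp
  finally show ?thesis by simp
 qed
 obtain a b where w: "w = lat a b" using lattice_E[OF assms(1)] .
 have "wp \<tau> (z + lat a b) = wp \<tau> z + (of_int a * 0 + of_int b * 0)"
  by (rule lattice_induct[where S = L]) (use per half_not_lattice assms lattice_add_iff in auto)
 thus ?thesis using w by simp
qed

lemma wsigma_odd: "wsigma \<tau> (- z) = - wsigma \<tau> z"
proof -
 define R where "R = norm z + 1"
 have z: "norm z < R" "norm (- z) < R" by (auto simp: R_def)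
 have "(\<Prod>l\<in>near R. weierstrass_factor 2 (- z/l)) = (\<Prod>l\<in>near R. weierstrass_factor 2 (z/l))"
  by (rule prod.reindex_bij_witness[where i = uminus and j = uminus]) (auto simp: near_def)
 moreover have "Gfar R (- z) = Gfar R z"
 proof -
  have "bij_betw uminus (far R) (far R)"
   by (rule bij_betwI[where g = uminus]) (auto simp: far_def)
  from infsum_reindex_bij_betw[OF this, of "\<lambda>l. sg l (- z)"]
  show ?thesis by (simp add: Gfar_def sg_def)
 qed
 ultimately show ?thesis unfolding wsigma_local[OF z(1)] wsigma_local[OF z(2)] by simp
qed

lemma wsigma_has_deriv: "DERIV (wsigma \<tau>) z :> deriv (wsigma \<tau>) z"
 using wsigma_deriv[OF DERIV_ident] by simp

lemma wzeta_odd: "wzeta (- z) = - wzeta z"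
proof -
 have "DERIV (\<lambda>z. - wsigma \<tau> (- z)) z :> - (deriv (wsigma \<tau>) (- z) * - 1)"
  by (intro DERIV_minus wsigma_deriv) (auto intro!: derivative_eq_intros)
 moreover have "(\<lambda>z. - wsigma \<tau> (- z)) = wsigma \<tau>" by (auto simp: wsigma_odd)
 ultimately have "DERIV (wsigma \<tau>) z :> deriv (wsigma \<tau>) (- z)" by simp
 hence "deriv (wsigma \<tau>) (- z) = deriv (wsigma \<tau>) z" by (rule DERIV_unique[OF _ wsigma_has_deriv])
 thus ?thesis by (simp add: wzeta_def wsigma_odd)
qed

definition eta1 :: complex where "eta1 = 2 * wzeta (1/2)"
definition eta2 :: complex where "eta2 = 2 * wzeta (\<tau>/2)"

abbreviation eta :: "int => int => complex" where "eta a b \<equiv> of_int a * eta1 + of_int b * eta2"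

lemma wzeta_quasi:
 assumes "z \<notin> L"
 shows "wzeta (z + lat a b) = wzeta z + eta a b"
proof -
 have per: "wzeta (z + w) = wzeta z + 2 * wzeta (w/2)" if "w \<in> L" "w/2 \<notin> L" "z \<notin> L" for z w
 proof -
  have "wzeta (z + w) - wzeta z = wzeta (-w/2 + w) - wzeta (-w/2)"
  proof (rule zero_deriv_imp_const[where f = "\<lambda>z. wzeta (z + w) - wzeta z", OF open_connected_Compl[OF lattice_sparse]])
   fix x assume "x \<in> - L"
   hence x: "x \<notin> L" "x + w \<notin> L" using lattice_add_iff[OF that(1)] by auto
   have "DERIV (\<lambda>z. wzeta (z + w)) x :> - wp \<tau> (x + w)"
    using wzeta_deriv[OF x(2)] by (simp add: DERIV_shift)
   from DERIV_diff[OF this wzeta_deriv[OF x(1)]]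
   show "DERIV (\<lambda>z. wzeta (z + w) - wzeta z) x :> 0"
    by (simp add: wp_periodic[OF that(1) x(1)])
  qed (use that in auto)
  also have "-w/2 + w = w/2" by (simp add: field_simps)
  also have "wzeta (w/2) - wzeta (-w/2) = 2 * wzeta (w/2)" using wzeta_odd[of "w/2"] by simp
  finally show ?thesis by (simp add: algebra_simps)
 qed
 show ?thesis
  by (rule lattice_induct[where S = L])
   (use per half_not_lattice assms lattice_add_iff in \<open>auto simp: eta1_def eta2_def\<close>)
qed

lemma wsigma_quasi:
 obtains C where "C \<noteq> 0"
 "\<And>z. wsigma \<tau> (z + lat a b) = C * exp ((eta a b) * z) * wsigma \<tau> z"
proof -
 define w where "w = lat a b"
 define h where "h = eta a b"
 have w: "w \<in> L" by (auto simp: w_def)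
 define f where "f = (\<lambda>z. wsigma \<tau> (z + w) / (exp (h * z) * wsigma \<tau> z))"
 have c: "f z = f (1/2)" if "z \<notin> L" for z
 proof (rule zero_deriv_imp_const[where f = f, OF open_connected_Compl[OF lattice_sparse]])
  fix x assume "x \<in> - L"
  hence x: "x \<notin> L" "x + w \<notin> L" using lattice_add_iff[OF w] by auto
  hence nz: "wsigma \<tau> x \<noteq> 0" "wsigma \<tau> (x + w) \<noteq> 0" by (auto simp: wsigma_zero_iff)
  have q: "wzeta (x + w) = wzeta x + h" using wzeta_quasi[OF x(1), of a b] by (simp add: w_def h_def)
  have e: "deriv (wsigma \<tau>) (x + w) = (wzeta x + h) * wsigma \<tau> (x + w)" "deriv (wsigma \<tau>) x = wzeta x * wsigma \<tau> x"
   using nz unfolding q[symmetric] by (auto simp: wzeta_def)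
  have d1: "DERIV (\<lambda>z. wsigma \<tau> (z + w)) x :> deriv (wsigma \<tau>) (x + w) * 1"
   by (rule wsigma_deriv) (auto intro!: derivative_eq_intros)
  have d2: "DERIV (\<lambda>z. exp (h * z) * wsigma \<tau> z) x :> (exp (h * x) * h) * wsigma \<tau> x + deriv (wsigma \<tau>) x * exp (h * x)"
   by (rule DERIV_mult[OF _ wsigma_has_deriv]) (auto intro!: derivative_eq_intros)
  have "DERIV f x :> (deriv (wsigma \<tau>) (x + w) * 1 * (exp (h * x) * wsigma \<tau> x) -
   wsigma \<tau> (x + w) * ((exp (h * x) * h) * wsigma \<tau> x + deriv (wsigma \<tau>) x * exp (h * x))) /
   ((exp (h * x) * wsigma \<tau> x) * (exp (h * x) * wsigma \<tau> x))"
   unfolding f_def by (rule DERIV_divide[OF d1 d2]) (use nz in auto)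
  moreover have "deriv (wsigma \<tau>) (x + w) * 1 * (exp (h * x) * wsigma \<tau> x) -
   wsigma \<tau> (x + w) * ((exp (h * x) * h) * wsigma \<tau> x + deriv (wsigma \<tau>) x * exp (h * x)) = 0"
   unfolding e by (simp add: algebra_simps)
  ultimately show "DERIV f x :> 0" by simp
 qed (use that half_not_lattice in auto)
 show thesis
 proof (rule that[of "f (1/2)"])
  show "f (1/2) \<noteq> 0" using half_not_lattice lattice_add_iff[OF w, of "1/2"] by (auto simp: f_def wsigma_zero_iff)
  show "wsigma \<tau> (z + lat a b) = f (1/2) * exp ((eta a b) * z) * wsigma \<tau> z" for z
  proof (cases "z \<in> L")
   case True
   hence "wsigma \<tau> z = 0" "wsigma \<tau> (z + w) = 0" using lattice_add_iff[OF w] by (auto simp: wsigma_zero_iff)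
   thus ?thesis by (simp add: w_def)
  next
   case False
   hence "wsigma \<tau> z \<noteq> 0" by (simp add: wsigma_zero_iff)
   thus ?thesis using c[OF False] by (simp add: f_def w_def h_def field_simps)
  qed
 qed
qed

lemma wsigma_deriv_lattice: assumes "w \<in> L" shows "deriv (wsigma \<tau>) w \<noteq> 0"
proof -
 obtain a b where w: "w = lat a b" using lattice_E[OF assms] .
 obtain C where C: "C \<noteq> 0" "\<And>z. wsigma \<tau> (z + w) = C * exp ((eta a b) * z) * wsigma \<tau> z"
  using wsigma_quasi[of a b] w by metis
 have "DERIV (\<lambda>z. wsigma \<tau> (z + w)) 0 :> deriv (wsigma \<tau>) (0 + w) * 1"
  by (rule wsigma_deriv) (auto intro!: derivative_eq_intros)
 moreover have "DERIV (\<lambda>z. C * exp ((eta a b) * z) * wsigma \<tau> z) 0 :>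
   (C * (exp ((eta a b) * 0) * (eta a b))) * wsigma \<tau> 0 + deriv (wsigma \<tau>) 0 * (C * exp ((eta a b) * 0))"
  by (rule DERIV_mult[OF _ wsigma_has_deriv]) (auto intro!: derivative_eq_intros)
 ultimately have "deriv (wsigma \<tau>) (0 + w) * 1 = (C * (exp ((eta a b) * 0) * (eta a b))) * wsigma \<tau> 0 + deriv (wsigma \<tau>) 0 * (C * exp ((eta a b) * 0))"
  unfolding C(2) by (rule DERIV_unique)
 hence "deriv (wsigma \<tau>) w = C" using wsigma_zero_iff[of 0] by (simp add: wsigma_deriv_0)
 thus ?thesis using C by simp
qed

lemma wzeta_near_lattice:
 assumes "l \<in> L"
 shows "\<exists>h. h analytic_on {l} \<and> eventually (\<lambda>z. wzeta z = 1 / (z - l) + h z) (at l)"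
proof -
 obtain a b where w: "l = lat a b" using lattice_E[OF assms] .
 obtain r where r: "r > 0" "\<And>z. z \<in> ball 0 r ==> z \<noteq> 0 ==> z \<notin> L" "r \<le> 1"
 proof -
  have "\<not> 0 islimpt L" using lattice_sparse by (simp add: sparse_in_open)
  then obtain e where "e > 0" "\<And>x. x \<in> L ==> x \<noteq> 0 ==> \<not> dist x 0 < e"
   unfolding islimpt_approachable by blast
  thus ?thesis by (intro that[of "min e 1"]) (auto simp: dist_norm)
 qed
 define h where "h = (\<lambda>z. (\<Sum>l\<in>near 1. zterm l z) + Gfar' 1 z + eta a b)"
 have "h holomorphic_on ball 0 r"
 proof -
  have "Gfar' 1 holomorphic_on ball 0 r"
   by (rule holomorphic_onI_deriv[OF open_ball Gfar'_deriv(1)]) (use r in auto)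
  thus ?thesis unfolding h_def
   by (intro holomorphic_intros) (use r(2) in \<open>auto simp: near_def\<close>)
 qed
 hence "h analytic_on {0}" using r by (intro holomorphic_on_imp_analytic_at[OF _ open_ball]) auto
 hence "(h \<circ> (\<lambda>z. z - l)) analytic_on {l}" by (intro analytic_on_compose analytic_intros) auto
 moreover have "eventually (\<lambda>z. z \<in> ball l r - {l}) (at l)" using r by (intro eventually_at_in_open) auto
 hence "eventually (\<lambda>z. wzeta z = 1 / (z - l) + (h \<circ> (\<lambda>z. z - l)) z) (at l)"
 proof eventually_elim
  case (elim z)
  hence z: "norm (z - l) < r" "z - l \<noteq> 0" by (auto simp: dist_norm norm_minus_commute)
  hence zL: "z - l \<notin> L" using r by auto
  have "wzeta z = wzeta (z - l) + eta a b"
   using wzeta_quasi[OF zL, of a b] by (simp add: w)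
  also have "wzeta (z - l) = 1/(z - l) + (\<Sum>l'\<in>near 1. (z - l)^2 / (l'^2 * (z - l - l'))) + Gfar' 1 (z - l)"
   by (rule wzeta_local) (use z r zL in auto)
  finally show ?case by (simp add: h_def)
 qed
 ultimately show ?thesis by blast
qed

end

section \<open>Legendre's relation and partial fractions\<close>

lemma contour_integral_linepath_alt:
 "contour_integral (linepath a b) f = integral {0..1} (\<lambda>t. f (a + of_real t * (b - a)) * (b - a))"
proof -
 have "linepath a b t = a + of_real t * (b - a)" for t
  by (simp add: linepath_def scaleR_conv_of_real algebra_simps)
 thus ?thesis by (simp add: contour_integral_integral)
qed

lemma contour_integral_shift:
 "contour_integral (linepath (a + w) (b + w)) f = contour_integral (linepath a b) (\<lambda>z. f (z + w))"
 unfolding contour_integral_linepath_alt by (simp add: algebra_simps)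

context half_plane begin

lemma elliptic_entire_const:
 assumes "f holomorphic_on UNIV" "\<And>z. f (z + 1) = f z" "\<And>z. f (z + \<tau>) = f z"
 shows "f z = f w"
proof -
 define h :: "real \<times> real => complex" where "h = (\<lambda>(x,y). pnt x y)"
 define K where "K = h ` ({0..1} \<times> {0..1})"
 have "compact K" unfolding K_def h_def
  by (intro compact_continuous_image compact_Times compact_Icc) (auto simp: case_prod_unfold intro!: continuous_intros)
 moreover have "continuous_on K f"
  using holomorphic_on_imp_continuous_on[OF assms(1)] continuous_on_subset by blast
 ultimately have bd: "bounded (f ` K)" by (intro compact_imp_bounded compact_continuous_image)
 have "f z \<in> f ` K" for z
 proof -
  obtain x y :: real where z: "z = pnt x y" by (rule coord_exists)
  define z' where "z' = h (frac x, frac y)"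
  have "z = z' + (of_int \<lfloor>x\<rfloor> + of_int \<lfloor>y\<rfloor> * \<tau>)" by (simp add: z z'_def h_def frac_def algebra_simps)
  moreover have "f (z' + (of_int \<lfloor>x\<rfloor> + of_int \<lfloor>y\<rfloor> * \<tau>)) = f z' + (of_int \<lfloor>x\<rfloor> * 0 + of_int \<lfloor>y\<rfloor> * 0)"
   by (rule lattice_induct[where S = "{}"]) (use assms in auto)
  moreover have "z' \<in> K" unfolding K_def z'_def
   using frac_ge_0[of x] frac_lt_1[of x] frac_ge_0[of y] frac_lt_1[of y] by (intro imageI) auto
  ultimately show ?thesis by auto
 qed
 hence "bounded (range f)" using bd by (meson bounded_subset image_subsetI)
 hence "f constant_on UNIV" using Liouville_theorem[OF assms(1)] by blast
 thus ?thesis by (auto simp: constant_on_def)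
qed

text \<open>The derivative is entire and elliptic, hence constant.\<close>
lemma quasi_elliptic_entire:
 assumes "f holomorphic_on UNIV" "\<And>z. f (z + 1) = f z + e1" "\<And>z. f (z + \<tau>) = f z + e2"
 shows "f z = f 0 + e1 * z" "e2 = e1 * \<tau>"
proof -
 have D: "DERIV f z :> deriv f z" for z
  using assms(1) by (rule holomorphic_derivI) auto
 have per: "deriv f (z + w) = deriv f z" if "\<And>z. f (z + w) = f z + e" for w e z
 proof -
  have "DERIV (\<lambda>z. f (z + w)) z :> deriv f (z + w)" using D[of "z + w"] by (simp add: DERIV_shift)
  moreover have "DERIV (\<lambda>z. f z + e) z :> deriv f z + 0" by (rule DERIV_add[OF D DERIV_const])
  ultimately show ?thesis unfolding that using DERIV_unique by fastforce
 qed
 have dh: "deriv f holomorphic_on UNIV" using assms(1) by (intro holomorphic_deriv) auto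
 have c: "deriv f z = deriv f 0" for z
  by (rule elliptic_entire_const[OF dh per[OF assms(2)] per[OF assms(3)]])
 have lin: "f z = f 0 + deriv f 0 * z" for z
 proof -
  have "f z - deriv f 0 * z = f 0 - deriv f 0 * 0"
  proof (rule zero_deriv_imp_const[where f = "\<lambda>z. f z - deriv f 0 * z" and S = UNIV])
   fix x
   have "DERIV (\<lambda>z. f z - deriv f 0 * z) x :> deriv f x - deriv f 0 * 1"
    by (intro DERIV_diff D DERIV_cmult DERIV_ident)
   thus "DERIV (\<lambda>z. f z - deriv f 0 * z) x :> 0" using c[of x] by simp
  qed auto
  thus ?thesis by (simp add: diff_eq_eq)
 qed
 have e1: "e1 = deriv f 0" using assms(2)[of 0] lin[of 1] by simp
 thus "f z = f 0 + e1 * z" using lin[of z] by (simp only:)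
 have "f \<tau> = f 0 + e2" using assms(3)[of 0] by simp
 with lin[of \<tau>] show "e2 = e1 * \<tau>" by (metis add_left_cancel e1)
qed

text \<open>The residue theorem for \<open>\<zeta>\<close> on a period parallelogram, cut into two triangles. With its lower left corner at
 \<open>-(1 + \<tau>)/3\<close>, the pole \<open>0\<close> is the centroid of one triangle and the other one contains no lattice point.\<close>
lemma legendre: "eta1 * \<tau> - eta2 = 2 * of_real pi * \<i>"
proof -
 define p where "p = - (1/3) - (1/3) * \<tau>"
 have third: "x = 1/3 \<and> y = 1/3" if pL: "p + (pnt x y) \<in> L" "0 \<le> x" "x \<le> 1" "0 \<le> y" "y \<le> 1" for x y :: real
 proof -
  obtain a b where "p + (pnt x y) = lat a b" by (rule lattice_E[OF pL(1)])
  hence "pnt (x - 1/3) (y - 1/3) = pnt (of_int a) (of_int b)"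
   by (simp add: p_def algebra_simps)
  from coord_unique[OF this] have "x - 1/3 = of_int a" "y - 1/3 = of_int b" by auto
  moreover have "a = 0" "b = 0" using calculation that(2-) by linarith+
  ultimately show ?thesis by auto
 qed
 have T2: "convex hull {p + 1, p + 1 + \<tau>, p + \<tau>} \<inter> L = {}"
 proof safe
  fix z assume "z \<in> convex hull {p + 1, p + 1 + \<tau>, p + \<tau>}" "z \<in> L"
  then obtain u v w :: real where uvw: "u \<ge> 0" "v \<ge> 0" "w \<ge> 0" "u + v + w = 1"
   "z = u *\<^sub>R (p + 1) + v *\<^sub>R (p + 1 + \<tau>) + w *\<^sub>R (p + \<tau>)" unfolding convex_hull_3 by blast
  have "z = of_real (u + v + w) * p + (pnt (u + v) (v + w))"
   unfolding uvw(5) by (simp add: scaleR_conv_of_real algebra_simps)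
  hence "z = p + (pnt (u + v) (v + w))" by (simp add: uvw(4))
  with \<open>z \<in> L\<close> have "u + v = 1/3 \<and> v + w = 1/3" by (intro third) (use uvw in auto)
  thus "z \<in> {}" using uvw by linarith
 qed
 have T1: "z = 0" if zin: "z \<in> convex hull {p, p + 1, p + \<tau>}" and zL: "z \<in> L" for z
 proof -
  obtain u v w :: real where uvw: "u \<ge> 0" "v \<ge> 0" "w \<ge> 0" "u + v + w = 1"
   "z = u *\<^sub>R p + v *\<^sub>R (p + 1) + w *\<^sub>R (p + \<tau>)" using zin unfolding convex_hull_3 by blast
  have "z = of_real (u + v + w) * p + (of_real v + of_real w * \<tau>)"
   unfolding uvw(5) by (simp add: scaleR_conv_of_real algebra_simps)
  hence z: "z = p + (of_real v + of_real w * \<tau>)" by (simp add: uvw(4))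
  with zL have "v = 1/3 \<and> w = 1/3" by (intro third) (use uvw in auto)
  hence e: "complex_of_real v = complex_of_real (1/3)" "complex_of_real w = complex_of_real (1/3)" by (simp_all only:)
  show ?thesis unfolding z e p_def by simp
 qed
 have int0: "0 \<in> interior (convex hull {p, p + 1, p + \<tau>})"
 proof -
  define Y where "Y = (\<lambda>z. Im (z - p) / Im \<tau>)"
  define X where "X = (\<lambda>z. Re (z - p) - Y z * Re \<tau>)"
  have cY: "continuous_on UNIV Y" unfolding Y_def using Im_tau by (intro continuous_intros) auto
  have cX: "continuous_on UNIV X" unfolding X_def by (intro continuous_intros cY)
  have z: "z = p + (pnt (X z) (Y z))" for z
   by (rule complex_eqI) (use Im_tau in \<open>auto simp: X_def Y_def\<close>)
  let ?O = "{z. 0 < X z} \<inter> {z. 0 < Y z} \<inter> {z. X z + Y z < 1}"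
  have "open ?O" by (intro open_Int open_Collect_less continuous_intros cX cY)
  moreover have "?O \<subseteq> convex hull {p, p + 1, p + \<tau>}"
  proof
   fix z assume zO: "z \<in> ?O"
   have "z = (1 - X z - Y z) *\<^sub>R p + X z *\<^sub>R (p + 1) + Y z *\<^sub>R (p + \<tau>)"
    by (subst z) (simp add: scaleR_conv_of_real algebra_simps)
   thus "z \<in> convex hull {p, p + 1, p + \<tau>}" unfolding convex_hull_3
    using zO by (intro CollectI exI[of _ "1 - X z - Y z"] exI[of _ "X z"] exI[of _ "Y z"]) auto
  qed
  moreover have "0 \<in> ?O"
  proof -
   have "Y 0 = 1/3" using Im_tau by (simp add: Y_def p_def)
   moreover have "X 0 = 1/3" unfolding X_def calculation by (simp add: p_def)
   ultimately show ?thesis by simp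
  qed
  ultimately show ?thesis using interior_maximal by blast
 qed
 let ?I = "\<lambda>a b. contour_integral (linepath a b) wzeta"
 define U where "U = - (L - {0})"
 have Us: "(L - {0}) sparse_in UNIV" using lattice_sparse by (rule sparse_in_subset2) auto
 have Uo: "open U" unfolding U_def using open_connected_Compl(1)[OF Us] .
 define F where "F = (\<lambda>w. if w = 0 then 1 else w * wzeta w)"
 have F: "F holomorphic_on U"
 proof -
  have "F analytic_on {a}" if "a \<in> U" for a
  proof (cases "a = 0")
   case True
   obtain h where h: "h analytic_on {0}" "eventually (\<lambda>z. wzeta z = 1 / (z - 0) + h z) (at 0)"
    using wzeta_near_lattice[OF lattice_0] by blast
   have "(\<lambda>z. 1 + z * h z) analytic_on {a}" unfolding True by (intro analytic_intros h)
   moreover have "eventually (\<lambda>z. F z = 1 + z * h z) (nhds a)"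
    using h(2) unfolding True eventually_at_filter
    by eventually_elim (auto simp: F_def field_simps)
   ultimately show ?thesis by (rule analytic_cong_at)
  next
   case False
   hence a: "a \<in> - L" using that by (auto simp: U_def)
   have "wzeta holomorphic_on (-L)"
    by (rule wzeta_holo)
   hence "(\<lambda>w. w * wzeta w) holomorphic_on (-L)" by (intro holomorphic_intros)
   hence "F holomorphic_on (-L)" by (rule holomorphic_transform) (auto simp: F_def)
   thus ?thesis using a open_connected_Compl(1)[OF lattice_sparse] holomorphic_on_imp_analytic_at by blast
  qed
  hence "F analytic_on U" by (subst analytic_on_analytic_at) auto
  thus ?thesis by (rule analytic_imp_holomorphic)
 qed
 have hz: "wzeta holomorphic_on (-L)"
  by (rule wzeta_holo)
 let ?T = "linepath p (p + 1) +++ linepath (p + 1) (p + \<tau>) +++ linepath (p + \<tau>) p"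
 have seg: "path_image ?T \<subseteq> convex hull {p, p + 1, p + \<tau>} - {0}"
 proof -
  have "path_image ?T \<subseteq> convex hull {p, p + 1, p + \<tau>}"
   by (simp add: path_image_join segments_subset_convex_hull)
  moreover have "0 \<notin> path_image ?T"
   using int0 interior_of_triangle[of p "p+1" "p+\<tau>"] by (auto simp: path_image_join)
  ultimately show ?thesis by blast
 qed
 have segL: "path_image ?T \<inter> L = {}" using seg T1 by blast
 have w1: "winding_number ?T 0 = 1"
  unfolding winding_number_triangle[OF int0] using Im_tau by (simp add: p_def)
 have hF: "F holomorphic_on convex hull {p, p + 1, p + \<tau>}"
  by (rule holomorphic_on_subset[OF F]) (use T1 in \<open>auto simp: U_def\<close>)
 have vT: "valid_path ?T" "pathfinish ?T = pathstart ?T" by (auto intro!: valid_path_join)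
 note C = Cauchy_integral_formula_convex_simple[OF convex_convex_hull hF int0 vT(1) seg vT(2)]
 have "(wzeta has_contour_integral (2*pi * \<i> * winding_number ?T 0 * F 0)) ?T"
  using C by (rule has_contour_integral_eq) (use seg in \<open>auto simp: F_def\<close>)
 hence "(wzeta has_contour_integral 2 * of_real pi * \<i>) ?T" unfolding w1 by (simp add: F_def)
 hence E1: "?I p (p + 1) + ?I (p + 1) (p + \<tau>) + ?I (p + \<tau>) p = 2 * of_real pi * \<i>"
  by (rule has_chain_integral_chain_integral3)
 have "(wzeta has_contour_integral 0) (linepath (p + 1) (p + 1 + \<tau>) +++ linepath (p + 1 + \<tau>) (p + \<tau>) +++ linepath (p + \<tau>) (p + 1))"
  by (rule Cauchy_theorem_triangle) (rule holomorphic_on_subset[OF hz], use T2 in auto)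
 hence E2: "?I (p + 1) (p + 1 + \<tau>) + ?I (p + 1 + \<tau>) (p + \<tau>) + ?I (p + \<tau>) (p + 1) = 0"
  by (rule has_chain_integral_chain_integral3)
 have cont: "continuous_on (closed_segment a b) wzeta" if "closed_segment a b \<inter> L = {}" for a b
  using holomorphic_on_imp_continuous_on[OF hz] continuous_on_subset that by (metis disjoint_eq_subset_Compl)
 have segs: "closed_segment p (p+1) \<inter> L = {}" "closed_segment (p+1) (p+\<tau>) \<inter> L = {}" "closed_segment (p+\<tau>) p \<inter> L = {}"
  using segL by (auto simp: path_image_join)
 have seg3: "closed_segment (p+1+\<tau>) (p+\<tau>) \<inter> L = {}"
 proof -
  have "closed_segment (p+1+\<tau>) (p+\<tau>) \<subseteq> convex hull {p + 1, p + 1 + \<tau>, p + \<tau>}"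
   using segments_subset_convex_hull by blast
  thus ?thesis using T2 by blast
 qed
 have r1: "?I (p + \<tau>) (p + 1) = - ?I (p + 1) (p + \<tau>)"
  by (rule contour_integral_reverse_linepath) (use cont segs closed_segment_commute in metis)
 have r2: "?I (p + \<tau>) p = - ?I p (p + \<tau>)"
  by (rule contour_integral_reverse_linepath) (use cont segs closed_segment_commute in metis)
 have r3: "?I (p + 1 + \<tau>) (p + \<tau>) = - ?I (p + \<tau>) (p + 1 + \<tau>)"
  by (rule contour_integral_reverse_linepath) (use cont seg3 closed_segment_commute in metis)
 have sh: "?I (a + w) (b + w) = ?I a b + e * (b - a)"
  if "closed_segment a b \<inter> L = {}" and q: "\<And>z. z \<notin> L ==> wzeta (z + w) = wzeta z + e" for a b w e
 proof -
  have "?I (a + w) (b + w) = contour_integral (linepath a b) (\<lambda>z. wzeta (z + w))" by (rule contour_integral_shift)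
  also have "\<dots> = contour_integral (linepath a b) (\<lambda>z. wzeta z + e)"
   by (rule contour_integral_cong) (use that in auto)
  also have "\<dots> = ?I a b + contour_integral (linepath a b) (\<lambda>z. e)"
   by (rule contour_integral_add) (use cont[OF that(1)] in \<open>auto intro: contour_integrable_continuous_linepath\<close>)
  also have "contour_integral (linepath a b) (\<lambda>z. e) = e * (b - a)" by simp
  finally show ?thesis .
 qed
 have s1: "?I (p + \<tau>) (p + 1 + \<tau>) = ?I p (p + 1) + eta2 * (p + 1 - p)"
  by (rule sh) (use segs wzeta_quasi[of _ 0 1] in auto)
 have "closed_segment p (p + \<tau>) \<inter> L = {}" using segs closed_segment_commute by metis
 hence "?I (p + 1) (p + \<tau> + 1) = ?I p (p + \<tau>) + eta1 * (p + \<tau> - p)"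
  by (rule sh) (use wzeta_quasi[of _ 1 0] in auto)
 hence s2: "?I (p + 1) (p + 1 + \<tau>) = ?I p (p + \<tau>) + eta1 * \<tau>" by (simp add: add_ac)
 from E1 E2 r1 r2 r3 s1 s2 show ?thesis by (simp add: algebra_simps)
qed

lemma legendre_inverse:
 assumes "L1 = c - eta1 * s" "L2 = c * \<tau> - eta2 * s"
 shows "s = (L2 - \<tau> * L1) / (2 * of_real pi * \<i>)" "c = (eta1 * L2 - eta2 * L1) / (2 * of_real pi * \<i>)"
proof -
 have nz: "2 * of_real pi * \<i> \<noteq> (0::complex)" by simp
 have "L2 - \<tau> * L1 = (eta1 * \<tau> - eta2) * s" unfolding assms by (simp add: algebra_simps)
 thus "s = (L2 - \<tau> * L1) / (2 * of_real pi * \<i>)" unfolding legendre using nz by simp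
 have "eta1 * L2 - eta2 * L1 = (eta1 * \<tau> - eta2) * c" unfolding assms by (simp add: algebra_simps)
 thus "c = (eta1 * L2 - eta2 * L1) / (2 * of_real pi * \<i>)" unfolding legendre using nz by simp
qed

lemma wzeta_shift_analytic: assumes "a - p \<notin> L" shows "(\<lambda>z. wzeta (z - p)) analytic_on {a}"
proof -
 have "wzeta analytic_on {a - p}"
  using holomorphic_on_imp_analytic_at[OF wzeta_holo] assms lattice_closed by (auto simp: open_Compl)
 hence "(wzeta \<circ> (\<lambda>z. z - p)) analytic_on {a}" by (intro analytic_on_compose analytic_intros) auto
 thus ?thesis by (simp add: o_def)
qed

lemma wzeta_shift_near:
 assumes "a - p \<in> L"
 shows "\<exists>h. h analytic_on {a} \<and> eventually (\<lambda>z. wzeta (z - p) = 1 / (z - a) + h z) (at a)"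
proof -
 obtain h where h: "h analytic_on {a - p}" "eventually (\<lambda>z. wzeta z = 1 / (z - (a - p)) + h z) (at (a - p))"
  using wzeta_near_lattice[OF assms] by blast
 have "(h \<circ> (\<lambda>z. z - p)) analytic_on {a}" using h(1) by (intro analytic_on_compose analytic_intros) auto
 moreover have "eventually (\<lambda>z. wzeta (z - p) = 1 / (z - a) + (h \<circ> (\<lambda>z. z - p)) z) (at a)"
  using h(2) unfolding at_to_0[of a] at_to_0[of "a - p"] eventually_filtermap
  by eventually_elim (simp add: algebra_simps)
 ultimately show ?thesis by blast
qed

text \<open>After the principal parts have been subtracted with translates of \<open>\<zeta>\<close>, an entire function with constant increments over
 the periods is left. It is linear, and by Legendre's relation its slope and the sum of the residues vanish.\<close>
theorem partial_fractions:
 assumes S: "S sparse_in UNIV" "\<And>z w. w \<in> L ==> z + w \<in> S \<longleftrightarrow> z \<in> S"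
  and q: "q holomorphic_on - S" "\<And>z. z \<notin> S ==> q (z + 1) = q z" "\<And>z. z \<notin> S ==> q (z + \<tau>) = q z"
  and res: "\<And>a. a \<in> S ==> \<exists>F. (\<lambda>w. q (a + w)) has_laurent_expansion F \<and>
        (fls_subdegree F \<ge> -1 \<or> F = 0) \<and> fls_nth F (-1) = r a"
  and Rp: "finite Rp" "Rp \<subseteq> S" "\<And>a. a \<in> S ==> \<exists>!p. p \<in> Rp \<and> a - p \<in> L"
 shows "(\<Sum>p\<in>Rp. r p) = 0" "\<exists>c. \<forall>z. z \<notin> S \<longrightarrow> q z = c + (\<Sum>p\<in>Rp. r p * wzeta (z - p))"
proof -
 have Lp: "z - p \<notin> L" if "z \<notin> S" "p \<in> Rp" for z p
 proof
  assume "z - p \<in> L"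
  hence "p + (z - p) \<in> S" using S(2)[of "z - p" p] that Rp(2) by blast
  thus False using that by simp
 qed
 have qper: "q (z + w) = q z" if "z \<notin> S" and wL: "w \<in> L" for z w
 proof -
  obtain a b where w: "w = lat a b" by (rule lattice_E[OF wL])
  have "q (z + lat a b) = q z + (of_int a * 0 + of_int b * 0)"
   by (rule lattice_induct[where S = S]) (use S q that in auto)
  thus ?thesis by (simp add: w)
 qed
 define f where "f = (\<lambda>z. q z - (\<Sum>p\<in>Rp. r p * wzeta (z - p)))"
 have nS: "eventually (\<lambda>z. z \<notin> S) (at a)" for a
  using S(1) sparse_in_eventually_iff[OF open_UNIV] by blast
 have "\<exists>h. h analytic_on {a} \<and> eventually (\<lambda>z. f z = h z) (at a)" for a
 proof (cases "a \<in> S")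
  case False
  have "q analytic_on {a}"
   using holomorphic_on_imp_analytic_at[OF q(1) open_connected_Compl(1)[OF S(1)]] False by blast
  hence "f analytic_on {a}" unfolding f_def
   using Lp[OF False] by (intro analytic_intros wzeta_shift_analytic) auto
  thus ?thesis by auto
 next
  case True
  obtain F where F: "(\<lambda>w. q (a + w)) has_laurent_expansion F" "fls_subdegree F \<ge> -1 \<or> F = 0" "fls_nth F (-1) = r a"
   using res[OF True] by blast
  obtain h where h: "h analytic_on {a}" "eventually (\<lambda>z. q z = r a / (z - a) + h z) (at a)"
   using laurent_pole_part[OF F(1,2)] F(3) by auto
  obtain p where p: "p \<in> Rp" "a - p \<in> L" "\<And>p'. p' \<in> Rp ==> a - p' \<in> L ==> p' = p"
   using Rp(3)[OF True] by metis
  have rp: "r p = r a"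
  proof -
   obtain G where G: "(\<lambda>w. q (p + w)) has_laurent_expansion G" "fls_nth G (-1) = r p"
    using res[of p] p(1) Rp(2) by blast
   have "eventually (\<lambda>w. p + w \<notin> S) (at 0)"
    using nS[of p] unfolding at_to_0[of p] eventually_filtermap by (simp add: add.commute)
   hence "eventually (\<lambda>w. q (a + w) = q (p + w)) (at 0)"
   proof eventually_elim
    case (elim w)
    from qper[OF elim p(2)] show ?case by (simp add: add.commute)
   qed
   hence "(\<lambda>w. q (p + w)) has_laurent_expansion F"
    using F(1) has_laurent_expansion_cong[OF _ refl] by metis
   hence "F = G" using has_laurent_expansion_unique G(1) by blast
   thus ?thesis using F(3) G(2) by simp
  qed
  obtain k where k: "k analytic_on {a}" "eventually (\<lambda>z. wzeta (z - p) = 1 / (z - a) + k z) (at a)"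
   using wzeta_shift_near[OF p(2)] by blast
  define H where "H = (\<lambda>z. h z - r a * k z - (\<Sum>p\<in>Rp - {p}. r p * wzeta (z - p)))"
  have "H analytic_on {a}" unfolding H_def
   using h(1) k(1) p(3) by (intro analytic_intros wzeta_shift_analytic) auto
  moreover have "eventually (\<lambda>z. f z = H z) (at a)"
   using h(2) k(2)
  proof eventually_elim
   case (elim z)
   have "(\<Sum>p\<in>Rp. r p * wzeta (z - p)) = r p * wzeta (z - p) + (\<Sum>p\<in>Rp - {p}. r p * wzeta (z - p))"
    by (rule sum.remove[OF Rp(1) p(1)])
   thus ?case unfolding f_def H_def elim rp by (simp add: algebra_simps)
  qed
  ultimately show ?thesis by blast
 qed
 then obtain g where g: "g holomorphic_on UNIV" "\<And>a. f analytic_on {a} ==> g a = f a"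
  "\<And>a. eventually (\<lambda>z. g z = f z) (at a)" using entire_extension by blast
 have gf: "g z = f z" if "z \<notin> S" for z
 proof (rule g(2))
  have "q analytic_on {z}"
   using holomorphic_on_imp_analytic_at[OF q(1) open_connected_Compl(1)[OF S(1)]] that by blast
  thus "f analytic_on {z}" unfolding f_def
   using Lp[OF that] by (intro analytic_intros wzeta_shift_analytic) auto
 qed
 define T where "T = (\<Sum>p\<in>Rp. r p)"
 have gq: "g (z + w) = g z + - (e * T)" if w: "w \<in> L" "\<And>z. z \<notin> L ==> wzeta (z + w) = wzeta z + e" for z w e
 proof -
  have "(\<lambda>z. g (z + w)) = (\<lambda>z. g z + - (e * T))"
  proof (rule entire_eq_sparse[OF S(1)])
   show "(\<lambda>z. g (z + w)) holomorphic_on UNIV"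
    by (rule holomorphic_on_compose_gen[unfolded o_def, OF _ g(1)]) (auto intro!: holomorphic_intros)
   show "(\<lambda>z. g z + - (e * T)) holomorphic_on UNIV" using g(1) by (intro holomorphic_intros)
   fix z assume z: "z \<notin> S"
   hence z': "z + w \<notin> S" using S(2)[OF w(1)] by blast
   have "(\<Sum>p\<in>Rp. r p * wzeta (z + w - p)) = (\<Sum>p\<in>Rp. r p * wzeta (z - p) + e * r p)"
   proof (rule sum.cong[OF refl])
    fix p assume "p \<in> Rp"
    have "wzeta (z + w - p) = wzeta (z - p) + e" using w(2)[OF Lp[OF z \<open>p \<in> Rp\<close>]] by (simp add: algebra_simps)
    thus "r p * wzeta (z + w - p) = r p * wzeta (z - p) + e * r p" by (simp add: algebra_simps)
   qed
   thus "g (z + w) = g z + - (e * T)"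
    unfolding gf[OF z] gf[OF z'] f_def T_def using qper[OF z w(1)] by (simp add: sum.distrib sum_distrib_left)
  qed
  thus ?thesis by metis
 qed
 have g1: "g (z + 1) = g z + - (eta1 * T)" for z
  by (rule gq) (use wzeta_quasi[of _ 1 0] in auto)
 have g2: "g (z + \<tau>) = g z + - (eta2 * T)" for z
  by (rule gq) (use wzeta_quasi[of _ 0 1] in auto)
 note lin = quasi_elliptic_entire[OF g(1) g1 g2]
 have "(eta1 * \<tau> - eta2) * T = 0" using lin(2) by (auto simp: algebra_simps)
 hence T0: "T = 0" unfolding legendre by simp
 thus "(\<Sum>p\<in>Rp. r p) = 0" by (simp add: T_def)
 have "q z = g 0 + (\<Sum>p\<in>Rp. r p * wzeta (z - p))" if "z \<notin> S" for z
  using lin(1)[of z] T0 gf[OF that] by (simp add: f_def algebra_simps)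
 thus "\<exists>c. \<forall>z. z \<notin> S \<longrightarrow> q z = c + (\<Sum>p\<in>Rp. r p * wzeta (z - p))" by blast
qed

end

section \<open>Zeros and poles of elliptic functions\<close>

lemma laurent_transfer:
 assumes "f has_laurent_expansion F" "eventually (\<lambda>w. f w = g w) (at 0)"
 shows "g has_laurent_expansion F"
 using has_laurent_expansion_cong[OF assms(2) refl] assms(1) by simp

lemma laurent_even:
 assumes F: "f has_laurent_expansion F" and ev: "eventually (\<lambda>w. f (- w) = f w) (at 0)" and k: "odd k"
 shows "fls_nth F k = 0"
proof -
 define G :: "complex fps" where "G = fps_const (-1) * fps_X"
 have "(\<lambda>w::complex. - w) has_fps_expansion G"
  unfolding G_def using has_fps_expansion_cmult_left[OF has_fps_expansion_fps_X, of "-1"] by simp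
 hence "uminus has_laurent_expansion fps_to_fls G" by (rule has_laurent_expansion_fps)
 moreover have "fps_nth G 0 = 0" "G \<noteq> 0"
 proof -
  show "fps_nth G 0 = 0" by (simp add: G_def)
  have "fps_nth G 1 = -1" by (simp add: G_def)
  thus "G \<noteq> 0" by auto
 qed
 ultimately have "(f \<circ> uminus) has_laurent_expansion fls_compose_fps F G"
  by (rule has_laurent_expansion_compose[OF F])
 hence "f has_laurent_expansion fls_compose_fps F G"
  using has_laurent_expansion_cong[OF ev refl] by (simp add: o_def)
 hence "F = fls_compose_fps F G" using F has_laurent_expansion_unique by blast
 hence "fls_nth F k = fls_nth F k * (-1) powi k"
  using fls_nth_fls_compose_fps_linear[of "-1" F k] unfolding G_def by simp
 thus ?thesis using k by simp
qed

lemma fls_quot_residue: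
 fixes F G H :: "complex fls"
 assumes "G * F = H" "F \<noteq> 0" "\<And>k. k < fls_subdegree F - 1 ==> fls_nth H k = 0"
 shows "fls_subdegree G \<ge> -1 \<or> G = 0" "fls_nth G (-1) * fls_nth F (fls_subdegree F) = fls_nth H (fls_subdegree F - 1)"
proof -
 have base: "fls_nth H (fls_subdegree G + fls_subdegree F) = fls_nth G (fls_subdegree G) * fls_nth F (fls_subdegree F)"
  unfolding assms(1)[symmetric] by (rule fls_times_base)
 show 1: "fls_subdegree G \<ge> -1 \<or> G = 0"
 proof (rule ccontr)
  assume "\<not> ?thesis"
  hence a: "fls_subdegree G < -1" "G \<noteq> 0" by auto
  hence "fls_nth H (fls_subdegree G + fls_subdegree F) = 0" by (intro assms(3)) auto
  thus False using base a assms(2) by simp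
 qed
 show "fls_nth G (-1) * fls_nth F (fls_subdegree F) = fls_nth H (fls_subdegree F - 1)"
 proof (cases "G = 0")
  case True thus ?thesis using assms(1) by auto
 next
  case False
  show ?thesis
  proof (cases "fls_subdegree G = -1")
   case True thus ?thesis using base by (simp add: add.commute)
  next
   case False2: False
   hence "fls_subdegree G > -1" using 1 False by auto
   hence "fls_nth G (-1) = 0" "fls_nth (G * F) (fls_subdegree F - 1) = 0" by (auto intro: fls_times_nth_eq0)
   thus ?thesis using assms(1) by simp
  qed
 qed
qed

lemma fls_deriv_quot:
 fixes F :: "complex fls"
 assumes "F \<noteq> 0"
 shows "fls_subdegree (fls_deriv F / F) \<ge> -1 \<or> fls_deriv F / F = 0"
  "fls_nth (fls_deriv F / F) (-1) = of_int (fls_subdegree F)"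
proof -
 have e: "(fls_deriv F / F) * F = fls_deriv F" using assms by simp
 have l: "fls_nth (fls_deriv F) k = 0" if "k < fls_subdegree F - 1" for k using that by simp
 show "fls_subdegree (fls_deriv F / F) \<ge> -1 \<or> fls_deriv F / F = 0"
  using fls_quot_residue(1)[OF e assms l] .
 have "fls_nth (fls_deriv F / F) (-1) * fls_nth F (fls_subdegree F) = of_int (fls_subdegree F) * fls_nth F (fls_subdegree F)"
  using fls_quot_residue(2)[OF e assms l] by simp
 thus "fls_nth (fls_deriv F / F) (-1) = of_int (fls_subdegree F)" using assms by simp
qed

lemma analytic_imp_laurent:
 assumes "f analytic_on {a}"
 shows "(\<lambda>w. f (a + w)) has_laurent_expansion fps_to_fls (fps_expansion f a)"
 using has_laurent_expansion_fps[OF analytic_at_imp_has_fps_expansion[OF assms]] .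

context half_plane begin

definition fund :: "complex set" where
 "fund = {pnt x y | x y. 0 \<le> x \<and> x < 1 \<and> 0 \<le> y \<and> y < 1}"

lemma fund_unique: "\<exists>!p. p \<in> fund \<and> a - p \<in> L"
proof -
 obtain x y :: real where a: "a = pnt x y" by (rule coord_exists)
 define p where "p = pnt (frac x) (frac y)"
 have "p \<in> fund" unfolding fund_def p_def using frac_ge_0[of x] frac_lt_1[of x] frac_ge_0[of y] frac_lt_1[of y] by blast
 moreover have "a - p = of_int \<lfloor>x\<rfloor> + of_int \<lfloor>y\<rfloor> * \<tau>" by (simp add: a p_def frac_def algebra_simps)
 hence "a - p \<in> L" by (simp only: lattice_I)
 moreover have "p1 = p2" if h: "p1 \<in> fund" "a - p1 \<in> L" "p2 \<in> fund" "a - p2 \<in> L" for p1 p2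
 proof -
  obtain x1 y1 where 1: "p1 = of_real x1 + of_real y1 * \<tau>" "0 \<le> x1" "x1 < 1" "0 \<le> y1" "y1 < 1"
   using h(1) unfolding fund_def by blast
  obtain x2 y2 where 2: "p2 = of_real x2 + of_real y2 * \<tau>" "0 \<le> x2" "x2 < 1" "0 \<le> y2" "y2 < 1"
   using h(3) unfolding fund_def by blast
  have "p1 - p2 \<in> L" using lattice_diff[OF h(4,2)] by simp
  then obtain m k where mk: "p1 - p2 = lat m k" by (rule lattice_E)
  have "pnt (x1 - x2) (y1 - y2) = pnt (of_int m) (of_int k)"
   using mk unfolding 1(1) 2(1) by (simp add: algebra_simps)
  from coord_unique[OF this] have "x1 - x2 = of_int m" "y1 - y2 = of_int k" by auto
  moreover have "m = 0" "k = 0" using calculation 1(2-) 2(2-) by linarith+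
  ultimately show ?thesis using 1 2 by simp
 qed
 ultimately show ?thesis by blast
qed

lemma fund_finite: assumes "S sparse_in UNIV" shows "finite (S \<inter> fund)"
proof -
 define h :: "real \<times> real => complex" where "h = (\<lambda>(x,y). pnt x y)"
 define K where "K = h ` ({0..1} \<times> {0..1})"
 have "compact K" unfolding K_def h_def
  by (intro compact_continuous_image compact_Times compact_Icc) (auto simp: case_prod_unfold intro!: continuous_intros)
 moreover have "S sparse_in K" using assms by (rule sparse_in_subset) auto
 ultimately have "finite (K \<inter> S)" by (intro sparse_in_compact_finite)
 moreover have "fund \<subseteq> K"
 proof
  fix z assume "z \<in> fund"
  then obtain x y where "z = pnt x y" "0 \<le> x" "x < 1" "0 \<le> y" "y < 1"
   unfolding fund_def by blast
  hence "z = h (x,y)" "(x,y) \<in> {0..1} \<times> {0..1}" by (auto simp: h_def)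
  thus "z \<in> K" unfolding K_def by blast
 qed
 hence "S \<inter> fund \<subseteq> K \<inter> S" by blast
 ultimately show ?thesis using finite_subset by blast
qed

lemma fund_reps:
 assumes "\<And>z w. w \<in> L ==> z + w \<in> S \<longleftrightarrow> z \<in> S" "a \<in> S"
 shows "\<exists>!p. p \<in> S \<inter> fund \<and> a - p \<in> L"
proof -
 have "p \<in> S" if "a - p \<in> L" for p
  using assms(1)[OF that, of p] assms(2) by simp
 thus ?thesis using fund_unique[of a] by blast
qed

lemma fund_0: "0 \<in> fund" unfolding fund_def by (auto intro!: exI[of _ 0])

lemma fund_lattice: "L \<inter> fund = {0}"
proof -
 have "p = 0" if "p \<in> L" "p \<in> fund" for p
  using fund_unique[of 0] fund_0 that lattice_uminus by (metis diff_0 diff_self lattice_0)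
 thus ?thesis using fund_0 by auto
qed

text \<open>The residues of the logarithmic derivative add up to zero.\<close>
lemma elliptic_divisor_degree:
 assumes S0: "S0 sparse_in UNIV" "\<And>z w. w \<in> L ==> z + w \<in> S0 \<longleftrightarrow> z \<in> S0"
  and f: "f holomorphic_on - S0" "\<And>z. z \<notin> S0 ==> f (z + 1) = f z" "\<And>z. z \<notin> S0 ==> f (z + \<tau>) = f z"
  and lau: "\<And>a. (\<lambda>w. f (a + w)) has_laurent_expansion F a" "\<And>a. F a \<noteq> 0"
 defines "S \<equiv> S0 \<union> {z. f z = 0}"
 shows "S sparse_in UNIV" "(\<Sum>p\<in>S \<inter> fund. fls_subdegree (F p)) = 0"
proof -
 show S: "S sparse_in UNIV"
 proof (subst sparse_in_eventually_iff[OF open_UNIV], intro ballI)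
  fix a :: complex
  have "eventually (\<lambda>z. z \<notin> S0) (at a)" using S0(1) sparse_in_eventually_iff[OF open_UNIV] by blast
  moreover have "eventually (\<lambda>z. f z \<noteq> 0) (at a)"
   using has_laurent_expansion_eventually_nonzero_iff[OF lau(1)] lau(2) by blast
  ultimately show "eventually (\<lambda>z. z \<notin> S) (at a)" by eventually_elim (auto simp: S_def)
 qed
 have nS: "eventually (\<lambda>z. z \<notin> S) (at a)" for a
  using S sparse_in_eventually_iff[OF open_UNIV] by blast
 have fper: "f (z + w) = f z" if "z \<notin> S0" and wL: "w \<in> L" for z w
 proof -
  obtain a b where w: "w = lat a b" by (rule lattice_E[OF wL])
  have "f (z + lat a b) = f z + (of_int a * 0 + of_int b * 0)"
   by (rule lattice_induct[where S = S0]) (use S0 f that in auto)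
  thus ?thesis by (simp add: w)
 qed
 have Sinv: "z + w \<in> S \<longleftrightarrow> z \<in> S" if "w \<in> L" for z w
  using S0(2)[OF that, of z] fper[OF _ that, of z] by (auto simp: S_def)
 define q where "q = (\<lambda>z. deriv f z / f z)"
 have o0: "open (- S0)" using open_connected_Compl(1)[OF S0(1)] .
 have "(\<Sum>p\<in>S \<inter> fund. (of_int (fls_subdegree (F p)) :: complex)) = 0"
 proof (rule partial_fractions(1)[OF S Sinv])
  show "q holomorphic_on - S" unfolding q_def
   by (intro holomorphic_on_divide holomorphic_on_subset[OF holomorphic_deriv[OF f(1) o0]] holomorphic_on_subset[OF f(1)]) (auto simp: S_def)
  have dper: "q (z + w) = q z" if z: "z \<notin> S" and w: "w \<in> L" for z w
  proof -
   have z': "z \<notin> S0" "z + w \<notin> S0" using z S0(2)[OF w] by (auto simp: S_def)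
   have "DERIV f (z + w) :> deriv f (z + w)" using holomorphic_derivI[OF f(1) o0] z' by blast
   hence "DERIV (\<lambda>z. f (z + w)) z :> deriv f (z + w)" by (simp add: DERIV_shift)
   moreover have "eventually (\<lambda>z. z \<in> - S0) (nhds z)" using o0 z' by (intro eventually_nhds_in_open) auto
   hence "eventually (\<lambda>z. f (z + w) = f z) (nhds z)" by eventually_elim (use fper[OF _ w] in auto)
   ultimately have "DERIV f z :> deriv f (z + w)" by (rule DERIV_transfer_ev)
   thus ?thesis unfolding q_def using fper[OF z'(1) w] by (simp add: DERIV_imp_deriv)
  qed
  show "q (z + 1) = q z" if "z \<notin> S" for z using dper[OF that] by simp
  show "q (z + \<tau>) = q z" if "z \<notin> S" for z using dper[OF that] by simp
  show "\<exists>Fa. (\<lambda>w. q (a + w)) has_laurent_expansion Fa \<and> (- 1 \<le> fls_subdegree Fa \<or> Fa = 0) \<and> fls_nth Fa (-1) = of_int (fls_subdegree (F a))" for a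
  proof (intro exI conjI)
   have "deriv (\<lambda>w. f (a + w)) has_laurent_expansion fls_deriv (F a)" by (intro laurent_expansion_intros lau)
   also have "deriv (\<lambda>w. f (a + w)) = (\<lambda>w. deriv f (a + w))" by (rule ext) (simp add: deriv_shift_0' o_def add_ac flip: deriv_shift_0)
   finally show "(\<lambda>w. q (a + w)) has_laurent_expansion (fls_deriv (F a) / F a)"
    unfolding q_def by (intro laurent_expansion_intros lau)
   show "- 1 \<le> fls_subdegree (fls_deriv (F a) / F a) \<or> fls_deriv (F a) / F a = 0"
    "fls_nth (fls_deriv (F a) / F a) (-1) = of_int (fls_subdegree (F a))"
    using fls_deriv_quot[OF lau(2)] by blast+
  qed
  show "finite (S \<inter> fund)" by (rule fund_finite[OF S])
 qed (use fund_reps[OF Sinv] in auto)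
 thus "(\<Sum>p\<in>S \<inter> fund. fls_subdegree (F p)) = 0" by (simp flip: of_int_sum)
qed

definition wpF :: "complex fls" where "wpF = laurent_expansion (wp \<tau>) 0"

lemma wp_laurent_aux:
 obtains F where "\<And>l. l \<in> L ==> (\<lambda>w. wp \<tau> (l + w)) has_laurent_expansion F" "fls_subdegree F = -2"
  "fls_nth F (-2) = 1" "\<And>k. odd k ==> fls_nth F k = 0"
proof -
 obtain h where h: "h analytic_on {0}" "eventually (\<lambda>z. wzeta z = 1 / (z - 0) + h z) (at 0)"
  using wzeta_near_lattice[OF lattice_0] by blast
 define G where "G = inverse fls_X + fps_to_fls (fps_expansion h 0)"
 have "(\<lambda>w::complex. inverse w + h w) has_laurent_expansion G" unfolding G_def
  using analytic_imp_laurent[OF h(1)] by (intro laurent_expansion_intros has_laurent_expansion_fps_X) auto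
 moreover have "eventually (\<lambda>w. inverse w + h w = wzeta w) (at 0)"
  using h(2) by eventually_elim (simp add: divide_inverse)
 ultimately have "wzeta has_laurent_expansion G" by (rule laurent_transfer)
 hence "(\<lambda>w. - deriv wzeta w) has_laurent_expansion - fls_deriv G" by (intro laurent_expansion_intros)
 moreover have nL: "eventually (\<lambda>z. z \<notin> L) (at 0)" using lattice_sparse sparse_in_eventually_iff[OF open_UNIV] by blast
 hence "eventually (\<lambda>w. - deriv wzeta w = wp \<tau> w) (at 0)"
  by eventually_elim (simp add: DERIV_imp_deriv[OF wzeta_deriv])
 ultimately have F: "wp \<tau> has_laurent_expansion - fls_deriv G" by (rule laurent_transfer)
 have Gn: "fls_nth G k = (if k = -1 then 1 else 0)" if "k < 0" for k
  using that unfolding G_def fls_inverse_X by (auto simp: fls_X_inv_conv_shift_1)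
 show thesis
 proof (rule that[of "- fls_deriv G"])
  show "(\<lambda>w. wp \<tau> (l + w)) has_laurent_expansion - fls_deriv G" if "l \<in> L" for l
  proof -
   have "eventually (\<lambda>w. wp \<tau> w = wp \<tau> (l + w)) (at 0)" using nL
    by eventually_elim (use wp_periodic[OF that] in \<open>simp add: add.commute\<close>)
   from laurent_transfer[OF F this] show ?thesis .
  qed
  show n2: "fls_nth (- fls_deriv G) (-2) = 1" using Gn[of "-1"] by simp
  show "fls_subdegree (- fls_deriv G) = -2"
   by (rule fls_subdegree_eqI) (use n2 Gn in auto)
  show "fls_nth (- fls_deriv G) k = 0" if "odd k" for k
   by (rule laurent_even[OF F _ that]) (simp add: wp_even)
 qed
qed

lemma wp_laurent:
 shows "l \<in> L ==> (\<lambda>w. wp \<tau> (l + w)) has_laurent_expansion wpF" "fls_subdegree wpF = -2"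
  "fls_nth wpF (-2) = 1" "odd k ==> fls_nth wpF k = 0"
proof -
 have "(\<forall>l\<in>L. (\<lambda>w. wp \<tau> (l + w)) has_laurent_expansion wpF) \<and> fls_subdegree wpF = -2 \<and>
  fls_nth wpF (-2) = 1 \<and> (\<forall>k. odd k \<longrightarrow> fls_nth wpF k = 0)"
 proof (rule wp_laurent_aux)
  fix F assume F: "\<And>l. l \<in> L ==> (\<lambda>w. wp \<tau> (l + w)) has_laurent_expansion F" "fls_subdegree F = -2"
   "fls_nth F (-2) = 1" "\<And>k. odd k ==> fls_nth F k = 0"
  have "wpF = F" using laurent_expansion_0_eqI[of "wp \<tau>" F] F(1)[OF lattice_0] by (simp add: wpF_def)
  thus ?thesis using F by auto
 qed
 thus "l \<in> L ==> (\<lambda>w. wp \<tau> (l + w)) has_laurent_expansion wpF" "fls_subdegree wpF = -2"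
  "fls_nth wpF (-2) = 1" "odd k ==> fls_nth wpF k = 0" by auto
qed

lemma wp_shift_analytic: assumes "a + p \<notin> L" shows "(\<lambda>z. wp \<tau> (z + p)) analytic_on {a}"
proof -
 have "wp \<tau> analytic_on {a + p}"
  using holomorphic_on_imp_analytic_at[OF wp_holo] assms lattice_closed by (auto simp: open_Compl)
 hence "(wp \<tau> \<circ> (\<lambda>z. z + p)) analytic_on {a}" by (intro analytic_on_compose analytic_intros) auto
 thus ?thesis by (simp add: o_def)
qed

text \<open>The function \<open>\<wp> - e\<close> has one double pole modulo the lattice, hence two zeros; \<open>v\<close> and \<open>-v\<close> are both of them unless \<open>2v\<close>
 is a period.\<close>
lemma wp_level_set:
 shows "{z. wp \<tau> z = e \<and> z \<notin> L} \<inter> fund \<in> {A. finite A}" (is ?A)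
  and "\<lbrakk>wp \<tau> v = wp \<tau> w; v \<notin> L; w \<notin> L; 2 * v \<notin> L\<rbrakk> \<Longrightarrow> w - v \<in> L \<or> w + v \<in> L"
proof -
 note W = wp_laurent(1,2)
 define F where "F = (\<lambda>e a. if a \<in> L then wpF - fls_const e else fps_to_fls (fps_expansion (\<lambda>z. wp \<tau> z - e) a))"
 have an: "(\<lambda>z. wp \<tau> z - e) analytic_on {a}" if "a \<notin> L" for a e
  using wp_shift_analytic[of a 0] that by (intro analytic_intros) auto
 have lau: "(\<lambda>w. wp \<tau> (a + w) - e) has_laurent_expansion F e a" for a e
 proof (cases "a \<in> L")
  case True
  have "(\<lambda>w. wp \<tau> (a + w) - e) has_laurent_expansion wpF - fls_const e"
   by (intro laurent_expansion_intros W True)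
  thus ?thesis using True by (simp add: F_def)
 next
  case False
  from analytic_imp_laurent[OF an[OF False, of e]] show ?thesis using False by (simp add: F_def)
 qed
 have sub0: "fls_subdegree (F e a) = -2" if "a \<in> L" for a e
 proof -
  have "fls_nth wpF (-2) \<noteq> 0" by (simp add: wp_laurent(3))
  thus ?thesis using that W(2) by (intro fls_subdegree_eqI) (auto simp: F_def)
 qed
 have F0: "F e a \<noteq> 0" for a e
 proof
  assume "F e a = 0"
  hence "eventually (\<lambda>w. wp \<tau> (a + w) - e = 0) (at 0)"
   using lau[where a = a and e = e] by (simp add: has_laurent_expansion_def)
  hence ev: "eventually (\<lambda>z. wp \<tau> z = e) (at a)"
   unfolding at_to_0[of a] eventually_filtermap by (simp add: add.commute)
  have "wp \<tau> z = e" if "z \<notin> L" for z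
  proof -
   have nL: "eventually (\<lambda>z. z \<notin> L) (at a)" using lattice_sparse sparse_in_eventually_iff[OF open_UNIV] by blast
   have "eventually (\<lambda>z. z \<notin> L \<and> wp \<tau> z = e) (at a)" using ev nL by eventually_elim auto
   then obtain U where U: "open U" "a \<in> U" "\<And>z. z \<in> U ==> z \<noteq> a ==> z \<notin> L \<and> wp \<tau> z = e"
    unfolding eventually_at_topological by blast
   obtain b where b: "b \<in> U - {a}" 
    using U(1,2) by (metis Diff_eq_empty_iff ex_in_conv not_open_singleton subset_singletonD empty_iff)
   show "wp \<tau> z = e"
   proof (rule analytic_continuation_open[of "U - {a}" "- L" "wp \<tau>" "\<lambda>_. e"])
    show "U - {a} \<subseteq> - L" using U(3) by auto
    show "U - {a} \<noteq> {}" using b by blast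
   qed (use U that b open_connected_Compl[OF lattice_sparse] wp_holo in auto)
  qed
  note we = this
  have "eventually (\<lambda>z. z \<notin> L) (at 0)"
   using lattice_sparse sparse_in_eventually_iff[OF open_UNIV, of L] by blast
  hence "eventually (\<lambda>w. wp \<tau> (0 + w) = e) (at 0)"
  proof eventually_elim
   case (elim w)
   from we[OF elim] show ?case by simp
  qed
  from laurent_transfer[OF W(1)[OF lattice_0] this] have "(\<lambda>w. e) has_laurent_expansion wpF" .
  hence "wpF = fls_const e" using has_laurent_expansion_const has_laurent_expansion_unique by blast
  thus False using W(2) by simp
 qed
 have per: "wp \<tau> (z + w) - e = wp \<tau> z - e" if "z \<notin> L" "w \<in> L" for z w e using wp_periodic that by simp
 have hol: "(\<lambda>z. wp \<tau> z - e) holomorphic_on - L" for e by (intro holomorphic_intros wp_holo)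
 define S where "S = (\<lambda>e. L \<union> {z. wp \<tau> z - e = 0})"
 have D: "S e sparse_in UNIV" "(\<Sum>p\<in>S e \<inter> fund. fls_subdegree (F e p)) = 0" for e
  using elliptic_divisor_degree[OF lattice_sparse lattice_add_iff hol per per lau F0] lattice_1 lattice_tau
  unfolding S_def by blast+
 have fin: "finite (S e \<inter> fund)" for e by (rule fund_finite[OF D(1)])
 show ?A using fin[of e] by (auto simp: S_def intro: finite_subset[rotated])
 assume h: "wp \<tau> v = wp \<tau> w" "v \<notin> L" "w \<notin> L" "2 * v \<notin> L"
 show "w - v \<in> L \<or> w + v \<in> L"
 proof (rule ccontr)
  assume neg: "\<not> ?thesis"
  define e where "e = wp \<tau> v"
  define Z where "Z = {z. wp \<tau> z = e \<and> z \<notin> L} \<inter> fund"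
  have rep: "\<exists>p\<in>Z. x - p \<in> L" if "wp \<tau> x = e" "x \<notin> L" for x
  proof -
   obtain p where p: "p \<in> fund" "x - p \<in> L" using fund_unique by blast
   have "p - x \<in> L" using p(2) lattice_diff_commute by blast
   from wp_periodic[OF this that(2)] that(1) have "wp \<tau> p = e" by simp
   moreover have "p \<notin> L" using lattice_add_iff[OF p(2), of p] that(2) by simp
   ultimately show ?thesis using p by (auto simp: Z_def)
  qed
  obtain p1 where p1: "p1 \<in> Z" "v - p1 \<in> L" using rep[of v] h by (auto simp: e_def)
  obtain p2 where p2: "p2 \<in> Z" "- v - p2 \<in> L" using rep[of "-v"] h by (auto simp: e_def wp_even)
  obtain p3 where p3: "p3 \<in> Z" "w - p3 \<in> L" using rep[of w] h by (auto simp: e_def)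
  have "p1 \<noteq> p2"
  proof
   assume "p1 = p2"
   thus False using lattice_diff[OF p1(2) p2(2)] h(4) by simp
  qed
  moreover have "p1 \<noteq> p3"
  proof
   assume "p1 = p3"
   thus False using lattice_diff[OF p3(2) p1(2)] neg by simp
  qed
  moreover have "p2 \<noteq> p3"
  proof
   assume "p2 = p3"
   thus False using lattice_diff[OF p3(2) p2(2)] neg by simp
  qed
  ultimately have c3: "card {p1, p2, p3} = 3" by simp
  have finZ: "finite Z" using fin[of e] by (rule finite_subset[rotated]) (auto simp: Z_def S_def)
  have "card {p1, p2, p3} \<le> card Z" using p1 p2 p3 finZ by (intro card_mono) auto
  hence cZ: "int (card Z) \<ge> 3" using c3 by simp
  have zero_pos: "fls_subdegree (F e p) \<ge> 1" if "p \<in> Z" for p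
  proof -
   have p: "p \<notin> L" "wp \<tau> p - e = 0" using that by (auto simp: Z_def)
   have "fls_nth (F e p) k = 0" if "k < 1" for k
   proof (cases "k = 0")
    case True
    have "fps_nth (fps_expansion (\<lambda>z. wp \<tau> z - e) p) 0 = 0"
     using p(2) by (simp add: fps_expansion_def)
    thus ?thesis using True p(1) by (simp add: F_def)
   next
    case False
    thus ?thesis using that p(1) by (simp add: F_def)
   qed
   thus ?thesis by (intro fls_subdegree_geI F0)
  qed
  have SZ: "S e \<inter> fund = insert 0 Z" using fund_lattice by (auto simp: S_def Z_def fund_0)
  have "0 \<notin> Z" by (simp add: Z_def)
  hence eq: "(\<Sum>p\<in>S e \<inter> fund. fls_subdegree (F e p)) = -2 + (\<Sum>p\<in>Z. fls_subdegree (F e p))"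
   unfolding SZ using finZ by (simp add: sub0)
  have "(\<Sum>p\<in>Z. 1) \<le> (\<Sum>p\<in>Z. fls_subdegree (F e p))" by (intro sum_mono zero_pos)
  hence "int (card Z) \<le> (\<Sum>p\<in>Z. fls_subdegree (F e p))" by simp
  thus False using D(2)[of e] cZ eq by simp
 qed
qed

end

section \<open>Elliptic functions with poles at the half periods\<close>

lemma fls_mult_low:
 fixes A B :: "complex fls"
 assumes A: "\<And>i. i < a ==> fls_nth A i = 0" and B: "\<And>i. i < b ==> fls_nth B i = 0"
 shows "i < a + b ==> fls_nth (A * B) i = 0"
  "fls_nth (A * B) (a + b) = fls_nth A a * fls_nth B b"
  "fls_nth (A * B) (a + b + 1) = fls_nth A a * fls_nth B (b + 1) + fls_nth A (a + 1) * fls_nth B b"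
proof -
 define A0 where "A0 = fls_shift a A"
 define B0 where "B0 = fls_shift b B"
 have sA: "fls_subdegree A0 \<ge> 0" by (rule fls_subdegree_ge0I) (simp add: A0_def A)
 have sB: "fls_subdegree B0 \<ge> 0" by (rule fls_subdegree_ge0I) (simp add: B0_def B)
 have sh: "A0 * B0 = fls_shift (a + b) (A * B)" unfolding A0_def B0_def by (rule fls_times_both_shifted_simp)
 have reg: "fls_regpart (A0 * B0) = fls_regpart A0 * fls_regpart B0" by (rule fls_times_conv_regpart[OF sA sB])
 have "fls_subdegree (A0 * B0) \<ge> 0" by (rule fls_mult_subdegree_ge_0[OF sA sB])
 hence "fls_nth (A0 * B0) k = 0" if "k < 0" for k using that by simp
 from this[of "i - (a + b)"] show "i < a + b ==> fls_nth (A * B) i = 0" by (simp add: sh)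
 have "fps_nth (fls_regpart (fls_shift (a + b) (A * B))) 0 = fps_nth (fls_regpart A0) 0 * fps_nth (fls_regpart B0) 0"
  by (simp only: reg fps_mult_nth_0 flip: sh)
 thus "fls_nth (A * B) (a + b) = fls_nth A a * fls_nth B b" by (simp add: A0_def B0_def)
 have "fps_nth (fls_regpart (fls_shift (a + b) (A * B))) 1 =
  fps_nth (fls_regpart A0) 0 * fps_nth (fls_regpart B0) 1 + fps_nth (fls_regpart A0) 1 * fps_nth (fls_regpart B0) 0"
  by (simp only: reg fps_mult_nth_1 flip: sh)
 thus "fls_nth (A * B) (a + b + 1) = fls_nth A a * fls_nth B (b + 1) + fls_nth A (a + 1) * fls_nth B b"
  by (simp add: A0_def B0_def add_ac)
qed

lemma deriv_shift: "deriv (\<lambda>w. f (a + w)) = (\<lambda>w. deriv f (a + w :: complex))"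
 by (rule ext) (simp add: deriv_shift_0' o_def add_ac flip: deriv_shift_0)

context half_plane begin

definition hp :: "nat => complex" where "hp k = omega \<tau> k / 2"

lemma le3: "k \<le> 3 \<longleftrightarrow> k = 0 \<or> k = 1 \<or> k = 2 \<or> k = (3::nat)" by auto

lemma omega_coord: "k \<le> 3 ==> omega \<tau> k = of_nat (k mod 2) + of_nat (k div 2) * \<tau>"
 unfolding le3 by (auto simp: omega_def)

lemma omega_lattice: "k \<le> 3 ==> omega \<tau> k \<in> L"
 unfolding omega_coord using lattice_I[of "int (k mod 2)" "int (k div 2)"] by simp

lemma hp_double: "hp k + hp k = omega \<tau> k" by (simp add: hp_def)

lemma hp_diff: assumes "j \<le> 3" "k \<le> 3" "hp j - hp k \<in> L" shows "j = k"
proof -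
 obtain a b where ab: "hp j - hp k = lat a b" using lattice_E[OF assms(3)] .
 have "of_real ((of_nat (j mod 2) - of_nat (k mod 2)) / 2) + of_real ((of_nat (j div 2) - of_nat (k div 2)) / 2) * \<tau>
  = pnt (of_int a) (of_int b)"
  using ab assms(1,2) by (simp add: hp_def omega_coord diff_divide_distrib add_divide_distrib algebra_simps)
 note c = coord_unique[OF this]
 have "real (j mod 2) - real (k mod 2) = of_int (2 * a)" "real (j div 2) - real (k div 2) = of_int (2 * b)"
  using c by auto
 hence "int (j mod 2) - int (k mod 2) = 2 * a" "int (j div 2) - int (k div 2) = 2 * b" by linarith+
 moreover have "j mod 2 < 2" "k mod 2 < 2" "j div 2 < 2" "k div 2 < 2" using assms by auto
 moreover have "a = 0" "b = 0" using calculation by linarith+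
 ultimately have "j mod 2 = k mod 2" "j div 2 = k div 2" by linarith+
 thus ?thesis by (metis mult_div_mod_eq)
qed

lemma hp_add_iff: "k \<le> 3 ==> z + hp k \<in> L \<longleftrightarrow> z - hp k \<in> L"
proof -
 assume k: "k \<le> 3"
 have e: "z - hp k + omega \<tau> k = z + hp k" by (simp add: hp_def)
 show ?thesis using lattice_add_iff[OF omega_lattice[OF k], of "z - hp k"] unfolding e .
qed

lemma half_lattice_iff: "z \<in> HL \<longleftrightarrow> (\<exists>k\<le>3. z - hp k \<in> L)"
proof
 assume "z \<in> HL"
 hence "2 * z \<in> L" by (simp add: half_lattice_def)
 then obtain a b where ab: "2 * z = lat a b" by (rule lattice_E)
 define k where "k = nat (a mod 2) + 2 * nat (b mod 2)"
 have k: "k \<le> 3" "k mod 2 = nat (a mod 2)" "k div 2 = nat (b mod 2)" 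
 proof -
  have "a mod 2 = 0 \<or> a mod 2 = 1" "b mod 2 = 0 \<or> b mod 2 = 1" by presburger+
  thus "k \<le> 3" "k mod 2 = nat (a mod 2)" "k div 2 = nat (b mod 2)" by (auto simp: k_def)
 qed
 have z: "z = lat a b / 2" unfolding ab[symmetric] by simp
 have "complex_of_int a = 2 * of_int (a div 2) + of_int (a mod 2)" "complex_of_int b = 2 * of_int (b div 2) + of_int (b mod 2)"
  by (metis mult_div_mod_eq of_int_add of_int_mult of_int_numeral)+
 hence "z - hp k = lat (a div 2) (b div 2)"
  unfolding hp_def omega_coord[OF k(1)] k(2,3) z by (simp add: field_simps)
 thus "\<exists>k\<le>3. z - hp k \<in> L" using k(1) by (metis lattice_I)
next
 assume "\<exists>k\<le>3. z - hp k \<in> L"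
 then obtain k where k: "k \<le> 3" "z - hp k \<in> L" by blast
 have "(z - hp k) + (z - hp k) + omega \<tau> k \<in> L"
  by (rule lattice_add[OF lattice_add[OF k(2) k(2)] omega_lattice[OF k(1)]])
 moreover have "(z - hp k) + (z - hp k) + omega \<tau> k = 2 * z" by (simp add: hp_def)
 ultimately show "z \<in> HL" by (simp add: half_lattice_def)
qed

lemma half_lattice_inv: assumes "w \<in> L" shows "z + w \<in> HL \<longleftrightarrow> z \<in> HL"
proof -
 have "2 * w \<in> L" using lattice_int_mult[OF assms, of 2] by simp
 from lattice_add_iff[OF this, of "2 * z"] show ?thesis by (simp add: half_lattice_def distrib_left)
qed

lemma half_lattice_uminus [simp]: "- z \<in> HL \<longleftrightarrow> z \<in> HL" by (simp add: half_lattice_def)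

lemma half_lattice_not_lattice: "z \<notin> HL ==> z \<notin> L"
 using half_lattice_iff[of z] by (auto simp: hp_def omega_def intro!: exI[of _ 0])

lemma half_lattice_sparse: "HL sparse_in UNIV"
proof (subst sparse_in_eventually_iff[OF open_UNIV], intro ballI)
 fix a :: complex
 have "eventually (\<lambda>z. z - p \<notin> L) (at a)" for p
 proof -
  have "eventually (\<lambda>z. z \<notin> L) (at (a - p))" using lattice_sparse sparse_in_eventually_iff[OF open_UNIV] by blast
  thus ?thesis unfolding at_to_0[of a] at_to_0[of "a - p"] eventually_filtermap by (simp add: add_diff_eq)
 qed
 hence "eventually (\<lambda>z. \<forall>k\<in>{..3}. z - hp k \<notin> L) (at a)" by (intro eventually_ball_finite) auto
 thus "eventually (\<lambda>z. z \<notin> HL) (at a)" by eventually_elim (auto simp: half_lattice_iff)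
qed

lemma half_lattice_Compl: "open (- HL)" "connected (- HL)"
 using open_connected_Compl[OF half_lattice_sparse] by auto

lemma near_half_lattice: "eventually (\<lambda>z. z \<notin> HL) (at a)"
 using half_lattice_sparse sparse_in_eventually_iff[OF open_UNIV] by blast

lemma near_half_lattice': "eventually (\<lambda>w. a + w \<notin> HL) (at 0)"
 using near_half_lattice[of a] unfolding at_to_0[of a] eventually_filtermap by (simp add: add.commute)

lemma fund_half_lattice: "HL \<inter> fund = hp ` {..3}"
proof -
 have hp_fund: "hp k \<in> fund" if "k \<le> 3" for k
  unfolding hp_def omega_coord[OF that] fund_def using that
  by (intro CollectI exI[of _ "real (k mod 2) / 2"] exI[of _ "real (k div 2) / 2"] conjI) (auto simp: add_divide_distrib)
 have hp_HL: "hp k \<in> HL" if "k \<le> 3" for k using that by (auto simp: half_lattice_iff intro!: exI[of _ k])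
 show ?thesis
 proof safe
  fix z assume "z \<in> HL" "z \<in> fund"
  then obtain k where k: "k \<le> 3" "z - hp k \<in> L" by (auto simp: half_lattice_iff)
  have "hp k = z" using fund_unique[of z] \<open>z \<in> fund\<close> hp_fund[OF k(1)] k(2) by (metis diff_self lattice_0)
  thus "z \<in> hp ` {..3}" using k(1) by auto
 qed (use hp_fund hp_HL in auto)
qed

lemma hp_inj: "inj_on hp {..3}"
 by (rule inj_onI) (use hp_diff in auto)

text \<open>Functions that are elliptic off the half-lattice, with parity \<open>s\<close>.\<close>
definition ellp :: "complex => (complex => complex) => bool" where
 "ellp s f \<longleftrightarrow> f holomorphic_on - HL \<and> f meromorphic_on UNIV \<and>
  (\<forall>z. z \<notin> HL \<longrightarrow> f (- z) = s * f z \<and> f (z + 1) = f z \<and> f (z + \<tau>) = f z)"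

lemma ellpD:
 assumes "ellp s f"
 shows "f holomorphic_on - HL" "f meromorphic_on UNIV" "z \<notin> HL ==> f (- z) = s * f z"
  "z \<notin> HL ==> w \<in> L ==> f (z + w) = f z"
  "(\<lambda>w. f (a + w)) has_laurent_expansion laurent_expansion f a"
  "z \<notin> HL ==> DERIV f z :> deriv f z"
proof -
 show h: "f holomorphic_on - HL" and m: "f meromorphic_on UNIV" and "z \<notin> HL ==> f (- z) = s * f z"
  using assms by (auto simp: ellp_def)
 show "(\<lambda>w. f (a + w)) has_laurent_expansion laurent_expansion f a"
  using m by (simp add: meromorphic_on_def')
 show "DERIV f z :> deriv f z" if "z \<notin> HL"
  by (rule holomorphic_derivI[OF h half_lattice_Compl(1)]) (use that in simp)
 show "f (z + w) = f z" if z: "z \<notin> HL" and w: "w \<in> L"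
 proof -
  obtain a b where ab: "w = lat a b" by (rule lattice_E[OF w])
  have "f (z + lat a b) = f z + (of_int a * 0 + of_int b * 0)"
   by (rule lattice_induct[where S = HL]) (use half_lattice_inv assms z in \<open>auto simp: ellp_def\<close>)
  thus ?thesis by (simp add: ab)
 qed
qed

lemma ellp_const [intro]: "ellp 1 (\<lambda>_. c)"
 by (auto simp: ellp_def intro!: meromorphic_intros holomorphic_intros)

lemma ellp_add [intro]: "ellp s f ==> ellp s g ==> ellp s (\<lambda>z. f z + g z)"
 by (auto simp: ellp_def distrib_left intro!: meromorphic_intros holomorphic_intros)

lemma ellp_diff [intro]: "ellp s f ==> ellp s g ==> ellp s (\<lambda>z. f z - g z)"
 by (auto simp: ellp_def right_diff_distrib intro!: meromorphic_intros holomorphic_intros)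

lemma ellp_mult: "ellp s f ==> ellp t g ==> ellp (s * t) (\<lambda>z. f z * g z)"
 by (auto simp: ellp_def intro!: meromorphic_intros holomorphic_intros)

lemma ellp_cmult [intro]: "ellp s f ==> ellp s (\<lambda>z. c * f z)"
 using ellp_mult[OF ellp_const] by fastforce

lemma ellp_sum: "(\<And>i. i \<in> I ==> ellp s (f i)) ==> ellp s (\<lambda>z. \<Sum>i\<in>I. f i z)"
 by (auto simp: ellp_def sum_distrib_left intro!: meromorphic_intros holomorphic_intros sum.cong)

lemma ellp_power: "ellp 1 f ==> ellp 1 (\<lambda>z. f z ^ m)"
 by (induction m) (use ellp_mult[of 1 f 1] in auto)

lemma deriv_cong_HL: assumes "\<And>z. z \<notin> HL ==> f z = g z" "z \<notin> HL" shows "deriv f z = deriv g z"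
proof (rule deriv_cong_ev[OF _ refl])
 have "eventually (\<lambda>z. z \<in> - HL) (nhds z)" using assms half_lattice_Compl by (intro eventually_nhds_in_open) auto
 thus "eventually (\<lambda>x. f x = g x) (nhds z)" by eventually_elim (use assms in auto)
qed

lemma ellp_deriv [intro]: assumes "ellp s f" shows "ellp (- s) (deriv f)"
proof -
 have D: "deriv g z = d" if "DERIV g z :> d" for g :: "complex => complex" and z d
  using that by (rule DERIV_imp_deriv)
 have nh: "eventually (\<lambda>z. z \<in> - HL) (nhds z)" if "z \<notin> HL" for z
  using that half_lattice_Compl by (intro eventually_nhds_in_open) auto
 have sh: "deriv f (z + w) = deriv f z" if z: "z \<notin> HL" and w: "w \<in> L" for z w
 proof -
  have "DERIV f (z + w) :> deriv f (z + w)"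
   using ellpD(6)[OF assms] z half_lattice_inv[OF w] by blast
  hence d: "DERIV (\<lambda>z. f (z + w)) z :> deriv f (z + w)" by (simp add: DERIV_shift)
  have "eventually (\<lambda>z. f (z + w) = f z) (nhds z)"
   using nh[OF z] by eventually_elim (use ellpD(4)[OF assms _ w] in auto)
  from D[OF DERIV_transfer_ev[OF d this]] show ?thesis by simp
 qed
 have mi: "deriv f (- z) = - s * deriv f z" if z: "z \<notin> HL" for z
 proof -
  have "DERIV f (- z) :> deriv f (- z)" using ellpD(6)[OF assms] z by simp
  from DERIV_chain2[where g = uminus and x = z and s = UNIV, OF this, of "-1"]
  have d: "DERIV (\<lambda>z. f (- z)) z :> deriv f (- z) * - 1" by (simp add: DERIV_minus)
  have "eventually (\<lambda>z. f (- z) = s * f z) (nhds z)"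
   using nh[OF z] by eventually_elim (use ellpD(3)[OF assms] in auto)
  from DERIV_transfer_ev[OF d this] have "DERIV (\<lambda>z. s * f z) z :> deriv f (- z) * - 1" .
  moreover have "DERIV (\<lambda>z. s * f z) z :> s * deriv f z"
   by (intro DERIV_cmult ellpD(6)[OF assms z])
  ultimately have "deriv f (- z) * - 1 = s * deriv f z" by (rule DERIV_unique)
  thus ?thesis by algebra
 qed
 show ?thesis unfolding ellp_def
  using holomorphic_deriv[OF ellpD(1)[OF assms] half_lattice_Compl(1)] ellpD(2)[OF assms] sh mi
  by (auto intro!: meromorphic_intros)
qed

text \<open>Because \<open>\<omega>\<^sub>k\<close> is a period, an even elliptic function is even about \<open>\<omega>\<^sub>k/2\<close>.\<close>
lemma ellp_laurent_odd:
 assumes "ellp 1 f" "k \<le> 3" "odd i"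
 shows "fls_nth (laurent_expansion f (hp k)) i = 0"
proof (rule laurent_even[OF ellpD(5)[OF assms(1)] _ assms(3)])
 show "eventually (\<lambda>w. f (hp k + - w) = f (hp k + w)) (at 0)"
  using near_half_lattice'[of "hp k"]
 proof eventually_elim
  case (elim w)
  have m: "- (hp k + w) \<notin> HL" using elim half_lattice_uminus[of "hp k + w"] by blast
  have "f (hp k + w) = f (- (hp k + w))" using ellpD(3)[OF assms(1) elim] by simp
  also have "\<dots> = f (- (hp k + w) + omega \<tau> k)"
   using ellpD(4)[OF assms(1) m omega_lattice[OF assms(2)]] by simp
  also have "- (hp k + w) + omega \<tau> k = hp k + - w" using hp_double[of k] by (simp add: algebra_simps)
  finally show ?case by simp
 qed
qed

lemma laurent_deriv: "f meromorphic_on UNIV ==> laurent_expansion (deriv f) a = fls_deriv (laurent_expansion f a)"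
proof (rule laurent_expansion_eqI)
 assume "f meromorphic_on UNIV"
 hence "deriv (\<lambda>w. f (a + w)) has_laurent_expansion fls_deriv (laurent_expansion f a)"
  by (intro has_laurent_expansion_deriv) (simp add: meromorphic_on_def')
 thus "(\<lambda>w. deriv f (a + w)) has_laurent_expansion fls_deriv (laurent_expansion f a)" by (simp add: deriv_shift)
qed

definition P :: "nat => complex => complex" where "P k z = wp \<tau> (z + hp k)"

lemma P_not_lattice: "z \<notin> HL ==> k \<le> 3 ==> z + hp k \<notin> L"
 using half_lattice_iff hp_add_iff by blast

lemma P_laurent:
 assumes "k \<le> 3"
 shows "(\<lambda>w. P k (hp k + w)) has_laurent_expansion wpF"
  "j \<le> 3 ==> j \<noteq> k ==> P k analytic_on {hp j}"
proof -
 have "(\<lambda>w. P k (hp k + w)) = (\<lambda>w. wp \<tau> (omega \<tau> k + w))"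
  using hp_double[of k] by (auto simp: P_def algebra_simps)
 thus "(\<lambda>w. P k (hp k + w)) has_laurent_expansion wpF"
  using wp_laurent(1)[OF omega_lattice[OF assms]] by simp
 assume j: "j \<le> 3" "j \<noteq> k"
 have "hp j + hp k \<notin> L" using hp_diff[OF j(1) assms] j hp_add_iff[OF assms, of "hp j"] by auto
 from wp_shift_analytic[OF this] show "P k analytic_on {hp j}" by (simp add: P_def[abs_def])
qed

lemma P_ellp: assumes "k \<le> 3" shows "ellp 1 (P k)"
proof -
 have an: "P k analytic_on {z}" if "z \<notin> HL" for z
  using wp_shift_analytic[OF P_not_lattice[OF that assms]] by (simp add: P_def[abs_def])
 hence "P k analytic_on (- HL)" by (subst analytic_on_analytic_at) auto
 moreover have "P k meromorphic_on UNIV"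
 proof -
  have "\<exists>F. (\<lambda>w. P k (a + w)) has_laurent_expansion F" for a
  proof (cases "a + hp k \<in> L")
   case True
   have "(\<lambda>w. P k (a + w)) = (\<lambda>w. wp \<tau> (a + hp k + w))" by (auto simp: P_def algebra_simps)
   thus ?thesis using wp_laurent(1)[OF True] by auto
  next
   case False
   have "P k analytic_on {a}" using wp_shift_analytic[OF False] by (simp add: P_def[abs_def])
   thus ?thesis using analytic_imp_laurent by blast
  qed
  thus ?thesis by (auto simp: meromorphic_on_def)
 qed
 moreover have "P k (- z) = 1 * P k z \<and> P k (z + 1) = P k z \<and> P k (z + \<tau>) = P k z" if z: "z \<notin> HL" for z
 proof -
  have z': "z + hp k \<notin> L" by (rule P_not_lattice[OF z assms])
  have "P k (- z) = wp \<tau> (z - hp k)" using wp_even[of "z - hp k"] by (simp add: P_def)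
  also have "\<dots> = wp \<tau> (z - hp k + omega \<tau> k)"
   by (rule wp_periodic[symmetric, OF omega_lattice[OF assms]]) (use z' hp_add_iff[OF assms] in auto)
  also have "z - hp k + omega \<tau> k = z + hp k" using hp_double[of k] by (simp add: algebra_simps)
  finally have "P k (- z) = P k z" by (simp add: P_def)
  moreover have "P k (z + w) = P k z" if "w \<in> L" for w
   using wp_periodic[OF that z'] by (simp add: P_def algebra_simps)
  ultimately show ?thesis by auto
 qed
 ultimately show ?thesis unfolding ellp_def by (auto dest: analytic_imp_holomorphic)
qed

lemma analytic_laurent_neg: "f analytic_on {a} ==> i < 0 ==> fls_nth (laurent_expansion f a) i = 0"
 using laurent_expansion_eqI[OF analytic_imp_laurent[of f a]] by simp

text \<open>A family with exactly one member for every even pole order at every half period spans the even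
 elliptic functions: subtract leading terms until only a constant is left.\<close>
lemma even_elliptic_span:
 assumes e: "\<And>k m. k \<le> 3 ==> m \<ge> 1 ==> ellp 1 (e k m)"
  and lead: "\<And>k m. k \<le> 3 ==> m \<ge> 1 ==> fls_nth (laurent_expansion (e k m) (hp k)) (- 2 * int m) \<noteq> 0"
  and low: "\<And>k m i. k \<le> 3 ==> m \<ge> 1 ==> i < - 2 * int m ==> fls_nth (laurent_expansion (e k m) (hp k)) i = 0"
  and other: "\<And>k m j i. k \<le> 3 ==> m \<ge> 1 ==> j \<le> 3 ==> j \<noteq> k ==> i < 0 ==> fls_nth (laurent_expansion (e k m) (hp j)) i = 0"
  and f: "ellp 1 f" "\<And>k i. k \<le> 3 ==> i < - 2 * int (d k) ==> fls_nth (laurent_expansion f (hp k)) i = 0"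
 shows "\<exists>c coef. \<forall>z. z \<notin> HL \<longrightarrow> f z = c + (\<Sum>(k,m)\<in>Sigma {..3} (\<lambda>k. {1..d k}). coef (k,m) * e k m z)"
 using f
proof (induction "\<Sum>k\<le>3. d k" arbitrary: d f rule: less_induct)
 case less
 show ?case
 proof (cases "\<exists>k\<le>3. d k > 0")
  case False
  hence d0: "d k = 0" if "k \<le> 3" for k using that by auto
  have "\<exists>h. h analytic_on {a} \<and> eventually (\<lambda>z. f z = h z) (at a)" for a
  proof (cases "a \<in> HL")
   case False
   hence "f analytic_on {a}"
    using holomorphic_on_imp_analytic_at[OF ellpD(1)[OF less.prems(1)] half_lattice_Compl(1)] by simp
   thus ?thesis by auto
  next
   case True
   then obtain k where k: "k \<le> 3" "a - hp k \<in> L" by (auto simp: half_lattice_iff)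
   have "eventually (\<lambda>w. f (hp k + w) = f (a + w)) (at 0)" using near_half_lattice'[of "hp k"]
   proof eventually_elim
    case (elim w)
    from ellpD(4)[OF less.prems(1) elim k(2)] show ?case by (simp add: algebra_simps)
   qed
   hence lau: "(\<lambda>w. f (a + w)) has_laurent_expansion laurent_expansion f (hp k)"
    by (rule laurent_transfer[OF ellpD(5)[OF less.prems(1), of "hp k"]])
   have z: "fls_nth (laurent_expansion f (hp k)) i = 0" if "i < 0" for i
    using less.prems(2)[OF k(1), of i] d0[OF k(1)] that by simp
   hence "fls_subdegree (laurent_expansion f (hp k)) \<ge> 0" by (rule fls_subdegree_ge0I)
   hence "fls_subdegree (laurent_expansion f (hp k)) \<ge> -1 \<or> laurent_expansion f (hp k) = 0" by simp
   from laurent_pole_part[OF lau this] show ?thesis using z[of "-1"] by simp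
  qed
  then obtain g where g: "g holomorphic_on UNIV" "\<And>a. f analytic_on {a} ==> g a = f a" using entire_extension by blast
  have gf: "g z = f z" if "z \<notin> HL" for z
   using g(2) holomorphic_on_imp_analytic_at[OF ellpD(1)[OF less.prems(1)] half_lattice_Compl(1)] that by simp
  have per: "g (z + w) = g z" if w: "w \<in> L" for z w
  proof -
   have "(\<lambda>z. g (z + w)) = g"
   proof (rule entire_eq_sparse[OF half_lattice_sparse _ g(1)])
    show "(\<lambda>z. g (z + w)) holomorphic_on UNIV"
     by (rule holomorphic_on_compose_gen[unfolded o_def, OF _ g(1)]) (auto intro!: holomorphic_intros)
    show "g (z + w) = g z" if "z \<notin> HL" for z
     using gf that half_lattice_inv[OF w] ellpD(4)[OF less.prems(1) that w] by simp
   qed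
   thus ?thesis by metis
  qed
  have "g z = g 0" for z by (rule elliptic_entire_const[OF g(1)]) (use per in auto)
  hence "f z = g 0" if "z \<notin> HL" for z using gf[OF that] by metis
  moreover have "Sigma {..3} (\<lambda>k. {1..d k}) = {}" using d0 by auto
  ultimately show ?thesis by (intro exI[of _ "g 0"]) auto
 next
  case True
  then obtain k where k: "k \<le> 3" "d k > 0" by blast
  define E where "E = laurent_expansion (e k (d k)) (hp k)"
  define lam where "lam = fls_nth (laurent_expansion f (hp k)) (- 2 * int (d k)) / fls_nth E (- 2 * int (d k))"
  have dk: "d k \<ge> 1" using k by simp
  define f' where "f' = (\<lambda>z. f z - lam * e k (d k) z)"
  define d' where "d' = d(k := d k - 1)"
  have ef: "ellp 1 f'" unfolding f'_def by (intro ellp_diff ellp_cmult less.prems e k dk)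
  have lau: "laurent_expansion f' a = laurent_expansion f a - fls_const lam * laurent_expansion (e k (d k)) a" for a
   unfolding f'_def by (intro laurent_expansion_eqI laurent_expansion_intros ellpD(5)[OF less.prems(1)] ellpD(5)[OF e[OF k(1) dk]])
  have sumlt: "(\<Sum>k\<le>3. d' k) < (\<Sum>k\<le>3. d k)"
   by (rule sum_strict_mono_ex1) (use k in \<open>auto simp: d'_def\<close>)
  have "fls_nth (laurent_expansion f' (hp j)) i = 0" if ji: "j \<le> 3" "i < - 2 * int (d' j)" for j i
  proof (cases "j = k")
   case False
   thus ?thesis unfolding lau using less.prems(2)[OF ji(1), of i] other[OF k(1) dk ji(1) False, of i] ji by (simp add: d'_def)
  next
   case True
   consider "i < - 2 * int (d k)" | "i = - 2 * int (d k)" | "i = - 2 * int (d k) + 1"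
    using ji(2) dk True by (force simp: d'_def)
   thus ?thesis
   proof cases
    case 1 thus ?thesis unfolding lau True using less.prems(2)[OF k(1) 1] low[OF k(1) dk 1] by simp
   next
    case 2 thus ?thesis unfolding lau True lam_def E_def using lead[OF k(1) dk] by simp
   next
    case 3 thus ?thesis unfolding True by (intro ellp_laurent_odd[OF ef k(1)]) auto
   qed
  qed
  from less.hyps[OF sumlt ef this] obtain c coef where
   c: "\<And>z. z \<notin> HL ==> f' z = c + (\<Sum>(k,m)\<in>Sigma {..3} (\<lambda>k. {1..d' k}). coef (k,m) * e k m z)" by blast
  have ins: "Sigma {..3} (\<lambda>k. {1..d k}) = insert (k, d k) (Sigma {..3} (\<lambda>k. {1..d' k}))"
   using k by (auto simp: d'_def split: if_splits)
  have nin: "(k, d k) \<notin> Sigma {..3} (\<lambda>k. {1..d' k})" using dk by (auto simp: d'_def)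
  have "f z = c + (\<Sum>(j,m)\<in>Sigma {..3} (\<lambda>k. {1..d k}). (coef((k, d k) := lam)) (j,m) * e j m z)" if "z \<notin> HL" for z
  proof -
   have "(\<Sum>(j,m)\<in>Sigma {..3} (\<lambda>k. {1..d k}). (coef((k, d k) := lam)) (j,m) * e j m z)
    = lam * e k (d k) z + (\<Sum>(j,m)\<in>Sigma {..3} (\<lambda>k. {1..d' k}). (coef((k, d k) := lam)) (j,m) * e j m z)"
    unfolding ins by (subst sum.insert) (use nin in auto)
   also have "(\<Sum>(j,m)\<in>Sigma {..3} (\<lambda>k. {1..d' k}). (coef((k, d k) := lam)) (j,m) * e j m z)
    = (\<Sum>(j,m)\<in>Sigma {..3} (\<lambda>k. {1..d' k}). coef (j,m) * e j m z)"
    by (rule sum.cong[OF refl]) (use nin in auto)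
   finally show ?thesis using c[OF that] by (simp add: f'_def algebra_simps)
  qed
  thus ?thesis by blast
 qed
qed

end

section \<open>A formal solution of the symmetric product equation\<close>

lemma more_vectors_than_coordinates:
 fixes v :: "'j => 'i => complex"
 assumes "finite I" "finite J" "card I < card J"
 shows "\<exists>l. (\<exists>j\<in>J. l j \<noteq> 0) \<and> (\<forall>i\<in>I. (\<Sum>j\<in>J. l j * v j i) = 0)"
 using assms
proof (induction I arbitrary: J v rule: finite_induct)
 case empty
 then obtain j where "j \<in> J" by (metis card.empty card_gt_0_iff ex_in_conv)
 thus ?case by (intro exI[of _ "\<lambda>_. 1"]) auto
next
 case (insert i I)
 show ?case
 proof (cases "\<forall>j\<in>J. v j i = 0")
  case True
  have "card I < card J" using insert by simp
  from insert.IH[OF insert.prems(1) this, of v] obtain l where "\<exists>j\<in>J. l j \<noteq> 0" "\<forall>i\<in>I. (\<Sum>j\<in>J. l j * v j i) = 0" by blast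
  thus ?thesis using True by (intro exI[of _ l]) auto
 next
  case False
  then obtain p where p: "p \<in> J" "v p i \<noteq> 0" by blast
  define J' where "J' = J - {p}"
  have J': "finite J'" "card I < card J'" using insert p by (auto simp: J'_def)
  define v' where "v' = (\<lambda>j k. v j k - v j i / v p i * v p k)"
  from insert.IH[OF J', of v'] obtain l where
   l: "\<exists>j\<in>J'. l j \<noteq> 0" "\<forall>k\<in>I. (\<Sum>j\<in>J'. l j * v' j k) = 0" by blast
  define l' where "l' = l(p := - (\<Sum>j\<in>J'. l j * v j i) / v p i)"
  have split: "(\<Sum>j\<in>J. l' j * v j k) = (\<Sum>j\<in>J'. l j * v j k) - (\<Sum>j\<in>J'. l j * v j i) / v p i * v p k" for k
  proof -
   have "(\<Sum>j\<in>J. l' j * v j k) = l' p * v p k + (\<Sum>j\<in>J'. l' j * v j k)"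
    unfolding J'_def using insert.prems(1) p(1) by (rule sum.remove)
   also have "(\<Sum>j\<in>J'. l' j * v j k) = (\<Sum>j\<in>J'. l j * v j k)"
    by (rule sum.cong) (auto simp: l'_def J'_def)
   finally show ?thesis by (simp add: l'_def)
  qed
  have "(\<Sum>j\<in>J. l' j * v j i) = 0" unfolding split using p(2) by simp
  moreover have "(\<Sum>j\<in>J. l' j * v j k) = 0" if "k \<in> I" for k
  proof -
   have "(\<Sum>j\<in>J. l' j * v j k) = (\<Sum>j\<in>J'. l j * v' j k)"
    unfolding split v'_def by (simp add: right_diff_distrib sum_subtractf sum_divide_distrib sum_distrib_right mult.assoc)
   thus ?thesis using l(2) that by simp
  qed
  moreover have "\<exists>j\<in>J. l' j \<noteq> 0" using l(1) by (auto simp: l'_def J'_def)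
  ultimately show ?thesis by (intro exI[of _ l']) auto
 qed
qed

lemma sum_rev: "(\<Sum>a\<le>j. f a (j - a)) = (\<Sum>a\<le>(j::nat). f (j - a) a)"
 by (rule sum.reindex_bij_witness[where i = "\<lambda>a. j - a" and j = "\<lambda>a. j - a"]) auto

locale lame = half_plane + fixes n :: "nat => nat"
begin

definition u :: "complex => complex" where "u z = (\<Sum>k\<le>3. of_nat (n k * (n k + 1)) * P k z)"

lemma potential_eq: "lame_potential n \<tau> B z = u z + B"
 by (simp add: lame_potential_def u_def P_def hp_def)

lemma u_ellp: "ellp 1 u"
 unfolding u_def[abs_def] by (intro ellp_sum ellp_cmult P_ellp) auto

lemma u_laurent:
 assumes "k \<le> 3"
 shows "i < -2 ==> fls_nth (laurent_expansion u (hp k)) i = 0"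
  "fls_nth (laurent_expansion u (hp k)) (-2) = of_nat (n k * (n k + 1))"
proof -
 have PL: "(\<lambda>w. P j (hp k + w)) has_laurent_expansion laurent_expansion (P j) (hp k)" if "j \<le> 3" for j
  by (rule ellpD(5)[OF P_ellp[OF that]])
 have PF: "laurent_expansion (P k) (hp k) = wpF" using laurent_expansion_eqI P_laurent(1)[OF assms] by blast
 have lu: "laurent_expansion u (hp k) = (\<Sum>j\<le>3. fls_const (of_nat (n j * (n j + 1))) * laurent_expansion (P j) (hp k))"
  unfolding u_def[abs_def] by (intro laurent_expansion_eqI laurent_expansion_intros PL) auto
 have nth: "fls_nth (laurent_expansion u (hp k)) i = of_nat (n k * (n k + 1)) * fls_nth wpF i" if "i < 0" for i
 proof -
  have "fls_nth (laurent_expansion u (hp k)) i = (\<Sum>j\<le>3. of_nat (n j * (n j + 1)) * fls_nth (laurent_expansion (P j) (hp k)) i)"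
   unfolding lu by (simp add: fls_nth_sum)
  also have "\<dots> = (\<Sum>j\<in>{k}. of_nat (n j * (n j + 1)) * fls_nth (laurent_expansion (P j) (hp k)) i)"
   by (rule sum.mono_neutral_right) (use assms analytic_laurent_neg[OF P_laurent(2) that] in auto)
  finally show ?thesis by (simp add: PF)
 qed
 show "i < -2 ==> fls_nth (laurent_expansion u (hp k)) i = 0" using nth[of i] wp_laurent(2) by simp
 show "fls_nth (laurent_expansion u (hp k)) (-2) = of_nat (n k * (n k + 1))" using nth[of "-2"] wp_laurent(3) by simp
qed

text \<open>The symmetric product equation reads \<open>T0 \<Phi> = 4B\<Phi>'\<close>.\<close>
definition T0 :: "(complex => complex) => complex => complex" where
 "T0 f z = deriv (deriv (deriv f)) z - 4 * u z * deriv f z - 2 * deriv u z * f z"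

text \<open>The coefficients of the formal solution \<open>\<Phi> = \<Sum> \<phi>\<^sub>j B\<^sup>-\<^sup>j\<close> of \<open>\<Phi>'\<^sup>2 - 2\<Phi>\<Phi>'' + 4(u + B)\<Phi>\<^sup>2 = B\<close>. Comparing coefficients determines
 them recursively as differential polynomials in \<open>u\<close>.\<close>
function phi :: "nat => complex => complex" where
 "phi 0 = (\<lambda>z. 1/2)"
| "phi (Suc j) = (\<lambda>z. - (\<Sum>a\<in>{1..j}. phi a z * phi (Suc j - a) z)
  - (1/4) * (\<Sum>a\<in>{..j}. deriv (phi a) z * deriv (phi (j - a)) z - 2 * phi a z * deriv (deriv (phi (j - a))) z
     + 4 * u z * phi a z * phi (j - a) z))"
 by pat_completeness auto
termination by (relation "Wellfounded.measure (\<lambda>x. x)") auto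

lemma phi_ellp: "ellp 1 (phi j)"
proof (induction j rule: less_induct)
 case (less j)
 show ?case
 proof (cases j)
  case 0 thus ?thesis by (simp add: ellp_const)
 next
  case (Suc i)
  have 1: "ellp 1 (\<lambda>z. phi a z * phi b z)" if "a < j" "b < j" for a b
   using ellp_mult[OF less less, OF that] by simp
  have 2: "ellp 1 (\<lambda>z. deriv (phi a) z * deriv (phi b) z)" if "a < j" "b < j" for a b
   using ellp_mult[OF ellp_deriv[OF less] ellp_deriv[OF less], OF that] by simp
  have 3: "ellp 1 (\<lambda>z. 2 * phi a z * deriv (deriv (phi b)) z)" if "a < j" "b < j" for a b
   using ellp_mult[OF ellp_cmult[OF less[OF that(1)], of 2] ellp_deriv[OF ellp_deriv[OF less[OF that(2)]]]] by simp
  have 4: "ellp 1 (\<lambda>z. 4 * u z * phi a z * phi b z)" if "a < j" "b < j" for a b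
   using ellp_mult[OF ellp_mult[OF ellp_cmult[OF u_ellp, of 4] less[OF that(1)]] less[OF that(2)]] by simp
  have s1: "ellp 1 (\<lambda>z. \<Sum>a\<in>{1..i}. phi a z * phi (Suc i - a) z)"
   by (rule ellp_sum, rule 1) (use Suc in auto)
  have s2: "ellp 1 (\<lambda>z. \<Sum>a\<in>{..i}. deriv (phi a) z * deriv (phi (i - a)) z - 2 * phi a z * deriv (deriv (phi (i - a))) z
     + 4 * u z * phi a z * phi (i - a) z)"
   by (rule ellp_sum, rule ellp_add, rule ellp_diff, rule 2, use Suc in simp, use Suc in simp, rule 3, use Suc in simp, use Suc in simp,
     rule 4) (use Suc in auto)
  have "ellp 1 (\<lambda>z. (-1) * (\<Sum>a\<in>{1..i}. phi a z * phi (Suc i - a) z) - (1/4) * (\<Sum>a\<in>{..i}. deriv (phi a) z * deriv (phi (i - a)) z - 2 * phi a z * deriv (deriv (phi (i - a))) z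
     + 4 * u z * phi a z * phi (i - a) z))"
   by (intro ellp_diff ellp_cmult s1 s2)
  thus ?thesis unfolding Suc phi.simps(2) by simp
 qed
qed

lemma phi_identity:
 "4 * (\<Sum>a\<le>Suc j. phi a z * phi (Suc j - a) z) + (\<Sum>a\<le>j. deriv (phi a) z * deriv (phi (j - a)) z
   - 2 * phi a z * deriv (deriv (phi (j - a))) z + 4 * u z * phi a z * phi (j - a) z) = 0"
proof -
 have "{..Suc j} = insert 0 (insert (Suc j) {1..j})" by auto
 hence A: "(\<Sum>a\<le>Suc j. phi a z * phi (Suc j - a) z) = phi (Suc j) z + (\<Sum>a\<in>{1..j}. phi a z * phi (Suc j - a) z)"
  by (simp del: phi.simps(2))
 show ?thesis unfolding A phi.simps(2)[of j] by (simp del: phi.simps)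
qed

text \<open>The recursion makes \<open>\<Sum> \<phi>\<^sub>j B\<^sup>-\<^sup>j\<close> a formal solution of the symmetric product equation: differentiating the
 quadratic identity and cancelling \<open>\<phi>\<^sub>0\<close> gives the linear one.\<close>
lemma phi_linear: "z \<notin> HL ==> T0 (phi j) z = 4 * deriv (phi (Suc j)) z"
proof (induction j rule: less_induct)
 case (less j)
 note z = less.prems
 define x where "x = (\<lambda>a. phi a z)"
 define x1 where "x1 = (\<lambda>a. deriv (phi a) z)"
 define x2 where "x2 = (\<lambda>a. deriv (deriv (phi a)) z)"
 define x3 where "x3 = (\<lambda>a. deriv (deriv (deriv (phi a))) z)"
 define u0 where "u0 = u z"
 define u1 where "u1 = deriv u z"
 have D0: "DERIV (phi a) z :> x1 a" for a unfolding x1_def by (rule ellpD(6)[OF phi_ellp z])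
 have D1: "DERIV (deriv (phi a)) z :> x2 a" for a unfolding x2_def by (rule ellpD(6)[OF ellp_deriv[OF phi_ellp] z])
 have D2: "DERIV (deriv (deriv (phi a))) z :> x3 a" for a unfolding x3_def
  by (rule ellpD(6)[OF ellp_deriv[OF ellp_deriv[OF phi_ellp]] z])
 have Du: "DERIV u z :> u1" unfolding u1_def by (rule ellpD(6)[OF u_ellp z])
 note I = x_def u0_def
 have term1: "DERIV (\<lambda>z. phi a z * phi b z) z :> (x1 a * x b + x1 b * x a)" for a b
  unfolding x_def by (rule DERIV_mult[OF D0 D0])
 have term2: "DERIV (\<lambda>z. deriv (phi a) z * deriv (phi b) z - 2 * phi a z * deriv (deriv (phi b)) z + 4 * u z * phi a z * phi b z) z :> ((x2 a * x1 b + x2 b * x1 a) - ((2 * x1 a) * x2 b + x3 b * (2 * x a))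
    + (((4 * u1) * x a + x1 a * (4 * u0)) * x b + x1 b * (4 * u0 * x a)))" for a b
  unfolding x_def u0_def x1_def[symmetric] x2_def[symmetric] 
  using DERIV_add[OF DERIV_diff[OF DERIV_mult[OF D1[of a] D1[of b]] DERIV_mult[OF DERIV_cmult[OF D0[of a], of 2] D2[of b]]]
   DERIV_mult[OF DERIV_mult[OF DERIV_cmult[OF Du, of 4] D0[of a]] D0[of b]]]
  by (simp add: x1_def x2_def)
 have "DERIV (\<lambda>z. 4 * (\<Sum>a\<le>Suc j. phi a z * phi (Suc j - a) z) + (\<Sum>a\<le>j. deriv (phi a) z * deriv (phi (j - a)) z
   - 2 * phi a z * deriv (deriv (phi (j - a))) z + 4 * u z * phi a z * phi (j - a) z)) z :>
  4 * (\<Sum>a\<le>Suc j. x1 a * x (Suc j - a) + x1 (Suc j - a) * x a) +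
  (\<Sum>a\<le>j. (x2 a * x1 (j-a) + x2 (j-a) * x1 a) - ((2 * x1 a) * x2 (j-a) + x3 (j-a) * (2 * x a))
    + (((4 * u1) * x a + x1 a * (4 * u0)) * x (j-a) + x1 (j-a) * (4 * u0 * x a)))"
  by (intro DERIV_add DERIV_cmult DERIV_sum term1 term2)
 hence "DERIV (\<lambda>z. 0) z :>
  4 * (\<Sum>a\<le>Suc j. x1 a * x (Suc j - a) + x1 (Suc j - a) * x a) +
  (\<Sum>a\<le>j. (x2 a * x1 (j-a) + x2 (j-a) * x1 a) - ((2 * x1 a) * x2 (j-a) + x3 (j-a) * (2 * x a))
    + (((4 * u1) * x a + x1 a * (4 * u0)) * x (j-a) + x1 (j-a) * (4 * u0 * x a)))"
  by (simp only: phi_identity)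
 from DERIV_unique[OF this DERIV_const]
 have E: "4 * (\<Sum>a\<le>Suc j. x1 a * x (Suc j - a) + x1 (Suc j - a) * x a) +
  (\<Sum>a\<le>j. (x2 a * x1 (j-a) + x2 (j-a) * x1 a) - ((2 * x1 a) * x2 (j-a) + x3 (j-a) * (2 * x a))
    + (((4 * u1) * x a + x1 a * (4 * u0)) * x (j-a) + x1 (j-a) * (4 * u0 * x a))) = 0" .
 have r1: "(\<Sum>a\<le>Suc j. x1 a * x (Suc j - a)) = (\<Sum>a\<le>Suc j. x1 (Suc j - a) * x a)" by (rule sum_rev)
 have r2: "(\<Sum>a\<le>j. x2 a * x1 (j-a)) = (\<Sum>a\<le>j. x2 (j-a) * x1 a)" by (rule sum_rev)
 have r3: "(\<Sum>a\<le>j. x1 a * x (j-a)) = (\<Sum>a\<le>j. x1 (j-a) * x a)" by (rule sum_rev)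
 define t where "t = (\<lambda>a. x3 a - 4 * u0 * x1 a - 2 * u1 * x a)"
 have "(\<Sum>a\<le>j. (x2 a * x1 (j-a) + x2 (j-a) * x1 a) - ((2 * x1 a) * x2 (j-a) + x3 (j-a) * (2 * x a))
    + (((4 * u1) * x a + x1 a * (4 * u0)) * x (j-a) + x1 (j-a) * (4 * u0 * x a)))
   = (\<Sum>a\<le>j. x2 a * x1 (j-a)) - (\<Sum>a\<le>j. x2 (j-a) * x1 a) + 4 * u0 * ((\<Sum>a\<le>j. x1 a * x (j-a)) - (\<Sum>a\<le>j. x1 (j-a) * x a))
    - 2 * (\<Sum>a\<le>j. x a * t (j - a))"
  unfolding t_def sum_distrib_left sum_subtractf[symmetric] sum.distrib[symmetric]
  by (rule sum.cong[OF refl]) (simp add: algebra_simps)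
 also have "\<dots> = - 2 * (\<Sum>a\<le>j. x a * t (j - a))" unfolding r2 r3 by simp
 finally have E2: "8 * (\<Sum>a\<le>Suc j. x1 (Suc j - a) * x a) = 2 * (\<Sum>a\<le>j. x a * t (j - a))"
  using E r1 by (simp add: sum.distrib del: sum.atMost_Suc)
 have x10: "x1 0 = 0" by (simp add: x1_def)
 have "{..j} = insert 0 {1..j}" by auto
 hence s1: "(\<Sum>a\<le>j. x a * t (j - a)) = x 0 * t j + (\<Sum>a\<in>{1..j}. x a * t (j - a))" by simp
 have s2: "(\<Sum>a\<in>{1..j}. x a * t (j - a)) = (\<Sum>a\<in>{1..j}. 4 * (x1 (Suc j - a) * x a))"
 proof (rule sum.cong[OF refl])
  fix a assume a: "a \<in> {1..j}"
  hence "T0 (phi (j - a)) z = 4 * deriv (phi (Suc (j - a))) z" by (intro less.IH z) auto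
  moreover have "Suc (j - a) = Suc j - a" using a by auto
  ultimately have "t (j - a) = 4 * x1 (Suc j - a)"
   by (simp only: T0_def t_def x_def x1_def x3_def u0_def u1_def)
  thus "x a * t (j - a) = 4 * (x1 (Suc j - a) * x a)" by simp
 qed
 have "{..Suc j} = insert 0 (insert (Suc j) {1..j})" by auto
 hence s3: "(\<Sum>a\<le>Suc j. x1 (Suc j - a) * x a) = x1 (Suc j) * x 0 + (\<Sum>a\<in>{1..j}. x1 (Suc j - a) * x a)"
  by (simp add: x10)
 have x0: "x 0 = 1/2" by (simp add: x_def)
 hence "t j = 4 * x1 (Suc j)" using E2 unfolding s1 s2 s3 sum_distrib_left[symmetric] x0 by (simp add: algebra_simps)
 thus ?case by (simp only: T0_def t_def x_def x1_def x3_def u0_def u1_def)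
qed

text \<open>The exponents of the equation at \<open>\<omega>\<^sub>k/2\<close> are \<open>-2n\<^sub>k\<close>, \<open>1\<close> and \<open>2n\<^sub>k + 2\<close>. A pole of \<open>\<phi>\<^sub>j\<^sub>+\<^sub>1\<close> beyond order \<open>2n\<^sub>k\<close> would come from one of
 \<open>\<phi>\<^sub>j\<close>, since \<open>T0\<close> loses an order at the exponent \<open>-2n\<^sub>k\<close>.\<close>
lemma phi_pole_order:
 assumes k: "k \<le> 3"
 shows "i < - 2 * int (n k) ==> fls_nth (laurent_expansion (phi j) (hp k)) i = 0"
proof (induction j arbitrary: i)
 case 0
 thus ?case using laurent_expansion_eqI[of "phi 0" "hp k" "fls_const (1/2)"] by simp
next
 case (Suc j)
 define m where "m = int (n k)"
 define F where "F = laurent_expansion (phi j) (hp k)"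
 define G where "G = laurent_expansion (phi (Suc j)) (hp k)"
 define U where "U = laurent_expansion u (hp k)"
 have U: "\<And>i. i < -2 ==> fls_nth U i = 0" "fls_nth U (-2) = of_int (m * (m + 1))" "\<And>i. odd i ==> fls_nth U i = 0"
  using u_laurent[OF k] ellp_laurent_odd[OF u_ellp k] by (auto simp: U_def m_def algebra_simps)
 have F: "\<And>i. i < -2*m ==> fls_nth F i = 0" "\<And>i. odd i ==> fls_nth F i = 0"
  using Suc.IH ellp_laurent_odd[OF phi_ellp k] by (auto simp: F_def m_def)
 have Fl: "(\<lambda>w. phi j (hp k + w)) has_laurent_expansion F" unfolding F_def by (rule ellpD(5)[OF phi_ellp])
 have Ul: "(\<lambda>w. u (hp k + w)) has_laurent_expansion U" unfolding U_def by (rule ellpD(5)[OF u_ellp])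
 have F1: "(\<lambda>w. deriv (phi j) (hp k + w)) has_laurent_expansion fls_deriv F"
  unfolding deriv_shift[symmetric] by (intro laurent_expansion_intros Fl)
 have F2: "(\<lambda>w. deriv (deriv (phi j)) (hp k + w)) has_laurent_expansion fls_deriv (fls_deriv F)"
  unfolding deriv_shift[of "deriv (phi j)", symmetric] by (intro laurent_expansion_intros F1)
 have F3: "(\<lambda>w. deriv (deriv (deriv (phi j))) (hp k + w)) has_laurent_expansion fls_deriv (fls_deriv (fls_deriv F))"
  unfolding deriv_shift[of "deriv (deriv (phi j))", symmetric] by (intro laurent_expansion_intros F2)
 have U1: "(\<lambda>w. deriv u (hp k + w)) has_laurent_expansion fls_deriv U"
  unfolding deriv_shift[symmetric] by (intro laurent_expansion_intros Ul)
 define T where "T = fls_deriv (fls_deriv (fls_deriv F)) - fls_const 4 * (U * fls_deriv F) - fls_const 2 * (fls_deriv U * F)"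
 have "(\<lambda>w. deriv (deriv (deriv (phi j))) (hp k + w) - 4 * (u (hp k + w) * deriv (phi j) (hp k + w))
   - 2 * (deriv u (hp k + w) * phi j (hp k + w))) has_laurent_expansion T"
  unfolding T_def by (intro laurent_expansion_intros Fl Ul F1 F3 U1)
 hence "(\<lambda>w. T0 (phi j) (hp k + w)) has_laurent_expansion T" by (simp add: T0_def mult.assoc)
 moreover have "eventually (\<lambda>w. T0 (phi j) (hp k + w) = 4 * deriv (phi (Suc j)) (hp k + w)) (at 0)"
  using near_half_lattice'[of "hp k"] by eventually_elim (rule phi_linear)
 ultimately have T: "(\<lambda>w. 4 * deriv (phi (Suc j)) (hp k + w)) has_laurent_expansion T" by (rule laurent_transfer)
 have "(\<lambda>w. phi (Suc j) (hp k + w)) has_laurent_expansion G" unfolding G_def by (rule ellpD(5)[OF phi_ellp])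
 hence "(\<lambda>w. deriv (phi (Suc j)) (hp k + w)) has_laurent_expansion fls_deriv G"
  unfolding deriv_shift[symmetric] by (intro laurent_expansion_intros)
 hence "(\<lambda>w. 4 * deriv (phi (Suc j)) (hp k + w)) has_laurent_expansion fls_const 4 * fls_deriv G" by (intro laurent_expansion_intros)
 hence TG: "T = fls_const 4 * fls_deriv G" using T has_laurent_expansion_unique by blast
 have dF: "\<And>i. i < -2*m - 1 ==> fls_nth (fls_deriv F) i = 0" using F(1) by simp
 have dU: "\<And>i. i < -3 ==> fls_nth (fls_deriv U) i = 0" using U(1) by simp
 have p1: "\<And>i. i < -2 + (-2*m - 1) ==> fls_nth (U * fls_deriv F) i = 0"
  "fls_nth (U * fls_deriv F) (-2 + (-2*m - 1)) = fls_nth U (-2) * fls_nth (fls_deriv F) (-2*m - 1)"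
  "fls_nth (U * fls_deriv F) (-2 + (-2*m - 1) + 1) =
   fls_nth U (-2) * fls_nth (fls_deriv F) (-2*m - 1 + 1) + fls_nth U (-2 + 1) * fls_nth (fls_deriv F) (-2*m - 1)"
  using fls_mult_low[of "-2" U "-2*m - 1" "fls_deriv F"] U(1) dF by blast+
 have p2: "\<And>i. i < -3 + -2*m ==> fls_nth (fls_deriv U * F) i = 0"
  "fls_nth (fls_deriv U * F) (-3 + -2*m) = fls_nth (fls_deriv U) (-3) * fls_nth F (-2*m)"
  "fls_nth (fls_deriv U * F) (-3 + -2*m + 1) =
   fls_nth (fls_deriv U) (-3) * fls_nth F (-2*m + 1) + fls_nth (fls_deriv U) (-3 + 1) * fls_nth F (-2*m)"
  using fls_mult_low[of "-3" "fls_deriv U" "-2*m" F] dU F(1) by blast+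
 have d3: "fls_nth (fls_deriv (fls_deriv (fls_deriv F))) i = of_int ((i + 1) * (i + 2) * (i + 3)) * fls_nth F (i + 3)" for i
 proof -
  have e: "i + 1 + 1 = i + 2" "i + 2 + 1 = i + 3" by auto
  show ?thesis unfolding fls_deriv_nth e by (simp only: of_int_mult mult.assoc)
 qed
 have low: "fls_nth T i = 0" if im: "i < -2*m - 1" for i
 proof -
  consider "i < -2*m - 3" | "i = -2*m - 3" | "i = -2*m - 2" using im by linarith
  thus ?thesis
  proof cases
   case 1
   have a: "fls_nth (fls_deriv (fls_deriv (fls_deriv F))) i = 0" unfolding d3 using F(1)[of "i + 3"] 1 by simp
   show ?thesis unfolding T_def fls_minus_nth fls_mult_const_nth a using p1(1)[of i] p2(1)[of i] 1 by simp
  next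
   case 2
   define f where "f = fls_nth F (-2*m)"
   have a: "fls_nth (fls_deriv (fls_deriv (fls_deriv F))) i = of_int ((-2*m-2) * (-2*m-1) * (-2*m)) * f"
    using d3[of i] unfolding 2 f_def by (simp add: algebra_simps)
   have i: "i = -2 + (-2*m - 1)" "i = -3 + -2*m" using 2 by auto
   have f1: "fls_nth (fls_deriv F) (-2*m - 1) = of_int (-2*m) * f" by (simp add: f_def)
   have b: "fls_nth (U * fls_deriv F) i = of_int (m*(m+1)) * (of_int (-2*m) * f)"
    unfolding i(1) p1(2) U(2) f1 ..
   have u3: "fls_nth (fls_deriv U) (-3) = (-2) * of_int (m*(m+1))" using U(2) by simp
   have c: "fls_nth (fls_deriv U * F) i = (-2) * of_int (m*(m+1)) * f"
    unfolding i(2) p2(2) u3 f_def ..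
   have "fls_nth T i = of_int ((-2*m-2) * (-2*m-1) * (-2*m)) * f - 4 * (of_int (m*(m+1)) * (of_int (-2*m) * f)) - 2 * ((-2) * of_int (m*(m+1)) * f)"
    unfolding T_def using a b c by simp
   thus ?thesis by (simp add: algebra_simps)
  next
   case 3
   have o1: "fls_nth F (-2*m + 1) = 0" by (rule F(2)) simp
   have o2: "fls_nth U (-1) = 0" by (rule U(3)) simp
   have a: "fls_nth (fls_deriv (fls_deriv (fls_deriv F))) i = 0"
    using d3[of i] o1 unfolding 3 by (simp add: algebra_simps)
   have i: "i = -2 + (-2*m - 1) + 1" "i = -3 + -2*m + 1" using 3 by auto
   have f1: "fls_nth (fls_deriv F) (-2*m - 1 + 1) = 0" using o1 by simp
   have u2: "fls_nth (fls_deriv U) (-3 + 1) = 0" "fls_nth U (-2 + 1) = 0" using o2 by auto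
   have b: "fls_nth (U * fls_deriv F) i = 0" unfolding i(1) p1(3) f1 u2 by simp
   have c: "fls_nth (fls_deriv U * F) i = 0" unfolding i(2) p2(3) u2 o1 by simp
   show ?thesis unfolding T_def using a b c by simp
  qed
 qed
 have "fls_nth T (i - 1) = 0" by (rule low) (use Suc.prems in \<open>simp add: m_def\<close>)
 hence "of_int i * fls_nth G i = 0" unfolding TG by simp
 moreover have "i \<noteq> 0" using Suc.prems by auto
 ultimately show ?case by (simp add: G_def)
qed

section \<open>The normalized even elliptic solution\<close>

text \<open>The index \<open>(k, m)\<close> stands for the basis function \<open>\<wp>(z + \<omega>\<^sub>k/2)\<^sup>m\<close>, which is \<open>ee (k, m)\<close>.\<close>
definition Sg :: "(nat \<times> nat) set" where "Sg = Sigma {..3} (\<lambda>k. {1..n k})"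
definition ee :: "nat \<times> nat => complex => complex" where "ee p z = P (fst p) z ^ snd p"

lemma Sg_finite [simp, intro]: "finite Sg" by (auto simp: Sg_def)

lemma SgD: "p \<in> Sg ==> fst p \<le> 3" "p \<in> Sg ==> snd p \<ge> 1" by (auto simp: Sg_def)

lemma ee_ellp: "fst p \<le> 3 ==> ellp 1 (ee p)"
 unfolding ee_def[abs_def] by (intro ellp_power P_ellp)

lemma ee_laurent:
 assumes "k \<le> 3"
 shows "laurent_expansion (ee (k,m)) (hp k) = wpF ^ m"
  "j \<le> 3 ==> j \<noteq> k ==> i < 0 ==> fls_nth (laurent_expansion (ee (k,m)) (hp j)) i = 0"
proof -
 show "laurent_expansion (ee (k,m)) (hp k) = wpF ^ m"
  unfolding ee_def[abs_def] fst_conv snd_conv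
  by (intro laurent_expansion_eqI laurent_expansion_intros P_laurent(1) assms)
 assume j: "j \<le> 3" "j \<noteq> k" "i < 0"
 have "ee (k,m) analytic_on {hp j}"
  unfolding ee_def[abs_def] fst_conv snd_conv by (intro analytic_intros P_laurent(2) assms j)
 thus "fls_nth (laurent_expansion (ee (k,m)) (hp j)) i = 0" by (rule analytic_laurent_neg) fact
qed

lemma wpF_power:
 "fls_nth (wpF ^ m) (- (2 * int m)) = 1" "i < - (2 * int m) ==> fls_nth (wpF ^ m) i = 0"
 using fls_pow_base[of wpF m] fls_pow_nth_below_subdegree[of i m wpF] by (simp_all add: wp_laurent mult.commute)

lemma span_ee:
 assumes "ellp 1 f" "\<And>k i. k \<le> 3 ==> i < - 2 * int (n k) ==> fls_nth (laurent_expansion f (hp k)) i = 0"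
 shows "\<exists>c coef. \<forall>z. z \<notin> HL \<longrightarrow> f z = c + (\<Sum>p\<in>Sg. coef p * ee p z)"
proof -
 have "\<exists>c coef. \<forall>z. z \<notin> HL \<longrightarrow> f z = c + (\<Sum>(k,m)\<in>Sigma {..3} (\<lambda>k. {1..n k}). coef (k,m) * ee (k,m) z)"
  by (rule even_elliptic_span[where e = "\<lambda>k m. ee (k,m)", OF _ _ _ _ assms])
   (auto intro!: ee_ellp simp: ee_laurent wpF_power)
 thus ?thesis by (simp add: Sg_def case_prod_unfold)
qed

lemma ee_independent:
 assumes "\<And>z. z \<notin> HL ==> c + (\<Sum>p\<in>Sg. a p * ee p z) = 0"
 shows "\<forall>p\<in>Sg. a p = 0" "c = 0"
proof -
 show a0: "\<forall>p\<in>Sg. a p = 0"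
 proof (rule ccontr)
  assume "\<not> ?thesis"
  then obtain k m0 where p0: "(k,m0) \<in> Sg" "a (k,m0) \<noteq> 0" by auto
  have k: "k \<le> 3" using p0 by (auto simp: Sg_def)
  define M where "M = {m. (k,m) \<in> Sg \<and> a (k,m) \<noteq> 0}"
  have fM: "finite M" by (rule finite_subset[of _ "{1..n k}"]) (auto simp: M_def Sg_def)
  have "M \<noteq> {}" using p0 by (auto simp: M_def)
  define m where "m = Max M"
  have mM: "m \<in> M" unfolding m_def using fM \<open>M \<noteq> {}\<close> by (rule Max_in)
  have mx: "m' \<le> m" if "m' \<in> M" for m' unfolding m_def using fM that by simp
  have m1: "m \<ge> 1" using mM by (auto simp: M_def Sg_def)
  define F where "F = fls_const c + (\<Sum>p\<in>Sg. fls_const (a p) * laurent_expansion (ee p) (hp k))"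
  have "(\<lambda>w. c + (\<Sum>p\<in>Sg. a p * ee p (hp k + w))) has_laurent_expansion F"
   unfolding F_def by (intro laurent_expansion_intros ellpD(5)[OF ee_ellp]) (auto simp: Sg_def)
  moreover have "eventually (\<lambda>w. c + (\<Sum>p\<in>Sg. a p * ee p (hp k + w)) = 0) (at 0)"
   using near_half_lattice'[of "hp k"] by eventually_elim (rule assms)
  ultimately have "(\<lambda>_. 0) has_laurent_expansion F" by (rule laurent_transfer)
  hence "F = 0" by (rule zero_has_laurent_expansion_imp_eq_0)
  hence "0 = fls_nth F (- 2 * int m)" by simp
  also have "\<dots> = (\<Sum>p\<in>Sg. a p * fls_nth (laurent_expansion (ee p) (hp k)) (- 2 * int m))"
   using m1 by (simp add: F_def fls_nth_sum)
  also have "\<dots> = (\<Sum>p\<in>{(k,m)}. a p * fls_nth (laurent_expansion (ee p) (hp k)) (- 2 * int m))"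
  proof (rule sum.mono_neutral_right)
   show "{(k,m)} \<subseteq> Sg" using mM by (auto simp: M_def)
   show "\<forall>p\<in>Sg - {(k,m)}. a p * fls_nth (laurent_expansion (ee p) (hp k)) (- 2 * int m) = 0"
   proof
    fix p assume p: "p \<in> Sg - {(k,m)}"
    obtain j m' where pj: "p = (j,m')" by (cases p)
    have j3: "j \<le> 3" using p pj by (auto simp: Sg_def)
    show "a p * fls_nth (laurent_expansion (ee p) (hp k)) (- 2 * int m) = 0"
    proof (cases "j = k")
     case False
     thus ?thesis unfolding pj using ee_laurent(2)[OF j3 k, of "- 2 * int m" m'] m1 by simp
    next
     case True
     hence ne: "m' \<noteq> m" using p pj by auto
     show ?thesis
     proof (cases "m' \<in> M")
      case False
      thus ?thesis using p pj True by (auto simp: M_def)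
     next
      case True2: True
      hence "m' < m" using mx[OF True2] ne by simp
      thus ?thesis unfolding pj True using wpF_power(2)[of "- 2 * int m" m'] by (simp add: ee_laurent(1)[OF k])
     qed
    qed
   qed
  qed auto
  also have "\<dots> = a (k,m)" by (simp add: ee_laurent(1)[OF k] wpF_power)
  finally show False using mM by (simp add: M_def)
 qed
 obtain z where z: "z \<notin> HL" using near_half_lattice[of 0] by (metis eventually_happens trivial_limit_at)
 show "c = 0" using assms[OF z] a0 by simp
qed

lemma deriv_lin:
 assumes "finite I" "\<And>p. p \<in> I ==> ellp s (f p)" "z \<notin> HL"
 shows "deriv (\<lambda>z. c + (\<Sum>p\<in>I. a p * f p z)) z = (\<Sum>p\<in>I. a p * deriv (f p) z)"
proof -
 have "DERIV (\<lambda>z. c + (\<Sum>p\<in>I. a p * f p z)) z :> 0 + (\<Sum>p\<in>I. a p * deriv (f p) z)"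
  by (intro DERIV_add DERIV_const DERIV_sum DERIV_cmult ellpD(6)[OF assms(2)] assms(3))
 thus ?thesis by (simp add: DERIV_imp_deriv)
qed

lemma deriv_lin0:
 assumes "finite I" "\<And>p. p \<in> I ==> ellp s (f p)" "z \<notin> HL"
 shows "deriv (\<lambda>z. (\<Sum>p\<in>I. a p * f p z)) z = (\<Sum>p\<in>I. a p * deriv (f p) z)"
 using deriv_lin[where I = I and f = f and s = s and z = z and c = 0 and a = a] assms by simp

lemma T0_lin:
 assumes "finite I" "\<And>p. p \<in> I ==> ellp s (f p)" "z \<notin> HL"
 shows "T0 (\<lambda>z. c + (\<Sum>p\<in>I. a p * f p z)) z = c * T0 (\<lambda>_. 1) z + (\<Sum>p\<in>I. a p * T0 (f p) z)"
proof -
 let ?F = "\<lambda>z. c + (\<Sum>p\<in>I. a p * f p z)"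
 have d1: "deriv ?F z = (\<Sum>p\<in>I. a p * deriv (f p) z)" if "z \<notin> HL" for z
  by (rule deriv_lin[OF assms(1,2) that])
 have d2: "deriv (deriv ?F) z = (\<Sum>p\<in>I. a p * deriv (deriv (f p)) z)" if z: "z \<notin> HL" for z
  using deriv_cong_HL[of "deriv ?F", OF d1 z] deriv_lin0[OF assms(1) ellp_deriv[OF assms(2)] z] by simp
 have d3: "deriv (deriv (deriv ?F)) z = (\<Sum>p\<in>I. a p * deriv (deriv (deriv (f p))) z)"
  using deriv_cong_HL[of "deriv (deriv ?F)", OF d2 assms(3)]
   deriv_lin0[OF assms(1) ellp_deriv[OF ellp_deriv[OF assms(2)]] assms(3)] by simp
 show ?thesis unfolding T0_def d1[OF assms(3)] d3
  by (simp add: right_diff_distrib distrib_left sum_subtractf sum.distrib sum_distrib_left sum_distrib_right algebra_simps)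
qed

text \<open>Families of functions in the span that depend polynomially on \<open>B\<close>, and the symmetric product equation as
 a polynomial identity in \<open>B\<close>.\<close>
definition PhiF :: "complex poly => (nat \<times> nat => complex poly) => complex => complex => complex" where
 "PhiF C b B z = poly C B + (\<Sum>p\<in>Sg. poly (b p) B * ee p z)"

definition eqpoly :: "complex poly => (nat \<times> nat => complex poly) => complex => complex poly" where
 "eqpoly C b z = smult (T0 (\<lambda>_. 1) z) C + (\<Sum>p\<in>Sg. smult (T0 (ee p) z) (b p) - smult (4 * deriv (ee p) z) (pCons 0 (b p)))"

definition Sol :: "complex poly => (nat \<times> nat => complex poly) => bool" where
 "Sol C b \<longleftrightarrow> (\<forall>z. z \<notin> HL \<longrightarrow> eqpoly C b z = 0)"

lemma PhiF_ellp: "ellp 1 (PhiF C b B)"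
 unfolding PhiF_def[abs_def] by (intro ellp_add ellp_const ellp_sum ellp_cmult ee_ellp) (auto simp: Sg_def)

lemma PhiF_deriv: "z \<notin> HL ==> deriv (PhiF C b B) z = (\<Sum>p\<in>Sg. poly (b p) B * deriv (ee p) z)"
 unfolding PhiF_def[abs_def] by (rule deriv_lin) (auto intro: ee_ellp simp: Sg_def)

lemma eqpoly_poly: "z \<notin> HL ==> poly (eqpoly C b z) B = T0 (PhiF C b B) z - 4 * B * deriv (PhiF C b B) z"
proof -
 assume z: "z \<notin> HL"
 have T: "T0 (PhiF C b B) z = poly C B * T0 (\<lambda>_. 1) z + (\<Sum>p\<in>Sg. poly (b p) B * T0 (ee p) z)"
  unfolding PhiF_def[abs_def] by (rule T0_lin[OF _ ee_ellp z]) (auto simp: Sg_def)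
 show ?thesis unfolding T PhiF_deriv[OF z]
  by (simp add: eqpoly_def poly_sum sum_subtractf sum_distrib_left algebra_simps)
qed

lemma sym_product_iff:
 "sym_product_solution n \<tau> B (PhiF C b B) \<longleftrightarrow> (\<forall>z. z \<notin> HL \<longrightarrow> poly (eqpoly C b z) B = 0)"
proof -
 have du: "deriv (lame_potential n \<tau> B) z = deriv u z" if "z \<notin> HL" for z
 proof -
  have "lame_potential n \<tau> B = (\<lambda>z. u z + B)" by (simp add: potential_eq fun_eq_iff)
  moreover have "DERIV (\<lambda>z. u z + B) z :> deriv u z + 0"
   by (intro DERIV_add DERIV_const ellpD(6)[OF u_ellp that])
  ultimately show ?thesis by (simp add: DERIV_imp_deriv)
 qed
 have "(deriv ^^ 3) (PhiF C b B) z - 4 * lame_potential n \<tau> B z * deriv (PhiF C b B) z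
     - 2 * deriv (lame_potential n \<tau> B) z * PhiF C b B z = poly (eqpoly C b z) B" if "z \<notin> HL" for z
  unfolding eqpoly_poly[OF that] T0_def potential_eq du[OF that] by (simp add: numeral_3_eq_3 algebra_simps)
 thus ?thesis unfolding sym_product_solution_def
  using ellpD(1,2)[OF PhiF_ellp[of C b B]] by auto
qed

lemma even_elliptic_PhiF: "even_elliptic \<tau> (PhiF C b B)"
 using PhiF_ellp[of C b B] unfolding even_elliptic_def ellp_def by auto

lemma Sol_lin:
 assumes "Sol C b" "Sol C' b'"
 shows "Sol (A * C - A' * C') (\<lambda>p. A * b p - A' * b' p)"
proof -
 have m: "eqpoly (A * C) (\<lambda>p. A * b p) z = A * eqpoly C b z" for A C b z
  by (simp add: eqpoly_def distrib_left sum_distrib_left right_diff_distrib mult_smult_right mult_pCons_right)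
 have d: "eqpoly (C - C') (\<lambda>p. b p - b' p) z = eqpoly C b z - eqpoly C' b' z" for C b C' b' z
 proof -
  have pc: "pCons 0 (x - y) = pCons 0 x - pCons 0 (y :: complex poly)" for x y by simp
  have g: "(a - b) - (c - d) = (a - c) - (b - d)" for a b c d :: "complex poly" by simp
  define X where "X = (\<lambda>b (p::nat \<times> nat). smult (T0 (ee p) z) (b p) - smult (4 * deriv (ee p) z) (pCons 0 (b p)))"
  have e: "eqpoly C b z = smult (T0 (\<lambda>_. 1) z) C + sum (X b) Sg" for C b by (simp only: eqpoly_def X_def)
  have "X (\<lambda>p. b p - b' p) p = X b p - X b' p" for p unfolding X_def pc smult_diff_right by (rule g)
  hence "sum (X (\<lambda>p. b p - b' p)) Sg = sum (X b) Sg - sum (X b') Sg" by (simp add: sum_subtractf)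
  thus ?thesis unfolding e smult_diff_right by simp
 qed
 show ?thesis using assms unfolding Sol_def d m by simp
qed

text \<open>The top coefficient in \<open>B\<close> of a solution is constant in \<open>z\<close>, since \<open>B\<close> multiplies \<open>4 d/dz\<close>.\<close>
lemma Sol_top:
 assumes S: "Sol C b" and deg: "degree C \<le> D" "\<And>p. p \<in> Sg ==> degree (b p) \<le> D" and p: "p \<in> Sg"
 shows "coeff (b p) D = 0"
proof -
 have der: "(\<Sum>p\<in>Sg. coeff (b p) D * deriv (ee p) z) = 0" if z: "z \<notin> HL" for z
 proof -
  have "0 = coeff (eqpoly C b z) (Suc D)" using S z by (simp add: Sol_def)
  also have "\<dots> = T0 (\<lambda>_. 1) z * coeff C (Suc D) + (\<Sum>p\<in>Sg. T0 (ee p) z * coeff (b p) (Suc D) - 4 * deriv (ee p) z * coeff (b p) D)"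
   by (simp add: eqpoly_def coeff_sum)
  also have "\<dots> = (\<Sum>p\<in>Sg. (-4) * (coeff (b p) D * deriv (ee p) z))"
  proof -
   have "coeff C (Suc D) = 0" using deg(1) by (simp add: coeff_eq_0)
   moreover have "coeff (b p) (Suc D) = 0" if "p \<in> Sg" for p using deg(2)[OF that] by (simp add: coeff_eq_0)
   ultimately show ?thesis by (simp add: mult_ac)
  qed
  finally have "0 = (-4) * (\<Sum>p\<in>Sg. coeff (b p) D * deriv (ee p) z)" by (simp only: sum_distrib_left)
  thus ?thesis by simp
 qed
 define f where "f = (\<lambda>z. 0 + (\<Sum>p\<in>Sg. coeff (b p) D * ee p z))"
 obtain z0 where z0: "z0 \<notin> HL" using near_half_lattice[of 0] by (metis eventually_happens trivial_limit_at)
 have ef: "ellp 1 f" unfolding f_def by (intro ellp_add ellp_const ellp_sum ellp_cmult ee_ellp) (auto simp: Sg_def)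
 have "f z = f z0" if "z \<notin> HL" for z
 proof (rule zero_deriv_imp_const[where f = f, OF half_lattice_Compl])
  fix x assume "x \<in> - HL"
  hence x: "x \<notin> HL" by simp
  have "deriv f x = 0" unfolding f_def
   using deriv_lin[where I = Sg and f = ee and s = 1 and z = x and c = 0 and a = "\<lambda>p. coeff (b p) D"]
    der[OF x] SgD(1) ee_ellp x by simp
  thus "DERIV f x :> 0" using ellpD(6)[OF ef x] by simp
 qed (use that z0 in auto)
 hence "- f z0 + (\<Sum>p\<in>Sg. coeff (b p) D * ee p z) = 0" if "z \<notin> HL" for z using that by (simp add: f_def)
 from ee_independent(1)[OF this] show ?thesis using p by blast
qed

lemma Sol_zero:
 assumes "Sol 0 b" "p \<in> Sg" shows "b p = 0"
proof (rule ccontr)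
 assume "b p \<noteq> 0"
 define D where "D = Max ((\<lambda>p. degree (b p)) ` {p \<in> Sg. b p \<noteq> 0})"
 have fin: "finite ((\<lambda>p. degree (b p)) ` {p \<in> Sg. b p \<noteq> 0})" by simp
 have ne: "(\<lambda>p. degree (b p)) ` {p \<in> Sg. b p \<noteq> 0} \<noteq> {}" 
 proof -
  have "p \<in> {p \<in> Sg. b p \<noteq> 0}" using assms(2) \<open>b p \<noteq> 0\<close> by simp
  thus ?thesis by blast
 qed
 have "D \<in> (\<lambda>p. degree (b p)) ` {p \<in> Sg. b p \<noteq> 0}" unfolding D_def by (rule Max_in[OF fin ne])
 then obtain p' where p': "p' \<in> Sg" "b p' \<noteq> 0" "degree (b p') = D" by auto
 have le: "degree (b q) \<le> D" if "q \<in> Sg" for q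
 proof (cases "b q = 0")
  case False
  hence "degree (b q) \<in> (\<lambda>p. degree (b p)) ` {p \<in> Sg. b p \<noteq> 0}" using that by blast
  thus ?thesis unfolding D_def using Max_ge[OF fin] by blast
 qed auto
 have "coeff (b p') D = 0" by (rule Sol_top[OF assms(1) _ le p'(1)]) auto
 thus False using p' by (metis leading_coeff_0_iff)
qed

lemma u_nonconst:
 assumes "k \<le> 3" "n k > 0" shows "\<exists>z. z \<notin> HL \<and> deriv u z \<noteq> 0"
proof (rule ccontr)
 assume "\<not> ?thesis"
 hence d: "deriv u z = 0" if "z \<notin> HL" for z using that by blast
 have "fls_deriv (laurent_expansion u (hp k)) = laurent_expansion (deriv u) (hp k)"
  using laurent_deriv[OF ellpD(2)[OF u_ellp]] by simp
 moreover have "(\<lambda>w. deriv u (hp k + w)) has_laurent_expansion laurent_expansion (deriv u) (hp k)"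
  by (rule ellpD(5)[OF ellp_deriv[OF u_ellp]])
 moreover have "eventually (\<lambda>w. deriv u (hp k + w) = 0) (at 0)"
  using near_half_lattice'[of "hp k"] by eventually_elim (rule d)
 ultimately have "(\<lambda>_. 0) has_laurent_expansion fls_deriv (laurent_expansion u (hp k))"
  using laurent_transfer by fastforce
 hence z: "fls_deriv (laurent_expansion u (hp k)) = 0" by (rule zero_has_laurent_expansion_imp_eq_0)
 have "of_int (-3 + 1) * fls_nth (laurent_expansion u (hp k)) (-3 + 1) = (0::complex)"
  unfolding fls_deriv_nth[symmetric] z by simp
 hence "fls_nth (laurent_expansion u (hp k)) (-2) = 0" by simp
 hence "of_nat (n k * (n k + 1)) = (0::complex)" unfolding u_laurent(2)[OF assms(1)] .
 hence "n k * (n k + 1) = 0" by (metis of_nat_eq_0_iff)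
 thus False using assms(2) by simp
qed

text \<open>By \<open>Sol_top\<close> the term of top degree in \<open>B\<close> has no pole. A solution that consists of a constant \<open>C\<close> only would force \<open>u' = 0\<close>.\<close>
lemma Sol_degree:
 assumes S: "Sol C b" and C: "C \<noteq> 0" and p: "p \<in> Sg" shows "degree (b p) < degree C"
proof -
 define D where "D = Max (insert (degree C) ((\<lambda>p. degree (b p)) ` Sg))"
 have fin: "finite (insert (degree C) ((\<lambda>p. degree (b p)) ` Sg))" by simp
 have leC: "degree C \<le> D" unfolding D_def by (rule Max_ge[OF fin]) simp
 have le: "degree (b q) \<le> D" if "q \<in> Sg" for q unfolding D_def by (rule Max_ge[OF fin]) (use that in auto)
 have z: "coeff (b q) D = 0" if "q \<in> Sg" for q by (rule Sol_top[OF S leC le that])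
 show ?thesis
 proof (cases "D = 0")
  case True
  have b0: "b q = 0" if "q \<in> Sg" for q
   using le[OF that] z[OF that] True by (metis le_zero_eq leading_coeff_0_iff)
  obtain k m where km: "p = (k,m)" by (cases p)
  have k: "k \<le> 3" "n k > 0" using p km by (auto simp: Sg_def)
  obtain w where w: "w \<notin> HL" "deriv u w \<noteq> 0" using u_nonconst[OF k] by blast
  have "eqpoly C b w = smult (T0 (\<lambda>_. 1) w) C" using b0 by (simp add: eqpoly_def)
  moreover have "T0 (\<lambda>_. 1) w = - 2 * deriv u w" by (simp add: T0_def)
  ultimately have "C = 0" using S w by (simp add: Sol_def)
  thus ?thesis using C by simp
 next
  case False
  have lt: "degree (b q) < D" if "q \<in> Sg" for q
   using le[OF that] z[OF that] False by (metis degree_0 le_neq_implies_less leading_coeff_0_iff neq0_conv)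
  have "D \<in> insert (degree C) ((\<lambda>p. degree (b p)) ` Sg)" unfolding D_def by (rule Max_in[OF fin]) simp
  hence "D = degree C" using lt by fastforce
  thus ?thesis using lt[OF p] by simp
 qed
qed

text \<open>Finitely many of the \<open>\<phi>\<^sub>j\<close> span a finite-dimensional space, so some linear combination vanishes; the same
 combination of the truncated series is a solution that is polynomial in \<open>B\<close>.\<close>
lemma Sol_exists: "\<exists>C b. Sol C b \<and> C \<noteq> 0"
proof -
 have "\<forall>j. \<exists>c coef. \<forall>z. z \<notin> HL \<longrightarrow> phi j z = c + (\<Sum>p\<in>Sg. coef p * ee p z)"
  using span_ee[OF phi_ellp phi_pole_order] by blast
 then obtain cc co where cc: "\<And>j z. z \<notin> HL ==> phi j z = cc j + (\<Sum>p\<in>Sg. co j p * ee p z)" by metis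
 have c0: "co 0 p = 0" if "p \<in> Sg" for p
 proof -
  have "(cc 0 - 1/2) + (\<Sum>p\<in>Sg. co 0 p * ee p z) = 0" if "z \<notin> HL" for z
  proof -
   have "1/2 = cc 0 + (\<Sum>p\<in>Sg. co 0 p * ee p z)" using cc[OF that, of 0] by simp
   thus ?thesis by algebra
  qed
  from ee_independent(1)[OF this] show ?thesis using that by blast
 qed
 have cc0: "cc 0 = 1/2"
 proof -
  obtain z where z: "z \<notin> HL" using near_half_lattice[of 0] by (metis eventually_happens trivial_limit_at)
  show ?thesis using cc[OF z, of 0] c0 by simp
 qed
 define d where "d = card Sg + 1"
 define v where "v = (\<lambda>j i. case i of None => cc j | Some p => co j p)"
 have ci: "card (insert None (Some ` Sg)) < card {..d}"
  by (subst card_insert_disjoint) (auto simp: card_image d_def)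
 obtain l where l: "\<exists>j\<in>{..d}. l j \<noteq> 0" "\<forall>i\<in>insert None (Some ` Sg). (\<Sum>j\<le>d. l j * v j i) = 0"
  using more_vectors_than_coordinates[OF _ _ ci, of v] by auto
 have lc: "(\<Sum>j\<le>d. l j * cc j) = 0" "\<And>p. p \<in> Sg ==> (\<Sum>j\<le>d. l j * co j p) = 0"
  using l(2) by (auto simp: v_def)
 define N where "N = Max {j. j \<le> d \<and> l j \<noteq> 0}"
 have fN: "finite {j. j \<le> d \<and> l j \<noteq> 0}" by simp
 have neN: "{j. j \<le> d \<and> l j \<noteq> 0} \<noteq> {}" using l(1) by auto
 have N: "N \<le> d" "l N \<noteq> 0" using Max_in[OF fN neN] by (auto simp: N_def)
 have Nmax: "l j = 0" if "j > N" "j \<le> d" for j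
 proof (rule ccontr)
  assume "l j \<noteq> 0"
  hence "j \<in> {j. j \<le> d \<and> l j \<noteq> 0}" using that by simp
  from Max_ge[OF fN this] show False using that by (simp add: N_def)
 qed
 define C where "C = (\<Sum>j\<le>d. \<Sum>i\<le>j. monom (l j * cc i) (j - i))"
 define b where "b = (\<lambda>p. \<Sum>j\<le>d. \<Sum>i\<le>j. monom (l j * co i p) (j - i))"
 have "coeff C N = (\<Sum>j\<le>d. \<Sum>i\<le>j. if j - i = N then l j * cc i else 0)" by (simp add: C_def coeff_sum)
 also have "\<dots> = (\<Sum>j\<in>{N}. \<Sum>i\<le>j. if j - i = N then l j * cc i else 0)"
 proof (rule sum.mono_neutral_right)
  show "\<forall>j\<in>{..d} - {N}. (\<Sum>i\<le>j. if j - i = N then l j * cc i else 0) = 0"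
   using Nmax by (intro ballI sum.neutral) (metis DiffE atMost_iff diff_le_self insertI1 le_neq_implies_less mult_zero_left)
 qed (use N in auto)
 also have "\<dots> = (\<Sum>i\<le>N. if N - i = N then l N * cc i else 0)" by simp
 also have "\<dots> = (\<Sum>i\<le>N. if i = 0 then l N * cc 0 else 0)" by (rule sum.cong) auto
 also have "\<dots> = l N * cc 0" by simp
 finally have cN: "coeff C N = l N * cc 0" .
 have "coeff C N \<noteq> 0" unfolding cN using N(2) by (simp add: cc0)
 hence C0: "C \<noteq> 0" by auto
 have "eqpoly C b z = 0" if z: "z \<notin> HL" for z
 proof (rule poly_eq_poly_eq_iff[THEN iffD1], rule ext)
  fix B
  define s where "s = (\<lambda>i. \<Sum>j\<in>{i..d}. l j * B ^ (j - i))"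
  have swap: "(\<Sum>j\<le>d. \<Sum>i\<le>j. l j * g i * B ^ (j - i)) = (\<Sum>i\<le>d. s i * g i)" for g
  proof -
   have "(\<Sum>j\<le>d. \<Sum>i\<le>j. l j * g i * B ^ (j - i)) = (\<Sum>(j,i)\<in>Sigma {..d} (\<lambda>j. {..j}). l j * g i * B ^ (j - i))"
    by (simp add: sum.Sigma)
   also have "\<dots> = (\<Sum>(i,j)\<in>Sigma {..d} (\<lambda>i. {i..d}). l j * g i * B ^ (j - i))"
    by (rule sum.reindex_bij_witness[where i = "\<lambda>(i,j). (j,i)" and j = "\<lambda>(i,j). (j,i)"]) auto
   also have "\<dots> = (\<Sum>i\<le>d. \<Sum>j\<in>{i..d}. l j * g i * B ^ (j - i))" by (simp add: sum.Sigma)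
   also have "\<dots> = (\<Sum>i\<le>d. s i * g i)" by (simp add: s_def sum_distrib_right sum_distrib_left mult_ac)
   finally show ?thesis .
  qed
  have PF: "PhiF C b B w = 0 + (\<Sum>i\<in>{..d}. s i * phi i w)" if w: "w \<notin> HL" for w
  proof -
   have "PhiF C b B w = (\<Sum>i\<le>d. s i * cc i) + (\<Sum>p\<in>Sg. (\<Sum>i\<le>d. s i * co i p) * ee p w)"
    by (simp add: PhiF_def C_def b_def poly_sum poly_monom swap)
   also have "(\<Sum>p\<in>Sg. (\<Sum>i\<le>d. s i * co i p) * ee p w) = (\<Sum>i\<le>d. \<Sum>p\<in>Sg. s i * co i p * ee p w)"
    by (simp add: sum_distrib_right) (rule sum.swap)
   also have "(\<Sum>i\<le>d. s i * cc i) + \<dots> = (\<Sum>i\<le>d. s i * phi i w)"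
    by (simp add: cc[OF w] distrib_left sum.distrib sum_distrib_left mult.assoc)
   finally show ?thesis by simp
  qed
  define G where "G = (\<lambda>w. 0 + (\<Sum>i\<in>{..d}. s i * phi i w))"
  have e0: "PhiF C b B w = G w" if "w \<notin> HL" for w using PF[OF that] by (simp add: G_def)
  have e1: "deriv (PhiF C b B) w = deriv G w" if "w \<notin> HL" for w by (rule deriv_cong_HL[OF e0 that])
  have e2: "deriv (deriv (PhiF C b B)) w = deriv (deriv G) w" if "w \<notin> HL" for w by (rule deriv_cong_HL[OF e1 that])
  have e3: "deriv (deriv (deriv (PhiF C b B))) w = deriv (deriv (deriv G)) w" if "w \<notin> HL" for w by (rule deriv_cong_HL[OF e2 that])
  have "T0 (PhiF C b B) z = T0 G z" unfolding T0_def e0[OF z] e1[OF z] e3[OF z] ..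
  also have "\<dots> = (\<Sum>i\<le>d. s i * T0 (phi i) z)" unfolding G_def by (subst T0_lin[OF _ phi_ellp z]) auto
  also have "\<dots> = (\<Sum>i\<le>d. s i * (4 * deriv (phi (Suc i)) z))" by (simp only: phi_linear[OF z])
  finally have T: "T0 (PhiF C b B) z = (\<Sum>i\<le>d. s i * (4 * deriv (phi (Suc i)) z))" .
  have D: "deriv (PhiF C b B) z = (\<Sum>i\<le>d. s i * deriv (phi i) z)"
   unfolding e1[OF z] G_def by (rule deriv_lin[OF _ phi_ellp z]) auto
  have p0: "deriv (phi 0) z = 0" by simp
  have "(\<Sum>i\<le>d. s i * deriv (phi i) z) = (\<Sum>i<d. s (Suc i) * deriv (phi (Suc i)) z)"
   by (subst sum.atMost_shift) (simp add: p0 del: phi.simps)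
  hence "4 * B * deriv (PhiF C b B) z = (\<Sum>i<d. (B * s (Suc i)) * (4 * deriv (phi (Suc i)) z))"
   unfolding D by (simp add: sum_distrib_left mult_ac del: phi.simps)
  also have "B * s (Suc i) = s i - l i" if "i < d" for i
  proof -
   have "{i..d} = insert i {Suc i..d}" using that by auto
   hence "s i = l i + (\<Sum>j\<in>{Suc i..d}. l j * B ^ (j - i))" unfolding s_def by simp
   also have "(\<Sum>j\<in>{Suc i..d}. l j * B ^ (j - i)) = B * s (Suc i)"
    unfolding s_def sum_distrib_left
   proof (rule sum.cong[OF refl])
    fix j assume "j \<in> {Suc i..d}"
    hence "j - i = Suc (j - Suc i)" by auto
    thus "l j * B ^ (j - i) = B * (l j * B ^ (j - Suc i))" by (simp add: mult_ac)
   qed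
   finally show ?thesis by simp
  qed
  hence "(\<Sum>i<d. (B * s (Suc i)) * (4 * deriv (phi (Suc i)) z)) = (\<Sum>i<d. (s i - l i) * (4 * deriv (phi (Suc i)) z))" by simp
  also have "\<dots> = (\<Sum>i\<le>d. (s i - l i) * (4 * deriv (phi (Suc i)) z))"
  proof -
   have "s d = l d" by (simp add: s_def)
   thus ?thesis by (simp add: lessThan_Suc_atMost[symmetric] del: phi.simps)
  qed
  also have "\<dots> = T0 (PhiF C b B) z - (\<Sum>i\<le>d. l i * (4 * deriv (phi (Suc i)) z))"
   unfolding T by (simp add: left_diff_distrib sum_subtractf del: phi.simps)
  also have "(\<Sum>i\<le>d. l i * (4 * deriv (phi (Suc i)) z)) = T0 (\<lambda>z. 0 + (\<Sum>i\<in>{..d}. l i * phi i z)) z"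
   by (subst T0_lin[OF _ phi_ellp z]) (simp_all only: phi_linear[OF z] mult_zero_left add_0 finite_atMost)
  also have "\<dots> = 0"
  proof -
   have "0 + (\<Sum>i\<in>{..d}. l i * phi i w) = (\<lambda>_. 0) w" if w: "w \<notin> HL" for w
   proof -
    have "(\<Sum>i\<le>d. l i * phi i w) = (\<Sum>i\<le>d. l i * cc i) + (\<Sum>i\<le>d. \<Sum>p\<in>Sg. l i * co i p * ee p w)"
     by (simp add: cc[OF w] distrib_left sum.distrib sum_distrib_left mult.assoc)
    also have "(\<Sum>i\<le>d. \<Sum>p\<in>Sg. l i * co i p * ee p w) = (\<Sum>p\<in>Sg. (\<Sum>i\<le>d. l i * co i p) * ee p w)"
     by (subst sum.swap) (simp add: sum_distrib_right)
    finally show ?thesis using lc by simp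
   qed
   note z0 = this
   let ?Z = "\<lambda>z. 0 + (\<Sum>i\<in>{..d}. l i * phi i z)"
   have z1: "deriv ?Z w = (\<lambda>_. 0) w" if "w \<notin> HL" for w using deriv_cong_HL[OF z0 that] by simp
   have z2: "deriv (deriv ?Z) w = (\<lambda>_. 0) w" if "w \<notin> HL" for w using deriv_cong_HL[OF z1 that] by simp
   have z3: "deriv (deriv (deriv ?Z)) w = (\<lambda>_. 0) w" if "w \<notin> HL" for w using deriv_cong_HL[OF z2 that] by simp
   show ?thesis unfolding T0_def z0[OF z] z1[OF z] z3[OF z] by simp
  qed
  finally show "poly (eqpoly C b z) B = poly 0 B" unfolding eqpoly_poly[OF z] by simp
 qed
 thus ?thesis using C0 unfolding Sol_def by blast
qed

lemma double_sum_Sg: "(\<Sum>k\<le>3. \<Sum>j<n k. F k (n k - j)) = (\<Sum>(k,m)\<in>Sg. F k m)"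
proof -
 have "(\<Sum>j<n k. F k (n k - j)) = (\<Sum>m\<in>{1..n k}. F k m)" for k
  by (rule sum.reindex_bij_witness[where i = "\<lambda>m. n k - m" and j = "\<lambda>j. n k - j"]) auto
 thus ?thesis by (simp add: Sg_def sum.Sigma)
qed

definition normal :: "complex poly => (nat \<times> nat => complex poly) => bool" where
 "normal C b \<longleftrightarrow> Sol C b \<and> (\<nexists>B. poly C B = 0 \<and> (\<forall>p\<in>Sg. poly (b p) B = 0)) \<and> lead_coeff C = 1/2"

text \<open>In a solution with \<open>C\<close> of least degree the coefficients have no common zero, as one could divide by it.\<close>
lemma normal_exists: "\<exists>C b. normal C b"
proof -
 define Q where "Q = (\<lambda>m. \<exists>C b. Sol C b \<and> C \<noteq> 0 \<and> degree C = m)"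
 have "\<exists>m. Q m" using Sol_exists by (auto simp: Q_def)
 hence "Q (LEAST m. Q m)" by (rule LeastI_ex)
 then obtain C b where Cb: "Sol C b" "C \<noteq> 0" "degree C = (LEAST m. Q m)" by (auto simp: Q_def)
 have min: "degree C \<le> degree C'" if "Sol C' b'" "C' \<noteq> 0" for C' b'
  unfolding Cb(3) by (rule Least_le) (use that in \<open>auto simp: Q_def\<close>)
 have nz: "\<nexists>B. poly C B = 0 \<and> (\<forall>p\<in>Sg. poly (b p) B = 0)"
 proof
  assume "\<exists>B. poly C B = 0 \<and> (\<forall>p\<in>Sg. poly (b p) B = 0)"
  then obtain B where B: "poly C B = 0" "\<And>p. p \<in> Sg ==> poly (b p) B = 0" by blast
  define l where "l = [:- B, 1:]"
  define C' where "C' = C div l"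
  define b' where "b' = (\<lambda>p. b p div l)"
  have dv: "q = l * (q div l)" if "poly q B = 0" for q
  proof -
   have "l dvd q" using that unfolding l_def poly_eq_0_iff_dvd .
   thus ?thesis by (simp only: dvd_mult_div_cancel)
  qed
  have C': "C = l * C'" unfolding C'_def by (rule dv[OF B(1)])
  have b': "b p = l * b' p" if "p \<in> Sg" for p unfolding b'_def by (rule dv[OF B(2)[OF that]])
  have l0: "l \<noteq> 0" "degree l = 1" by (auto simp: l_def)
  have "eqpoly C b z = l * eqpoly C' b' z" for z
  proof -
   have "(\<Sum>p\<in>Sg. smult (T0 (ee p) z) (b p) - smult (4 * deriv (ee p) z) (pCons 0 (b p))) =
    (\<Sum>p\<in>Sg. l * (smult (T0 (ee p) z) (b' p) - smult (4 * deriv (ee p) z) (pCons 0 (b' p))))"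
    by (rule sum.cong[OF refl]) (simp add: b' right_diff_distrib mult_smult_right mult_pCons_right)
   thus ?thesis unfolding eqpoly_def C' by (simp add: distrib_left sum_distrib_left mult_smult_right)
  qed
  hence "Sol C' b'" using Cb(1) l0(1) by (auto simp: Sol_def)
  moreover have C'0: "C' \<noteq> 0" using C' Cb(2) by auto
  ultimately have "degree C \<le> degree C'" by (rule min)
  moreover have "degree C = 1 + degree C'" unfolding C' using degree_mult_eq[OF l0(1) C'0] l0(2) by simp
  ultimately show False by simp
 qed
 define a where "a = 1 / (2 * lead_coeff C)"
 have a0: "a \<noteq> 0" using Cb(2) by (simp add: a_def)
 have "Sol ([:a:] * C - 0 * C) (\<lambda>p. [:a:] * b p - 0 * b p)" by (rule Sol_lin[OF Cb(1) Cb(1)])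
 hence "Sol (smult a C) (\<lambda>p. smult a (b p))" by simp
 hence "normal (smult a C) (\<lambda>p. smult a (b p))"
  unfolding normal_def using nz a0 Cb(2) by (auto simp: a_def)
 thus ?thesis by blast
qed

text \<open>A linear combination of two solutions eliminates the term without poles, so it vanishes by \<open>Sol_zero\<close>. The two are
 proportional, and without common zeros of the coefficients the factor is constant.\<close>
lemma normal_unique:
 assumes 1: "normal C1 b1" and 2: "normal C2 b2"
 shows "C1 = C2" "\<And>p. p \<in> Sg ==> b1 p = b2 p"
proof -
 have C0: "C1 \<noteq> 0" "C2 \<noteq> 0" using 1 2 by (auto simp: normal_def)
 have "Sol (C2 * C1 - C1 * C2) (\<lambda>p. C2 * b1 p - C1 * b2 p)"
  by (rule Sol_lin) (use 1 2 in \<open>auto simp: normal_def\<close>)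
 hence "Sol 0 (\<lambda>p. C2 * b1 p - C1 * b2 p)" by (simp add: mult.commute)
 hence eq: "C2 * b1 p = C1 * b2 p" if "p \<in> Sg" for p using Sol_zero[OF _ that] by fastforce
 have ord: "order x C1 \<le> order x C2"
  if C: "C1 \<noteq> 0" "C2 \<noteq> 0" and nz: "\<nexists>B. poly C1 B = 0 \<and> (\<forall>p\<in>Sg. poly (b1 p) B = 0)"
   and eq: "\<And>p. p \<in> Sg ==> C2 * b1 p = C1 * b2 p" for C1 C2 b1 b2 and x :: complex
 proof (cases "poly C1 x = 0")
  case False thus ?thesis by (simp add: order_0I)
 next
  case True
  then obtain p where p: "p \<in> Sg" "poly (b1 p) x \<noteq> 0" using nz by blast
  have b1: "b1 p \<noteq> 0" using p by auto
  hence b2: "b2 p \<noteq> 0" using eq[OF p(1)] C by auto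
  have "order x (C2 * b1 p) = order x C2" using C b1 p(2) by (simp add: order_mult order_0I)
  moreover have "order x (C1 * b2 p) = order x C1 + order x (b2 p)" using C b2 by (simp add: order_mult)
  ultimately show ?thesis using eq[OF p(1)] by simp
 qed
 have oe: "order x C1 = order x C2" for x
 proof (rule antisym)
  show "order x C1 \<le> order x C2" by (rule ord[OF C0 _ eq]) (use 1 in \<open>auto simp: normal_def\<close>)
  show "order x C2 \<le> order x C1"
   by (rule ord[OF C0(2,1), of b2 b1]) (use 2 eq in \<open>auto simp: normal_def\<close>)
 qed
 hence S: "{z. poly C1 z = 0} = {z. poly C2 z = 0}" using C0 by (simp add: order_root)
 have "lead_coeff C1 = 1/2" "lead_coeff C2 = 1/2" using 1 2 unfolding normal_def by blast+
 hence l: "lead_coeff C1 = lead_coeff C2" by (simp only:)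
 have "smult (lead_coeff C1) (\<Prod>z | poly C1 z = 0. [:- z, 1:] ^ order z C1) = smult (lead_coeff C2) (\<Prod>z | poly C2 z = 0. [:- z, 1:] ^ order z C2)"
  unfolding l S oe ..
 thus C12: "C1 = C2" unfolding complex_poly_decompose .
 fix p assume "p \<in> Sg"
 from eq[OF this] C12 C0 show "b1 p = b2 p" by simp
qed

lemma PhiF_conv:
 "(\<lambda>B z. poly C B + (\<Sum>k\<le>3. \<Sum>j<n k. poly (b k j) B * wp \<tau> (z + omega \<tau> k / 2) ^ (n k - j)))
  = PhiF C (\<lambda>(k,m). b k (n k - m))"
proof (intro ext)
 fix B z
 have "(\<Sum>k\<le>3. \<Sum>j<n k. poly (b k j) B * wp \<tau> (z + omega \<tau> k / 2) ^ (n k - j)) =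
  (\<Sum>k\<le>3. \<Sum>j<n k. (\<lambda>k m. poly (b k (n k - m)) B * P k z ^ m) k (n k - j))"
  by (intro sum.cong refl) (auto simp: P_def hp_def)
 also have "\<dots> = (\<Sum>(k,m)\<in>Sg. poly (b k (n k - m)) B * P k z ^ m)" by (rule double_sum_Sg)
 finally show "poly C B + (\<Sum>k\<le>3. \<Sum>j<n k. poly (b k j) B * wp \<tau> (z + omega \<tau> k / 2) ^ (n k - j)) = PhiF C (\<lambda>(k,m). b k (n k - m)) B z"
  by (simp add: PhiF_def ee_def case_prod_unfold)
qed

lemma Sol_iff: "Sol C b \<longleftrightarrow> (\<forall>B. sym_product_solution n \<tau> B (PhiF C b B))"
proof -
 have "(\<forall>B. poly (eqpoly C b z) B = 0) \<longleftrightarrow> eqpoly C b z = 0" for z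
  using poly_eq_poly_eq_iff[of "eqpoly C b z" 0] by (auto simp: fun_eq_iff)
 thus ?thesis unfolding Sol_def sym_product_iff by blast
qed

lemma Phi_normalized_iff: "Phi_normalized n \<tau> \<Phi> \<longleftrightarrow> (\<exists>C b. normal C b \<and> \<Phi> = PhiF C b)"
proof
 assume "Phi_normalized n \<tau> \<Phi>"
 then obtain C b where h: "\<Phi> = PhiF C (\<lambda>(k,m). b k (n k - m))"
  "\<forall>B. sym_product_solution n \<tau> B (\<Phi> B)"
  "\<nexists>B. poly C B = 0 \<and> (\<forall>k\<le>3. \<forall>j<n k. poly (b k j) B = 0)" "lead_coeff C = 1/2"
  unfolding Phi_normalized_def PhiF_conv by blast
 have "(\<forall>k\<le>3. \<forall>j<n k. poly (b k j) B = 0) \<longleftrightarrow> (\<forall>p\<in>Sg. poly ((\<lambda>(k,m). b k (n k - m)) p) B = 0)" for B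
 proof safe
  fix k m assume "\<forall>k\<le>3. \<forall>j<n k. poly (b k j) B = 0" "(k,m) \<in> Sg"
  thus "poly (b k (n k - m)) B = 0" by (auto simp: Sg_def)
 next
  fix k j assume a: "\<forall>p\<in>Sg. poly ((\<lambda>(k,m). b k (n k - m)) p) B = 0" "k \<le> 3" "j < n k"
  have "(k, n k - j) \<in> Sg" using a by (auto simp: Sg_def)
  from bspec[OF a(1) this] show "poly (b k j) B = 0" using a(3) by simp
 qed
 hence "normal C (\<lambda>(k,m). b k (n k - m))" unfolding normal_def Sol_iff using h by auto
 thus "\<exists>C b. normal C b \<and> \<Phi> = PhiF C b" using h(1) by blast
next
 assume "\<exists>C b. normal C b \<and> \<Phi> = PhiF C b"
 then obtain C b where h: "normal C b" "\<Phi> = PhiF C b" by blast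
 define b' where "b' = (\<lambda>k j. b (k, n k - j))"
 have bb: "(\<lambda>(k,m). b' k (n k - m)) p = b p" if "p \<in> Sg" for p using that by (auto simp: b'_def Sg_def)
 have PF: "PhiF C (\<lambda>(k,m). b' k (n k - m)) = \<Phi>"
 proof (intro ext)
  fix B z
  show "PhiF C (\<lambda>(k,m). b' k (n k - m)) B z = \<Phi> B z" unfolding h(2) PhiF_def
   by (intro arg_cong2[of _ _ _ _ "(+)"] refl sum.cong) (simp only: bb)
 qed
 have inSg: "(k, n k - j) \<in> Sg" if "k \<le> 3" "j < n k" for k j using that by (auto simp: Sg_def)
 have C0: "C \<noteq> 0" using h(1) by (auto simp: normal_def)
 have nz: "\<nexists>B. poly C B = 0 \<and> (\<forall>k\<le>3. \<forall>j<n k. poly (b' k j) B = 0)"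
 proof
  assume "\<exists>B. poly C B = 0 \<and> (\<forall>k\<le>3. \<forall>j<n k. poly (b' k j) B = 0)"
  then obtain B where B: "poly C B = 0" "\<And>k j. k \<le> 3 ==> j < n k ==> poly (b' k j) B = 0" by blast
  have "poly (b p) B = 0" if p: "p \<in> Sg" for p
  proof -
   obtain k m where km: "p = (k,m)" "k \<le> 3" "m \<ge> 1" "m \<le> n k" using p by (auto simp: Sg_def)
   from B(2)[of k "n k - m"] km show ?thesis by (simp add: b'_def)
  qed
  thus False using B(1) h(1) by (auto simp: normal_def)
 qed
 show "Phi_normalized n \<tau> \<Phi>" unfolding Phi_normalized_def
 proof (intro exI conjI)
  show "\<Phi> = (\<lambda>B z. poly C B + (\<Sum>k\<le>3. \<Sum>j<n k. poly (b' k j) B * wp \<tau> (z + omega \<tau> k / 2) ^ (n k - j)))"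
   unfolding PhiF_conv PF ..
  show "\<forall>B. sym_product_solution n \<tau> B (\<Phi> B) \<and> even_elliptic \<tau> (\<Phi> B)"
   using h even_elliptic_PhiF Sol_iff by (auto simp: normal_def)
  show "\<forall>k\<le>3. \<forall>j<n k. degree (b' k j) < degree C"
   using Sol_degree[OF _ C0 inSg] h(1) by (auto simp: normal_def b'_def)
  show "lead_coeff C = 1 / 2" using h(1) by (simp add: normal_def)
 qed (fact nz)
qed

text \<open>The coefficients of \<open>\<Phi>\<^sub>e\<close>, by \<open>Phi_e_eq\<close>.\<close>
definition Cp :: "complex poly" where "Cp = fst (SOME (C,b). normal C b)"
definition bp :: "nat \<times> nat => complex poly" where "bp = snd (SOME (C,b). normal C b)"

lemma normal_Cp: "normal Cp bp"
proof -
 have "\<exists>x. case x of (C,b) => normal C b" using normal_exists by auto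
 from someI_ex[OF this] show ?thesis by (simp add: Cp_def bp_def case_prod_unfold)
qed

lemma Phi_e_eq: "Phi_e n \<tau> = PhiF Cp bp"
proof -
 have "(THE \<Phi>. Phi_normalized n \<tau> \<Phi>) = PhiF Cp bp"
 proof (rule the_equality)
  show "Phi_normalized n \<tau> (PhiF Cp bp)" using normal_Cp Phi_normalized_iff by blast
  fix \<Phi> assume "Phi_normalized n \<tau> \<Phi>"
  then obtain C b where "normal C b" "\<Phi> = PhiF C b" using Phi_normalized_iff by blast
  thus "\<Phi> = PhiF Cp bp" using normal_unique[OF _ normal_Cp, of C b] by (auto simp: PhiF_def fun_eq_iff)
 qed
 thus ?thesis by (simp add: Phi_e_def)
qed

end

section \<open>The spectral polynomial\<close>

lemma holomorphic_eq_off_sparse: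
 assumes S: "S sparse_in UNIV" and D: "open D" and f: "f holomorphic_on D" and g: "g holomorphic_on D"
  and eq: "\<And>z. z \<in> D ==> z \<notin> S ==> f z = g z" and z: "z \<in> D"
 shows "f z = g z"
proof -
 have "eventually (\<lambda>w. w \<notin> S) (at z)" using S sparse_in_eventually_iff[OF open_UNIV] by blast
 moreover have "eventually (\<lambda>w. w \<in> D) (at z)" using D z by (rule eventually_at_in_open')
 ultimately have ev: "eventually (\<lambda>w. f w = g w) (at z)" by eventually_elim (use eq in auto)
 have "f \<midarrow>z\<rightarrow> f z" "g \<midarrow>z\<rightarrow> g z"
  using holomorphic_on_imp_continuous_on[OF f] holomorphic_on_imp_continuous_on[OF g] z D
  by (auto simp: continuous_on_eq_continuous_at isCont_def)
 thus "f z = g z" using tendsto_cong[OF ev] tendsto_unique[OF at_neq_bot, of g] by blast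
qed

context lame begin

abbreviation "Phi \<equiv> PhiF Cp bp"
definition gg :: nat where "gg = degree Cp"
definition Qp :: "complex poly" where "Qp = spectral_poly n \<tau>"

lemma Phi_ellp: "ellp 1 (Phi B)" by (rule PhiF_ellp)

lemma Cp_facts: "lead_coeff Cp = 1/2" "Cp \<noteq> 0" "p \<in> Sg ==> degree (bp p) < gg"
proof -
 show "lead_coeff Cp = 1/2" using normal_Cp unfolding normal_def by blast
 show C0: "Cp \<noteq> 0" using normal_Cp by (auto simp: normal_def)
 show "p \<in> Sg ==> degree (bp p) < gg" unfolding gg_def
  using Sol_degree[OF _ C0] normal_Cp by (auto simp: normal_def)
qed

lemma Phi_T: "z \<notin> HL ==> T0 (Phi B) z = 4 * B * deriv (Phi B) z"
proof -
 assume z: "z \<notin> HL"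
 have "eqpoly Cp bp z = 0" using normal_Cp z by (auto simp: normal_def Sol_def)
 from arg_cong[OF this, of "\<lambda>p. poly p B"] show ?thesis unfolding eqpoly_poly[OF z] by simp
qed

lemma Phi_nontrivial: "\<exists>z. z \<notin> HL \<and> Phi B z \<noteq> 0"
proof (rule ccontr)
 assume "\<not> ?thesis"
 hence "poly Cp B + (\<Sum>p\<in>Sg. poly (bp p) B * ee p z) = 0" if "z \<notin> HL" for z using that by (auto simp: PhiF_def)
 from ee_independent[OF this] show False using normal_Cp by (auto simp: normal_def)
qed

lemma Phi_laurent_nonzero: "laurent_expansion (Phi B) a \<noteq> 0"
proof
 assume F0: "laurent_expansion (Phi B) a = 0"
 have "eventually (\<lambda>w. eval_fls 0 w = Phi B (a + w)) (at 0)"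
  using ellpD(5)[OF Phi_ellp, of B a] unfolding F0 has_laurent_expansion_def by blast
 hence "eventually (\<lambda>w. Phi B (a + w) = 0) (at 0)" by eventually_elim simp
 hence "eventually (\<lambda>z. Phi B z = 0) (at a)"
  unfolding at_to_0[of a] eventually_filtermap by (simp add: add.commute)
 hence "eventually (\<lambda>z. z \<notin> HL \<and> Phi B z = 0) (at a)"
  using near_half_lattice[of a] by eventually_elim auto
 then obtain U where U: "open U" "a \<in> U" "\<And>z. z \<in> U ==> z \<noteq> a ==> z \<notin> HL \<and> Phi B z = 0"
  unfolding eventually_at_topological by blast
 obtain e where e: "e > 0" "ball a e \<subseteq> U" by (rule openE[OF U(1,2)])
 have "a + of_real (e/2) \<in> ball a e" using e(1) by (simp add: dist_norm)
 hence b: "a + of_real (e/2) \<in> U - {a}" using e by auto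
 obtain z where z: "z \<notin> HL" "Phi B z \<noteq> 0" using Phi_nontrivial by blast
 have "Phi B z = 0"
 proof (rule analytic_continuation_open[of "U - {a}" "- HL" "Phi B" "\<lambda>_. 0"])
  show "U - {a} \<subseteq> - HL" using U(3) by auto
  show "U - {a} \<noteq> {}" using b by blast
 qed (use U z half_lattice_Compl ellpD(1)[OF Phi_ellp] in auto)
 thus False using z by simp
qed

definition Qf :: "complex => complex => complex" where
 "Qf B z = deriv (Phi B) z ^ 2 - 2 * Phi B z * deriv (deriv (Phi B)) z + 4 * (u z + B) * Phi B z ^ 2"

text \<open>The derivative of this expression in \<open>z\<close> is a multiple of the symmetric product equation.\<close>
lemma Qf_const: assumes "z \<notin> HL" "w \<notin> HL" shows "Qf B z = Qf B w"
proof (rule zero_deriv_imp_const[where f = "Qf B", OF half_lattice_Compl])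
 fix x assume "x \<in> - HL"
 hence x: "x \<notin> HL" by simp
 note D0 = ellpD(6)[OF Phi_ellp x, of B]
 note D1 = ellpD(6)[OF ellp_deriv[OF Phi_ellp] x, of B]
 note D2 = ellpD(6)[OF ellp_deriv[OF ellp_deriv[OF Phi_ellp]] x, of B]
 note Du = ellpD(6)[OF u_ellp x]
 let ?f = "Phi B x" and ?f1 = "deriv (Phi B) x" and ?f2 = "deriv (deriv (Phi B)) x" and ?f3 = "deriv (deriv (deriv (Phi B))) x"
 have "DERIV (\<lambda>z. deriv (Phi B) z * deriv (Phi B) z - 2 * Phi B z * deriv (deriv (Phi B)) z + (4 * (u z + B)) * (Phi B z * Phi B z)) x :>
  (?f2 * ?f1 + ?f2 * ?f1) - ((2 * ?f1) * ?f2 + ?f3 * (2 * ?f)) + ((4 * (deriv u x + 0)) * (?f * ?f) + (?f1 * ?f + ?f1 * ?f) * (4 * (u x + B)))"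
  by (intro DERIV_add DERIV_diff DERIV_mult DERIV_cmult DERIV_const D0 D1 D2 Du)
 moreover have "(?f2 * ?f1 + ?f2 * ?f1) - ((2 * ?f1) * ?f2 + ?f3 * (2 * ?f)) + ((4 * (deriv u x + 0)) * (?f * ?f) + (?f1 * ?f + ?f1 * ?f) * (4 * (u x + B)))
  = - 2 * ?f * (T0 (Phi B) x - 4 * B * ?f1)" by (simp add: T0_def algebra_simps)
 moreover have "T0 (Phi B) x - 4 * B * ?f1 = 0" using Phi_T[OF x] by simp
 ultimately show "DERIV (Qf B) x :> 0"
  unfolding Qf_def[abs_def] power2_eq_square by (simp add: mult.assoc)
qed (use assms in auto)

text \<open>\<open>\<Phi>\<close>, and below \<open>Q\<close>, at a fixed \<open>z\<close> as polynomials in \<open>B\<close>.\<close>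
definition PP :: "complex => complex poly" where "PP z = Cp + (\<Sum>p\<in>Sg. smult (ee p z) (bp p))"

lemma poly_PP: "poly (PP z) B = Phi B z"
 by (simp add: PP_def PhiF_def poly_sum mult.commute)

definition QQ :: "complex => complex poly" where
 "QQ z = (\<Sum>p\<in>Sg. smult (deriv (ee p) z) (bp p))^2 - 2 * PP z * (\<Sum>p\<in>Sg. smult (deriv (deriv (ee p)) z) (bp p))
  + smult 4 ([:u z, 1:] * PP z ^ 2)"

lemma poly_QQ: assumes "z \<notin> HL" shows "poly (QQ z) B = Qf B z"
proof -
 have d1: "deriv (Phi B) w = (\<Sum>p\<in>Sg. poly (bp p) B * deriv (ee p) w)" if "w \<notin> HL" for w by (rule PhiF_deriv[OF that])
 have d2: "deriv (deriv (Phi B)) z = (\<Sum>p\<in>Sg. poly (bp p) B * deriv (deriv (ee p)) z)"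
  using deriv_cong_HL[of "deriv (Phi B)", OF d1 assms]
   deriv_lin0[where I = Sg and f = "\<lambda>p. deriv (ee p)" and s = "-1" and a = "\<lambda>p. poly (bp p) B", OF _ _ assms] ellp_deriv[OF ee_ellp] SgD(1)
  by simp
 show ?thesis unfolding QQ_def Qf_def d2 d1[OF assms]
  by (simp add: poly_sum poly_PP algebra_simps)
qed

lemma Qp_eq: "z \<notin> HL ==> Qp = QQ z" "z \<notin> HL ==> poly Qp B = Qf B z"
proof -
 obtain z0 where z0: "z0 \<notin> HL" using Phi_nontrivial by blast
 have sp: "Qp = QQ z0" unfolding Qp_def spectral_poly_def
 proof (rule the_equality)
  have e: "deriv (Phi_e n \<tau> B) z ^ 2 - 2 * Phi_e n \<tau> B z * deriv (deriv (Phi_e n \<tau> B)) z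
        + 4 * lame_potential n \<tau> B z * Phi_e n \<tau> B z ^ 2 = Qf B z" for B z
   by (simp add: Phi_e_eq potential_eq Qf_def)
  show "\<forall>B z. z \<notin> HL \<longrightarrow> poly (QQ z0) B = deriv (Phi_e n \<tau> B) z ^ 2 - 2 * Phi_e n \<tau> B z * deriv (deriv (Phi_e n \<tau> B)) z
        + 4 * lame_potential n \<tau> B z * Phi_e n \<tau> B z ^ 2"
   unfolding e using poly_QQ[OF z0] Qf_const[OF z0] by auto
  fix Q assume "\<forall>B z. z \<notin> HL \<longrightarrow> poly Q B = deriv (Phi_e n \<tau> B) z ^ 2 - 2 * Phi_e n \<tau> B z * deriv (deriv (Phi_e n \<tau> B)) z
        + 4 * lame_potential n \<tau> B z * Phi_e n \<tau> B z ^ 2"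
  hence "poly Q = poly (QQ z0)" unfolding e using poly_QQ[OF z0] z0 by auto
  thus "Q = QQ z0" by (simp add: poly_eq_poly_eq_iff)
 qed
 show 2: "poly Qp B = Qf B z" if "z \<notin> HL" for z B unfolding sp poly_QQ[OF z0] by (rule Qf_const[OF z0 that])
 show "Qp = QQ z" if "z \<notin> HL" for z
 proof -
  have "poly Qp = poly (QQ z)" using 2[OF that] poly_QQ[OF that] by auto
  thus ?thesis by (simp add: poly_eq_poly_eq_iff)
 qed
qed

lemma small_degree: "degree (\<Sum>p\<in>Sg. smult (f p) (bp p)) \<le> gg - 1" "gg = 0 ==> (\<Sum>p\<in>Sg. smult (f p) (bp p)) = 0"
proof -
 have "degree (smult (f p) (bp p)) \<le> gg - 1" if "p \<in> Sg" for p
  using Cp_facts(3)[OF that] degree_smult_le[of "f p" "bp p"] by linarith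
 thus "degree (\<Sum>p\<in>Sg. smult (f p) (bp p)) \<le> gg - 1" by (intro degree_sum_le) auto
 assume "gg = 0"
 hence "Sg = {}" using Cp_facts(3) by auto
 thus "(\<Sum>p\<in>Sg. smult (f p) (bp p)) = 0" by simp
qed

lemma PP_degree: "degree (PP z) = gg" "lead_coeff (PP z) = 1/2"
proof -
 let ?S = "\<Sum>p\<in>Sg. smult (ee p z) (bp p)"
 have "coeff ?S gg = 0"
 proof (cases "gg = 0")
  case True thus ?thesis using small_degree(2) by simp
 next
  case False
  hence "degree ?S < gg" using small_degree(1)[of "\<lambda>p. ee p z"] by simp
  thus ?thesis by (rule coeff_eq_0)
 qed
 hence c: "coeff (PP z) gg = 1/2" using Cp_facts(1) by (simp add: PP_def gg_def)
 have "degree (PP z) \<le> gg" unfolding PP_def using small_degree(1)[of "\<lambda>p. ee p z"] by (intro degree_add_le) (auto simp: gg_def)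
 moreover have "gg \<le> degree (PP z)" by (rule le_degree) (simp add: c)
 ultimately show "degree (PP z) = gg" by simp
 thus "lead_coeff (PP z) = 1/2" using c by simp
qed

lemma Qp_degree: "degree Qp = 2 * gg + 1" "lead_coeff Qp = 1"
proof -
 obtain z where z: "z \<notin> HL" using Phi_nontrivial by blast
 let ?S1 = "\<Sum>p\<in>Sg. smult (deriv (ee p) z) (bp p)" and ?S2 = "\<Sum>p\<in>Sg. smult (deriv (deriv (ee p)) z) (bp p)"
 have P0: "PP z \<noteq> 0" using PP_degree(2)[of z] by auto
 define M where "M = smult 4 ([:u z, 1:] * PP z ^ 2)"
 have dM: "degree M = 2 * gg + 1" unfolding M_def using P0 by (simp add: degree_mult_eq degree_power_eq PP_degree(1) del: mult_pCons_left)
 have lM: "lead_coeff M = 1" unfolding M_def using P0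
  by (simp add: lead_coeff_mult lead_coeff_power PP_degree(2) power2_eq_square del: mult_pCons_left)
 define R where "R = ?S1 ^ 2 - 2 * PP z * ?S2"
 have "degree (?S1 ^ 2) \<le> 2 * gg" using degree_power_le[of ?S1 2] small_degree(1)[of "\<lambda>p. deriv (ee p) z"] by simp
 moreover have "degree (2 * PP z * ?S2) \<le> 2 * gg"
  using degree_mult_le[of "2 * PP z" ?S2] degree_mult_le[of 2 "PP z"] small_degree(1)[of "\<lambda>p. deriv (deriv (ee p)) z"] by (simp add: PP_degree(1))
 ultimately have dR: "degree R \<le> 2 * gg" unfolding R_def by (intro degree_diff_le)
 have Q: "Qp = R + M" unfolding Qp_eq(1)[OF z] QQ_def R_def M_def ..
 show d: "degree Qp = 2 * gg + 1" unfolding Q using dR dM by (simp add: degree_add_eq_right)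
 have "coeff R (2 * gg + 1) = 0" using dR by (intro coeff_eq_0) auto
 thus "lead_coeff Qp = 1" unfolding d using lM dM Q by simp
qed

lemma Qp_nonzero: "Qp \<noteq> 0" using Qp_degree(2) by auto

text \<open>At most one \<open>k\<close> contributes: \<open>- nn a\<close> is the negative exponent of the Lame equation at \<open>a\<close>, or \<open>0\<close> at a regular point.\<close>
definition nn :: "complex => nat" where
 "nn a = (\<Sum>k | k \<le> 3 \<and> a - hp k \<in> L. n k)"

lemma nn_hp: assumes "k \<le> 3" "a - hp k \<in> L" shows "nn a = n k"
proof -
 have "j = k" if "j \<le> 3" "a - hp j \<in> L" for j
 proof (rule hp_diff[OF that(1) assms(1)])
  have "(a - hp k) - (a - hp j) \<in> L" using assms(2) that(2) by (rule lattice_diff)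
  hence "hp j - hp k \<in> L" by simp
  thus "hp j - hp k \<in> L" .
 qed
 note uniq = this
 have "{j. j \<le> 3 \<and> a - hp j \<in> L} = {k}"
 proof (intro equalityI subsetI)
  show "j \<in> {k}" if "j \<in> {j. j \<le> 3 \<and> a - hp j \<in> L}" for j using uniq[of j] that by simp
  show "j \<in> {j. j \<le> 3 \<and> a - hp j \<in> L}" if "j \<in> {k}" for j using assms that by simp
 qed
 thus ?thesis unfolding nn_def by simp
qed

lemma nn_off: assumes "a \<notin> HL" shows "nn a = 0"
proof -
 have "{k. k \<le> 3 \<and> a - hp k \<in> L} = {}" using assms half_lattice_iff by auto
 thus ?thesis by (simp only: nn_def sum.empty)
qed

lemma laurent_shift_lattice:
 assumes "ellp s f" "a - b \<in> L" shows "laurent_expansion f a = laurent_expansion f b"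
proof -
 have "eventually (\<lambda>w. f (b + w) = f (a + w)) (at 0)" using near_half_lattice'[of b]
 proof eventually_elim
  case (elim w)
  from ellpD(4)[OF assms(1) elim assms(2)] show ?case by (simp add: algebra_simps)
 qed
 from laurent_transfer[OF ellpD(5)[OF assms(1), of b] this] show ?thesis by (rule laurent_expansion_eqI)
qed

lemma u_laurent_at:
 "i < -2 ==> fls_nth (laurent_expansion u a) i = 0"
 "fls_nth (laurent_expansion u a) (-2) = of_nat (nn a * (nn a + 1))"
proof -
 have "(i < -2 \<longrightarrow> fls_nth (laurent_expansion u a) i = 0) \<and> fls_nth (laurent_expansion u a) (-2) = of_nat (nn a * (nn a + 1))"
 proof (cases "a \<in> HL")
  case True
  then obtain k where k: "k \<le> 3" "a - hp k \<in> L" by (auto simp: half_lattice_iff)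
  show ?thesis unfolding laurent_shift_lattice[OF u_ellp k(2)] nn_hp[OF k]
   using u_laurent[OF k(1)] by blast
 next
  case False
  have "u analytic_on {a}"
   using holomorphic_on_imp_analytic_at[OF ellpD(1)[OF u_ellp] half_lattice_Compl(1)] False by simp
  from analytic_laurent_neg[OF this] show ?thesis by (simp add: nn_off[OF False])
 qed
 thus "i < -2 ==> fls_nth (laurent_expansion u a) i = 0"
  "fls_nth (laurent_expansion u a) (-2) = of_nat (nn a * (nn a + 1))" by blast+
qed

text \<open>The logarithmic derivative of \<open>y\<^sub>1\<close>.\<close>
definition qq :: "complex => complex => complex => complex" where
 "qq B W z = (deriv (Phi B) z - W) / (2 * Phi B z)"

text \<open>The leading coefficients of the identity defining \<open>Q\<close> leave only three possible orders of \<open>\<Phi>\<close> at a point,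
 and the logarithmic derivative of \<open>y\<^sub>1\<close> has an integral residue in each case.\<close>
lemma qq_residue:
 assumes W: "W ^ 2 = poly Qp B"
 shows "\<exists>F m. (\<lambda>w. qq B W (a + w)) has_laurent_expansion F \<and> (fls_subdegree F \<ge> -1 \<or> F = 0) \<and>
  fls_nth F (-1) = of_nat m - of_nat (nn a)"
proof -
 define F where "F = laurent_expansion (Phi B) a"
 define U where "U = laurent_expansion u a"
 define s where "s = fls_subdegree F"
 define f where "f = fls_nth F s"
 define v where "v = int (nn a)"
 have F0: "F \<noteq> 0" unfolding F_def by (rule Phi_laurent_nonzero)
 have f0: "f \<noteq> 0" using F0 by (simp add: f_def s_def)
 have low: "fls_nth F i = 0" if "i < s" for i using that by (simp add: s_def)
 have Fl: "(\<lambda>w. Phi B (a + w)) has_laurent_expansion F" unfolding F_def by (rule ellpD(5)[OF Phi_ellp])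
 have Ul: "(\<lambda>w. u (a + w)) has_laurent_expansion U" unfolding U_def by (rule ellpD(5)[OF u_ellp])
 have F1: "(\<lambda>w. deriv (Phi B) (a + w)) has_laurent_expansion fls_deriv F"
  unfolding deriv_shift[symmetric] by (intro laurent_expansion_intros Fl)
 have F2: "(\<lambda>w. deriv (deriv (Phi B)) (a + w)) has_laurent_expansion fls_deriv (fls_deriv F)"
  unfolding deriv_shift[of "deriv (Phi B)", symmetric] by (intro laurent_expansion_intros F1)
 define E where "E = fls_deriv F * fls_deriv F - fls_const 2 * (F * fls_deriv (fls_deriv F)) + fls_const 4 * ((U + fls_const B) * (F * F))"
 have "(\<lambda>w. deriv (Phi B) (a + w) * deriv (Phi B) (a + w) - 2 * (Phi B (a + w) * deriv (deriv (Phi B)) (a + w))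
  + 4 * ((u (a + w) + B) * (Phi B (a + w) * Phi B (a + w)))) has_laurent_expansion E"
  unfolding E_def by (intro laurent_expansion_intros Fl F1 F2 Ul)
 moreover have "eventually (\<lambda>w. deriv (Phi B) (a + w) * deriv (Phi B) (a + w) - 2 * (Phi B (a + w) * deriv (deriv (Phi B)) (a + w))
  + 4 * ((u (a + w) + B) * (Phi B (a + w) * Phi B (a + w))) = W ^ 2) (at 0)"
  using near_half_lattice'[of a]
 proof eventually_elim
  case (elim w)
  show ?case unfolding W Qp_eq(2)[OF elim] Qf_def by (simp add: power2_eq_square mult.assoc)
 qed
 ultimately have "(\<lambda>_. W ^ 2) has_laurent_expansion E" by (rule laurent_transfer)
 hence EW: "E = fls_const (W ^ 2)" using has_laurent_expansion_const has_laurent_expansion_unique by blast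
 have l1: "\<And>i. i < s - 1 ==> fls_nth (fls_deriv F) i = 0" using low by simp
 have l2: "\<And>i. i < s - 2 ==> fls_nth (fls_deriv (fls_deriv F)) i = 0" using low by simp
 have lU: "\<And>i. i < -2 ==> fls_nth (U + fls_const B) i = 0" using u_laurent_at(1)[of _ a] by (simp add: U_def)
 have lFF: "\<And>i. i < s + s ==> fls_nth (F * F) i = 0" "fls_nth (F * F) (s + s) = f * f"
  using fls_mult_low(1,2)[of s F s F] low by (auto simp: f_def)
 have a1: "\<And>i. i < (s - 1) + (s - 1) ==> fls_nth (fls_deriv F * fls_deriv F) i = 0"
  "fls_nth (fls_deriv F * fls_deriv F) ((s - 1) + (s - 1)) = (of_int s * f) * (of_int s * f)"
  using fls_mult_low(1,2)[of "s - 1" "fls_deriv F" "s - 1" "fls_deriv F"] l1 by (auto simp: f_def)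
 have a2: "\<And>i. i < s + (s - 2) ==> fls_nth (F * fls_deriv (fls_deriv F)) i = 0"
  "fls_nth (F * fls_deriv (fls_deriv F)) (s + (s - 2)) = f * (of_int (s - 1) * (of_int s * f))"
 proof -
  note m = fls_mult_low(1,2)[of s F "s - 2" "fls_deriv (fls_deriv F)"]
  show "\<And>i. i < s + (s - 2) ==> fls_nth (F * fls_deriv (fls_deriv F)) i = 0" using m(1) low l2 by blast
  have "fls_nth (fls_deriv (fls_deriv F)) (s - 2) = of_int (s - 1) * (of_int s * f)" by (simp add: f_def)
  moreover have "fls_nth (F * fls_deriv (fls_deriv F)) (s + (s - 2)) = fls_nth F s * fls_nth (fls_deriv (fls_deriv F)) (s - 2)"
   using m(2) low l2 by blast
  ultimately show "fls_nth (F * fls_deriv (fls_deriv F)) (s + (s - 2)) = f * (of_int (s - 1) * (of_int s * f))"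
   by (simp only: f_def)
 qed
 have a3: "\<And>i. i < -2 + (s + s) ==> fls_nth ((U + fls_const B) * (F * F)) i = 0"
  "fls_nth ((U + fls_const B) * (F * F)) (-2 + (s + s)) = of_int (v * (v + 1)) * (f * f)"
 proof -
  note m = fls_mult_low(1,2)[of "-2" "U + fls_const B" "s + s" "F * F"]
  show "\<And>i. i < -2 + (s + s) ==> fls_nth ((U + fls_const B) * (F * F)) i = 0" using m(1) lU lFF(1) by blast
  have "fls_nth (U + fls_const B) (-2) = of_int (v * (v + 1))" using u_laurent_at(2)[of a] by (simp add: U_def v_def algebra_simps)
  moreover have "fls_nth ((U + fls_const B) * (F * F)) (-2 + (s + s)) = fls_nth (U + fls_const B) (-2) * fls_nth (F * F) (s + s)"
   using m(2) lU lFF(1) by blast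
  ultimately show "fls_nth ((U + fls_const B) * (F * F)) (-2 + (s + s)) = of_int (v * (v + 1)) * (f * f)" by (simp only: lFF(2))
 qed
 have idx: "(s - 1) + (s - 1) = 2 * s - 2" "s + (s - 2) = 2 * s - 2" "-2 + (s + s) = 2 * s - 2" by auto
 have E0: "fls_nth E i = 0" if "i < 2 * s - 2" for i
  unfolding E_def using a1(1)[of i] a2(1)[of i] a3(1)[of i] that idx by simp
 have "fls_nth E (2 * s - 2) = (of_int s * f) * (of_int s * f) - 2 * (f * (of_int (s - 1) * (of_int s * f))) + 4 * (of_int (v * (v + 1)) * (f * f))"
  unfolding E_def using a1(2) a2(2) a3(2) unfolding idx by simp
 also have "\<dots> = - (f * f) * of_int ((s + 2 * v) * (s - 2 * v - 2))" by (simp add: algebra_simps)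
 finally have E1: "fls_nth E (2 * s - 2) = - (f * f) * of_int ((s + 2 * v) * (s - 2 * v - 2))" .
 have cases: "s = - 2 * v \<or> (s = 2 * v + 2 \<and> W = 0) \<or> (s = 1 \<and> v = 0 \<and> W ^ 2 = f ^ 2)"
 proof (cases "(s + 2 * v) * (s - 2 * v - 2) = 0")
  case True
  have "W = 0" if "s = 2 * v + 2"
  proof -
   have "fls_nth E 0 = 0" by (rule E0) (use that v_def in simp)
   thus ?thesis by (simp add: EW)
  qed
  thus ?thesis using True by auto
 next
  case False
  hence "fls_nth E (2 * s - 2) \<noteq> 0" unfolding E1 using f0 by (metis mult_eq_0_iff neg_equal_0_iff_equal of_int_eq_0_iff)
  hence s1: "s = 1" by (auto simp: EW split: if_splits)
  have "a \<notin> HL"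
  proof
   assume "a \<in> HL"
   then obtain k where k: "k \<le> 3" "a - hp k \<in> L" by (auto simp: half_lattice_iff)
   have "fls_nth F 1 = 0" unfolding F_def laurent_shift_lattice[OF Phi_ellp k(2)]
    by (rule ellp_laurent_odd[OF Phi_ellp k(1)]) simp
   thus False using f0 by (simp add: f_def s1)
  qed
  hence v0: "v = 0" by (simp add: v_def nn_off)
  have "fls_nth E 0 = f * f" using E1 unfolding s1 v0 by simp
  hence "W ^ 2 = f ^ 2" by (simp add: EW power2_eq_square)
  thus ?thesis using s1 v0 by blast
 qed
 define H where "H = fls_deriv F - fls_const W"
 define G where "G = H / (fls_const 2 * F)"
 have F20: "fls_const 2 * F \<noteq> 0" using F0 by simp
 have s2: "fls_subdegree (fls_const 2 * F) = s" by (rule fls_subdegree_eqI) (use f0 low in \<open>auto simp: f_def\<close>)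
 have GF: "G * (fls_const 2 * F) = H" unfolding G_def using F20 by simp
 have Hlow: "fls_nth H k = 0" if k: "k < fls_subdegree (fls_const 2 * F) - 1" for k
 proof -
  have k': "k < s - 1" using k s2 by simp
  have "fls_nth (fls_const W) k = 0"
  proof (cases "k = 0")
   case True
   hence "s > 1" using k' by simp
   hence "W = 0" using cases v_def by auto
   thus ?thesis by simp
  qed auto
  thus ?thesis unfolding H_def using l1[OF k'] by simp
 qed
 note R = fls_quot_residue[OF GF F20 Hlow]
 have r: "fls_nth G (-1) * (2 * f) = of_int s * f - (if s = 1 then W else 0)"
  using R(2) unfolding s2 by (simp add: H_def f_def)
 have Gl: "(\<lambda>w. qq B W (a + w)) has_laurent_expansion G"
  unfolding qq_def G_def H_def by (intro laurent_expansion_intros F1 Fl)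
 have c: "x = y" if "x * (2 * f) = y * (2 * f)" for x y :: complex using that f0 by simp
 have "\<exists>m. fls_nth G (-1) = of_nat m - of_nat (nn a)"
 proof -
  consider "s = - 2 * v" | "s = 2 * v + 2" "W = 0" | "s = 1" "v = 0" "W ^ 2 = f ^ 2" using cases by blast
  thus ?thesis
  proof cases
   case 1
   hence "s \<noteq> 1" by presburger
   hence "fls_nth G (-1) * (2 * f) = (- of_int v) * (2 * f)" using r 1 by simp
   hence "fls_nth G (-1) = - of_int v" by (rule c)
   hence "fls_nth G (-1) = of_nat 0 - of_nat (nn a)" by (simp add: v_def)
   thus ?thesis by blast
  next
   case 2
   have "s \<noteq> 1" using 2(1) v_def by auto
   hence "fls_nth G (-1) * (2 * f) = (of_int v + 1) * (2 * f)" using r 2(1) by (simp add: algebra_simps)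
   hence "fls_nth G (-1) = of_int v + 1" by (rule c)
   hence "fls_nth G (-1) = of_nat (2 * nn a + 1) - of_nat (nn a)" by (simp add: v_def)
   thus ?thesis by blast
  next
   case 3
   have n0: "nn a = 0" using 3 by (simp add: v_def)
   have r': "fls_nth G (-1) * (2 * f) = f - W" using r 3 by simp
   from 3(3) have "W = f \<or> W = - f" by (rule power2_eq_iff[THEN iffD1])
   thus ?thesis
   proof
    assume "W = f"
    hence "fls_nth G (-1) * (2 * f) = 0 * (2 * f)" using r' by simp
    hence "fls_nth G (-1) = 0" by (rule c)
    hence "fls_nth G (-1) = of_nat 0" by simp
    thus ?thesis using n0 by (metis diff_zero of_nat_0)
   next
    assume "W = - f"
    hence "fls_nth G (-1) * (2 * f) = 1 * (2 * f)" using r' by simp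
    hence "fls_nth G (-1) = 1" by (rule c)
    hence "fls_nth G (-1) = of_nat 1" by simp
    thus ?thesis using n0 by (metis diff_zero of_nat_0)
   qed
  qed
 qed
 thus ?thesis using Gl R(1) by blast
qed

end

section \<open>Sigma products\<close>

lemma exp_integral_log_deriv:
 assumes U: "open U" and f: "f holomorphic_on U" and seg: "closed_segment a b \<subseteq> U"
  and nz: "\<And>z. z \<in> closed_segment a b ==> f z \<noteq> (0::complex)"
 shows "f b = f a * exp (contour_integral (linepath a b) (\<lambda>z. deriv f z / f z))"
proof -
 define V where "V = {z \<in> U. f z \<noteq> 0}"
 have "continuous_on U f" using f by (rule holomorphic_on_imp_continuous_on)
 hence "open (U \<inter> f -` (- {0}))" using U by (intro continuous_open_preimage) auto
 moreover have "V = U \<inter> f -` (- {0})" by (auto simp: V_def)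
 ultimately have V: "open V" by simp
 have segV: "closed_segment a b \<subseteq> V" using seg nz by (auto simp: V_def)
 obtain e where e: "e > 0" "(\<Union>x\<in>closed_segment a b. ball x e) \<subseteq> V"
  using compact_subset_open_imp_ball_epsilon_subset[OF compact_segment(1) V segV] by blast
 define N where "N = (\<Union>x\<in>closed_segment a b. ball x e)"
 have N: "open N" "N \<subseteq> V" "closed_segment a b \<subseteq> N" using e by (auto simp: N_def)
 have "N = (\<Union>x\<in>closed_segment a b. \<Union>y\<in>ball 0 e. {x + y})"
 proof (intro equalityI subsetI)
  fix z assume "z \<in> N"
  then obtain x where x: "x \<in> closed_segment a b" "dist x z < e" unfolding N_def by (elim UN_E) simp
  have "z - x \<in> ball 0 e" using x(2) by (simp add: dist_norm norm_minus_commute)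
  moreover have "z \<in> {x + (z - x)}" by simp
  ultimately show "z \<in> (\<Union>x\<in>closed_segment a b. \<Union>y\<in>ball 0 e. {x + y})" using x(1) by blast
 next
  fix z assume "z \<in> (\<Union>x\<in>closed_segment a b. \<Union>y\<in>ball 0 e. {x + y})"
  then obtain x y where x: "x \<in> closed_segment a b" "y \<in> ball 0 e" "z = x + y" by blast
  have "z \<in> ball x e" using x(2) by (simp add: x(3) dist_norm)
  thus "z \<in> N" using x(1) unfolding N_def by blast
 qed
 hence cN: "convex N" using convex_sums[OF convex_closed_segment[of a b] convex_ball[of "0::complex" e]] by simp
 have hf: "f holomorphic_on N" "\<And>z. z \<in> N ==> f z \<noteq> 0" using f N(2) by (auto simp: V_def intro: holomorphic_on_subset)
 have hq: "(\<lambda>z. deriv f z / f z) holomorphic_on N"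
  by (intro holomorphic_intros holomorphic_deriv hf(1) N(1)) (use hf in auto)
 obtain g where g: "\<And>z. z \<in> N ==> DERIV g z :> deriv f z / f z"
  using holomorphic_convex_primitive'[OF cN N(1) hq] at_within_open[OF _ N(1)] by metis
 have ab: "a \<in> N" "b \<in> N" using N(3) by auto
 have "f b * exp (- g b) = f a * exp (- g a)"
 proof (rule zero_deriv_imp_const[where f = "\<lambda>z. f z * exp (- g z)" and S = N])
  fix x assume x: "x \<in> N"
  have "DERIV f x :> deriv f x" using holomorphic_derivI[OF hf(1) N(1) x] .
  hence "DERIV (\<lambda>z. f z * exp (- g z)) x :> deriv f x * exp (- g x) + (exp (- g x) * (- (deriv f x / f x))) * f x"
   by (intro DERIV_mult DERIV_fun_exp DERIV_minus g x)
  thus "DERIV (\<lambda>z. f z * exp (- g z)) x :> 0" using hf(2)[OF x] by simp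
 qed (use N cN ab convex_connected in auto)
 hence "f b * (exp (- g b) * exp (g b)) = f a * (exp (- g a) * exp (g b))" by (metis mult.assoc)
 hence fb: "f b = f a * exp (g b - g a)" by (simp add: exp_minus exp_diff field_simps)
 have "((\<lambda>z. deriv f z / f z) has_contour_integral (g (pathfinish (linepath a b)) - g (pathstart (linepath a b)))) (linepath a b)"
  by (rule contour_integral_primitive[where S = N]) (use g N(3) at_within_open[OF _ N(1)] in auto)
 hence "contour_integral (linepath a b) (\<lambda>z. deriv f z / f z) = g b - g a" by (simp add: contour_integral_unique)
 thus ?thesis using fb by simp
qed

context half_plane begin

text \<open>A sparse set is countable, so there is a line in either direction of the lattice that avoids it.\<close>
lemma base_point:
 assumes S: "S sparse_in UNIV"
 obtains z where "closed_segment z (z + 1) \<inter> S = {}" "closed_segment z (z + \<tau>) \<inter> S = {}"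
proof -
 have cS: "countable S" using sparse_imp_countable[OF open_UNIV S] by simp
 define Y where "Y = (\<lambda>z. Im z / Im \<tau>)"
 define X where "X = (\<lambda>z. Re z - Y z * Re \<tau>)"
 have unc: "\<exists>t::real. t \<notin> T" if "countable T" for T :: "real set"
  using that uncountable_UNIV_real by (metis UNIV_eq_I)
 obtain x where x: "x \<notin> X ` S" using unc[of "X ` S"] cS by auto
 obtain y where y: "y \<notin> Y ` S" using unc[of "Y ` S"] cS by auto
 have XY: "X (pnt x y) = x" "Y (pnt x y) = y" for x y
  using Im_tau by (auto simp: X_def Y_def)
 define z where "z = pnt x y"
 have "w \<notin> S" if w: "w \<in> closed_segment z (z + 1)" for w
 proof -
  obtain t where "w = (1 - t) *\<^sub>R z + t *\<^sub>R (z + 1)" using w unfolding closed_segment_def by blast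
  hence "w = pnt (x + t) y" by (simp add: z_def scaleR_conv_of_real algebra_simps)
  thus ?thesis using y XY(2)[of "x + t" y] by (metis image_eqI)
 qed
 moreover have "w \<notin> S" if w: "w \<in> closed_segment z (z + \<tau>)" for w
 proof -
  obtain t where "w = (1 - t) *\<^sub>R z + t *\<^sub>R (z + \<tau>)" using w unfolding closed_segment_def by blast
  hence "w = pnt x (y + t)" by (simp add: z_def scaleR_conv_of_real algebra_simps)
  thus ?thesis using x XY(1)[of x "y + t"] by (metis image_eqI)
 qed
 ultimately show thesis using that by blast
qed

lemma prod_sigma_deriv:
 assumes "\<And>a. a \<in># A ==> z - a \<notin> L"
 shows "DERIV (\<lambda>z. \<Prod>a\<in>#A. wsigma \<tau> (z - a)) z :> (\<Prod>a\<in>#A. wsigma \<tau> (z - a)) * (\<Sum>a\<in>#A. wzeta (z - a))"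
 using assms
proof (induction A)
 case empty thus ?case by simp
next
 case (add x A)
 have zx: "z - x \<notin> L" using add.prems by simp
 have "DERIV (\<lambda>z. wsigma \<tau> (z - x)) z :> deriv (wsigma \<tau>) (z - x) * (1 - 0)"
  by (rule wsigma_deriv) (intro DERIV_diff DERIV_ident DERIV_const)
 moreover have "deriv (wsigma \<tau>) (z - x) = wsigma \<tau> (z - x) * wzeta (z - x)"
  using zx wsigma_zero_iff by (simp add: wzeta_def)
 ultimately have "DERIV (\<lambda>z. wsigma \<tau> (z - x)) z :> wsigma \<tau> (z - x) * wzeta (z - x)" by simp
 from DERIV_mult[OF this add.IH] show ?case using add.prems by (simp add: algebra_simps)
qed

lemma prod_sigma_holo: "(\<lambda>z. \<Prod>a\<in>#A. wsigma \<tau> (z - a)) holomorphic_on UNIV"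
 by (induction A) (auto intro!: holomorphic_intros)

lemma prod_sigma_zero: "(\<Prod>a\<in>#A. wsigma \<tau> (z - a)) = 0 \<longleftrightarrow> (\<exists>a. a \<in># A \<and> z - a \<in> L)"
 by (induction A) (auto simp: wsigma_zero_iff)

lemma prod_sigma_quasi:
 assumes "\<And>z. wsigma \<tau> (z + w) = C * exp (h * z) * wsigma \<tau> z"
 shows "(\<Prod>a\<in>#A. wsigma \<tau> (z + w - a)) = C ^ size A * exp (h * (of_nat (size A) * z - \<Sum>\<^sub># A)) * (\<Prod>a\<in>#A. wsigma \<tau> (z - a))"
proof (induction A)
 case empty thus ?case by simp
next
 case (add x A)
 have "wsigma \<tau> (z + w - x) = C * exp (h * (z - x)) * wsigma \<tau> (z - x)"
  using assms[of "z - x"] by (simp add: algebra_simps)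
 moreover have "exp (h * (of_nat (size (add_mset x A)) * z - \<Sum>\<^sub># (add_mset x A))) = exp (h * (z - x)) * exp (h * (of_nat (size A) * z - \<Sum>\<^sub># A))"
  by (simp add: exp_add[symmetric] algebra_simps)
 ultimately show ?case using add by simp
qed

end

context lame begin

definition NN :: nat where "NN = (\<Sum>k\<le>3. n k)"
definition den :: "complex => complex" where "den z = (\<Prod>k\<le>3. wsigma \<tau> (z - hp k) ^ n k)"
text \<open>The form of \<open>y\<^sub>1\<close>, with the multiset \<open>A\<close> of the zeros.\<close>
definition yfun :: "complex => complex multiset => complex => complex" where
 "yfun c A z = exp (c * z) * (\<Prod>a\<in>#A. wsigma \<tau> (z - a)) / den z"

definition denA :: "complex multiset" where "denA = (\<Sum>k\<le>3. replicate_mset (n k) (hp k))"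

lemma den_alt: "den z = (\<Prod>a\<in>#denA. wsigma \<tau> (z - a))"
proof -
 have *: "{..3::nat} = {0, 1, 2, 3}" by auto
 show ?thesis unfolding den_def denA_def * by (simp add: mult.assoc)
qed

lemma denA_facts: "size denA = NN" "\<Sum>\<^sub># denA = (\<Sum>k\<le>3. of_nat (n k) * hp k)" "a \<in># denA ==> a \<in> HL"
proof -
 show "size denA = NN" by (simp add: denA_def NN_def numeral_3_eq_3)
 show "\<Sum>\<^sub># denA = (\<Sum>k\<le>3. of_nat (n k) * hp k)" by (simp add: denA_def numeral_3_eq_3)
 assume "a \<in># denA"
 then obtain k where "k \<le> 3" "a = hp k" by (auto simp: denA_def set_mset_sum split: if_splits)
 thus "a \<in> HL" unfolding half_lattice_iff by (intro exI[of _ k]) auto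
qed

lemma denA_sum: "(\<Sum>a\<in>#denA. f a) = (\<Sum>k\<le>3. of_nat (n k) * (f (hp k) :: complex))"
 by (simp add: denA_def numeral_3_eq_3)

lemma den_off: assumes "z \<notin> HL" shows "a \<in># denA ==> z - a \<notin> L" "den z \<noteq> 0"
proof -
 show 1: "z - a \<notin> L" if "a \<in># denA" for a
 proof
  assume "z - a \<in> L"
  from half_lattice_inv[OF this, of a] show False using denA_facts(3)[OF that] assms by simp
 qed
 show "den z \<noteq> 0" unfolding den_alt prod_sigma_zero using 1 by blast
qed

lemma yfun_holo: "yfun c A holomorphic_on - HL"
 unfolding yfun_def[abs_def] den_alt
 by (intro holomorphic_intros holomorphic_on_subset[OF prod_sigma_holo]) (use den_off(2) den_alt in auto)

lemma yfun_mero: "yfun c A meromorphic_on UNIV"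
proof -
 have h: "(\<lambda>z. \<Prod>a\<in>#A. wsigma \<tau> (z - a)) meromorphic_on UNIV" for A
  using prod_sigma_holo by (intro analytic_on_imp_meromorphic_on) (simp add: analytic_on_open)
 have e: "(\<lambda>z. exp (c * z)) meromorphic_on UNIV"
  by (intro analytic_on_imp_meromorphic_on analytic_intros)
 show ?thesis unfolding yfun_def[abs_def] den_alt by (intro meromorphic_intros h e)
qed

lemma yfun_deriv:
 assumes "z \<notin> HL" "\<And>a. a \<in># A ==> z - a \<notin> L"
 shows "DERIV (yfun c A) z :> yfun c A z * (c + (\<Sum>a\<in>#A. wzeta (z - a)) - (\<Sum>k\<le>3. of_nat (n k) * wzeta (z - hp k)))"
proof -
 let ?N = "\<Prod>a\<in>#A. wsigma \<tau> (z - a)" and ?ZA = "\<Sum>a\<in>#A. wzeta (z - a)" and ?ZD = "\<Sum>a\<in>#denA. wzeta (z - a)"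
 have e: "DERIV (\<lambda>z. exp (c * z)) z :> exp (c * z) * c"
  by (auto intro!: derivative_eq_intros)
 note dA = prod_sigma_deriv[OF assms(2)]
 have dD: "DERIV den z :> den z * ?ZD"
  unfolding den_alt by (rule prod_sigma_deriv[OF den_off(1)[OF assms(1)]])
 have eqy: "yfun c A = (\<lambda>z. (exp (c * z) * (\<Prod>a\<in>#A. wsigma \<tau> (z - a))) / den z)" by (simp add: yfun_def fun_eq_iff)
 have "DERIV (yfun c A) z :>
  (((exp (c * z) * c) * ?N + (?N * ?ZA) * exp (c * z)) * den z - (exp (c * z) * ?N) * (den z * ?ZD)) / (den z * den z)"
  unfolding eqy by (intro DERIV_divide DERIV_mult e dA dD den_off(2)[OF assms(1)])
 moreover have "(((exp (c * z) * c) * ?N + (?N * ?ZA) * exp (c * z)) * den z - (exp (c * z) * ?N) * (den z * ?ZD)) / (den z * den z)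
  = yfun c A z * (c + ?ZA - ?ZD)"
  unfolding yfun_def using den_off(2)[OF assms(1)] by (simp add: field_simps)
 ultimately show ?thesis unfolding denA_sum by simp
qed

lemma yfun_zero: "z \<notin> HL ==> yfun c A z = 0 \<longleftrightarrow> (\<exists>a. a \<in># A \<and> z - a \<in> L)"
 unfolding yfun_def using den_off(2) prod_sigma_zero by simp

definition shift :: "complex multiset => complex" where "shift A = \<Sum>\<^sub># A - (\<Sum>k\<le>3. of_nat (n k) * hp k)"

lemma yfun_quasi:
 assumes "size A = NN"
 shows "yfun c A (z + lat a b) =
  exp (c * (lat a b) - eta a b * shift A) * yfun c A z"
proof -
 define w where "w = lat a b"
 define h where "h = eta a b"
 obtain C where C: "C \<noteq> 0" "\<And>z. wsigma \<tau> (z + w) = C * exp (h * z) * wsigma \<tau> z"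
  unfolding w_def h_def using wsigma_quasi by blast
 let ?N = "\<Prod>a\<in>#A. wsigma \<tau> (z - a)"
 have "yfun c A (z + w) = exp (c * (z + w)) * (C ^ NN * exp (h * (of_nat NN * z - \<Sum>\<^sub># A)) * ?N)
  / (C ^ NN * exp (h * (of_nat NN * z - \<Sum>\<^sub># denA)) * den z)"
  unfolding yfun_def den_alt prod_sigma_quasi[OF C(2)] assms denA_facts(1) ..
 also have "exp (h * (of_nat NN * z - \<Sum>\<^sub># A)) = exp (h * (of_nat NN * z - \<Sum>\<^sub># denA)) * exp (- h * shift A)"
  by (simp add: exp_add[symmetric] shift_def denA_facts(2) algebra_simps)
 also have "exp (c * (z + w)) = exp (c * z) * exp (c * w)" by (simp add: exp_add[symmetric] algebra_simps)
 also have "exp (c * z) * exp (c * w) * (C ^ NN * (exp (h * (of_nat NN * z - \<Sum>\<^sub># denA)) * exp (- h * shift A)) * ?N)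
  / (C ^ NN * exp (h * (of_nat NN * z - \<Sum>\<^sub># denA)) * den z) = exp (c * w) * exp (- h * shift A) * (exp (c * z) * ?N / den z)"
  using C(1) by simp
 also have "exp (c * w) * exp (- h * shift A) = exp (c * w - h * shift A)" by (simp add: exp_add[symmetric])
 finally show ?thesis by (simp add: w_def h_def yfun_def)
qed

definition SS :: "complex => complex set" where "SS B = HL \<union> {z. Phi B z = 0}"

lemma SS_sparse: "SS B sparse_in UNIV"
 unfolding SS_def
 by (rule elliptic_divisor_degree(1)[OF half_lattice_sparse half_lattice_inv ellpD(1)[OF Phi_ellp] _ _ ellpD(5)[OF Phi_ellp] Phi_laurent_nonzero])
  (use ellpD(4)[OF Phi_ellp] in auto)

lemma SS_inv: "w \<in> L ==> z + w \<in> SS B \<longleftrightarrow> z \<in> SS B"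
 unfolding SS_def using half_lattice_inv[of w z] ellpD(4)[OF Phi_ellp, of z w B] by auto

lemma SS_uminus: "- z \<in> SS B \<longleftrightarrow> z \<in> SS B"
proof (cases "z \<in> HL")
 case True
 thus ?thesis using half_lattice_uminus[of z] by (simp add: SS_def)
next
 case False
 hence "Phi B (- z) = Phi B z" using ellpD(3)[OF Phi_ellp, of z B] by simp
 thus ?thesis using half_lattice_uminus[of z] by (simp add: SS_def)
qed

lemma SS_D: "z \<notin> SS B ==> z \<notin> HL" "z \<notin> SS B ==> Phi B z \<noteq> 0" by (auto simp: SS_def)

lemma qq_holo: "qq B W holomorphic_on - SS B"
 unfolding qq_def[abs_def]
 by (intro holomorphic_intros holomorphic_on_subset[OF ellpD(1)[OF Phi_ellp]] holomorphic_on_subset[OF ellpD(1)[OF ellp_deriv[OF Phi_ellp]]])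
  (auto simp: SS_def)

lemma qq_partial_fractions:
 assumes W: "W ^ 2 = poly Qp B"
 obtains A c where "size A = NN"
  "\<And>z. z \<notin> SS B ==> qq B W z = c + (\<Sum>a\<in>#A. wzeta (z - a)) - (\<Sum>k\<le>3. of_nat (n k) * wzeta (z - hp k))"
  "\<And>a. a \<in># A ==> a \<in> SS B"
proof -
 have "\<forall>a. \<exists>m. \<exists>F. (\<lambda>w. qq B W (a + w)) has_laurent_expansion F \<and> (fls_subdegree F \<ge> -1 \<or> F = 0) \<and>
  fls_nth F (-1) = of_nat m - of_nat (nn a)" using qq_residue[OF W] by blast
 then obtain m where m: "\<And>a. \<exists>F. (\<lambda>w. qq B W (a + w)) has_laurent_expansion F \<and> (fls_subdegree F \<ge> -1 \<or> F = 0) \<and>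
  fls_nth F (-1) = of_nat (m a) - of_nat (nn a)" by metis
 define R where "R = SS B \<inter> fund"
 have fR: "finite R" unfolding R_def by (rule fund_finite[OF SS_sparse])
 have per: "qq B W (z + w) = qq B W z" if "z \<notin> SS B" "w \<in> L" for z w
  unfolding qq_def using ellpD(4)[OF Phi_ellp _ that(2)] ellpD(4)[OF ellp_deriv[OF Phi_ellp] _ that(2)] SS_D(1)[OF that(1)] by simp
 have reps: "\<exists>!p. p \<in> R \<and> a - p \<in> L" if "a \<in> SS B" for a
  unfolding R_def by (rule fund_reps[OF SS_inv that])
 note pf = partial_fractions[OF SS_sparse SS_inv qq_holo per[OF _ lattice_1] per[OF _ lattice_tau] m fR _ reps]
 have RS: "R \<subseteq> SS B" by (auto simp: R_def)
 obtain c where c: "\<And>z. z \<notin> SS B ==> qq B W z = c + (\<Sum>p\<in>R. (of_nat (m p) - of_nat (nn p)) * wzeta (z - p))"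
  using pf(2)[OF _ _ _ RS] by auto
 have s0: "(\<Sum>p\<in>R. (of_nat (m p) - of_nat (nn p)) :: complex) = 0" using pf(1)[OF _ _ _ RS] by auto
 have hpR: "hp ` {..3} \<subseteq> R" using fund_half_lattice by (auto simp: R_def SS_def)
 have nnR: "(\<Sum>p\<in>R. of_nat (nn p) * (f p :: complex)) = (\<Sum>k\<le>3. of_nat (n k) * f (hp k))" for f
 proof -
  have "(\<Sum>p\<in>R. of_nat (nn p) * f p) = (\<Sum>p\<in>hp ` {..3}. of_nat (nn p) * f p)"
  proof (rule sum.mono_neutral_right[OF fR hpR], intro ballI)
   fix p assume p: "p \<in> R - hp ` {..3}"
   hence "p \<notin> HL" using fund_half_lattice by (auto simp: R_def)
   thus "of_nat (nn p) * f p = 0" by (simp add: nn_off)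
  qed
  also have "\<dots> = (\<Sum>k\<le>3. of_nat (nn (hp k)) * f (hp k))" by (rule sum.reindex_cong[OF hp_inj]) auto
  also have "\<dots> = (\<Sum>k\<le>3. of_nat (n k) * f (hp k))" by (intro sum.cong refl) (simp add: nn_hp)
  finally show ?thesis .
 qed
 define A where "A = (\<Sum>p\<in>R. replicate_mset (m p) p)"
 have Asum: "(\<Sum>a\<in>#A. f a) = (\<Sum>p\<in>R. of_nat (m p) * (f p :: complex))" for f
  unfolding A_def using fR by (induction R rule: finite_induct) auto
 have "size A = (\<Sum>p\<in>R. m p)" unfolding A_def using fR by (induction R rule: finite_induct) auto
 moreover have "(\<Sum>p\<in>R. m p) = NN"
 proof -
  have "(of_nat (\<Sum>p\<in>R. m p) :: complex) = (\<Sum>p\<in>R. of_nat (nn p) * 1)"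
   using s0 by (simp add: sum_subtractf)
  also have "\<dots> = of_nat NN" unfolding nnR by (simp add: NN_def)
  finally show ?thesis by (simp only: of_nat_eq_iff)
 qed
 ultimately have "size A = NN" by simp
 moreover have "qq B W z = c + (\<Sum>a\<in>#A. wzeta (z - a)) - (\<Sum>k\<le>3. of_nat (n k) * wzeta (z - hp k))" if "z \<notin> SS B" for z
  unfolding c[OF that] Asum nnR[symmetric, of "\<lambda>p. wzeta (z - p)"] by (simp add: left_diff_distrib sum_subtractf)
 moreover have "a \<in> SS B" if "a \<in># A" for a
 proof -
  have "a \<in> R" using that fR by (auto simp: A_def set_mset_sum split: if_splits)
  thus ?thesis using RS by blast
 qed
 ultimately show thesis using that by blast
qed

text \<open>The identity that defines \<open>Q\<close>, divided by \<open>4\<Phi>\<^sup>2\<close>.\<close>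
lemma qq_riccati:
 assumes z: "z \<notin> SS B" and W: "W ^ 2 = poly Qp B"
 shows "DERIV (qq B W) z :> (u z + B) - qq B W z ^ 2"
proof -
 note z' = SS_D[OF z]
 let ?f = "Phi B z" and ?f1 = "deriv (Phi B) z" and ?f2 = "deriv (deriv (Phi B)) z"
 have "DERIV (qq B W) z :> ((?f2 - 0) * (2 * ?f) - (?f1 - W) * (2 * ?f1)) / ((2 * ?f) * (2 * ?f))"
  unfolding qq_def[abs_def]
  by (intro DERIV_divide DERIV_diff DERIV_const DERIV_cmult ellpD(6)[OF Phi_ellp z'(1)] ellpD(6)[OF ellp_deriv[OF Phi_ellp] z'(1)]) (use z' in auto)
 moreover have "((?f2 - 0) * (2 * ?f) - (?f1 - W) * (2 * ?f1)) / ((2 * ?f) * (2 * ?f)) = (u z + B) - qq B W z ^ 2"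
 proof -
  have e: "W ^ 2 = ?f1 ^ 2 - 2 * ?f * ?f2 + 4 * (u z + B) * ?f ^ 2" unfolding W Qp_eq(2)[OF z'(1)] Qf_def ..
  have "((u z + B) - qq B W z ^ 2) * ((2 * ?f) * (2 * ?f)) = 4 * (u z + B) * ?f ^ 2 - (?f1 - W) ^ 2"
   unfolding qq_def using z'(2) by (simp add: power_divide power2_eq_square field_simps)
  also have "\<dots> = (?f2 - 0) * (2 * ?f) - (?f1 - W) * (2 * ?f1)"
   using e by (simp add: power2_eq_square algebra_simps)
  finally show ?thesis using z'(2) by (simp add: eq_divide_imp[symmetric] nonzero_eq_divide_eq)
 qed
 ultimately show ?thesis by simp
qed

end

section \<open>The addition map and the multipliers\<close>

context half_plane begin

lemma torus_class_eq_iff: "torus_class \<tau> z = torus_class \<tau> w \<longleftrightarrow> z - w \<in> L"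
proof
 assume e: "torus_class \<tau> z = torus_class \<tau> w"
 have "w \<in> torus_class \<tau> w" using lattice_0 by (simp add: torus_class_def lattice_rel_def)
 hence "w \<in> torus_class \<tau> z" using e by simp
 thus "z - w \<in> L" by (simp add: torus_class_def lattice_rel_def)
next
 assume d: "z - w \<in> L"
 have "z - v \<in> L \<longleftrightarrow> w - v \<in> L" for v
 proof -
  have "z - v = (w - v) + (z - w)" by simp
  thus ?thesis using lattice_add_iff[OF d, of "w - v"] by simp
 qed
 thus "torus_class \<tau> z = torus_class \<tau> w" by (auto simp: torus_class_def lattice_rel_def)
qed

lemma torus_class_in: "torus_class \<tau> z \<in> torus \<tau>"
 unfolding torus_def torus_class_def by (rule quotientI) simp

lemma torus_E: assumes "p \<in> torus \<tau>" obtains z where "p = torus_class \<tau> z"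
 using assms unfolding torus_def torus_class_def by (blast elim: quotientE)

end

context lame begin

lemma SS_open: "open (- SS B)" "connected (- SS B)"
 using open_connected_Compl[OF SS_sparse] by auto

lemma reflected_deriv:
 assumes "y holomorphic_on - HL" "z \<notin> HL"
 shows "DERIV (\<lambda>w. y (- w)) z :> - deriv y (- z)"
proof -
 have "DERIV y (- z) :> deriv y (- z)"
  by (rule holomorphic_derivI[OF assms(1) half_lattice_Compl(1)]) (use assms(2) in simp)
 moreover have "DERIV (\<lambda>w. - w) z :> - 1" by (intro derivative_intros)
 ultimately have "DERIV (\<lambda>w. y (- w)) z :> deriv y (- z) * (- 1)" by (rule DERIV_chain2)
 thus ?thesis by simp
qed

lemma reflected_holo: "y holomorphic_on - HL ==> (\<lambda>w. y (- w)) holomorphic_on - HL"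
proof -
 assume y: "y holomorphic_on - HL"
 have "(y \<circ> uminus) holomorphic_on - HL"
 proof (rule holomorphic_on_compose_gen[OF _ y])
  show "uminus holomorphic_on - HL" by (rule holomorphic_on_minus[OF holomorphic_on_ident])
 qed auto
 thus ?thesis by (simp add: o_def)
qed

lemma qq_uminus: "z \<notin> HL ==> qq B W (- z) = - (deriv (Phi B) z + W) / (2 * Phi B z)"
 using ellpD(3)[OF Phi_ellp, of z B] ellpD(3)[OF ellp_deriv[OF Phi_ellp], of z B] by (simp add: qq_def)

text \<open>The sigma product whose logarithmic derivative is \<open>qq\<close> solves the equation by \<open>qq_riccati\<close>; the constant \<open>d\<close> adjusts its
 product with its reflection to \<open>\<Phi>\<close>.\<close>
lemma y1_exists:
 assumes W: "W ^ 2 = poly Qp B"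
 obtains A c d where "size A = NN" "d \<noteq> 0" "is_y1 n \<tau> B W (\<lambda>z. d * yfun c A z)"
proof -
 obtain A c where A: "size A = NN"
  "\<And>z. z \<notin> SS B ==> qq B W z = c + (\<Sum>a\<in>#A. wzeta (z - a)) - (\<Sum>k\<le>3. of_nat (n k) * wzeta (z - hp k))"
  "\<And>a. a \<in># A ==> a \<in> SS B" by (rule qq_partial_fractions[OF W]) (rule that; blast)
 have off: "z - a \<notin> L" if z: "z \<notin> SS B" and a: "a \<in># A" for z a
 proof
  assume "z - a \<in> L"
  from SS_inv[OF this, of a B] show False using A(3)[OF a] z by simp
 qed
 define y where "y = yfun c A"
 have hy: "y holomorphic_on - HL" unfolding y_def by (rule yfun_holo)
 have y0: "y z \<noteq> 0" if z: "z \<notin> SS B" for z unfolding y_def yfun_zero[OF SS_D(1)[OF z]] using off[OF z] by blast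
 have dy: "DERIV y z :> y z * qq B W z" if z: "z \<notin> SS B" for z
  unfolding y_def A(2)[OF z] by (rule yfun_deriv[OF SS_D(1)[OF z] off[OF z]])
 note dy' = DERIV_imp_deriv[OF dy]
 have ddy: "deriv (deriv y) z = (u z + B) * y z" if z: "z \<notin> SS B" for z
 proof -
  have "eventually (\<lambda>w. w \<in> - SS B) (nhds z)" by (rule eventually_nhds_in_open[OF SS_open(1)]) (use z in simp)
  hence ev: "eventually (\<lambda>w. deriv y w = y w * qq B W w) (nhds z)" by eventually_elim (simp add: dy')
  have "deriv (deriv y) z = deriv (\<lambda>w. y w * qq B W w) z" by (rule deriv_cong_ev[OF ev refl])
  also have "\<dots> = y z * qq B W z * qq B W z + (u z + B - qq B W z ^ 2) * y z"
   by (rule DERIV_imp_deriv[OF DERIV_mult[OF dy[OF z] qq_riccati[OF z W]]])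
  also have "\<dots> = (u z + B) * y z" by (simp add: power2_eq_square algebra_simps)
  finally show ?thesis .
 qed
 have hdd: "deriv (deriv y) holomorphic_on - HL" by (intro holomorphic_deriv hy half_lattice_Compl(1))
 have hu: "u holomorphic_on - HL" by (rule ellpD(1)[OF u_ellp])
 have ode: "deriv (deriv y) z = (u z + B) * y z" if "z \<notin> HL" for z
  by (rule holomorphic_eq_off_sparse[OF SS_sparse half_lattice_Compl(1) hdd _ ddy]) (use that in \<open>auto intro!: holomorphic_intros hu hy\<close>)
 \<comment> \<open>The function \<open>y(z)y(-z)\<close> has the same logarithmic derivative as \<open>\<Phi>\<close>.\<close>
 define G where "G = (\<lambda>z. y z * y (- z))"
 have Gd: "DERIV G z :> G z * deriv (Phi B) z / Phi B z" if z: "z \<notin> SS B" for z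
 proof -
  have m: "- z \<notin> SS B" using z by (simp add: SS_uminus)
  have "DERIV G z :> (y z * qq B W z) * y (- z) + (- (y (- z) * qq B W (- z))) * y z"
   unfolding G_def using reflected_deriv[OF hy SS_D(1)[OF z]] unfolding dy'[OF m] by (intro DERIV_mult dy[OF z])
  moreover have "(y z * qq B W z) * y (- z) + (- (y (- z) * qq B W (- z))) * y z = G z * deriv (Phi B) z / Phi B z"
   unfolding qq_uminus[OF SS_D(1)[OF z]] using SS_D(2)[OF z] by (simp add: qq_def G_def field_simps)
  ultimately show ?thesis by simp
 qed
 obtain z1 where z1: "z1 \<notin> SS B" using Phi_nontrivial[of B] by (auto simp: SS_def)
 define \<kappa> where "\<kappa> = G z1 / Phi B z1"
 have k0: "\<kappa> \<noteq> 0" using y0[OF z1] y0[of "- z1"] z1 SS_D(2)[OF z1] by (simp add: \<kappa>_def G_def SS_uminus)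
 have Gk: "G z = \<kappa> * Phi B z" if z: "z \<notin> SS B" for z
 proof -
  have "G z / Phi B z = G z1 / Phi B z1"
  proof (rule zero_deriv_imp_const[where f = "\<lambda>z. G z / Phi B z" and S = "- SS B"])
   fix x assume "x \<in> - SS B"
   hence x: "x \<notin> SS B" by simp
   have "DERIV (\<lambda>z. G z / Phi B z) x :> ((G x * deriv (Phi B) x / Phi B x) * Phi B x - G x * deriv (Phi B) x) / (Phi B x * Phi B x)"
    by (intro DERIV_divide Gd[OF x] ellpD(6)[OF Phi_ellp SS_D(1)[OF x]] SS_D(2)[OF x])
   thus "DERIV (\<lambda>z. G z / Phi B z) x :> 0" using SS_D(2)[OF x] by simp
  qed (use SS_open z z1 in auto)
  thus ?thesis using SS_D(2)[OF z] by (simp add: \<kappa>_def field_simps)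
 qed
 define d where "d = csqrt (1 / \<kappa>)"
 have d: "d ^ 2 * \<kappa> = 1" "d \<noteq> 0" using k0 by (auto simp: d_def)
 define Y where "Y = (\<lambda>z. d * y z)"
 have hY: "Y holomorphic_on - HL" unfolding Y_def by (intro holomorphic_intros hy)
 have dY: "deriv Y z = d * deriv y z" if "z \<notin> HL" for z
  unfolding Y_def by (rule DERIV_imp_deriv[OF DERIV_cmult[OF holomorphic_derivI[OF hy half_lattice_Compl(1)]]]) (use that in simp)
 have ddY: "deriv (deriv Y) z = d * deriv (deriv y) z" if "z \<notin> HL" for z
 proof -
  have "deriv (deriv Y) z = deriv (\<lambda>z. d * deriv y z) z" by (rule deriv_cong_HL[OF dY that])
  also have "\<dots> = d * deriv (deriv y) z"
   by (rule DERIV_imp_deriv[OF DERIV_cmult[OF holomorphic_derivI[OF holomorphic_deriv[OF hy half_lattice_Compl(1)] half_lattice_Compl(1)]]]) (use that in simp)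
  finally show ?thesis .
 qed
 have mY: "Y meromorphic_on UNIV" unfolding Y_def y_def by (intro meromorphic_intros yfun_mero)
 have sol: "lame_solution n \<tau> B Y" unfolding lame_solution_def
  using mY hY ddY ode by (auto simp: potential_eq Y_def)
 have mon: "monodromy_eigenfunction \<tau> Y" unfolding monodromy_eigenfunction_def
  using yfun_quasi[OF A(1), of c _ 1 0] yfun_quasi[OF A(1), of c _ 0 1]
  by (intro exI[of _ "exp (c - eta1 * shift A)"] exI[of _ "exp (c * \<tau> - eta2 * shift A)"]) (simp add: Y_def y_def)
 have prod: "Y z * Y (- z) = Phi B z" if "z \<notin> HL" for z
 proof (rule holomorphic_eq_off_sparse[OF SS_sparse half_lattice_Compl(1), where f = "\<lambda>z. Y z * Y (- z)" and g = "Phi B"])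
  show "(\<lambda>z. Y z * Y (- z)) holomorphic_on - HL" by (intro holomorphic_intros hY reflected_holo)
  show "Phi B holomorphic_on - HL" by (rule ellpD(1)[OF Phi_ellp])
  fix w assume "w \<notin> SS B"
  from Gk[OF this] have "Y w * Y (- w) = d ^ 2 * (\<kappa> * Phi B w)" by (simp add: Y_def G_def power2_eq_square)
  thus "Y w * Y (- w) = Phi B w" using d(1) by (metis mult.assoc mult_1)
 qed (use that in simp)
 have wr: "wronskian Y (\<lambda>u. Y (- u)) z = W" if z: "z \<notin> HL" for z
 proof -
  have e: "wronskian Y (\<lambda>u. Y (- u)) z = Y z * (- deriv Y (- z)) - deriv Y z * Y (- z)" if "z \<notin> HL" for z
   unfolding wronskian_def using DERIV_imp_deriv[OF reflected_deriv[OF hY that]] by simp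
  have "Y z * (- deriv Y (- z)) - deriv Y z * Y (- z) = W"
  proof (rule holomorphic_eq_off_sparse[OF SS_sparse half_lattice_Compl(1), where f = "\<lambda>z. Y z * (- deriv Y (- z)) - deriv Y z * Y (- z)" and g = "\<lambda>_. W"])
   have "(\<lambda>z. deriv Y (- z)) holomorphic_on - HL" by (intro reflected_holo holomorphic_deriv hY half_lattice_Compl(1))
   thus "(\<lambda>z. Y z * (- deriv Y (- z)) - deriv Y z * Y (- z)) holomorphic_on - HL"
    by (intro holomorphic_intros hY reflected_holo holomorphic_deriv half_lattice_Compl(1))
   fix w assume w: "w \<notin> SS B"
   have m: "- w \<notin> SS B" using w by (simp add: SS_uminus)
   have "Y w * (- deriv Y (- w)) - deriv Y w * Y (- w) = - (Y w * Y (- w)) * (qq B W w + qq B W (- w))"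
    using dY[of w] dY[of "- w"] SS_D(1)[OF w] by (simp add: dy'[OF w] dy'[OF m] Y_def algebra_simps)
   also have "\<dots> = - Phi B w * (qq B W w + qq B W (- w))" using prod[OF SS_D(1)[OF w]] by simp
   also have "\<dots> = W" unfolding qq_uminus[OF SS_D(1)[OF w]] using SS_D(2)[OF w] by (simp add: qq_def field_simps)
   finally show "Y w * (- deriv Y (- w)) - deriv Y w * Y (- w) = W" .
  qed (use z in auto)
  thus ?thesis using e[OF z] by simp
 qed
 have "is_y1 n \<tau> B W Y" unfolding is_y1_def Phi_e_eq using sol mon prod wr by blast
 thus thesis using that A(1) d(2) unfolding Y_def y_def by blast
qed

text \<open>The Wronskian is the difference, and \<open>\<Phi>'\<close> the sum, of the two terms of the product rule for \<open>y(z)y(-z)\<close>.\<close>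
lemma y1_log_deriv:
 assumes y: "is_y1 n \<tau> B W y" and z: "z \<notin> SS B"
 shows "y z \<noteq> 0" "deriv y z / y z = qq B W z"
proof -
 have hy: "y holomorphic_on - HL" using y by (auto simp: is_y1_def lame_solution_def)
 have pr: "y z * y (- z) = Phi B z" if "z \<notin> HL" for z using y that by (auto simp: is_y1_def Phi_e_eq)
 note z1 = SS_D(1)[OF z] and z2 = SS_D(2)[OF z]
 show y0: "y z \<noteq> 0" using pr[OF z1] z2 by auto
 have m0: "y (- z) \<noteq> 0" using pr[OF z1] z2 by auto
 have d: "DERIV y z :> deriv y z"
  by (rule holomorphic_derivI[OF hy half_lattice_Compl(1)]) (use z1 in simp)
 have "deriv (Phi B) z = deriv (\<lambda>z. y z * y (- z)) z" by (rule deriv_cong_HL[OF pr z1, symmetric])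
 also have "\<dots> = deriv y z * y (- z) + (- deriv y (- z)) * y z"
  by (rule DERIV_imp_deriv[OF DERIV_mult[OF d reflected_deriv[OF hy z1]]])
 finally have e1: "deriv (Phi B) z = deriv y z * y (- z) + (- deriv y (- z)) * y z" .
 have "wronskian y (\<lambda>u. y (- u)) z = W" using y z1 unfolding is_y1_def by blast
 hence e2: "W = y z * (- deriv y (- z)) - deriv y z * y (- z)"
  unfolding wronskian_def DERIV_imp_deriv[OF reflected_deriv[OF hy z1]] ..
 have "deriv (Phi B) z - W = 2 * (deriv y z * y (- z))" unfolding e1 e2 by (simp add: algebra_simps)
 thus "deriv y z / y z = qq B W z" unfolding qq_def pr[OF z1, symmetric] using y0 m0 by (simp add: field_simps)
qed

text \<open>A representative \<open>s\<close> of the image of \<open>(B, W)\<close> in the torus, with the exponent \<open>c\<close> of the same factorization. The pair is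
 determined up to periods and the corresponding quasi-periods.\<close>
definition is_lift :: "complex => complex => complex => complex => bool" where
 "is_lift B W s c \<longleftrightarrow> (\<exists>y A d. is_y1 n \<tau> B W y \<and> size A = NN \<and> d \<noteq> 0 \<and>
  (\<forall>z. z \<notin> HL \<longrightarrow> y z = d * yfun c A z) \<and> s = shift A)"

lemma lift_exists: "W ^ 2 = poly Qp B ==> \<exists>s c. is_lift B W s c"
 by (rule y1_exists, assumption) (use is_lift_def in blast)

text \<open>The multiplier of \<open>y\<^sub>1\<close>, computed from its sigma product and from its logarithmic derivative.\<close>
lemma lift_periods:
 assumes l: "is_lift B W s c" and z0: "closed_segment z0 (z0 + lat a b) \<inter> SS B = {}"
 shows "exp (c * (lat a b) - eta a b * s) =
  exp (contour_integral (linepath z0 (z0 + lat a b)) (qq B W))"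
proof -
 define w where "w = lat a b"
 obtain y A d where y: "is_y1 n \<tau> B W y" and A: "size A = NN" "d \<noteq> 0"
  "\<And>z. z \<notin> HL ==> y z = d * yfun c A z" "s = shift A" using l unfolding is_lift_def by blast
 have hy: "y holomorphic_on - HL" using y by (auto simp: is_y1_def lame_solution_def)
 have seg: "z \<notin> SS B" if "z \<in> closed_segment z0 (z0 + w)" for z using that z0 unfolding w_def by blast
 have e: "y (z0 + w) = y z0 * exp (contour_integral (linepath z0 (z0 + w)) (\<lambda>z. deriv y z / y z))"
  by (rule exp_integral_log_deriv[OF half_lattice_Compl(1) hy]) (use seg y1_log_deriv(1)[OF y] SS_D(1) in \<open>blast+\<close>)
 have "contour_integral (linepath z0 (z0 + w)) (\<lambda>z. deriv y z / y z) = contour_integral (linepath z0 (z0 + w)) (qq B W)"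
  by (rule contour_integral_eq) (use seg y1_log_deriv(2)[OF y] in auto)
 note e = e[unfolded this]
 have s0: "z0 \<notin> SS B" "z0 + w \<notin> SS B" using seg by auto
 have "y (z0 + w) = exp (c * w - eta a b * s) * y z0"
  using A(3)[OF SS_D(1)[OF s0(1)]] A(3)[OF SS_D(1)[OF s0(2)]] yfun_quasi[OF A(1), of c z0 a b] A(4) by (simp add: w_def)
 thus ?thesis using e y1_log_deriv(1)[OF y s0(1)] by (simp add: w_def)
qed

text \<open>The multipliers determine the pair \<open>(s, c)\<close> up to the action of the lattice, by Legendre's relation.\<close>
lemma lift_congruent:
 assumes l: "is_lift B W s c" and z0: "closed_segment z0 (z0 + 1) \<inter> SS B = {}" "closed_segment z0 (z0 + \<tau>) \<inter> SS B = {}"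
  and e: "exp (c1 - eta1 * s1) = exp (contour_integral (linepath z0 (z0 + 1)) (qq B W))"
   "exp (c1 * \<tau> - eta2 * s1) = exp (contour_integral (linepath z0 (z0 + \<tau>)) (qq B W))"
 obtains a b :: int where "s1 = s + lat a b" "c1 = c + eta a b"
proof -
 have "exp (c1 - eta1 * s1) = exp (c - eta1 * s)" "exp (c1 * \<tau> - eta2 * s1) = exp (c * \<tau> - eta2 * s)"
  using e lift_periods[OF l, of z0 1 0] lift_periods[OF l, of z0 0 1] z0 by simp_all
 note ex = this
 from ex(1) obtain m1 :: int where m1: "c1 - eta1 * s1 = c - eta1 * s + complex_of_real (real_of_int (2 * m1) * pi) * \<i>"
  unfolding exp_eq by blast
 from ex(2) obtain m2 :: int where m2: "c1 * \<tau> - eta2 * s1 = c * \<tau> - eta2 * s + complex_of_real (real_of_int (2 * m2) * pi) * \<i>"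
  unfolding exp_eq by blast
 define P where "P = 2 * complex_of_real pi * \<i>"
 have nz: "P \<noteq> 0" by (simp add: P_def)
 have L: "of_int m1 * P = (c1 - c) - eta1 * (s1 - s)" "of_int m2 * P = (c1 - c) * \<tau> - eta2 * (s1 - s)"
  using m1 m2 by (simp_all add: P_def algebra_simps)
 have "s1 - s = (of_int m2 * P - \<tau> * (of_int m1 * P)) / P"
  unfolding P_def by (rule legendre_inverse(1)[OF L[unfolded P_def]])
 hence "s1 - s = of_int m2 - \<tau> * of_int m1" using nz by (simp add: diff_divide_distrib)
 moreover have "c1 - c = (eta1 * (of_int m2 * P) - eta2 * (of_int m1 * P)) / P"
  unfolding P_def by (rule legendre_inverse(2)[OF L[unfolded P_def]])
 hence "c1 - c = eta1 * of_int m2 - eta2 * of_int m1" using nz by (simp add: diff_divide_distrib)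
 ultimately show thesis using that[of m2 "- m1"] by (simp add: algebra_simps)
qed

lemma lift_unique:
 assumes "is_lift B W s c" "is_lift B W s1 c1"
 obtains a b :: int where "s1 = s + lat a b" "c1 = c + eta a b"
proof -
 obtain z0 where z0: "closed_segment z0 (z0 + 1) \<inter> SS B = {}" "closed_segment z0 (z0 + \<tau>) \<inter> SS B = {}"
  by (rule base_point[OF SS_sparse])
 show thesis
  by (rule lift_congruent[OF assms(1) z0 _ _ that])
   (use lift_periods[OF assms(2), of z0 1 0] lift_periods[OF assms(2), of z0 0 1] z0 in simp_all)
qed

lemma finite_addition_map_lift:
 assumes l: "is_lift B W s c" shows "finite_addition_map n \<tau> B W = torus_class \<tau> s"
proof -
 have den: "(\<Prod>k\<le>3. wsigma \<tau> (z - omega \<tau> k / 2) ^ n k) = den z" for z by (simp add: den_def hp_def)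
 have sh: "\<Sum>\<^sub># A - (\<Sum>k=1..3. of_nat (n k) * omega \<tau> k / 2) = shift A" for A
 proof -
  have "{..3::nat} = insert 0 {1..3}" by auto
  hence "(\<Sum>k\<le>3. of_nat (n k) * hp k) = of_nat (n 0) * hp 0 + (\<Sum>k=1..3. of_nat (n k) * hp k)" by simp
  moreover have "hp 0 = 0" by (simp add: hp_def omega_def)
  ultimately show ?thesis by (simp add: shift_def hp_def)
 qed
 have fac: "sigma_factorization n \<tau> y A \<longleftrightarrow> size A = NN \<and> (\<exists>c d. d \<noteq> 0 \<and> (\<forall>z. z \<notin> HL \<longrightarrow> y z = d * yfun c A z))" for y A
  unfolding sigma_factorization_def den NN_def yfun_def ..
 show ?thesis unfolding finite_addition_map_def sh
 proof (rule the_equality)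
  show "\<exists>y A. is_y1 n \<tau> B W y \<and> sigma_factorization n \<tau> y A \<and> torus_class \<tau> s = torus_class \<tau> (shift A)"
   using l unfolding is_lift_def fac by blast
  fix p assume "\<exists>y A. is_y1 n \<tau> B W y \<and> sigma_factorization n \<tau> y A \<and> p = torus_class \<tau> (shift A)"
  then obtain c1 s1 where l1: "is_lift B W s1 c1" "p = torus_class \<tau> s1"
   unfolding is_lift_def fac by blast
  obtain a b :: int where "s1 = s + lat a b" by (rule lift_unique[OF l l1(1)])
  hence "s1 - s \<in> L" using lattice_I by simp
  thus "p = torus_class \<tau> s" unfolding l1(2) torus_class_eq_iff .
 qed
qed

end

section \<open>Periods of even elliptic functions\<close>

context half_plane begin

lemma deriv_P_ellp: "k \<le> 3 ==> ellp ((-1) ^ j) ((deriv ^^ j) (P k))"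
proof (induction j)
 case 0 thus ?case using P_ellp by simp
next
 case (Suc j)
 have "ellp (- ((-1) ^ j)) (deriv ((deriv ^^ j) (P k)))" by (rule ellp_deriv[OF Suc.IH[OF Suc.prems]])
 thus ?case by simp
qed

lemma deriv_P_laurent:
 assumes k: "k \<le> 3"
 shows "laurent_expansion ((deriv ^^ j) (P k)) (hp l) = (fls_deriv ^^ j) (laurent_expansion (P k) (hp l))"
proof (induction j)
 case (Suc j)
 have "laurent_expansion (deriv ((deriv ^^ j) (P k))) (hp l) = fls_deriv (laurent_expansion ((deriv ^^ j) (P k)) (hp l))"
  by (rule laurent_deriv[OF ellpD(2)[OF deriv_P_ellp[OF k]]])
 thus ?case using Suc by simp
qed simp

lemma fls_deriv_pole:
 fixes F :: "complex fls"
 shows "(\<And>i. i < - 2 ==> fls_nth F i = 0) ==> i < - 2 - int j ==> fls_nth ((fls_deriv ^^ j) F) i = 0"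
  and "fls_nth F (- 2) \<noteq> 0 ==> fls_nth ((fls_deriv ^^ j) F) (- 2 - int j) \<noteq> 0"
  and "(\<And>i. i < 0 ==> fls_nth F i = 0) ==> l < 0 ==> fls_nth ((fls_deriv ^^ j) F) l = 0"
proof -
 show "i < - 2 - int j ==> fls_nth ((fls_deriv ^^ j) F) i = 0" if "\<And>i. i < - 2 ==> fls_nth F i = 0"
  by (induction j arbitrary: i) (simp_all add: that)
 show "fls_nth F (- 2) \<noteq> 0 ==> fls_nth ((fls_deriv ^^ j) F) (- 2 - int j) \<noteq> 0"
 proof (induction j)
  case (Suc j)
  have i: "- 2 - int (Suc j) + 1 = - 2 - int j" by simp
  have "(of_int (- 2 - int j) :: complex) \<noteq> 0" unfolding of_int_eq_0_iff by simp
  thus ?case using Suc by (simp only: funpow.simps(2) o_apply fls_deriv_nth i mult_eq_0_iff) blast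
 qed simp
 have "l < 0 \<longrightarrow> fls_nth ((fls_deriv ^^ j) F) l = 0" if h: "\<And>i. i < 0 ==> fls_nth F i = 0"
 proof (induction j arbitrary: l)
  case 0 thus ?case using h by simp
 next
  case (Suc j)
  show ?case
  proof
   assume l: "l < 0"
   show "fls_nth ((fls_deriv ^^ Suc j) F) l = 0"
   proof (cases "l = -1")
    case False
    hence "l + 1 < 0" using l by simp
    hence "fls_nth ((fls_deriv ^^ j) F) (l + 1) = 0" using Suc[of "l + 1"] by blast
    thus ?thesis by simp
   qed simp
  qed
 qed
 thus "l < 0 ==> fls_nth ((fls_deriv ^^ j) F) l = 0" if "\<And>i. i < 0 ==> fls_nth F i = 0" using that by blast
qed

abbreviation seg :: "complex => complex => complex set" where "seg z w \<equiv> closed_segment z (z + w)"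
abbreviation pint :: "complex => complex => (complex => complex) => complex" where
 "pint z w \<equiv> contour_integral (linepath z (z + w))"

text \<open>An even elliptic function has no residues. Written in the basis of even derivatives of the four translates of
 \<open>\<wp>\<close>, it has an explicit primitive, whose increment over a period is a combination of the period and of the
 increment of the zeta function.\<close>
lemma even_elliptic_periods:
 assumes f: "ellp 1 f" "\<And>k i. k \<le> 3 ==> i < - 2 * int (d k) ==> fls_nth (laurent_expansion f (hp k)) i = 0"
 shows "\<exists>\<alpha> \<beta>. \<forall>z0 a b. seg z0 (lat a b) \<inter> HL = {} \<longrightarrow>
  (f has_contour_integral \<alpha> * (lat a b) - \<beta> * (eta a b))
   (linepath z0 (z0 + lat a b))"
proof -
 let ?e = "\<lambda>k m. (deriv ^^ (2 * m - 2)) (P k)"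
 have L0: "laurent_expansion (P k) (hp k) = wpF" if "k \<le> 3" for k by (rule laurent_expansion_eqI[OF P_laurent(1)[OF that]])
 have low: "fls_nth wpF i = 0" if "i < - 2" for i using wp_laurent that by simp
 have top: "fls_nth wpF (- 2) \<noteq> 0" using wp_laurent by simp
 have "\<exists>c coef. \<forall>z. z \<notin> HL \<longrightarrow> f z = c + (\<Sum>(k,m)\<in>Sigma {..3} (\<lambda>k. {1..d k}). coef (k,m) * ?e k m z)"
 proof (rule even_elliptic_span[OF _ _ _ _ f])
  fix k m :: nat assume k: "k \<le> 3" and m: "m \<ge> 1"
  have "ellp ((-1) ^ (2 * (m - 1))) (?e k m)" using deriv_P_ellp[OF k, of "2 * m - 2"] by (simp add: right_diff_distrib')
  thus "ellp 1 (?e k m)" by simp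
  have im: "- 2 - int (2 * m - 2) = - 2 * int m" using m by simp
  show "fls_nth (laurent_expansion (?e k m) (hp k)) (- 2 * int m) \<noteq> 0"
   unfolding deriv_P_laurent[OF k] L0[OF k] using fls_deriv_pole(2)[OF top, of "2 * m - 2"] unfolding im .
  show "fls_nth (laurent_expansion (?e k m) (hp k)) i = 0" if "i < - 2 * int m" for i
   unfolding deriv_P_laurent[OF k] L0[OF k] by (rule fls_deriv_pole(1)[OF low]) (use that im in auto)
  show "fls_nth (laurent_expansion (?e k m) (hp j)) i = 0" if j: "j \<le> 3" "j \<noteq> k" and i: "i < 0" for j i
   unfolding deriv_P_laurent[OF k] by (rule fls_deriv_pole(3)[OF analytic_laurent_neg[OF P_laurent(2)[OF k j]] i])
 qed
 then obtain c coef where fz: "\<And>z. z \<notin> HL ==> f z = c + (\<Sum>p\<in>Sigma {..3} (\<lambda>k. {1..d k}). coef p * ?e (fst p) (snd p) z)"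
  by (auto simp: case_prod_unfold)
 define I where "I = Sigma {..3::nat} (\<lambda>k. {1..d k})"
 have I: "fst p \<le> 3" "snd p \<ge> 1" if "p \<in> I" for p using that by (auto simp: I_def)
 define g where "g = (\<lambda>(k::nat) (m::nat) z. if m = 1 then - wzeta (z + hp k) else (deriv ^^ (2 * m - 3)) (P k) z)"
 have dg: "DERIV (g k m) z :> ?e k m z" if k: "k \<le> 3" and m: "m \<ge> 1" and z: "z \<notin> HL" for k m z
 proof (cases "m = 1")
  case True
  have "DERIV (\<lambda>z. wzeta (z + hp k)) z :> - wp \<tau> (z + hp k) * (1 + 0)"
   by (rule DERIV_chain2[where f = wzeta and g = "\<lambda>z. z + hp k", OF wzeta_deriv[OF P_not_lattice[OF z k]]]) (intro DERIV_add DERIV_ident DERIV_const)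
  from DERIV_minus[OF this] show ?thesis by (simp add: g_def True P_def)
 next
  case False
  hence e: "2 * m - 2 = Suc (2 * m - 3)" using m by simp
  have "DERIV ((deriv ^^ (2 * m - 3)) (P k)) z :> deriv ((deriv ^^ (2 * m - 3)) (P k)) z"
   by (rule ellpD(6)[OF deriv_P_ellp[OF k] z])
  thus ?thesis unfolding e using False by (simp add: g_def)
 qed
 have pg: "g k m (z + lat a b) - g k m z = (if m = 1 then - eta a b else 0)"
  if k: "k \<le> 3" and z: "z \<notin> HL" for k m z a b
 proof (cases "m = 1")
  case True
  have "z + lat a b + hp k = z + hp k + lat a b" by simp
  thus ?thesis using wzeta_quasi[OF P_not_lattice[OF z k], of a b] by (simp only: g_def True) simp
 next
  case False
  thus ?thesis using ellpD(4)[OF deriv_P_ellp[OF k] z lattice_I[of a b]] by (simp add: g_def)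
 qed
 define G where "G = (\<lambda>z. c * z + (\<Sum>p\<in>I. coef p * g (fst p) (snd p) z))"
 have dG: "DERIV G z :> f z" if z: "z \<notin> HL" for z
 proof -
  have "DERIV G z :> c * 1 + (\<Sum>p\<in>I. coef p * ?e (fst p) (snd p) z)"
   unfolding G_def by (intro DERIV_add DERIV_cmult DERIV_ident DERIV_sum dg I z)
  thus ?thesis by (simp add: fz[OF z] I_def)
 qed
 define \<beta> where "\<beta> = (\<Sum>p\<in>I. if snd p = 1 then coef p else 0)"
 have main: "(f has_contour_integral c * (lat a b) - \<beta> * (eta a b))
   (linepath z0 (z0 + lat a b))" if s: "seg z0 (lat a b) \<inter> HL = {}" for z0 a b
 proof -
  define w where "w = lat a b"
  define h where "h = eta a b"
  have z0: "z0 \<notin> HL" using s by auto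
  have "G (z0 + w) - G z0 = c * w + (\<Sum>p\<in>I. coef p * (g (fst p) (snd p) (z0 + w) - g (fst p) (snd p) z0))"
   by (simp add: G_def right_diff_distrib sum_subtractf algebra_simps)
  also have "(\<Sum>p\<in>I. coef p * (g (fst p) (snd p) (z0 + w) - g (fst p) (snd p) z0)) = (\<Sum>p\<in>I. (if snd p = 1 then coef p else 0) * - h)"
   by (intro sum.cong refl) (use I z0 in \<open>simp add: w_def h_def pg\<close>)
  also have "\<dots> = - (\<beta> * h)" by (simp add: \<beta>_def sum_distrib_right sum_negf)
  finally have inc: "G (z0 + w) - G z0 = c * w - \<beta> * h" by simp
  have "(f has_contour_integral (G (pathfinish (linepath z0 (z0 + w))) - G (pathstart (linepath z0 (z0 + w))))) (linepath z0 (z0 + w))"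
  proof (rule contour_integral_primitive)
   show "(G has_field_derivative f x) (at x within - HL)" if "x \<in> - HL" for x
    using dG that by (auto intro: has_field_derivative_at_within)
   show "path_image (linepath z0 (z0 + w)) \<subseteq> - HL" using s by (auto simp: w_def)
  qed auto
  thus ?thesis using inc by (simp add: w_def h_def)
 qed
 show ?thesis using main by blast
qed

end

context lame begin

text \<open>The pair \<open>(\<alpha>, \<beta>)\<close> that describes the periods of a basis function as in \<open>even_elliptic_periods\<close>.\<close>
definition al :: "nat \<times> nat => complex \<times> complex" where
 "al p = (SOME q. \<forall>z0 a b. seg z0 (lat a b) \<inter> HL = {} \<longrightarrow>
  (ee p has_contour_integral fst q * (lat a b) - snd q * (eta a b))
   (linepath z0 (z0 + lat a b)))"

lemma ee_integral:
 assumes p: "p \<in> Sg" and s: "seg z0 (lat a b) \<inter> HL = {}"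
 shows "(ee p has_contour_integral fst (al p) * (lat a b) - snd (al p) * (eta a b))
   (linepath z0 (z0 + lat a b))"
proof -
 obtain k m where km: "p = (k, m)" by (cases p)
 have k: "k \<le> 3" using SgD[OF p] by (simp add: km)
 have 1: "ellp 1 (ee p)" using k by (intro ee_ellp) (simp add: km)
 have 2: "fls_nth (laurent_expansion (ee p) (hp j)) i = 0" if j: "j \<le> 3" and i: "i < - 2 * int m" for j i
 proof (cases "j = k")
  case True
  show ?thesis unfolding km True ee_laurent(1)[OF k] by (rule wpF_power(2)) (use i in simp)
 next
  case False
  show ?thesis unfolding km by (rule ee_laurent(2)[OF k j False]) (use i in simp)
 qed
 obtain \<alpha> \<beta> where ab: "\<forall>z0 a b. seg z0 (lat a b) \<inter> HL = {} \<longrightarrow>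
  (ee p has_contour_integral \<alpha> * (lat a b) - \<beta> * (eta a b))
   (linepath z0 (z0 + lat a b))"
  using even_elliptic_periods[where d = "\<lambda>_. m", OF 1 2] by blast
 have "\<exists>q. \<forall>z0 a b. seg z0 (lat a b) \<inter> HL = {} \<longrightarrow>
  (ee p has_contour_integral fst q * (lat a b) - snd q * (eta a b))
   (linepath z0 (z0 + lat a b))"
  by (intro exI[of _ "(\<alpha>, \<beta>)"]) (use ab in auto)
 from someI_ex[OF this] show ?thesis using s unfolding al_def by blast
qed

lemma PhiF_integral:
 assumes s: "seg z0 (lat a b) \<inter> HL = {}"
 shows "(PhiF C c B has_contour_integral
  (poly C B + (\<Sum>p\<in>Sg. poly (c p) B * fst (al p))) * (lat a b)
   - (\<Sum>p\<in>Sg. poly (c p) B * snd (al p)) * (eta a b))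
   (linepath z0 (z0 + lat a b))"
proof -
 define w where "w = lat a b"
 define h where "h = eta a b"
 have c: "((\<lambda>_. poly C B) has_contour_integral poly C B * w) (linepath z0 (z0 + w))"
 proof -
  have e: "z0 + w - z0 = w" by simp
  show ?thesis using has_contour_integral_const_linepath[of "poly C B" "z0 + w" z0] unfolding e .
 qed
 have fin: "finite Sg" by (simp add: Sg_def)
 have "((\<lambda>z. poly C B + (\<Sum>p\<in>Sg. poly (c p) B * ee p z)) has_contour_integral
  poly C B * w + (\<Sum>p\<in>Sg. poly (c p) B * (fst (al p) * w - snd (al p) * h))) (linepath z0 (z0 + w))"
  by (intro has_contour_integral_add c has_contour_integral_sum has_contour_integral_lmul fin
   ee_integral[OF _ s, folded w_def h_def])
 moreover have "poly C B * w + (\<Sum>p\<in>Sg. poly (c p) B * (fst (al p) * w - snd (al p) * h))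
  = (poly C B + (\<Sum>p\<in>Sg. poly (c p) B * fst (al p))) * w - (\<Sum>p\<in>Sg. poly (c p) B * snd (al p)) * h"
  by (simp add: right_diff_distrib sum_subtractf sum_distrib_right sum_distrib_left algebra_simps)
 moreover have "PhiF C c B = (\<lambda>z. poly C B + (\<Sum>p\<in>Sg. poly (c p) B * ee p z))" by (simp add: PhiF_def fun_eq_iff)
 ultimately show ?thesis by (simp only: w_def h_def)
qed

text \<open>Up to sign, the combination of the two periods of \<open>\<Phi>\<close> that the addition map sees; it is a polynomial in \<open>B\<close>
 because the periods of \<open>\<Phi>\<close> do not depend on the path between the poles.\<close>
definition Ap :: "complex poly" where "Ap = (\<Sum>p\<in>Sg. smult (snd (al p)) (bp p))"

lemma Ap_eq:
 assumes s: "seg z0 1 \<inter> HL = {}" "seg z1 \<tau> \<inter> HL = {}"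
 shows "(pint z1 \<tau> (Phi B) - \<tau> * pint z0 1 (Phi B)) / (2 * of_real pi * \<i>) = poly Ap B"
proof -
 define X where "X = poly Cp B + (\<Sum>p\<in>Sg. poly (bp p) B * fst (al p))"
 have Y: "poly Ap B = (\<Sum>p\<in>Sg. poly (bp p) B * snd (al p))" by (simp add: Ap_def poly_sum mult.commute)
 have 1: "pint z0 1 (Phi B) = X - poly Ap B * eta1"
  using contour_integral_unique[OF PhiF_integral[of z0 1 0 Cp bp B]] s(1) by (simp add: X_def Y)
 have 2: "pint z1 \<tau> (Phi B) = X * \<tau> - poly Ap B * eta2"
  using contour_integral_unique[OF PhiF_integral[of z1 0 1 Cp bp B]] s(2) by (simp add: X_def Y)
 have "(pint z1 \<tau> (Phi B) - \<tau> * pint z0 1 (Phi B)) = poly Ap B * (eta1 * \<tau> - eta2)"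
  unfolding 1 2 by (simp add: algebra_simps)
 thus ?thesis unfolding legendre by simp
qed

section \<open>The lift as a function of the spectral parameter\<close>

lemma PhiF_deriv2: "z \<notin> HL ==> deriv (deriv (PhiF C c B)) z = (\<Sum>p\<in>Sg. poly (c p) B * deriv (deriv (ee p)) z)"
proof -
 assume z: "z \<notin> HL"
 have "deriv (deriv (PhiF C c B)) z = deriv (\<lambda>z. \<Sum>p\<in>Sg. poly (c p) B * deriv (ee p) z) z"
  by (rule deriv_cong_HL[OF PhiF_deriv z])
 also have "\<dots> = (\<Sum>p\<in>Sg. poly (c p) B * deriv (deriv (ee p)) z)"
  by (rule deriv_lin0[where s = "-1", OF Sg_finite _ z]) (use ellp_deriv[OF ee_ellp] SgD(1) in simp)
 finally show ?thesis .
qed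

lemma continuous_snd_compose:
 assumes "f holomorphic_on D" shows "continuous_on (X \<times> D) (\<lambda>x. f (snd x))"
 by (rule continuous_on_compose2[OF holomorphic_on_imp_continuous_on[OF assms] continuous_on_snd]) auto

lemma ee_holo: "p \<in> Sg ==> ee p holomorphic_on - HL" "p \<in> Sg ==> deriv (ee p) holomorphic_on - HL"
 using ellpD(1)[OF ee_ellp] ellpD(1)[OF ellp_deriv[OF ee_ellp]] SgD(1) by auto

lemma PhiF_continuous: "continuous_on (X \<times> (- HL)) (\<lambda>x. PhiF C c (fst x) (snd x))"
 unfolding PhiF_def by (intro continuous_intros continuous_snd_compose ee_holo)

lemma PhiF_deriv_continuous: "continuous_on (X \<times> (- HL)) (\<lambda>x. deriv (PhiF C c (fst x)) (snd x))"
proof -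
 have "continuous_on (X \<times> (- HL)) (\<lambda>x. \<Sum>p\<in>Sg. poly (c p) (fst x) * deriv (ee p) (snd x))"
  by (intro continuous_intros continuous_snd_compose ee_holo)
 thus ?thesis by (rule continuous_on_eq) (auto simp: PhiF_deriv)
qed

abbreviation "PhiB \<equiv> PhiF (pderiv Cp) (\<lambda>p. pderiv (bp p))"

lemma param_deriv:
 "DERIV (\<lambda>B. poly C B + (\<Sum>p\<in>Sg. poly (c p) B * g p)) B :>
  poly (pderiv C) B + (\<Sum>p\<in>Sg. poly (pderiv (c p)) B * g p)"
 by (intro DERIV_add DERIV_sum DERIV_cmult_right poly_DERIV)

lemma Phi_param_deriv:
 "DERIV (\<lambda>B. Phi B z) B :> PhiB B z"
 "z \<notin> HL ==> DERIV (\<lambda>B. deriv (Phi B) z) B :> deriv (PhiB B) z"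
 "z \<notin> HL ==> DERIV (\<lambda>B. deriv (deriv (Phi B)) z) B :> deriv (deriv (PhiB B)) z"
 using param_deriv[of Cp bp "\<lambda>p. ee p z" B] param_deriv[of 0 bp "\<lambda>p. deriv (ee p) z" B]
  param_deriv[of 0 bp "\<lambda>p. deriv (deriv (ee p)) z" B]
 by (simp_all add: PhiF_def[of _ _ _ z] PhiF_deriv PhiF_deriv2)

text \<open>Differentiating the identity that defines \<open>Q\<close> with respect to \<open>B\<close> shows that the derivative of \<open>\<surd>Q / (2\<Phi>)\<close>
 with respect to \<open>B\<close>, times \<open>\<surd>Q\<close>, is \<open>\<Phi>\<close> up to a derivative of an elliptic function.\<close>
lemma Psi_identity:
 assumes z: "z \<notin> SS B"
 shows "DERIV (\<lambda>z. (deriv (Phi B) z * PhiB B z / Phi B z - deriv (PhiB B) z) / 2) z :>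
  poly (pderiv Qp) B / (4 * Phi B z) - poly Qp B * PhiB B z / (2 * Phi B z ^ 2) - Phi B z"
proof -
 note z' = SS_D[OF z]
 let ?f = "Phi B z" and ?f1 = "deriv (Phi B) z" and ?f2 = "deriv (deriv (Phi B)) z"
 let ?b = "PhiB B z" and ?b1 = "deriv (PhiB B) z" and ?b2 = "deriv (deriv (PhiB B)) z"
 have eB: "ellp 1 (PhiB B)" by (rule PhiF_ellp)
 have D: "DERIV (\<lambda>z. (deriv (Phi B) z * PhiB B z / Phi B z - deriv (PhiB B) z) / 2) z :>
  (((?f2 * ?b + ?b1 * ?f1) * ?f - (?f1 * ?b) * ?f1) / (?f * ?f) - ?b2) / 2"
  by (intro DERIV_cdivide DERIV_diff DERIV_divide DERIV_mult ellpD(6)[OF Phi_ellp z'(1)] ellpD(6)[OF ellp_deriv[OF Phi_ellp] z'(1)]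
   ellpD(6)[OF eB z'(1)] ellpD(6)[OF ellp_deriv[OF eB] z'(1)] z'(2))
 have "DERIV (\<lambda>B. Qf B z) B :>
  (?b1 * ?f1 + ?b1 * ?f1) - ((2 * ?b) * ?f2 + ?b2 * (2 * ?f)) + ((4 * (0 + 1)) * (?f * ?f) + (?b * ?f + ?b * ?f) * (4 * (u z + B)))"
  unfolding Qf_def power2_eq_square
  by (intro DERIV_add DERIV_diff DERIV_mult DERIV_cmult DERIV_const DERIV_ident Phi_param_deriv z'(1))
 moreover have "DERIV (\<lambda>B. Qf B z) B :> poly (pderiv Qp) B"
  using poly_DERIV[of Qp B] unfolding Qp_eq(2)[OF z'(1)] .
 ultimately have q1: "poly (pderiv Qp) B = (?b1 * ?f1 + ?b1 * ?f1) - ((2 * ?b) * ?f2 + ?b2 * (2 * ?f)) + ((4 * (0 + 1)) * (?f * ?f) + (?b * ?f + ?b * ?f) * (4 * (u z + B)))"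
  by (rule DERIV_unique[symmetric])
 have q0: "poly Qp B = ?f1 ^ 2 - 2 * ?f * ?f2 + 4 * (u z + B) * ?f ^ 2" unfolding Qp_eq(2)[OF z'(1)] Qf_def ..
 have "(((?f2 * ?b + ?b1 * ?f1) * ?f - (?f1 * ?b) * ?f1) / (?f * ?f) - ?b2) / 2
  = poly (pderiv Qp) B / (4 * ?f) - poly Qp B * ?b / (2 * ?f ^ 2) - ?f"
  unfolding q0 q1 using z'(2) by (simp add: divide_simps power2_eq_square) (simp add: algebra_simps)
 thus ?thesis by (rule DERIV_cong[OF D])
qed

text \<open>Half the periods of \<open>1/\<Phi>\<close> and of \<open>\<Phi>'/\<Phi>\<close>; \<open>hI'\<close> is the derivative of \<open>hI\<close> with respect to \<open>B\<close>.\<close>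
definition hI :: "complex => complex => complex => complex" where
 "hI z0 w B = pint z0 w (\<lambda>z. 1 / Phi B z) / 2"
definition hI' :: "complex => complex => complex => complex" where
 "hI' z0 w B = pint z0 w (\<lambda>z. - PhiB B z / Phi B z ^ 2) / 2"
definition lI :: "complex => complex => complex => complex" where
 "lI z0 w B = pint z0 w (\<lambda>z. deriv (Phi B) z / Phi B z) / 2"

context
 fixes U :: "complex set" and z0 w :: complex
 assumes U: "open U" "convex U" and seg: "\<And>B. B \<in> U ==> seg z0 w \<inter> SS B = {}"
begin

lemma seg_point: assumes "B \<in> U" "t \<in> {0..1::real}" shows "z0 + of_real t * w \<notin> SS B"
proof -
 have "z0 + of_real t * w \<in> seg z0 w"
  unfolding closed_segment_def using assms(2) by (intro CollectI exI[of _ t]) (auto simp: scaleR_conv_of_real algebra_simps)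
 thus ?thesis using seg[OF assms(1)] by blast
qed

lemma seg_continuous:
 assumes "continuous_on (U \<times> (- HL)) (\<lambda>x. f (fst x) (snd x) :: complex)"
 shows "continuous_on (U \<times> {0..1::real}) (\<lambda>x. f (fst x) (z0 + of_real (snd x) * w))"
proof -
 have "continuous_on (U \<times> {0..1::real}) (\<lambda>x. (fst x, z0 + of_real (snd x) * w))" by (intro continuous_intros)
 moreover have "(\<lambda>x. (fst x, z0 + of_real (snd x) * w)) ` (U \<times> {0..1::real}) \<subseteq> U \<times> (- HL)"
  using seg_point SS_D(1) by fastforce
 ultimately show ?thesis using continuous_on_compose2[OF assms, of "U \<times> {0..1::real}" "\<lambda>x. (fst x, z0 + of_real (snd x) * w)"] by simp
qed

lemma hI_deriv: assumes B: "B \<in> U" shows "DERIV (hI z0 w) B :> hI' z0 w B"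
proof -
 let ?z = "\<lambda>t. z0 + of_real t * (z0 + w - z0)"
 have zt: "?z t = z0 + of_real t * w" for t by simp
 have "((\<lambda>B. integral (cbox 0 (1::real)) (\<lambda>t. 1 / Phi B (z0 + of_real t * w) * w)) has_field_derivative
  integral (cbox 0 1) (\<lambda>t. - PhiB B (z0 + of_real t * w) / Phi B (z0 + of_real t * w) ^ 2 * w)) (at B within U)"
 proof (rule leibniz_rule_field_derivative)
  fix B t assume B: "B \<in> U" and t: "t \<in> cbox 0 (1::real)"
  have n: "Phi B (z0 + of_real t * w) \<noteq> 0" using SS_D(2)[OF seg_point[OF B]] t by simp
  have "DERIV (\<lambda>B. 1 / Phi B (z0 + of_real t * w)) B :>
   (0 * Phi B (z0 + of_real t * w) - 1 * PhiB B (z0 + of_real t * w)) / (Phi B (z0 + of_real t * w) * Phi B (z0 + of_real t * w))"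
   by (intro DERIV_divide DERIV_const Phi_param_deriv(1) n)
  hence "DERIV (\<lambda>B. 1 / Phi B (z0 + of_real t * w)) B :> - PhiB B (z0 + of_real t * w) / Phi B (z0 + of_real t * w) ^ 2"
   by (simp add: power2_eq_square)
  from DERIV_cmult_right[OF this, of w]
  show "((\<lambda>B. 1 / Phi B (z0 + of_real t * w) * w) has_field_derivative - PhiB B (z0 + of_real t * w) / Phi B (z0 + of_real t * w) ^ 2 * w) (at B within U)"
   by (rule has_field_derivative_at_within)
 next
  fix B assume B: "B \<in> U"
  have 1: "continuous_on ({B} \<times> {0..1::real}) (\<lambda>x. Phi (fst x) (z0 + of_real (snd x) * w))"
   by (rule continuous_on_subset[OF seg_continuous[OF PhiF_continuous]]) (use B in auto)
  have "continuous_on {0..1::real} (\<lambda>t. Phi B (z0 + of_real t * w))"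
  proof -
   have "continuous_on {0..1::real} (\<lambda>t. (B, t))" by (intro continuous_on_Pair continuous_on_const continuous_on_id)
   from continuous_on_compose2[OF 1 this] show ?thesis by auto
  qed
  hence "continuous_on {0..1::real} (\<lambda>t. 1 / Phi B (z0 + of_real t * w) * w)"
   by (intro continuous_intros) (use SS_D(2)[OF seg_point[OF B]] in auto)
  thus "(\<lambda>t. 1 / Phi B (z0 + of_real t * w) * w) integrable_on cbox 0 1"
   unfolding cbox_interval by (rule integrable_continuous_interval)
 next
  have "continuous_on (U \<times> {0..1::real}) (\<lambda>x. - PhiB (fst x) (z0 + of_real (snd x) * w) / Phi (fst x) (z0 + of_real (snd x) * w) ^ 2 * w)"
   by (intro continuous_intros seg_continuous[OF PhiF_continuous]) (use SS_D(2)[OF seg_point] in auto)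
  thus "continuous_on (U \<times> cbox 0 (1::real)) (\<lambda>(B, t). - PhiB B (z0 + of_real t * w) / Phi B (z0 + of_real t * w) ^ 2 * w)"
   by (simp add: case_prod_unfold)
 qed (use U B in auto)
 hence "DERIV (\<lambda>B. integral (cbox 0 (1::real)) (\<lambda>t. 1 / Phi B (z0 + of_real t * w) * w) / 2) B :>
  integral (cbox 0 1) (\<lambda>t. - PhiB B (z0 + of_real t * w) / Phi B (z0 + of_real t * w) ^ 2 * w) / 2"
  unfolding at_within_open[OF B U(1)] by (rule DERIV_cdivide)
 thus ?thesis unfolding hI_def[abs_def] hI'_def contour_integral_linepath_alt zt cbox_interval by simp
qed

lemma lI_continuous: "continuous_on U (lI z0 w)"
proof -
 have zt: "z0 + of_real t * (z0 + w - z0) = z0 + of_real t * w" for t by simp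
 have "continuous_on (U \<times> {0..1::real}) (\<lambda>x. deriv (Phi (fst x)) (z0 + of_real (snd x) * w) / Phi (fst x) (z0 + of_real (snd x) * w) * w)"
  by (intro continuous_intros seg_continuous[OF PhiF_continuous] seg_continuous[OF PhiF_deriv_continuous]) (use SS_D(2)[OF seg_point] in auto)
 hence "continuous_on U (\<lambda>B. integral (cbox 0 (1::real)) (\<lambda>t. deriv (Phi B) (z0 + of_real t * w) / Phi B (z0 + of_real t * w) * w))"
  by (intro integral_continuous_on_param) (simp add: case_prod_unfold)
 hence "continuous_on U (\<lambda>B. integral {0..(1::real)} (\<lambda>t. deriv (Phi B) (z0 + of_real t * w) / Phi B (z0 + of_real t * w) * (z0 + w - z0)) / 2)"
  by (intro continuous_intros) simp_all
 thus ?thesis unfolding lI_def[abs_def] contour_integral_linepath_alt zt .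
qed

lemma lI_discrete: assumes w: "w \<in> L" and B: "B \<in> U" shows "\<exists>m::int. lI z0 w B = of_int m * of_real pi * \<i>"
proof -
 have s: "z0 \<notin> SS B" "z \<in> seg z0 w ==> z \<notin> SS B" for z using seg[OF B] by auto
 have "Phi B (z0 + w) = Phi B z0 * exp (pint z0 w (\<lambda>z. deriv (Phi B) z / Phi B z))"
  by (rule exp_integral_log_deriv[OF half_lattice_Compl(1) ellpD(1)[OF Phi_ellp]]) (use s(2) SS_D in \<open>blast+\<close>)
 hence "exp (2 * lI z0 w B) = 1" using ellpD(4)[OF Phi_ellp SS_D(1)[OF s(1)] w] SS_D(2)[OF s(1)] by (simp add: lI_def)
 then obtain m :: int where "2 * lI z0 w B = complex_of_real (real_of_int (2 * m) * pi) * \<i>" using exp_eq[of "2 * lI z0 w B" 0] by auto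
 hence "lI z0 w B = of_int m * of_real pi * \<i>" by simp
 thus ?thesis by blast
qed

lemma lI_locally_constant:
 assumes w: "w \<in> L" shows "\<exists>m::int. \<forall>B\<in>U. lI z0 w B = of_int m * of_real pi * \<i>"
proof (cases "U = {}")
 case False
 have "lI z0 w constant_on U"
 proof (rule continuous_discrete_range_constant[OF convex_connected[OF U(2)] lI_continuous])
  fix x assume x: "x \<in> U"
  show "\<exists>e>0. \<forall>y. y \<in> U \<and> lI z0 w y \<noteq> lI z0 w x \<longrightarrow> e \<le> norm (lI z0 w y - lI z0 w x)"
  proof (intro exI[of _ pi] conjI allI impI)
   fix y assume y: "y \<in> U \<and> lI z0 w y \<noteq> lI z0 w x"
   obtain m k :: int where mk: "lI z0 w y = of_int m * of_real pi * \<i>" "lI z0 w x = of_int k * of_real pi * \<i>"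
    using lI_discrete[OF w] x y by metis
   have "m \<noteq> k" using y mk by auto
   hence "\<bar>m - k\<bar> \<ge> 1" by linarith
   hence "\<bar>real_of_int (m - k)\<bar> \<ge> 1" by linarith
   moreover have "lI z0 w y - lI z0 w x = of_real (real_of_int (m - k) * pi) * \<i>" unfolding mk by (simp add: algebra_simps)
   hence "norm (lI z0 w y - lI z0 w x) = \<bar>real_of_int (m - k)\<bar> * pi" by (simp only: norm_mult norm_of_real norm_ii abs_mult) simp
   ultimately show "pi \<le> norm (lI z0 w y - lI z0 w x)" by simp
  qed simp
 qed
 then obtain c where c: "\<And>B. B \<in> U ==> lI z0 w B = c" unfolding constant_on_def by blast
 thus ?thesis using False lI_discrete[OF w] by (metis ex_in_conv)
qed simp

lemma seg_integrable:
 assumes B: "B \<in> U" and f: "f holomorphic_on - SS B" shows "f contour_integrable_on linepath z0 (z0 + w)"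
 by (rule contour_integrable_continuous_linepath, rule continuous_on_subset[OF holomorphic_on_imp_continuous_on[OF f]])
  (use seg[OF B] in auto)

text \<open>The identity \<open>Psi_identity\<close>, integrated over a period.\<close>
lemma hI_equation:
 assumes w: "w \<in> L" and B: "B \<in> U"
 shows "poly (pderiv Qp) B / 2 * hI z0 w B + poly Qp B * hI' z0 w B = pint z0 w (Phi B)"
proof -
 let ?g = "linepath z0 (z0 + w)"
 let ?G = "\<lambda>z. (deriv (Phi B) z * PhiB B z / Phi B z - deriv (PhiB B) z) / 2"
 have eB: "ellp 1 (PhiB B)" by (rule PhiF_ellp)
 have z0: "z0 \<notin> SS B" using seg[OF B] by auto
 note n = SS_D[of _ B]
 have sub: "f holomorphic_on - HL ==> f holomorphic_on - SS B" for f by (rule holomorphic_on_subset) (auto simp: SS_def)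
 have hP: "Phi B holomorphic_on - SS B" by (rule sub[OF ellpD(1)[OF Phi_ellp]])
 have hB: "PhiB B holomorphic_on - SS B" by (rule sub[OF ellpD(1)[OF eB]])
 have i1: "((\<lambda>z. 1 / Phi B z) has_contour_integral 2 * hI z0 w B) ?g"
 proof -
  have "(\<lambda>z. 1 / Phi B z) holomorphic_on - SS B" by (intro holomorphic_intros hP) (use n(2) in auto)
  from has_contour_integral_integral[OF seg_integrable[OF B this]] show ?thesis by (simp add: hI_def)
 qed
 have i2: "((\<lambda>z. - PhiB B z / Phi B z ^ 2) has_contour_integral 2 * hI' z0 w B) ?g"
 proof -
  have "(\<lambda>z. - PhiB B z / Phi B z ^ 2) holomorphic_on - SS B" by (intro holomorphic_intros hP hB) (use n(2) in auto)
  from has_contour_integral_integral[OF seg_integrable[OF B this]] show ?thesis by (simp add: hI'_def)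
 qed
 have i3: "(Phi B has_contour_integral contour_integral ?g (Phi B)) ?g"
  by (rule has_contour_integral_integral[OF seg_integrable[OF B hP]])
 have "((\<lambda>z. poly (pderiv Qp) B / (4 * Phi B z) - poly Qp B * PhiB B z / (2 * Phi B z ^ 2) - Phi B z) has_contour_integral (?G (pathfinish ?g) - ?G (pathstart ?g))) ?g"
 proof (rule contour_integral_primitive)
  show "(?G has_field_derivative poly (pderiv Qp) B / (4 * Phi B x) - poly Qp B * PhiB B x / (2 * Phi B x ^ 2) - Phi B x) (at x within - SS B)"
   if "x \<in> - SS B" for x by (rule has_field_derivative_at_within[OF Psi_identity]) (use that in simp)
  show "path_image ?g \<subseteq> - SS B" using seg[OF B] by auto
 qed auto
 moreover have "?G (z0 + w) = ?G z0"
  using ellpD(4)[OF Phi_ellp n(1)[OF z0] w] ellpD(4)[OF ellp_deriv[OF Phi_ellp] n(1)[OF z0] w]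
   ellpD(4)[OF eB n(1)[OF z0] w] ellpD(4)[OF ellp_deriv[OF eB] n(1)[OF z0] w] by simp
 ultimately have i4: "((\<lambda>z. poly (pderiv Qp) B / (4 * Phi B z) - poly Qp B * PhiB B z / (2 * Phi B z ^ 2) - Phi B z) has_contour_integral 0) ?g" by simp
 have i5: "((\<lambda>z. (poly (pderiv Qp) B / 4 * (1 / Phi B z) + poly Qp B / 2 * (- PhiB B z / Phi B z ^ 2)) - Phi B z) has_contour_integral
  (poly (pderiv Qp) B / 4 * (2 * hI z0 w B) + poly Qp B / 2 * (2 * hI' z0 w B)) - contour_integral ?g (Phi B)) ?g"
  by (intro has_contour_integral_add has_contour_integral_diff has_contour_integral_lmul i1 i2 i3)
 have "(\<lambda>z. (poly (pderiv Qp) B / 4 * (1 / Phi B z) + poly Qp B / 2 * (- PhiB B z / Phi B z ^ 2)) - Phi B z)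
  = (\<lambda>z. poly (pderiv Qp) B / (4 * Phi B z) - poly Qp B * PhiB B z / (2 * Phi B z ^ 2) - Phi B z)" by (simp add: fun_eq_iff)
 from has_contour_integral_unique[OF i5[unfolded this] i4] show ?thesis by (simp add: mult.commute)
qed

end

lemma tube:
 assumes "compact K" "K \<inter> SS B0 = {}"
 obtains r where "r > 0" "\<And>B. B \<in> ball B0 r ==> K \<inter> SS B = {}"
proof -
 define W where "W = (UNIV \<times> (- HL)) \<inter> (\<lambda>x. Phi (fst x) (snd x)) -` (- {0})"
 have oW: "open W" unfolding W_def
  by (rule continuous_open_preimage[OF PhiF_continuous]) (intro open_Times half_lattice_Compl(1) open_UNIV, auto)
 have sW: "{B0} \<times> K \<subseteq> W"
 proof
  fix x assume x: "x \<in> {B0} \<times> K"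
  hence "snd x \<notin> SS B0" "fst x = B0" using assms(2) by auto
  thus "x \<in> W" using SS_D[of "snd x" B0] by (cases x) (simp add: W_def)
 qed
 have "\<exists>X. B0 \<in> X \<and> open X \<and> X \<times> K \<subseteq> W" by (rule Elementary_Topology.tube_lemma[OF assms(1) oW sW])
 then obtain X where X: "B0 \<in> X" "open X" "X \<times> K \<subseteq> W" by (elim exE conjE)
 obtain r where "r > 0" "ball B0 r \<subseteq> X" by (rule openE[OF X(2,1)])
 moreover have "K \<inter> SS B = {}" if B: "B \<in> X" for B
 proof (rule ccontr)
  assume "K \<inter> SS B \<noteq> {}"
  then obtain z where z: "z \<in> K" "z \<in> SS B" by blast
  have "(B, z) \<in> W" using X(3) B z(1) by blast
  thus False using z(2) by (simp add: W_def SS_def)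
 qed
 ultimately show thesis using that[of r] by blast
qed

text \<open>The combinations of the half periods of \<open>1/\<Phi>\<close> that Legendre's relation turns into the coefficients of \<open>W\<close> in \<open>s\<close> and \<open>c\<close>.\<close>
definition Hc :: "complex => complex => complex" where "Hc z0 B = (hI z0 \<tau> B - \<tau> * hI z0 1 B) / (2 * of_real pi * \<i>)"
definition Hc' :: "complex => complex => complex" where "Hc' z0 B = (hI' z0 \<tau> B - \<tau> * hI' z0 1 B) / (2 * of_real pi * \<i>)"
definition Kc :: "complex => complex => complex" where "Kc z0 B = (eta1 * hI z0 \<tau> B - eta2 * hI z0 1 B) / (2 * of_real pi * \<i>)"

text \<open>A half period and the corresponding half quasi-period.\<close>
definition halfs :: "int => int => complex" where "halfs m1 m2 = (of_int m2 - of_int m1 * \<tau>) / 2"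
definition halfc :: "int => int => complex" where "halfc m1 m2 = (of_int m2 * eta1 - of_int m1 * eta2) / 2"

text \<open>The integral of \<open>qq\<close> over a period is a half integral multiple of \<open>2\<pi>i\<close> minus \<open>W\<close> times an integral that depends on \<open>B\<close> only.\<close>
lemma lift_formula:
 assumes l: "is_lift B W s c" and z0: "seg z0 1 \<inter> SS B = {}" "seg z0 \<tau> \<inter> SS B = {}"
  and m: "lI z0 1 B = of_int m1 * of_real pi * \<i>" "lI z0 \<tau> B = of_int m2 * of_real pi * \<i>"
 shows "\<exists>a b::int. halfs m1 m2 - W * Hc z0 B = s + lat a b \<and>
  halfc m1 m2 - W * Kc z0 B = c + eta a b"
proof -
 define P where "P = 2 * complex_of_real pi * \<i>"
 have P0: "P \<noteq> 0" by (simp add: P_def)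
 have split: "pint z0 w (qq B W) = lI z0 w B - W * hI z0 w B"
  if sg: "seg z0 w \<inter> SS B = {}" for w
 proof -
  have hP: "Phi B holomorphic_on - SS B" "deriv (Phi B) holomorphic_on - SS B"
   by (rule holomorphic_on_subset[OF ellpD(1)[OF Phi_ellp]], auto simp: SS_def)
    (rule holomorphic_on_subset[OF ellpD(1)[OF ellp_deriv[OF Phi_ellp]]], auto simp: SS_def)
  have int: "f contour_integrable_on linepath z0 (z0 + w)" if "f holomorphic_on - SS B" for f
   by (rule contour_integrable_continuous_linepath, rule continuous_on_subset[OF holomorphic_on_imp_continuous_on[OF that]])
    (use sg in auto)
  have h1: "(\<lambda>z. deriv (Phi B) z / Phi B z) holomorphic_on - SS B" "(\<lambda>z. 1 / Phi B z) holomorphic_on - SS B"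
   by (intro holomorphic_intros hP; use SS_D(2)[of _ B] in auto)+
  have "((\<lambda>z. (1/2) * (deriv (Phi B) z / Phi B z) - (W / 2) * (1 / Phi B z)) has_contour_integral
   (1/2) * pint z0 w (\<lambda>z. deriv (Phi B) z / Phi B z) - (W / 2) * pint z0 w (\<lambda>z. 1 / Phi B z)) (linepath z0 (z0 + w))"
   by (intro has_contour_integral_diff has_contour_integral_lmul has_contour_integral_integral int h1)
  moreover have "(\<lambda>z. (1/2) * (deriv (Phi B) z / Phi B z) - (W / 2) * (1 / Phi B z)) = qq B W"
   by (simp add: fun_eq_iff qq_def diff_divide_distrib)
  ultimately have "(qq B W has_contour_integral
   (1/2) * pint z0 w (\<lambda>z. deriv (Phi B) z / Phi B z) - (W / 2) * pint z0 w (\<lambda>z. 1 / Phi B z)) (linepath z0 (z0 + w))" by simp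
  from contour_integral_unique[OF this] show ?thesis by (simp add: lI_def hI_def)
 qed
 define L1 where "L1 = pint z0 1 (qq B W)"
 define L2 where "L2 = pint z0 \<tau> (qq B W)"
 have L: "L1 = of_int m1 * (P / 2) - W * hI z0 1 B" "L2 = of_int m2 * (P / 2) - W * hI z0 \<tau> B"
  unfolding L1_def L2_def split[OF z0(1)] split[OF z0(2)] m by (simp_all add: P_def)
 define s1 where "s1 = halfs m1 m2 - W * Hc z0 B"
 define c1 where "c1 = halfc m1 m2 - W * Kc z0 B"
 have s1: "P * s1 = L2 - \<tau> * L1" and c1: "P * c1 = eta1 * L2 - eta2 * L1"
  using P0 unfolding s1_def c1_def L halfs_def halfc_def Hc_def Kc_def P_def[symmetric] by (simp_all add: field_simps)
 have "P * (c1 - eta1 * s1) = P * c1 - eta1 * (P * s1)" by (simp add: algebra_simps)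
 also have "\<dots> = (eta1 * \<tau> - eta2) * L1" unfolding s1 c1 by (simp add: algebra_simps)
 also have "\<dots> = P * L1" unfolding legendre P_def ..
 finally have e1: "c1 - eta1 * s1 = L1" using P0 by simp
 have "P * (c1 * \<tau> - eta2 * s1) = P * c1 * \<tau> - eta2 * (P * s1)" by (simp add: algebra_simps)
 also have "\<dots> = (eta1 * \<tau> - eta2) * L2" unfolding s1 c1 by (simp add: algebra_simps)
 also have "\<dots> = P * L2" unfolding legendre P_def ..
 finally have e2: "c1 * \<tau> - eta2 * s1 = L2" using P0 by simp
 obtain a b :: int where "s1 = s + lat a b" "c1 = c + eta a b"
  by (rule lift_congruent[OF l z0, of c1 s1]) (use e1 e2 in \<open>simp_all add: L1_def L2_def\<close>)
 thus ?thesis unfolding s1_def c1_def by blast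
qed

text \<open>Near every \<open>B\<close> the lift is linear in \<open>W\<close>. The differential equation of \<open>H\<close> says that \<open>ds = - A dB/W\<close>.\<close>
lemma chart:
 fixes B0 :: complex
 obtains r H H' K m1 m2 where "r > 0" "\<And>B. B \<in> ball B0 r ==> DERIV H B :> H' B"
  "\<And>B. B \<in> ball B0 r ==> poly (pderiv Qp) B / 2 * H B + poly Qp B * H' B = poly Ap B"
  "K holomorphic_on ball B0 r"
  "\<And>B W s c. B \<in> ball B0 r ==> is_lift B W s c ==> \<exists>a b::int.
   halfs m1 m2 - W * H B = s + lat a b \<and> halfc m1 m2 - W * K B = c + eta a b"
proof -
 obtain z0 where z0: "seg z0 1 \<inter> SS B0 = {}" "seg z0 \<tau> \<inter> SS B0 = {}"
  by (rule base_point[OF SS_sparse])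
 have "(seg z0 1 \<union> seg z0 \<tau>) \<inter> SS B0 = {}" using z0 by blast
 then obtain r where r: "r > 0" and s: "\<And>B. B \<in> ball B0 r ==> (seg z0 1 \<union> seg z0 \<tau>) \<inter> SS B = {}"
  using tube[of "seg z0 1 \<union> seg z0 \<tau>" B0] by (metis compact_Un compact_segment(1))
 let ?U = "ball B0 r"
 have s1: "seg z0 1 \<inter> SS B = {}" and s2: "seg z0 \<tau> \<inter> SS B = {}" if "B \<in> ?U" for B
  using s[OF that] by blast+
 have U: "open ?U" "convex ?U" by auto
 obtain m1 :: int where m1: "\<And>B. B \<in> ?U ==> lI z0 1 B = of_int m1 * of_real pi * \<i>"
  using lI_locally_constant[OF U s1 lattice_1] by blast
 obtain m2 :: int where m2: "\<And>B. B \<in> ?U ==> lI z0 \<tau> B = of_int m2 * of_real pi * \<i>"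
  using lI_locally_constant[OF U s2 lattice_tau] by blast
 note d1 = hI_deriv[OF U s1] and d2 = hI_deriv[OF U s2]
 have dH: "DERIV (Hc z0) B :> Hc' z0 B" if B: "B \<in> ?U" for B
  unfolding Hc_def[abs_def] Hc'_def by (intro DERIV_cdivide DERIV_diff DERIV_cmult d1 d2 B)
 have dK: "DERIV (Kc z0) B :> (eta1 * hI' z0 \<tau> B - eta2 * hI' z0 1 B) / (2 * of_real pi * \<i>)" if B: "B \<in> ?U" for B
  unfolding Kc_def[abs_def] by (intro DERIV_cdivide DERIV_diff DERIV_cmult d1 d2 B)
 show thesis
 proof (rule that[OF r dH])
  fix B assume B: "B \<in> ?U"
  have sH: "seg z0 1 \<inter> HL = {}" "seg z0 \<tau> \<inter> HL = {}"
   using s1[OF B] s2[OF B] by (auto simp: SS_def)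
  have "poly (pderiv Qp) B / 2 * Hc z0 B + poly Qp B * Hc' z0 B =
   ((poly (pderiv Qp) B / 2 * hI z0 \<tau> B + poly Qp B * hI' z0 \<tau> B) - \<tau> * (poly (pderiv Qp) B / 2 * hI z0 1 B + poly Qp B * hI' z0 1 B)) / (2 * of_real pi * \<i>)"
   unfolding Hc_def Hc'_def by (simp add: field_simps)
  also have "\<dots> = poly Ap B" 
  proof -
   have e1: "poly (pderiv Qp) B / 2 * hI z0 1 B + poly Qp B * hI' z0 1 B = pint z0 1 (Phi B)"
    by (rule hI_equation[OF U _ lattice_1 B]) (rule s1)
   have e2: "poly (pderiv Qp) B / 2 * hI z0 \<tau> B + poly Qp B * hI' z0 \<tau> B = pint z0 \<tau> (Phi B)"
    by (rule hI_equation[OF U _ lattice_tau B]) (rule s2)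
   show ?thesis unfolding e1 e2 by (rule Ap_eq[OF sH])
  qed
  finally show "poly (pderiv Qp) B / 2 * Hc z0 B + poly Qp B * Hc' z0 B = poly Ap B" .
 next
  show "Kc z0 holomorphic_on ?U" by (rule holomorphic_onI_deriv[OF open_ball dK])
 next
  fix B W s c assume B: "B \<in> ?U" and l: "is_lift B W s c"
  show "\<exists>a b::int. halfs m1 m2 - W * Hc z0 B = s + lat a b \<and> halfc m1 m2 - W * Kc z0 B = c + eta a b"
   by (rule lift_formula[OF l s1[OF B] s2[OF B] m1[OF B] m2[OF B]])
 qed
qed

end

section \<open>The lift at infinity\<close>

lemma poly_over_power_tendsto:
 fixes p :: "complex poly"
 assumes "degree p \<le> k" shows "((\<lambda>x. poly p x / x ^ k) \<longlongrightarrow> coeff p k) at_infinity"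
proof (cases "degree p = k")
 case True thus ?thesis using poly_divide_tendsto_aux[of p] by simp
next
 case False
 hence "degree p < degree (monom (1::complex) k)" using assms by (simp add: degree_monom_eq)
 from poly_divide_tendsto_0_at_infinity[OF this] have "((\<lambda>x. poly p x / x ^ k) \<longlongrightarrow> 0) at_infinity" by (simp add: poly_monom)
 moreover have "coeff p k = 0" using False assms by (intro coeff_eq_0) simp
 ultimately show ?thesis by simp
qed

lemma at_infinity_nonzero: "eventually (\<lambda>x::complex. x \<noteq> 0) at_infinity"
 unfolding eventually_at_infinity by (intro exI[of _ 1]) auto

lemma inverse_at_infinity: "((\<lambda>x::complex. 1 / x) \<longlongrightarrow> 0) at_infinity"
proof -
 have "(\<lambda>x::complex. 1 / x) = inverse" by (simp add: fun_eq_iff inverse_eq_divide)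
 thus ?thesis using tendsto_inverse_0 by simp
qed

lemma uniform_limit_of_tendsto:
 assumes "(b \<longlongrightarrow> b0) F" shows "uniform_limit K (\<lambda>B z. b B) (\<lambda>z. b0) F"
proof (rule uniform_limitI)
 fix e :: real assume "e > 0"
 from tendstoD[OF assms this] show "eventually (\<lambda>B. \<forall>z\<in>K. dist (b B) b0 < e) F" by eventually_elim simp
qed

lemma uniform_limit_linear_combination:
 fixes a :: "complex => complex"
 assumes "finite I" "(a \<longlongrightarrow> a0) F" "\<And>p. p \<in> I ==> (c p \<longlongrightarrow> c0 p) F" "\<And>p. p \<in> I ==> bounded (g p ` K)"
 shows "uniform_limit K (\<lambda>B z. a B + (\<Sum>p\<in>I. c p B * g p z)) (\<lambda>z. a0 + (\<Sum>p\<in>I. c0 p * (g p z :: complex))) F"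
proof -
 note const = uniform_limit_of_tendsto
 have "uniform_limit K (\<lambda>B z. (\<Sum>p\<in>I. c p B * g p z)) (\<lambda>z. (\<Sum>p\<in>I. c0 p * g p z)) F"
  using assms(1,3,4)
 proof (induction I rule: finite_induct)
  case empty thus ?case by (simp add: uniform_limit_const)
 next
  case (insert x I)
  have "uniform_limit K (\<lambda>B z. c x B * g x z) (\<lambda>z. c0 x * g x z) F"
  proof (rule uniform_lim_mult)
   show "uniform_limit K (\<lambda>B z. c x B) (\<lambda>z. c0 x) F" using const insert.prems(1) by blast
   show "bounded ((\<lambda>z. c0 x) ` K)" by (rule bounded_subset[of "{c0 x}"]) auto
   show "bounded (g x ` K)" using insert.prems(2) by blast
  qed (rule uniform_limit_const)
  from uniform_limit_add[OF this insert.IH] insert show ?case by simp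
 qed
 from uniform_limit_add[OF const[OF assms(2)] this] show ?thesis .
qed

lemma linepath_uniform_limit:
 assumes "eventually (\<lambda>n. f n contour_integrable_on linepath a b) F" "uniform_limit (closed_segment a b) f l F" "F \<noteq> bot"
 shows "((\<lambda>n. contour_integral (linepath a b) (f n)) \<longlongrightarrow> contour_integral (linepath a b) l) F"
 by (rule contour_integral_uniform_limit(2)[where B = "norm (b - a)"]) (use assms in \<open>auto simp: vector_derivative_linepath_at\<close>)

context lame begin

definition DD :: nat where "DD = (\<Sum>k\<le>3. n k * (n k + 1) div 2)"

lemma sum_n: "(\<Sum>k\<le>3. of_nat (n k * (n k + 1)) :: complex) = 2 * of_nat DD"
proof -
 have "n k * (n k + 1) = 2 * (n k * (n k + 1) div 2)" for k
  by (rule dvd_mult_div_cancel[symmetric]) simp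
 hence "(\<Sum>k\<le>3. n k * (n k + 1)) = 2 * DD" unfolding DD_def sum_distrib_left by (intro sum.cong refl)
 thus ?thesis by (metis of_nat_sum of_nat_mult of_nat_numeral)
qed

lemma u_integral:
 assumes s: "seg z0 (lat a b) \<inter> HL = {}"
 shows "(u has_contour_integral - 2 * of_nat DD * (eta a b)) (linepath z0 (z0 + lat a b))"
proof -
 define w where "w = lat a b"
 define h where "h = eta a b"
 define G where "G = (\<lambda>z. \<Sum>k\<le>3. of_nat (n k * (n k + 1)) * - wzeta (z + hp k))"
 have z0: "z0 \<notin> HL" using s by auto
 have dG: "DERIV G z :> u z" if z: "z \<notin> HL" for z
 proof -
  have "DERIV (\<lambda>z. - wzeta (z + hp k)) z :> - (- wp \<tau> (z + hp k) * (1 + 0))" if k: "k \<in> {..3}" for k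
   by (intro DERIV_minus DERIV_chain2[where f = wzeta and g = "\<lambda>z. z + hp k", OF wzeta_deriv[OF P_not_lattice[OF z]]] DERIV_add DERIV_ident DERIV_const)
    (use k in simp)
  hence "DERIV G z :> (\<Sum>k\<le>3. of_nat (n k * (n k + 1)) * (- (- wp \<tau> (z + hp k) * (1 + 0))))"
   unfolding G_def by (intro DERIV_sum DERIV_cmult)
  thus ?thesis by (simp add: u_def P_def)
 qed
 have "(u has_contour_integral (G (pathfinish (linepath z0 (z0 + w))) - G (pathstart (linepath z0 (z0 + w))))) (linepath z0 (z0 + w))"
 proof (rule contour_integral_primitive)
  show "(G has_field_derivative u x) (at x within - HL)" if "x \<in> - HL" for x
   using dG that by (auto intro: has_field_derivative_at_within)
  show "path_image (linepath z0 (z0 + w)) \<subseteq> - HL" using s by (auto simp: w_def)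
 qed auto
 moreover have "G (z0 + w) - G z0 = - 2 * of_nat DD * h"
 proof -
  have "G (z0 + w) = (\<Sum>k\<le>3. of_nat (n k * (n k + 1)) * (- wzeta (z0 + hp k) - h))"
   unfolding G_def
  proof (intro sum.cong refl)
   fix k :: nat assume k: "k \<in> {..3}"
   have "z0 + w + hp k = z0 + hp k + lat a b" by (simp add: w_def)
   hence "wzeta (z0 + w + hp k) = wzeta (z0 + hp k) + h"
    unfolding h_def by (simp only:) (rule wzeta_quasi[OF P_not_lattice[OF z0]], use k in simp)
   thus "of_nat (n k * (n k + 1)) * - wzeta (z0 + w + hp k) = of_nat (n k * (n k + 1)) * (- wzeta (z0 + hp k) - h)" by simp
  qed
  also have "\<dots> = G z0 - (\<Sum>k\<le>3. of_nat (n k * (n k + 1))) * h"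
   unfolding G_def right_diff_distrib sum_subtractf sum_distrib_right ..
  finally show ?thesis unfolding sum_n by simp
 qed
 ultimately show ?thesis by (simp add: w_def h_def)
qed

text \<open>The coefficient of \<open>B\<^sup>g\<^sup>-\<^sup>1\<close> in \<open>\<Phi>\<close>, for \<open>g = gg\<close>.\<close>
definition phi1 :: "complex => complex" where
 "phi1 z = coeff Cp (gg - 1) + (\<Sum>p\<in>Sg. coeff (bp p) (gg - 1) * ee p z)"

lemma phi1_eq:
 assumes g: "gg \<ge> 1"
 obtains C where "\<And>z. z \<notin> HL ==> phi1 z = C - u z / 4"
proof -
 have ellp1: "ellp 1 phi1" unfolding phi1_def[abs_def]
  by (intro ellp_add ellp_const ellp_sum ellp_cmult ee_ellp) (auto simp: Sg_def)
 have dphi: "deriv phi1 z = (\<Sum>p\<in>Sg. coeff (bp p) (gg - 1) * deriv (ee p) z)" if "z \<notin> HL" for z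
  unfolding phi1_def[abs_def] by (rule deriv_lin[OF Sg_finite _ that]) (auto intro: ee_ellp simp: Sg_def)
 \<comment> \<open>The coefficient of \<open>B\<^sup>g\<close> in the differential equation of \<open>\<Phi>\<close>.\<close>
 have d: "4 * deriv phi1 z = - deriv u z" if z: "z \<notin> HL" for z
 proof -
  have b0: "coeff (bp p) gg = 0" if "p \<in> Sg" for p using Cp_facts(3)[OF that] by (rule coeff_eq_0)
  have Sg: "gg = Suc (gg - 1)" using g by simp
  have "0 = coeff (eqpoly Cp bp z) gg" using normal_Cp z by (simp add: normal_def Sol_def)
  also have "\<dots> = T0 (\<lambda>_. 1) z * coeff Cp gg + (\<Sum>p\<in>Sg. T0 (ee p) z * coeff (bp p) gg - 4 * deriv (ee p) z * coeff (pCons 0 (bp p)) gg)"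
   unfolding eqpoly_def coeff_add coeff_smult coeff_sum coeff_diff ..
  also have "(\<Sum>p\<in>Sg. T0 (ee p) z * coeff (bp p) gg - 4 * deriv (ee p) z * coeff (pCons 0 (bp p)) gg)
   = (\<Sum>p\<in>Sg. - 4 * (coeff (bp p) (gg - 1) * deriv (ee p) z))"
  proof (intro sum.cong refl)
   fix p assume p: "p \<in> Sg"
   have "coeff (pCons 0 (bp p)) gg = coeff (bp p) (gg - 1)" by (subst Sg) (simp only: coeff_pCons_Suc)
   thus "T0 (ee p) z * coeff (bp p) gg - 4 * deriv (ee p) z * coeff (pCons 0 (bp p)) gg = - 4 * (coeff (bp p) (gg - 1) * deriv (ee p) z)"
    using b0[OF p] by simp
  qed
  also have "\<dots> = - 4 * deriv phi1 z" unfolding dphi[OF z] sum_distrib_left ..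
  also have "coeff Cp gg = 1/2" using Cp_facts(1) by (simp add: gg_def)
  also have "T0 (\<lambda>_. 1) z = - 2 * deriv u z" by (simp add: T0_def)
  finally show ?thesis by (simp add: algebra_simps eq_neg_iff_add_eq_0)
 qed
 obtain z1 where z1: "z1 \<notin> HL" using Phi_nontrivial by blast
 have "phi1 z + u z / 4 = phi1 z1 + u z1 / 4" if z: "z \<notin> HL" for z
 proof (rule zero_deriv_imp_const[where f = "\<lambda>z. phi1 z + u z / 4", OF half_lattice_Compl])
  fix x assume "x \<in> - HL"
  hence x: "x \<notin> HL" by simp
  have "DERIV (\<lambda>z. phi1 z + u z / 4) x :> deriv phi1 x + deriv u x / 4"
   by (intro DERIV_add DERIV_cdivide ellpD(6)[OF ellp1 x] ellpD(6)[OF u_ellp x])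
  moreover have "deriv phi1 x + deriv u x / 4 = 0" using d[OF x] by (simp add: field_simps)
  ultimately show "DERIV (\<lambda>z. phi1 z + u z / 4) x :> 0" by simp
 qed (use z z1 in auto)
 thus thesis using that[of "phi1 z1 + u z1 / 4"] by (simp add: algebra_simps)
qed

lemma phi1_integral:
 assumes s: "seg z0 (lat a b) \<inter> HL = {}"
 shows "pint z0 (lat a b) phi1 =
  (coeff Cp (gg - 1) + (\<Sum>p\<in>Sg. coeff (bp p) (gg - 1) * fst (al p))) * (lat a b)
   - coeff Ap (gg - 1) * (eta a b)"
proof -
 have e: "phi1 = PhiF [:coeff Cp (gg - 1):] (\<lambda>p. [:coeff (bp p) (gg - 1):]) 0"
  by (simp add: fun_eq_iff phi1_def PhiF_def)
 have A: "coeff Ap (gg - 1) = (\<Sum>p\<in>Sg. coeff (bp p) (gg - 1) * snd (al p))"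
  by (simp add: Ap_def coeff_sum mult.commute)
 show ?thesis unfolding e A
  using contour_integral_unique[OF PhiF_integral[OF s, of "[:coeff Cp (gg - 1):]" "\<lambda>p. [:coeff (bp p) (gg - 1):]" 0]] by simp
qed

text \<open>The leading coefficient comes from the periods of \<open>phi1 = C - u/4\<close>, and those of \<open>u\<close> are \<open>-2N\<eta>\<^sub>1\<close> and \<open>-2N\<eta>\<^sub>2\<close> with \<open>N = DD\<close>.\<close>
lemma Ap_degree:
 assumes g: "gg \<ge> 1"
 shows "degree Ap \<le> gg - 1" "coeff Ap (gg - 1) = - of_nat DD / 2"
proof -
 show "degree Ap \<le> gg - 1" unfolding Ap_def
 proof (rule degree_sum_le[OF Sg_finite])
  fix p assume "p \<in> Sg"
  thus "degree (smult (snd (al p)) (bp p)) \<le> gg - 1" using Cp_facts(3)[of p] degree_smult_le[of "snd (al p)" "bp p"] by linarith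
 qed
 obtain z0 where z0: "seg z0 1 \<inter> HL = {}" "seg z0 \<tau> \<inter> HL = {}"
  by (rule base_point[OF half_lattice_sparse])
 obtain C where C: "\<And>z. z \<notin> HL ==> phi1 z = C - u z / 4" by (rule phi1_eq[OF g]) (rule that; blast)
 define X where "X = coeff Cp (gg - 1) + (\<Sum>p\<in>Sg. coeff (bp p) (gg - 1) * fst (al p))"
 have *: "X * (lat a b) - coeff Ap (gg - 1) * (eta a b)
  = C * (lat a b) + of_nat DD / 2 * (eta a b)"
  if s: "seg z0 (lat a b) \<inter> HL = {}" for a b
 proof -
  define w where "w = lat a b"
  have c: "((\<lambda>_. C) has_contour_integral C * (z0 + w - z0)) (linepath z0 (z0 + w))"
   by (rule has_contour_integral_const_linepath)
  have "((\<lambda>z. C - u z / 4) has_contour_integral C * (z0 + w - z0) - (- 2 * of_nat DD * (eta a b)) / 4) (linepath z0 (z0 + w))"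
   by (intro has_contour_integral_diff has_contour_integral_div c u_integral[OF s, folded w_def])
  moreover have "pint z0 w phi1 = pint z0 w (\<lambda>z. C - u z / 4)"
   by (rule contour_integral_eq) (use C s in \<open>auto simp: w_def\<close>)
  ultimately show ?thesis using phi1_integral[OF s] contour_integral_unique by (fastforce simp: w_def X_def)
 qed
 define K where "K = X - C"
 define a where "a = coeff Ap (gg - 1) + of_nat DD / 2"
 have "K = a * eta1" using *[of 1 0] z0(1) by (simp add: K_def a_def algebra_simps)
 moreover have "K * \<tau> = a * eta2" using *[of 0 1] z0(2) by (simp add: K_def a_def algebra_simps)
 ultimately have "a * (eta1 * \<tau> - eta2) = 0" by (simp add: algebra_simps)
 hence "a = 0" unfolding legendre by simp
 thus "coeff Ap (gg - 1) = - of_nat DD / 2" by (simp add: a_def eq_neg_iff_add_eq_0)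
qed

text \<open>The expansions of the periods of \<open>1/(2\<Phi>)\<close> and \<open>\<Phi>'/(2\<Phi>)\<close> at \<open>B = \<infinity>\<close>, along a segment that avoids the poles.\<close>
lemma periods_at_infinity:
 assumes g: "gg \<ge> 1" and w: "w \<in> L" and s: "seg z0 w \<inter> HL = {}"
 shows "eventually (\<lambda>B. seg z0 w \<inter> SS B = {}) at_infinity"
  "((\<lambda>B. B * (B ^ gg * hI z0 w B - w)) \<longlongrightarrow> - 2 * pint z0 w phi1) at_infinity"
  "((\<lambda>B. B ^ gg * hI z0 w B) \<longlongrightarrow> w) at_infinity"
  "eventually (\<lambda>B. lI z0 w B = 0) at_infinity"
proof -
 let ?K = "seg z0 w" and ?g = "linepath z0 (z0 + w)"
 let ?m = "\<lambda>B z. poly (Cp - monom (1/2) gg) B / B ^ (gg - 1) + (\<Sum>p\<in>Sg. poly (bp p) B / B ^ (gg - 1) * ee p z)"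
 let ?d = "\<lambda>B z. (\<Sum>p\<in>Sg. poly (bp p) B * deriv (ee p) z) / B ^ gg"
 have KHL: "?K \<subseteq> - HL" using s by auto
 have bnd: "bounded (f ` ?K)" if "f holomorphic_on - HL" for f :: "complex => complex"
  by (intro compact_imp_bounded compact_continuous_image compact_segment continuous_on_subset[OF holomorphic_on_imp_continuous_on[OF that] KHL])
 have be: "bounded (ee p ` ?K)" "bounded (deriv (ee p) ` ?K)" if "p \<in> Sg" for p using bnd ee_holo[OF that] by blast+
 have phol: "phi1 holomorphic_on - HL" unfolding phi1_def[abs_def] by (intro holomorphic_intros ee_holo)
 have dbp: "degree (bp p) \<le> gg - 1" if "p \<in> Sg" for p using Cp_facts(3)[OF that] by simp
 define \<Delta> where "\<Delta> = (\<lambda>B z. B * (Phi B z / B ^ gg - 1/2))"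
 have u1: "uniform_limit ?K \<Delta> phi1 at_infinity"
 proof -
  have "uniform_limit ?K (\<lambda>B z. ?m B z)
   (\<lambda>z. coeff (Cp - monom (1/2) gg) (gg - 1) + (\<Sum>p\<in>Sg. coeff (bp p) (gg - 1) * ee p z)) at_infinity"
  proof (rule uniform_limit_linear_combination[OF Sg_finite])
   have d: "degree (Cp - monom (1/2) gg) \<le> gg" by (intro degree_diff_le) (auto simp: gg_def degree_monom_le)
   have c: "coeff (Cp - monom (1/2) gg) gg = 0" using Cp_facts(1) by (simp add: gg_def)
   have "degree (Cp - monom (1/2) gg) \<le> gg - 1"
   proof (rule degree_le, intro allI impI)
    fix i assume "gg - 1 < i"
    hence "i = gg \<or> gg < i" by linarith
    thus "coeff (Cp - monom (1/2) gg) i = 0" using c d coeff_eq_0 by (metis le_less_trans)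
   qed
   thus "((\<lambda>x. poly (Cp - monom (1/2) gg) x / x ^ (gg - 1)) \<longlongrightarrow> coeff (Cp - monom (1/2) gg) (gg - 1)) at_infinity"
    by (rule poly_over_power_tendsto)
   show "((\<lambda>x. poly (bp p) x / x ^ (gg - 1)) \<longlongrightarrow> coeff (bp p) (gg - 1)) at_infinity" if "p \<in> Sg" for p
    by (rule poly_over_power_tendsto[OF dbp[OF that]])
  qed (rule be)
  also have "(\<lambda>z. coeff (Cp - monom (1/2) gg) (gg - 1) + (\<Sum>p\<in>Sg. coeff (bp p) (gg - 1) * ee p z)) = phi1"
   using g by (simp add: phi1_def fun_eq_iff)
  finally have *: "uniform_limit ?K (\<lambda>B z. ?m B z) phi1 at_infinity" .
  have "eventually (\<lambda>B. \<forall>z\<in>?K. ?m B z = \<Delta> B z) at_infinity"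
   using at_infinity_nonzero
  proof eventually_elim
   case (elim B)
   have eB: "B ^ gg = B ^ (gg - 1) * B" using g by (metis One_nat_def Suc_le_eq Suc_pred' mult.commute power_Suc)
   show ?case
   proof
    fix z
    have "?m B z
     = (poly Cp B - B ^ gg / 2 + (\<Sum>p\<in>Sg. poly (bp p) B * ee p z)) / B ^ (gg - 1)"
     by (simp add: poly_monom add_divide_distrib sum_divide_distrib)
    also have "\<dots> = \<Delta> B z" unfolding \<Delta>_def PhiF_def eB using elim by (simp add: field_simps)
    finally show "?m B z = \<Delta> B z" .
   qed
  qed
  from uniform_limit_cong[OF this refl] * show ?thesis by blast
 qed
 have inv: "uniform_limit ?K (\<lambda>(B::complex) z. 1 / B) (\<lambda>z. 0) at_infinity"
  by (rule uniform_limit_of_tendsto[OF inverse_at_infinity])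
 have "uniform_limit ?K (\<lambda>B z. 1/2 + 1 / B * \<Delta> B z) (\<lambda>z. 1/2 + 0 * phi1 z) at_infinity"
  by (intro uniform_limit_add uniform_limit_const uniform_lim_mult inv u1 bnd phol) (auto intro: bounded_subset[of "{0}"])
 hence u2: "uniform_limit ?K (\<lambda>B z. 1/2 + 1 / B * \<Delta> B z) (\<lambda>z. 1/2) at_infinity" by simp
 have D: "1/2 + 1 / B * \<Delta> B z = Phi B z / B ^ gg" if "B \<noteq> 0" for B z using that by (simp add: \<Delta>_def field_simps)
 have u2': "uniform_limit ?K (\<lambda>B z. Phi B z / B ^ gg) (\<lambda>z. 1/2) at_infinity"
 proof -
  have "eventually (\<lambda>B. \<forall>z\<in>?K. 1/2 + 1 / B * \<Delta> B z = Phi B z / B ^ gg) at_infinity"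
   using at_infinity_nonzero by eventually_elim (use D in blast)
  from uniform_limit_cong[OF this refl] u2 show ?thesis by blast
 qed
 have half: "(0::real) < 1/2" by simp
 have nz: "eventually (\<lambda>B. B \<noteq> 0 \<and> ?K \<inter> SS B = {}) at_infinity"
  using uniform_limitD[OF u2' half] at_infinity_nonzero
 proof eventually_elim
  case (elim B)
  have "Phi B z \<noteq> 0" if z: "z \<in> ?K" for z
  proof
   assume "Phi B z = 0"
   hence "dist (Phi B z / B ^ gg) (1/2) = 1/2" by (simp add: dist_norm norm_divide)
   thus False using elim(1) z by (metis less_irrefl zero_less_divide_1_iff zero_less_numeral)
  qed
  thus ?case using elim(2) KHL by (auto simp: SS_def)
 qed
 show n1: "eventually (\<lambda>B. ?K \<inter> SS B = {}) at_infinity" using nz by eventually_elim simp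
 have int: "f contour_integrable_on ?g" if "?K \<inter> SS B = {}" "f holomorphic_on - SS B" for f B
  by (rule contour_integrable_continuous_linepath, rule continuous_on_subset[OF holomorphic_on_imp_continuous_on[OF that(2)]])
   (use that(1) in auto)
 have sub: "f holomorphic_on - HL ==> f holomorphic_on - SS B" for f :: "complex => complex" and B
  by (rule holomorphic_on_subset) (auto simp: SS_def)
 have hP: "Phi B holomorphic_on - SS B" "deriv (Phi B) holomorphic_on - SS B" for B
  using sub ellpD(1)[OF Phi_ellp] ellpD(1)[OF ellp_deriv[OF Phi_ellp]] by blast+
 have h1: "(\<lambda>z. 1 / Phi B z) holomorphic_on - SS B" "(\<lambda>z. deriv (Phi B) z / Phi B z) holomorphic_on - SS B" for B
  by (intro holomorphic_intros hP; use SS_D(2)[of _ B] in auto)+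
 have uh: "uniform_limit ?K (\<lambda>B z. - 2 * (\<Delta> B z / (1/2 + 1 / B * \<Delta> B z))) (\<lambda>z. - 2 * (phi1 z / (1/2))) at_infinity"
 proof (rule uniform_lim_mult[OF uniform_limit_const])
  show "uniform_limit ?K (\<lambda>B z. \<Delta> B z / (1/2 + 1 / B * \<Delta> B z)) (\<lambda>z. phi1 z / (1/2)) at_infinity"
   by (rule uniform_lim_divide[OF u1 u2 bnd[OF phol] _ half]) (simp add: norm_divide)
  show "bounded ((\<lambda>a. - 2 :: complex) ` ?K)" by (rule bounded_subset[of "{- 2}"]) auto
  have "(\<lambda>a. phi1 a / (1/2)) holomorphic_on - HL" by (intro holomorphic_intros phol) simp
  thus "bounded ((\<lambda>a. phi1 a / (1/2)) ` ?K)" by (rule bnd)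
 qed
 have ev: "eventually (\<lambda>B. \<forall>z\<in>?K. - 2 * (\<Delta> B z / (1/2 + 1 / B * \<Delta> B z)) = B * (B ^ gg * (1 / Phi B z) - 2)) at_infinity"
  using nz
 proof eventually_elim
  case (elim B)
  hence B: "B \<noteq> 0" by simp
  show ?case
  proof
   fix z assume "z \<in> ?K"
   hence f: "Phi B z \<noteq> 0" using elim SS_D(2)[of z B] by blast
   show "- 2 * (\<Delta> B z / (1/2 + 1 / B * \<Delta> B z)) = B * (B ^ gg * (1 / Phi B z) - 2)"
    unfolding D[OF B] unfolding \<Delta>_def using f B by (simp add: field_simps)
  qed
 qed
 have "uniform_limit ?K (\<lambda>B z. B * (B ^ gg * (1 / Phi B z) - 2)) (\<lambda>z. - 2 * (phi1 z / (1/2))) at_infinity"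
  using uniform_limit_cong[OF ev refl] uh by blast
 moreover have ci: "((\<lambda>z. B * (B ^ gg * (1 / Phi B z) - 2)) has_contour_integral B * (B ^ gg * (2 * hI z0 w B) - 2 * w)) ?g"
  if B: "?K \<inter> SS B = {}" for B
 proof -
  have "((\<lambda>z. 1 / Phi B z) has_contour_integral 2 * hI z0 w B) ?g"
   using has_contour_integral_integral[OF int[OF B h1(1)]] by (simp add: hI_def)
  moreover have "((\<lambda>_. 2) has_contour_integral 2 * (z0 + w - z0)) ?g" by (rule has_contour_integral_const_linepath)
  ultimately have "((\<lambda>z. B * (B ^ gg * (1 / Phi B z) - 2)) has_contour_integral B * (B ^ gg * (2 * hI z0 w B) - 2 * (z0 + w - z0))) ?g"
   by (intro has_contour_integral_lmul has_contour_integral_diff)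
  thus ?thesis by simp
 qed
 ultimately have lim: "((\<lambda>B. contour_integral ?g (\<lambda>z. B * (B ^ gg * (1 / Phi B z) - 2))) \<longlongrightarrow> contour_integral ?g (\<lambda>z. - 2 * (phi1 z / (1/2)))) at_infinity"
  by (intro linepath_uniform_limit) (use n1 trivial_limit_at_infinity in \<open>auto elim!: eventually_mono simp: contour_integrable_on_def\<close>)
 have "phi1 contour_integrable_on ?g"
  by (rule contour_integrable_continuous_linepath, rule continuous_on_subset[OF holomorphic_on_imp_continuous_on[OF phol] KHL])
 hence r: "contour_integral ?g (\<lambda>z. - 2 * (phi1 z / (1/2))) = - 4 * contour_integral ?g phi1"
  using contour_integral_lmul[of phi1 ?g "- 4"] by simp
 have evh: "eventually (\<lambda>B. contour_integral ?g (\<lambda>z. B * (B ^ gg * (1 / Phi B z) - 2)) = 2 * (B * (B ^ gg * hI z0 w B - w))) at_infinity"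
  using n1
 proof eventually_elim
  case (elim B)
  show ?case unfolding contour_integral_unique[OF ci[OF elim]] by (simp add: algebra_simps)
 qed
 have "((\<lambda>B. 2 * (B * (B ^ gg * hI z0 w B - w))) \<longlongrightarrow> - 4 * contour_integral ?g phi1) at_infinity"
  by (rule tendsto_cong[OF evh, THEN iffD1, OF lim[unfolded r]])
 hence "((\<lambda>B. (1/2) * (2 * (B * (B ^ gg * hI z0 w B - w)))) \<longlongrightarrow> (1/2) * (- 4 * contour_integral ?g phi1)) at_infinity"
  by (rule tendsto_mult[OF tendsto_const])
 thus l2: "((\<lambda>B. B * (B ^ gg * hI z0 w B - w)) \<longlongrightarrow> - 2 * contour_integral ?g phi1) at_infinity" by simp
 have "((\<lambda>B. 1 / B * (B * (B ^ gg * hI z0 w B - w)) + w) \<longlongrightarrow> 0 * (- 2 * contour_integral ?g phi1) + w) at_infinity"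
  by (intro tendsto_intros inverse_at_infinity l2)
 hence l: "((\<lambda>B. 1 / B * (B * (B ^ gg * hI z0 w B - w)) + w) \<longlongrightarrow> w) at_infinity" by simp
 have evw: "eventually (\<lambda>B. 1 / B * (B * (B ^ gg * hI z0 w B - w)) + w = B ^ gg * hI z0 w B) at_infinity"
  using at_infinity_nonzero
 proof eventually_elim
  case (elim B)
  have "1 / B * (B * X) = X" for X using elim by simp
  thus ?case by (simp only: diff_add_cancel)
 qed
 show "((\<lambda>B. B ^ gg * hI z0 w B) \<longlongrightarrow> w) at_infinity" by (rule tendsto_cong[OF evw, THEN iffD1, OF l])
 \<comment> \<open>The periods of \<open>\<Phi>'/(2\<Phi>)\<close> are integral multiples of \<open>\<pi>i\<close> and tend to \<open>0\<close>.\<close>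
 have "uniform_limit ?K (\<lambda>B z. 0 + (\<Sum>p\<in>Sg. poly (bp p) B / B ^ gg * deriv (ee p) z)) (\<lambda>z. 0 + (\<Sum>p\<in>Sg. coeff (bp p) gg * deriv (ee p) z)) at_infinity"
  by (rule uniform_limit_linear_combination[OF Sg_finite tendsto_const _ be(2)])
   (rule poly_over_power_tendsto, use Cp_facts(3) in \<open>simp add: less_imp_le\<close>)
 moreover have "(\<lambda>z. 0 + (\<Sum>p\<in>Sg. coeff (bp p) gg * deriv (ee p) z)) = (\<lambda>z. 0)"
  using Cp_facts(3) by (auto simp: fun_eq_iff coeff_eq_0 intro!: sum.neutral)
 moreover have "(\<lambda>B z. 0 + (\<Sum>p\<in>Sg. poly (bp p) B / B ^ gg * deriv (ee p) z)) = (\<lambda>B z. ?d B z)"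
  by (simp add: fun_eq_iff sum_divide_distrib)
 ultimately have "uniform_limit ?K (\<lambda>B z. ?d B z) (\<lambda>z. 0) at_infinity" by simp
 hence "uniform_limit ?K (\<lambda>B z. ?d B z / (Phi B z / B ^ gg)) (\<lambda>z. 0 / (1/2)) at_infinity"
  by (rule uniform_lim_divide[OF _ u2' _ _ half]) (auto intro: bounded_subset[of "{0}"] simp: norm_divide)
 hence ul: "uniform_limit ?K (\<lambda>B z. ?d B z / (Phi B z / B ^ gg)) (\<lambda>z. 0) at_infinity" by simp
 have evd: "eventually (\<lambda>B. \<forall>z\<in>?K. ?d B z / (Phi B z / B ^ gg) = deriv (Phi B) z / Phi B z) at_infinity"
  using at_infinity_nonzero
 proof eventually_elim
  case (elim B)
  show ?case
  proof
   fix z assume "z \<in> ?K"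
   hence "z \<notin> HL" using KHL by blast
   from PhiF_deriv[OF this, of Cp bp B] elim
   show "?d B z / (Phi B z / B ^ gg) = deriv (Phi B) z / Phi B z" by simp
  qed
 qed
 have "uniform_limit ?K (\<lambda>B z. deriv (Phi B) z / Phi B z) (\<lambda>z. 0) at_infinity"
  using uniform_limit_cong[OF evd refl, THEN iffD1, OF ul] .
 hence "((\<lambda>B. contour_integral ?g (\<lambda>z. deriv (Phi B) z / Phi B z)) \<longlongrightarrow> contour_integral ?g (\<lambda>z. 0)) at_infinity"
  by (intro linepath_uniform_limit) (use n1 trivial_limit_at_infinity int[OF _ h1(2)] in \<open>auto elim!: eventually_mono\<close>)
 hence "((\<lambda>B. contour_integral ?g (\<lambda>z. deriv (Phi B) z / Phi B z) / 2) \<longlongrightarrow> 0 / 2) at_infinity"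
  by (intro tendsto_divide tendsto_const) (simp_all add: contour_integral_0)
 hence "(lI z0 w \<longlongrightarrow> 0) at_infinity" by (simp add: lI_def[abs_def])
 from tendstoD[OF this pi_gt_zero] have "eventually (\<lambda>B. norm (lI z0 w B) < pi) at_infinity" by (simp add: dist_norm)
 thus "eventually (\<lambda>B. lI z0 w B = 0) at_infinity" using n1
 proof eventually_elim
  case (elim B)
  obtain r where r: "r > 0" "\<And>B'. B' \<in> ball B r ==> ?K \<inter> SS B' = {}" by (rule tube[OF compact_segment elim(2)]) (rule that; blast)
  obtain m :: int where m: "lI z0 w B = of_int m * of_real pi * \<i>"
   using lI_discrete[of "ball B r" z0 w B] r w by auto
  have "norm (lI z0 w B) = \<bar>real_of_int m\<bar> * pi" unfolding m by (simp add: norm_mult)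
  hence "\<bar>real_of_int m\<bar> * pi < 1 * pi" using elim(1) by simp
  hence "\<bar>real_of_int m\<bar> < 1" using pi_gt_zero mult_less_cancel_right_pos by blast
  hence "m = 0" by linarith
  thus ?case using m by simp
 qed
qed

lemma chart_at_infinity:
 assumes g: "gg \<ge> 1"
 shows "\<exists>H K. eventually (\<lambda>B. \<forall>W s c. is_lift B W s c \<longrightarrow> (\<exists>a b::int. - W * H B = s + lat a b \<and> - W * K B = c + eta a b)) at_infinity
  \<and> ((\<lambda>B. B ^ (gg + 1) * H B) \<longlongrightarrow> of_nat DD) at_infinity \<and> ((\<lambda>B. B ^ gg * K B) \<longlongrightarrow> 1) at_infinity"
proof -
 obtain z0 where z0: "seg z0 1 \<inter> HL = {}" "seg z0 \<tau> \<inter> HL = {}"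
  by (rule base_point[OF half_lattice_sparse])
 note p1 = periods_at_infinity[OF g lattice_1 z0(1)] and p2 = periods_at_infinity[OF g lattice_tau z0(2)]
 define P where "P = 2 * complex_of_real pi * \<i>"
 have P0: "P \<noteq> 0" by (simp add: P_def)
 have i1: "pint z0 1 phi1 =
  (coeff Cp (gg - 1) + (\<Sum>p\<in>Sg. coeff (bp p) (gg - 1) * fst (al p))) - coeff Ap (gg - 1) * eta1"
  using phi1_integral[of z0 1 0] z0(1) by simp
 have i2: "pint z0 \<tau> phi1 =
  (coeff Cp (gg - 1) + (\<Sum>p\<in>Sg. coeff (bp p) (gg - 1) * fst (al p))) * \<tau> - coeff Ap (gg - 1) * eta2"
  using phi1_integral[of z0 0 1] z0(2) by simp
 have "((\<lambda>B. (B * (B ^ gg * hI z0 \<tau> B - \<tau>) - \<tau> * (B * (B ^ gg * hI z0 1 B - 1))) / P) \<longlongrightarrow>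
  (- 2 * pint z0 \<tau> phi1 - \<tau> * (- 2 * pint z0 1 phi1)) / P) at_infinity"
  by (intro tendsto_intros p1(2) p2(2) P0)
 moreover have "- 2 * pint z0 \<tau> phi1 - \<tau> * (- 2 * pint z0 1 phi1)
  = - 2 * coeff Ap (gg - 1) * (eta1 * \<tau> - eta2)" unfolding i1 i2 by (simp add: algebra_simps)
 moreover have "- 2 * coeff Ap (gg - 1) * (eta1 * \<tau> - eta2) / P = of_nat DD"
  unfolding legendre P_def[symmetric] Ap_degree(2)[OF g] using P0 by simp
 moreover have "(\<lambda>B. (B * (B ^ gg * hI z0 \<tau> B - \<tau>) - \<tau> * (B * (B ^ gg * hI z0 1 B - 1))) / P) = (\<lambda>B. B ^ (gg + 1) * Hc z0 B)"
  by (simp add: fun_eq_iff Hc_def P_def algebra_simps)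
 ultimately have lH: "((\<lambda>B. B ^ (gg + 1) * Hc z0 B) \<longlongrightarrow> of_nat DD) at_infinity" by simp
 have "((\<lambda>B. (eta1 * (B ^ gg * hI z0 \<tau> B) - eta2 * (B ^ gg * hI z0 1 B)) / P) \<longlongrightarrow> (eta1 * \<tau> - eta2 * 1) / P) at_infinity"
  by (intro tendsto_intros p1(3) p2(3) P0)
 moreover have "(eta1 * \<tau> - eta2 * 1) / P = 1" using legendre P0 by (simp add: P_def)
 moreover have "(\<lambda>B. (eta1 * (B ^ gg * hI z0 \<tau> B) - eta2 * (B ^ gg * hI z0 1 B)) / P) = (\<lambda>B. B ^ gg * Kc z0 B)"
  by (simp add: fun_eq_iff Kc_def P_def algebra_simps)
 ultimately have lK: "((\<lambda>B. B ^ gg * Kc z0 B) \<longlongrightarrow> 1) at_infinity" by simp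
 have "eventually (\<lambda>B. \<forall>W s c. is_lift B W s c \<longrightarrow> (\<exists>a b::int. - W * Hc z0 B = s + lat a b \<and> - W * Kc z0 B = c + eta a b)) at_infinity"
  using p1(1) p1(4) p2(1) p2(4)
 proof eventually_elim
  case (elim B)
  show ?case
  proof (intro allI impI)
   fix W s c assume l: "is_lift B W s c"
   from lift_formula[OF l elim(1,3), of 0 0] elim(2,4)
   show "\<exists>a b::int. - W * Hc z0 B = s + lat a b \<and> - W * Kc z0 B = c + eta a b"
    by (simp add: halfs_def halfc_def)
  qed
 qed
 thus ?thesis using lH lK by blast
qed

end

section \<open>Local behaviour of the composition with the Weierstrass function\<close>

text \<open>The two branches of the square root, cut along the negative and the positive axis, cover the punctured plane.\<close>
lemma even_entire_in_square:
 assumes f: "f holomorphic_on UNIV" and ev: "\<And>x. f (- x) = f x"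
 shows "\<exists>F. F holomorphic_on UNIV \<and> (\<forall>x. f x = F (x ^ 2))"
proof -
 define F where "F = (\<lambda>y. f (csqrt y))"
 have root: "f x = F y" if "x ^ 2 = y" for x y
 proof -
  have "csqrt y ^ 2 = x ^ 2" using that by simp
  hence "csqrt y = x \<or> csqrt y = - x" by (simp only: power2_eq_iff)
  thus ?thesis using ev[of x] by (auto simp: F_def)
 qed
 have comp: "(\<lambda>x. f (h x)) holomorphic_on S" if "h holomorphic_on S" for h S
  using holomorphic_on_compose_gen[OF that f] by (simp add: o_def)
 have F1: "F holomorphic_on - \<real>\<^sub>\<le>\<^sub>0" unfolding F_def by (intro comp holomorphic_on_csqrt)
 have "(\<lambda>y. f (\<i> * csqrt (- y))) holomorphic_on - (uminus ` \<real>\<^sub>\<le>\<^sub>0)"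
  by (intro comp holomorphic_intros) (metis ComplD image_eqI minus_minus)
 moreover have "(\<lambda>y. f (\<i> * csqrt (- y))) = F" using root by (auto simp: fun_eq_iff power_mult_distrib)
 ultimately have F2: "F holomorphic_on - (uminus ` \<real>\<^sub>\<le>\<^sub>0)" by simp
 have cl: "closed (uminus ` (\<real>\<^sub>\<le>\<^sub>0 :: complex set))" by (rule closed_negations) simp
 have "F holomorphic_on (- \<real>\<^sub>\<le>\<^sub>0 \<union> - (uminus ` \<real>\<^sub>\<le>\<^sub>0))"
  using F1 F2 cl by (intro holomorphic_on_Un) (auto simp: open_Compl)
 moreover have "UNIV - {0} \<subseteq> - \<real>\<^sub>\<le>\<^sub>0 \<union> - (uminus ` (\<real>\<^sub>\<le>\<^sub>0 :: complex set))"
  by (auto simp: complex_nonpos_Reals_iff complex_eq_iff)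
 ultimately have F3: "F holomorphic_on UNIV - {0}" by (rule holomorphic_on_subset)
 have "isCont F y" for y
 proof (cases "y = 0")
  case False
  have "F holomorphic_on - {0}" using F3 by (simp add: Compl_eq_Diff_UNIV)
  hence "DERIV F y :> deriv F y" by (rule holomorphic_derivI) (use False in auto)
  thus ?thesis by (rule DERIV_isCont)
 next
  case True
  have "isCont f 0" using holomorphic_derivI[OF f open_UNIV, of 0] by (intro DERIV_isCont[of f]) simp_all
  have "F \<midarrow>0\<rightarrow> F 0" unfolding LIM_def
  proof (intro allI impI)
   fix e :: real assume "e > 0"
   then obtain d where d: "d > 0" "\<And>x. norm x < d ==> dist (f x) (f 0) < e"
    using \<open>isCont f 0\<close> unfolding continuous_at_eps_delta by (auto simp: dist_norm)
   show "\<exists>s>0. \<forall>x. x \<noteq> 0 \<and> dist x 0 < s \<longrightarrow> dist (F x) (F 0) < e"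
   proof (intro exI[of _ "d ^ 2"] conjI allI impI)
    fix x :: complex assume x: "x \<noteq> 0 \<and> dist x 0 < d ^ 2"
    have "norm (csqrt x) ^ 2 = norm x" by (metis norm_power power2_csqrt)
    hence "norm (csqrt x) ^ 2 < d ^ 2" using x by simp
    hence "norm (csqrt x) < d" using d(1) by (meson less_imp_le power_less_imp_less_base)
    from d(2)[OF this] show "dist (F x) (F 0) < e" by (simp add: F_def)
   qed (use d in simp)
  qed
  thus ?thesis by (simp add: True isCont_def)
 qed
 hence "continuous_on UNIV F" by (simp add: continuous_at_imp_continuous_on)
 hence "F holomorphic_on UNIV" by (rule no_isolated_singularity[OF _ F3]) auto
 thus ?thesis using root by blast
qed

lemma log_deriv_product:
 fixes d h h' p y c :: complex
 assumes "y \<noteq> 0" "p \<noteq> 0" "h \<noteq> 0" "d * y = (c * h + h' * y) * p"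
 shows "d / (2 * (p * h)) = c / (2 * y) + h' / (2 * h)"
proof -
 have "d = (c * h + h' * y) * p / y" using assms(1,4) by (simp add: eq_divide_imp)
 thus ?thesis using assms(1-3) by (simp add: field_simps)
qed

context lame begin

text \<open>At a half period, \<open>\<sigma>\<close> times this exponential is even or odd, so its square is a function of \<open>x\<^sup>2\<close>.\<close>
definition Ef :: "int => int => complex => complex" where
 "Ef m1 m2 x = wsigma \<tau> (halfs m1 m2 + x) * exp (- (halfc m1 m2) * x)"

lemma Ef_facts:
 shows "Ef m1 m2 holomorphic_on UNIV"
  and "Ef m1 m2 x = 0 \<longleftrightarrow> halfs m1 m2 + x \<in> L"
  and "\<exists>\<kappa>. \<kappa> ^ 2 = 1 \<and> (\<forall>x. Ef m1 m2 (- x) = \<kappa> * Ef m1 m2 x)"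
  and "deriv (Ef m1 m2) x = (deriv (wsigma \<tau>) (halfs m1 m2 + x) - halfc m1 m2 * wsigma \<tau> (halfs m1 m2 + x)) * exp (- (halfc m1 m2) * x)"
proof -
 let ?s = "halfs m1 m2" and ?c = "halfc m1 m2"
 show holo: "Ef m1 m2 holomorphic_on UNIV" unfolding Ef_def[abs_def] by (intro holomorphic_intros)
 show zero: "Ef m1 m2 x = 0 \<longleftrightarrow> ?s + x \<in> L" for x by (simp add: Ef_def wsigma_zero_iff)
 have dx: "DERIV (\<lambda>x. ?s + x) x :> 1" using DERIV_add[OF DERIV_const DERIV_ident] by simp
 have d1: "DERIV (\<lambda>x. wsigma \<tau> (?s + x)) x :> deriv (wsigma \<tau>) (?s + x) * 1" by (rule wsigma_deriv[OF dx])
 have "DERIV (\<lambda>x. - ?c * x) x :> - ?c * 1" by (rule DERIV_cmult[OF DERIV_ident])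
 from DERIV_mult[OF d1 DERIV_fun_exp[OF this]]
 have "DERIV (Ef m1 m2) x :> (deriv (wsigma \<tau>) (?s + x) * 1) * exp (- ?c * x) + (exp (- ?c * x) * (- ?c * 1)) * wsigma \<tau> (?s + x)"
  by (simp add: Ef_def[abs_def])
 from DERIV_imp_deriv[OF this]
 show "deriv (Ef m1 m2) x = (deriv (wsigma \<tau>) (?s + x) - ?c * wsigma \<tau> (?s + x)) * exp (- ?c * x)" by (simp add: algebra_simps)
 define w where "w = lat (- m2) m1"
 define h where "h = eta (- m2) m1"
 have w: "w = - 2 * ?s" and h: "h = - 2 * ?c" by (simp_all add: w_def h_def halfs_def halfc_def)
 obtain C where C: "\<And>z. wsigma \<tau> (z + w) = C * exp (h * z) * wsigma \<tau> z"
  unfolding w_def h_def using wsigma_quasi[of "- m2" m1] by metis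
 define \<kappa> where "\<kappa> = - (C * exp (h * ?s))"
 have par: "Ef m1 m2 (- x) = \<kappa> * Ef m1 m2 x" for x
 proof -
  have e: "?s + - x = - (?s + x + w)" by (simp add: w)
  have "Ef m1 m2 (- x) = - (wsigma \<tau> (?s + x + w)) * exp (?c * x)" unfolding Ef_def e wsigma_odd by simp
  also have "\<dots> = - (C * exp (h * ?s)) * (exp (h * x) * exp (?c * x)) * wsigma \<tau> (?s + x)"
   unfolding C by (simp add: distrib_left exp_add)
  also have "exp (h * x) * exp (?c * x) = exp (- ?c * x)" by (simp add: h exp_add[symmetric] algebra_simps)
  finally show ?thesis by (simp add: Ef_def \<kappa>_def)
 qed
 obtain x0 where x0: "?s + x0 \<notin> L"
 proof -
  obtain z where "z \<notin> HL" using Phi_nontrivial by blast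
  hence "z \<notin> L" using half_lattice_not_lattice by blast
  hence "?s + (z - ?s) \<notin> L" by simp
  thus thesis by (rule that)
 qed
 have "Ef m1 m2 x0 = \<kappa> * (\<kappa> * Ef m1 m2 x0)" using par[of "- x0"] par[of x0] by simp
 hence "\<kappa> ^ 2 = 1" using zero[of x0] x0 by (simp add: power2_eq_square)
 thus "\<exists>\<kappa>. \<kappa> ^ 2 = 1 \<and> (\<forall>x. Ef m1 m2 (- x) = \<kappa> * Ef m1 m2 x)" using par by blast
qed

lemma Ef_log_deriv:
 assumes "halfs m1 m2 + x \<notin> L"
 shows "deriv (Ef m1 m2) x = Ef m1 m2 x * (wzeta (halfs m1 m2 + x) - halfc m1 m2)"
  and "(deriv (Ef m1 m2) x) ^ 2 - Ef m1 m2 x * deriv (deriv (Ef m1 m2)) x = wp \<tau> (halfs m1 m2 + x) * Ef m1 m2 x ^ 2"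
proof -
 let ?s = "halfs m1 m2" and ?c = "halfc m1 m2" and ?E = "Ef m1 m2"
 have d: "deriv ?E y = ?E y * (wzeta (?s + y) - ?c)" if "?s + y \<notin> L" for y
  unfolding Ef_facts(4) using that by (simp add: Ef_def wzeta_def wsigma_zero_iff field_simps)
 show "deriv ?E x = ?E x * (wzeta (?s + x) - ?c)" by (rule d[OF assms])
 have op: "open {y. ?s + y \<notin> L}"
 proof -
  have "{y. ?s + y \<notin> L} = (\<lambda>y. ?s + y) -` (- L)" by auto
  also have "open \<dots>" by (rule open_vimage) (use lattice_closed in \<open>auto simp: open_Compl intro!: continuous_intros\<close>)
  finally show ?thesis .
 qed
 have "eventually (\<lambda>y. y \<in> {y. ?s + y \<notin> L}) (nhds x)" by (rule eventually_nhds_in_open[OF op]) (use assms in simp)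
 hence "eventually (\<lambda>y. deriv ?E y = ?E y * (wzeta (?s + y) - ?c)) (nhds x)" by eventually_elim (use d in simp)
 hence "deriv (deriv ?E) x = deriv (\<lambda>y. ?E y * (wzeta (?s + y) - ?c)) x" by (intro deriv_cong_ev refl)
 also have "\<dots> = deriv ?E x * (wzeta (?s + x) - ?c) + (- wp \<tau> (?s + x) * (0 + 1) - 0) * ?E x"
 proof (rule DERIV_imp_deriv, rule DERIV_mult)
  show "DERIV ?E x :> deriv ?E x" by (rule holomorphic_derivI[OF Ef_facts(1) open_UNIV]) simp
  show "DERIV (\<lambda>y. wzeta (?s + y) - ?c) x :> - wp \<tau> (?s + x) * (0 + 1) - 0"
   by (intro DERIV_diff DERIV_const DERIV_chain2[where f = wzeta and g = "\<lambda>y. ?s + y", OF wzeta_deriv[OF assms]] DERIV_add DERIV_ident)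
 qed
 finally have dd: "deriv (deriv ?E) x = deriv ?E x * (wzeta (?s + x) - ?c) + (- wp \<tau> (?s + x) * (0 + 1) - 0) * ?E x" .
 show "(deriv ?E x) ^ 2 - ?E x * deriv (deriv ?E) x = wp \<tau> (?s + x) * ?E x ^ 2"
  unfolding dd d[OF assms] by (simp add: power2_eq_square algebra_simps)
qed

text \<open>One of the two points over \<open>B\<close>, and a lift at it.\<close>
definition Wr :: "complex => complex" where "Wr B = csqrt (poly Qp B)"
definition sB :: "complex => complex" where "sB B = fst (SOME q. is_lift B (Wr B) (fst q) (snd q))"
definition cB :: "complex => complex" where "cB B = snd (SOME q. is_lift B (Wr B) (fst q) (snd q))"

lemma Wr: "Wr B ^ 2 = poly Qp B" by (simp add: Wr_def)

lemma lift_B: "is_lift B (Wr B) (sB B) (cB B)"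
proof -
 have "\<exists>q. is_lift B (Wr B) (fst q) (snd q)" using lift_exists[OF Wr] by auto
 from someI_ex[OF this] show ?thesis by (simp add: sB_def cB_def)
qed

text \<open>The value of \<open>\<wp>\<close> at the lift, and the function \<open>TT\<close> whose residues count the poles of \<open>RR\<close>. Neither depends on the choice of the lift or on the
 sign of \<open>W\<close>.\<close>
definition RR :: "complex => complex" where "RR B = wp \<tau> (sB B)"
definition TT :: "complex => complex" where "TT B = - (cB B - wzeta (sB B)) * poly Ap B / Wr B"

lemma lattice_translate:
 assumes "s1 = s + lat a b" "c1 = c + eta a b"
 shows "s1 \<in> L \<longleftrightarrow> s \<in> L" "s \<notin> L ==> wp \<tau> s1 = wp \<tau> s" "s \<notin> L ==> c1 - wzeta s1 = c - wzeta s"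
proof -
 show "s1 \<in> L \<longleftrightarrow> s \<in> L" unfolding assms by (rule lattice_add_iff[OF lattice_I])
 show "s \<notin> L ==> wp \<tau> s1 = wp \<tau> s" unfolding assms by (rule wp_periodic[OF lattice_I])
 show "s \<notin> L ==> c1 - wzeta s1 = c - wzeta s" unfolding assms wzeta_quasi by simp
qed

text \<open>For \<open>x = -WH\<close> and the function \<open>E\<close> given by \<open>Ef\<close>, \<open>E\<^sup>2\<close> and \<open>E'\<^sup>2 - EE'' = \<wp>E\<^sup>2\<close> are functions of \<open>x\<^sup>2 = QH\<^sup>2\<close> and thus holomorphic in \<open>B\<close>; their
 quotient is \<open>RR\<close>. The first one is \<open>g\<close>. It does not vanish identically, because the lift is not locally constant.\<close>
lemma local_model:
 assumes A0: "Ap \<noteq> 0"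
 shows "\<exists>r g m k. r > 0 \<and> g holomorphic_on ball b r \<and> m holomorphic_on ball b r \<and> k holomorphic_on ball b r \<and>
  (\<forall>B\<in>ball b r. (g B = 0 \<longleftrightarrow> sB B \<in> L) \<and> (g B \<noteq> 0 \<longrightarrow> RR B = m B / g B) \<and> (g B = 0 \<longrightarrow> m B \<noteq> 0) \<and>
   (g B \<noteq> 0 \<and> poly Qp B \<noteq> 0 \<longrightarrow> TT B = k B - deriv g B / (2 * g B))) \<and>
  (\<exists>B\<in>ball b r. g B \<noteq> 0)"
proof -
 obtain r H H' K m1 m2 where r: "r > 0" and dH: "\<And>B. B \<in> ball b r ==> DERIV H B :> H' B"
  and eq: "\<And>B. B \<in> ball b r ==> poly (pderiv Qp) B / 2 * H B + poly Qp B * H' B = poly Ap B"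
  and K: "K holomorphic_on ball b r"
  and lift: "\<And>B W s c. B \<in> ball b r ==> is_lift B W s c ==> \<exists>a b::int.
   halfs m1 m2 - W * H B = s + lat a b \<and> halfc m1 m2 - W * K B = c + eta a b"
  by (rule chart[of b]) (rule that; blast)
 let ?s = "halfs m1 m2" and ?c = "halfc m1 m2" and ?U = "ball b r"
 define E where "E = Ef m1 m2"
 define x where "x = (\<lambda>B. - (Wr B * H B))"
 obtain \<kappa> where k: "\<kappa> ^ 2 = 1" "\<And>x. E (- x) = \<kappa> * E x" using Ef_facts(3)[of m1 m2] by (auto simp: E_def)
 have hE: "E holomorphic_on UNIV" unfolding E_def by (rule Ef_facts(1))
 have dE: "DERIV E y :> deriv E y" "DERIV (deriv E) y :> deriv (deriv E) y" for y
  using holomorphic_derivI[OF hE open_UNIV] holomorphic_derivI[OF holomorphic_deriv[OF hE open_UNIV] open_UNIV] by simp_all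
 have neg: "DERIV (\<lambda>x. f (- x)) y :> - f' (- y)"
  if "\<And>y. DERIV f y :> f' y" for f f' :: "complex => complex" and y
 proof -
  have "DERIV (\<lambda>x. f (- x)) y :> f' (- y) * - 1"
   by (rule DERIV_chain2[where f = f and g = uminus, OF that]) (rule DERIV_minus[OF DERIV_ident])
  thus ?thesis by simp
 qed
 have k1: "deriv E (- y) = - \<kappa> * deriv E y" for y
 proof -
  have "DERIV (\<lambda>x. E (- x)) y :> \<kappa> * deriv E y" unfolding k(2) by (rule DERIV_cmult[OF dE(1)])
  from DERIV_unique[OF this neg[OF dE(1)]] show ?thesis by simp
 qed
 have k2: "deriv (deriv E) (- y) = \<kappa> * deriv (deriv E) y" for y
 proof -
  have "DERIV (\<lambda>x. deriv E (- x)) y :> - \<kappa> * deriv (deriv E) y" unfolding k1 by (rule DERIV_cmult[OF dE(2)])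
  from DERIV_unique[OF this neg[OF dE(2)]] show ?thesis by simp
 qed
 define M where "M = (\<lambda>y. (deriv E y) ^ 2 - E y * deriv (deriv E) y)"
 have "\<exists>F. F holomorphic_on UNIV \<and> (\<forall>y. E y ^ 2 = F (y ^ 2))"
 proof (rule even_entire_in_square[of "\<lambda>y. E y ^ 2"])
  show "(\<lambda>y. E y ^ 2) holomorphic_on UNIV" by (intro holomorphic_intros hE)
  show "E (- y) ^ 2 = E y ^ 2" for y unfolding k(2) power_mult_distrib k(1) by simp
 qed
 then obtain FE where FE: "FE holomorphic_on UNIV" "\<And>y. E y ^ 2 = FE (y ^ 2)" by blast
 have "\<exists>F. F holomorphic_on UNIV \<and> (\<forall>y. M y = F (y ^ 2))"
 proof (rule even_entire_in_square[of M])
  show "M holomorphic_on UNIV" unfolding M_def by (intro holomorphic_intros hE holomorphic_deriv open_UNIV)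
  show "M (- y) = M y" for y
  proof -
   have "M (- y) = \<kappa> ^ 2 * M y" unfolding M_def k(2) k1 k2 by (simp add: power2_eq_square algebra_simps)
   thus ?thesis by (simp add: k(1))
  qed
 qed
 then obtain FM where FM: "FM holomorphic_on UNIV" "\<And>y. M y = FM (y ^ 2)" by blast
 \<comment> \<open>The derivative of \<open>E\<^sup>2 = FE(x\<^sup>2)\<close>, without a division by \<open>x\<close>.\<close>
 have FE': "E y * deriv E y = y * deriv FE (y ^ 2)" for y
 proof -
  have "DERIV (\<lambda>y. E y ^ 2) y :> deriv E y * E y + deriv E y * E y"
   unfolding power2_eq_square by (rule DERIV_mult[OF dE(1) dE(1)])
  moreover have "DERIV (\<lambda>y. FE (y ^ 2)) y :> deriv FE (y ^ 2) * (1 * y + 1 * y)"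
   unfolding power2_eq_square
   by (rule DERIV_chain2[where f = FE and g = "\<lambda>y. y * y", OF holomorphic_derivI[OF FE(1) open_UNIV UNIV_I] DERIV_mult[OF DERIV_ident DERIV_ident]])
  ultimately have "deriv E y * E y + deriv E y * E y = deriv FE (y ^ 2) * (1 * y + 1 * y)"
   unfolding FE(2) by (rule DERIV_unique)
  thus ?thesis by (simp add: algebra_simps)
 qed
 define q where "q = (\<lambda>B. poly Qp B * H B * H B)"
 have xq: "x B ^ 2 = q B" for B using Wr[of B] by (simp add: x_def q_def power2_eq_square)
 have dq: "DERIV q B :> 2 * H B * poly Ap B" if B: "B \<in> ?U" for B
 proof -
  have "DERIV q B :> (poly (pderiv Qp) B * H B + H' B * poly Qp B) * H B + H' B * (poly Qp B * H B)"
   unfolding q_def by (intro DERIV_mult poly_DERIV dH B)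
  moreover have "(poly (pderiv Qp) B * H B + H' B * poly Qp B) * H B + H' B * (poly Qp B * H B) = 2 * H B * poly Ap B"
   unfolding eq[OF B, symmetric] by (simp add: algebra_simps)
  ultimately show ?thesis by simp
 qed
 have hq: "q holomorphic_on ?U" by (rule holomorphic_onI_deriv[OF open_ball dq])
 define g where "g = (\<lambda>B. FE (q B))"
 have gE: "g B = E (x B) ^ 2" for B unfolding g_def FE(2) xq ..
 have dg: "deriv g B = deriv FE (q B) * (2 * H B * poly Ap B)" if B: "B \<in> ?U" for B
  unfolding g_def by (rule DERIV_imp_deriv, rule DERIV_chain2[where f = FE and g = q, OF holomorphic_derivI[OF FE(1) open_UNIV UNIV_I] dq[OF B]])
 have trans: "?s + x B \<in> L \<longleftrightarrow> sB B \<in> L" "sB B \<notin> L ==> wp \<tau> (?s + x B) = RR B"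
  "sB B \<notin> L ==> (?c - Wr B * K B) - wzeta (?s + x B) = cB B - wzeta (sB B)" if B: "B \<in> ?U" for B
 proof -
  obtain a b :: int where ab: "?s - Wr B * H B = sB B + lat a b" "?c - Wr B * K B = cB B + eta a b"
   using lift[OF B lift_B] by blast
  have sx: "?s + x B = ?s - Wr B * H B" by (simp add: x_def)
  show "?s + x B \<in> L \<longleftrightarrow> sB B \<in> L" "sB B \<notin> L ==> wp \<tau> (?s + x B) = RR B"
   "sB B \<notin> L ==> (?c - Wr B * K B) - wzeta (?s + x B) = cB B - wzeta (sB B)"
   unfolding sx RR_def using lattice_translate[OF ab] by blast+
 qed
 have g0: "g B = 0 \<longleftrightarrow> sB B \<in> L" if B: "B \<in> ?U" for B
  unfolding gE using trans(1)[OF B] by (simp add: E_def Ef_facts(2))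
 have hg: "g holomorphic_on ?U" unfolding g_def using holomorphic_on_compose_gen[OF hq FE(1)] by (simp add: o_def)
 have hm: "(\<lambda>B. FM (q B)) holomorphic_on ?U" using holomorphic_on_compose_gen[OF hq FM(1)] by (simp add: o_def)
 have mM: "FM (q B) = M (x B)" for B unfolding FM(2) xq ..
 have n0: "\<exists>B\<in>?U. g B \<noteq> 0"
 proof (rule ccontr)
  assume "\<not> ?thesis"
  hence allL: "?s + x B \<in> L" if "B \<in> ?U" for B using that g0 trans(1) by blast
  have "countable L" using sparse_imp_countable[OF open_UNIV lattice_sparse] by simp
  moreover have "q ` ?U \<subseteq> (\<lambda>l. (l - ?s) ^ 2) ` L"
  proof
   fix v assume "v \<in> q ` ?U"
   then obtain B where B: "B \<in> ?U" "v = q B" by blast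
   have "v = ((?s + x B) - ?s) ^ 2" by (simp add: B(2) xq)
   thus "v \<in> (\<lambda>l. (l - ?s) ^ 2) ` L" using allL[OF B(1)] by blast
  qed
  ultimately have "countable (q ` ?U)" by (meson countable_image countable_subset)
  moreover have "connected (q ` ?U)" by (intro connected_continuous_image holomorphic_on_imp_continuous_on hq) simp
  ultimately have qc: "q B = q b" if "B \<in> ?U" for B
   using connected_uncountable[of "q ` ?U" "q B" "q b"] that r by force
  define S where "S = ?U - {B. poly Ap B = 0}"
  have fin: "finite {B. poly Ap B = 0}" by (rule poly_roots_finite[OF A0])
  have oS: "open S" unfolding S_def by (intro open_Diff open_ball finite_imp_closed fin)
  have "infinite ?U" using uncountable_ball[OF r] countable_finite by blast
  hence "S \<noteq> {}" using fin unfolding S_def by (metis Diff_eq_empty_iff finite_subset)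
  then obtain B where B: "B \<in> S" by blast
  have H0: "H B' = 0" if B': "B' \<in> S" for B'
  proof -
   have B'U: "B' \<in> ?U" using B' by (simp add: S_def)
   have "eventually (\<lambda>B. B \<in> ?U) (nhds B')" by (rule eventually_nhds_in_open[OF open_ball B'U])
   hence "eventually (\<lambda>B. q B = q b) (nhds B')" by eventually_elim (rule qc)
   hence "deriv q B' = deriv (\<lambda>_. q b) B'" by (intro deriv_cong_ev refl)
   hence "2 * H B' * poly Ap B' = 0" using DERIV_imp_deriv[OF dq[OF B'U]] by simp
   thus ?thesis using B' by (simp add: S_def)
  qed
  have "eventually (\<lambda>B. B \<in> S) (nhds B)" by (rule eventually_nhds_in_open[OF oS B])
  hence "eventually (\<lambda>B. H B = 0) (nhds B)" by eventually_elim (rule H0)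
  hence "deriv H B = deriv (\<lambda>_. 0) B" by (intro deriv_cong_ev refl)
  hence "H' B = 0" using DERIV_imp_deriv[OF dH[of B]] B by (simp add: S_def)
  thus False using eq[of B] H0[OF B] B by (simp add: S_def)
 qed
 have hk: "(\<lambda>B. K B * poly Ap B) holomorphic_on ?U" by (intro holomorphic_intros K)
 have c1: "RR B = FM (q B) / g B" if B: "B \<in> ?U" and g: "g B \<noteq> 0" for B
 proof -
  have nL: "sB B \<notin> L" "?s + x B \<notin> L" using g0[OF B] trans(1)[OF B] g by blast+
  have "FM (q B) = RR B * g B" unfolding mM gE M_def E_def Ef_log_deriv(2)[OF nL(2)] trans(2)[OF B nL(1)] ..
  thus ?thesis using g by simp
 qed
 have c2: "FM (q B) \<noteq> 0" if B: "B \<in> ?U" and g: "g B = 0" for B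
 proof -
  have inL: "?s + x B \<in> L" using g0[OF B] trans(1)[OF B] g by blast
  have z: "E (x B) = 0" using g by (simp add: gE)
  have "wsigma \<tau> (?s + x B) = 0" using inL by (simp add: wsigma_zero_iff)
  hence "deriv E (x B) \<noteq> 0" unfolding E_def Ef_facts(4) using wsigma_deriv_lattice[OF inL] by simp
  thus ?thesis unfolding mM M_def z by simp
 qed
 have c3: "TT B = K B * poly Ap B - deriv g B / (2 * g B)" if B: "B \<in> ?U" and g: "g B \<noteq> 0" and Q: "poly Qp B \<noteq> 0" for B
 proof -
  have nL: "sB B \<notin> L" "?s + x B \<notin> L" using g0[OF B] trans(1)[OF B] g by blast+
  have W: "Wr B \<noteq> 0" using Q Wr[of B] by auto
  define Z where "Z = wzeta (?s + x B) - ?c"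
  have "Wr B * deriv g B = - 2 * poly Ap B * (x B * deriv FE (x B ^ 2))" unfolding dg[OF B] xq by (simp add: x_def)
  also have "\<dots> = - 2 * poly Ap B * (E (x B) * (E (x B) * Z))"
   unfolding FE'[symmetric] Z_def using Ef_log_deriv(1)[OF nL(2)] by (simp add: E_def)
  also have "\<dots> = - 2 * poly Ap B * Z * g B" by (simp add: gE power2_eq_square)
  finally have "deriv g B / (2 * g B) = - (poly Ap B * Z / Wr B)" using W g by (simp add: field_simps)
  moreover have "TT B = K B * poly Ap B + poly Ap B * Z / Wr B"
   unfolding TT_def trans(3)[OF B nL(1), symmetric] Z_def using W by (simp add: field_simps)
  ultimately show ?thesis by simp
 qed
 show ?thesis
 proof (rule exI[of _ r], rule exI[of _ g], rule exI[of _ "\<lambda>B. FM (q B)"], rule exI[of _ "\<lambda>B. K B * poly Ap B"], intro conjI ballI impI)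
  show "r > 0" by (rule r)
  show "g holomorphic_on ?U" by (rule hg)
  show "(\<lambda>B. FM (q B)) holomorphic_on ?U" by (rule hm)
  show "(\<lambda>B. K B * poly Ap B) holomorphic_on ?U" by (rule hk)
  show "\<exists>B\<in>?U. g B \<noteq> 0" by (rule n0)
  fix B assume B: "B \<in> ?U"
  show "g B = 0 \<longleftrightarrow> sB B \<in> L" by (rule g0[OF B])
  show "RR B = FM (q B) / g B" if "g B \<noteq> 0" by (rule c1[OF B that])
  show "FM (q B) \<noteq> 0" if "g B = 0" by (rule c2[OF B that])
  show "TT B = K B * poly Ap B - deriv g B / (2 * g B)" if "g B \<noteq> 0 \<and> poly Qp B \<noteq> 0" using c3[OF B] that by blast
 qed
qed

text \<open>A power of \<open>B - b\<close> splits off from the denominator \<open>g\<close> of \<open>RR\<close>. Its exponent \<open>o'\<close> is the order of the pole, and it enters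
 \<open>TT\<close> through \<open>g'/(2g)\<close>.\<close>
lemma local_orders:
 assumes A0: "Ap \<noteq> 0"
 shows "\<exists>(o'::nat) r \<rho> t. r > 0 \<and> \<rho> holomorphic_on ball b r \<and> t holomorphic_on ball b r \<and>
  (\<forall>B\<in>ball b r. B \<noteq> b \<longrightarrow> sB B \<notin> L \<and> RR B * (B - b) ^ o' = \<rho> B \<and>
   (poly Qp B \<noteq> 0 \<longrightarrow> TT B + of_nat o' / (2 * (B - b)) = t B)) \<and>
  (o' = 0 \<longleftrightarrow> sB b \<notin> L) \<and> (o' = 0 \<longrightarrow> RR b = \<rho> b) \<and> (o' > 0 \<longrightarrow> \<rho> b \<noteq> 0) \<and>
  (o' = 0 \<longrightarrow> poly Qp b \<noteq> 0 \<longrightarrow> TT b = t b)"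
proof -
 obtain r g m k where r: "r > 0" and hg: "g holomorphic_on ball b r" and hm: "m holomorphic_on ball b r" and hk: "k holomorphic_on ball b r"
  and g0: "\<And>B. B \<in> ball b r ==> g B = 0 \<longleftrightarrow> sB B \<in> L"
  and R: "\<And>B. B \<in> ball b r ==> g B \<noteq> 0 ==> RR B = m B / g B"
  and m0: "\<And>B. B \<in> ball b r ==> g B = 0 ==> m B \<noteq> 0"
  and T: "\<And>B. B \<in> ball b r ==> g B \<noteq> 0 ==> poly Qp B \<noteq> 0 ==> TT B = k B - deriv g B / (2 * g B)"
  and n0: "\<exists>B\<in>ball b r. g B \<noteq> 0"
  using local_model[OF A0, of b] by blast
 have bb: "b \<in> ball b r" using r by simp
 have "\<exists>n r' h. r' > 0 \<and> ball b r' \<subseteq> ball b r \<and> h holomorphic_on ball b r' \<and> (\<forall>B\<in>ball b r'. g B = (B - b) ^ n * h B \<and> h B \<noteq> 0)"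
 proof (cases "g b = 0")
  case True
  have "\<not> g constant_on ball b r" using n0 True bb unfolding constant_on_def by metis
  from holomorphic_factor_zero_nonconstant[OF hg open_ball connected_ball bb True this]
  show ?thesis by metis
 next
  case False
  have "isCont g b" using holomorphic_derivI[OF hg open_ball bb] by (rule DERIV_isCont)
  from continuous_at_avoid[OF this False] obtain e where e: "e > 0" "\<And>B. dist b B < e ==> g B \<noteq> 0" by (auto simp: dist_commute)
  show ?thesis
   by (rule exI[of _ 0], rule exI[of _ "min r e"], rule exI[of _ g]) (use r e hg in \<open>auto intro: holomorphic_on_subset\<close>)
 qed
 then obtain n r' h where r': "r' > 0" "ball b r' \<subseteq> ball b r" and hh: "h holomorphic_on ball b r'"
  and f: "\<And>B. B \<in> ball b r' ==> g B = (B - b) ^ n * h B" and hn: "\<And>B. B \<in> ball b r' ==> h B \<noteq> 0" by blast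
 have bb': "b \<in> ball b r'" using r'(1) by simp
 have hm': "m holomorphic_on ball b r'" and hk': "k holomorphic_on ball b r'"
  using hm hk r'(2) holomorphic_on_subset by blast+
 define \<rho> where "\<rho> = (\<lambda>B. m B / h B)"
 define t where "t = (\<lambda>B. k B - deriv h B / (2 * h B))"
 have gb: "g b = 0 \<longleftrightarrow> n > 0" using f[OF bb'] hn[OF bb'] by (cases n) auto
 have main: "sB B \<notin> L \<and> RR B * (B - b) ^ n = \<rho> B \<and> (poly Qp B \<noteq> 0 \<longrightarrow> TT B + of_nat n / (2 * (B - b)) = t B)"
  if B: "B \<in> ball b r'" and nb: "B \<noteq> b" for B
 proof -
  have Br: "B \<in> ball b r" using B r'(2) by blast
  have gn: "g B \<noteq> 0" using f[OF B] hn[OF B] nb by simp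
  have "RR B * (B - b) ^ n = \<rho> B" unfolding R[OF Br gn] f[OF B] \<rho>_def using nb hn[OF B] by simp
  moreover have "TT B + of_nat n / (2 * (B - b)) = t B" if Q: "poly Qp B \<noteq> 0"
  proof -
   have "eventually (\<lambda>B. B \<in> ball b r') (nhds B)" by (rule eventually_nhds_in_open[OF open_ball B])
   hence "eventually (\<lambda>B. g B = (B - b) ^ n * h B) (nhds B)" by eventually_elim (rule f)
   hence "deriv g B = deriv (\<lambda>B. (B - b) ^ n * h B) B" by (intro deriv_cong_ev refl)
   also have "\<dots> = (of_nat n * (B - b) ^ (n - 1)) * h B + deriv h B * (B - b) ^ n"
   proof (rule DERIV_imp_deriv, rule DERIV_mult)
    show "DERIV (\<lambda>B. (B - b) ^ n) B :> of_nat n * (B - b) ^ (n - 1)"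
     by (auto intro!: derivative_eq_intros)
    show "DERIV h B :> deriv h B" by (rule holomorphic_derivI[OF hh open_ball B])
   qed
   finally have dg: "deriv g B = (of_nat n * (B - b) ^ (n - 1)) * h B + deriv h B * (B - b) ^ n" .
   have e: "of_nat n * (B - b) ^ n = of_nat n * (B - b) ^ (n - 1) * (B - b)" by (cases n) auto
   have "deriv g B * (B - b) = (of_nat n * (B - b) ^ (n - 1) * (B - b)) * h B + deriv h B * (B - b) * (B - b) ^ n"
    unfolding dg by (simp add: algebra_simps)
   also have "\<dots> = (of_nat n * h B + deriv h B * (B - b)) * (B - b) ^ n"
    unfolding e[symmetric] by (simp add: algebra_simps)
   finally have "deriv g B * (B - b) = (of_nat n * h B + deriv h B * (B - b)) * (B - b) ^ n" .
   hence "deriv g B / (2 * g B) = of_nat n / (2 * (B - b)) + deriv h B / (2 * h B)"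
    unfolding f[OF B] by (intro log_deriv_product hn[OF B]) (use nb in auto)
   thus ?thesis using T[OF Br gn Q] by (simp add: t_def)
  qed
  ultimately show ?thesis using g0[OF Br] gn by blast
 qed
 have f1: "\<rho> holomorphic_on ball b r'" unfolding \<rho>_def by (intro holomorphic_intros hm' hh hn)
 have f2: "t holomorphic_on ball b r'" unfolding t_def
  by (intro holomorphic_intros hk' hh holomorphic_deriv open_ball) (use hn in auto)
 have f3: "n = 0 \<longleftrightarrow> sB b \<notin> L" using gb g0[OF bb] by auto
 have f4: "n = 0 \<longrightarrow> RR b = \<rho> b"
 proof
  assume n: "n = 0"
  hence "g b \<noteq> 0" using gb by simp
  from R[OF bb this] show "RR b = \<rho> b" using f[OF bb'] n by (simp add: \<rho>_def)
 qed
 have f5: "n > 0 \<longrightarrow> \<rho> b \<noteq> 0" using gb m0[OF bb] hn[OF bb'] by (simp add: \<rho>_def)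
 have f7: "n = 0 \<longrightarrow> poly Qp b \<noteq> 0 \<longrightarrow> TT b = t b"
 proof (intro impI)
  assume n: "n = 0" and Q: "poly Qp b \<noteq> 0"
  have gb0: "g b \<noteq> 0" using gb n by simp
  have "eventually (\<lambda>B. B \<in> ball b r') (nhds b)" by (rule eventually_nhds_in_open[OF open_ball bb'])
  hence "eventually (\<lambda>B. g B = h B) (nhds b)" by eventually_elim (use f n in simp)
  hence "deriv g b = deriv h b" by (intro deriv_cong_ev refl)
  thus "TT b = t b" using T[OF bb gb0 Q] f[OF bb'] n by (simp add: t_def)
 qed
 have f6: "\<forall>B\<in>ball b r'. B \<noteq> b \<longrightarrow> sB B \<notin> L \<and> RR B * (B - b) ^ n = \<rho> B \<and> (poly Qp B \<noteq> 0 \<longrightarrow> TT B + of_nat n / (2 * (B - b)) = t B)"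
  using main by simp
 show ?thesis
  by (rule exI[of _ n], rule exI[of _ r'], rule exI[of _ \<rho>], rule exI[of _ t]) (intro conjI r'(1) f1 f2 f3 f4 f5 f6 f7)
qed

end

section \<open>Counting the poles of a rational function\<close>

lemma entire_extension_ex:
 assumes "\<And>a. \<exists>h. h analytic_on {a} \<and> eventually (\<lambda>z. f z = h z) (at a)"
 shows "\<exists>g. g holomorphic_on UNIV \<and> (\<forall>a. f analytic_on {a} \<longrightarrow> g a = f a) \<and> (\<forall>a. eventually (\<lambda>z. g z = f z) (at a))"
 by (rule entire_extension[OF assms]) blast

text \<open>The leading coefficient is that of \<open>PD\<close> times \<open>deg P - deg D\<close>.\<close>
lemma wronskian_poly_nonzero:
 fixes P D :: "complex poly"
 assumes "degree D < degree P" "D \<noteq> 0"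
 shows "pderiv P * D - P * pderiv D \<noteq> 0"
proof -
 let ?N = "degree P" and ?d = "degree D"
 have P0: "P \<noteq> 0" using assms(1) by auto
 have c1: "coeff (pderiv P * D) (?N - 1 + ?d) = of_nat ?N * lead_coeff P * lead_coeff D"
 proof -
  have "coeff (pderiv P * D) (degree (pderiv P) + ?d) = lead_coeff (pderiv P) * lead_coeff D" by (rule coeff_mult_degree_sum)
  moreover have "lead_coeff (pderiv P) = of_nat ?N * lead_coeff P"
   using assms(1) by (simp add: degree_pderiv coeff_pderiv)
  ultimately show ?thesis by (simp add: degree_pderiv)
 qed
 have c2: "coeff (P * pderiv D) (?N - 1 + ?d) = of_nat ?d * lead_coeff P * lead_coeff D"
 proof (cases "?d = 0")
  case True
  hence "pderiv D = 0" by (simp add: pderiv_eq_0_iff)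
  thus ?thesis using True by simp
 next
  case False
  have "coeff (P * pderiv D) (?N + degree (pderiv D)) = lead_coeff P * lead_coeff (pderiv D)" by (rule coeff_mult_degree_sum)
  moreover have "lead_coeff (pderiv D) = of_nat ?d * lead_coeff D" using False by (simp add: degree_pderiv coeff_pderiv)
  moreover have "?N + degree (pderiv D) = ?N - 1 + ?d" using False assms(1) by (simp add: degree_pderiv)
  ultimately show ?thesis by simp
 qed
 have "coeff (pderiv P * D - P * pderiv D) (?N - 1 + ?d) = (of_nat ?N - of_nat ?d) * (lead_coeff P * lead_coeff D)"
  unfolding coeff_diff c1 c2 by (simp add: algebra_simps)
 moreover have "(of_nat ?N :: complex) \<noteq> of_nat ?d" using assms(1) by (simp only: of_nat_eq_iff)
 ultimately show ?thesis using assms(2) P0 by (metis coeff_0 eq_iff_diff_eq_0 leading_coeff_0_iff mult_eq_0_iff)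
qed

text \<open>A multiple root of \<open>P - vD\<close> is a root of \<open>P'D - PD'\<close>.\<close>
lemma generic_fibre_of_rational:
 fixes P D :: "complex poly"
 assumes deg: "degree D < degree P" and D0: "D \<noteq> 0" and cop: "\<And>B. poly D B = 0 ==> poly P B \<noteq> 0"
 shows "\<exists>V. finite V \<and> (\<forall>v. v \<notin> V \<longrightarrow> finite {B. poly P B = v * poly D B} \<and> card {B. poly P B = v * poly D B} = degree P)"
proof -
 define W where "W = pderiv P * D - P * pderiv D"
 define V where "V = (\<lambda>B. poly P B / poly D B) ` {B. poly W B = 0}"
 have fV: "finite V" unfolding V_def W_def by (intro finite_imageI poly_roots_finite wronskian_poly_nonzero deg D0)
 have main: "finite {B. poly P B = v * poly D B} \<and> card {B. poly P B = v * poly D B} = degree P" if v: "v \<notin> V" for v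
 proof -
  define q where "q = P - smult v D"
  have dq: "degree q = degree P"
  proof -
   have "degree (- smult v D) < degree P" using deg degree_smult_le[of v D] by simp
   hence "degree (P + - smult v D) = degree P" by (rule degree_add_eq_left)
   thus ?thesis by (simp add: q_def)
  qed
  have q0: "q \<noteq> 0" using dq deg by auto
  have "rsquarefree q" unfolding rsquarefree_roots
  proof (intro allI notI)
   fix a assume "poly q a = 0 \<and> poly (pderiv q) a = 0"
   hence 1: "poly P a = v * poly D a" and 2: "poly (pderiv P) a = v * poly (pderiv D) a"
    by (simp_all add: q_def pderiv_diff pderiv_smult)
   have Da: "poly D a \<noteq> 0" using cop[of a] 1 by auto
   have "poly W a = 0" unfolding W_def by (simp add: 1 2)
   moreover have "v = poly P a / poly D a" using 1 Da by simp
   ultimately show False using v unfolding V_def by blast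
  qed
  have "degree q = card {z. poly q z = 0}"
  proof -
   have fin: "finite {z. poly q z = 0}" by (rule poly_roots_finite[OF q0])
   have "q = smult (lead_coeff q) (\<Prod>z|poly q z = 0. [:-z, 1:])"
    by (rule complex_poly_decompose_rsquarefree[symmetric]) fact
   hence "degree q = degree (\<Prod>z|poly q z = 0. [:-z, 1:])" using q0 by (metis degree_smult_eq leading_coeff_0_iff)
   also have "\<dots> = (\<Sum>z|poly q z = 0. degree [:-z, 1:])" by (rule degree_prod_eq_sum_degree) auto
   also have "\<dots> = card {z. poly q z = 0}" by simp
   finally show ?thesis .
  qed
  moreover have "{z. poly q z = 0} = {B. poly P B = v * poly D B}" by (auto simp: q_def)
  ultimately show ?thesis using dq poly_roots_finite[OF q0] by simp
 qed
 show ?thesis using fV main by blast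
qed

lemma entire_with_polynomial_limit:
 assumes g: "g holomorphic_on UNIV" and lim: "((\<lambda>B. g B / B ^ d) \<longlongrightarrow> c) at_infinity"
 obtains P :: "complex poly" where "\<And>B. g B = poly P B" "degree P \<le> d" "coeff P d = c"
proof -
 from tendstoD[OF lim zero_less_one] obtain A where A: "\<And>B. norm B \<ge> A ==> dist (g B / B ^ d) c < 1"
  unfolding eventually_at_infinity by blast
 have bd: "norm (g B) \<le> (norm c + 1) * norm B ^ d" if B: "max A 1 \<le> norm B" for B
 proof -
  have B0: "B \<noteq> 0" using B by auto
  have "norm (g B / B ^ d) \<le> norm c + norm (g B / B ^ d - c)" by (metis add_diff_cancel_left' diff_add_cancel norm_triangle_ineq)
  also have "\<dots> \<le> norm c + 1" using A[of B] B by (simp add: dist_norm)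
  finally show ?thesis using B0 by (simp add: norm_divide norm_power divide_le_eq)
 qed
 define P where "P = (\<Sum>k\<le>d. monom ((deriv ^^ k) g 0 / fact k) k)"
 have P: "g B = poly P B" for B unfolding P_def poly_sum poly_monom by (rule Liouville_polynomial[OF g bd])
 have dP: "degree P \<le> d" unfolding P_def by (intro degree_sum_le) (auto intro: order_trans[OF degree_monom_le])
 have "coeff P d = c" by (rule tendsto_unique[OF _ poly_over_power_tendsto[OF dP]]) (use lim in \<open>simp_all add: P trivial_limit_at_infinity\<close>)
 thus thesis using that P dP by blast
qed

lemma analytic_at_of_ball: "f holomorphic_on ball b r ==> r > 0 ==> f analytic_on {b}"
 by (meson analytic_on_analytic_at analytic_on_open centre_in_ball open_ball singletonD)

text \<open>A function with finitely many poles and linear growth is rational, and its poles can be counted with the help of a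
 second function whose residues are minus half the pole orders: both the sum of these residues and the value at
 infinity are known.\<close>
lemma rational_from_local_orders:
 fixes R T :: "complex => complex" and ord :: "complex => nat"
 assumes r: "\<And>b. r b > 0" and \<rho>: "\<And>b. \<rho> b holomorphic_on ball b (r b)" and t: "\<And>b. t b holomorphic_on ball b (r b)"
  and ord0: "\<And>b B. B \<in> ball b (r b) ==> B \<noteq> b ==> ord B = 0"
  and R1: "\<And>b B. B \<in> ball b (r b) ==> B \<noteq> b ==> R B * (B - b) ^ ord b = \<rho> b B"
  and T1: "\<And>b B. B \<in> ball b (r b) ==> B \<noteq> b ==> B \<notin> Z ==> T B + of_nat (ord b) / (2 * (B - b)) = t b B"
  and R2: "\<And>b. ord b = 0 ==> R b = \<rho> b b" and R3: "\<And>b. ord b > 0 ==> \<rho> b b \<noteq> 0"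
  and T2: "\<And>b. ord b = 0 ==> b \<notin> Z ==> T b = t b b"
  and Z: "finite Z" and inf: "eventually (\<lambda>B. ord B = 0) at_infinity"
  and limR: "((\<lambda>B. R B / B) \<longlongrightarrow> c) at_infinity" and c: "c \<noteq> 0"
  and limT: "((\<lambda>B. B * T B) \<longlongrightarrow> - of_nat M / 2) at_infinity"
 obtains P D :: "complex poly" where "degree P = M + 1" "degree D = M" "D \<noteq> 0"
  "\<And>B. poly D B = 0 \<longleftrightarrow> ord B > 0" "\<And>B. ord B = 0 ==> poly P B = R B * poly D B" "\<And>B. ord B > 0 ==> poly P B \<noteq> 0"
proof -
 define F where "F = {b. ord b > 0}"
 have fF: "finite F"
 proof (rule ccontr)
  assume nf: "infinite F"
  from inf obtain A where A: "\<And>B. norm B \<ge> A ==> ord B = 0" unfolding eventually_at_infinity by blast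
  have "F \<subseteq> cball 0 A"
  proof
   fix b assume "b \<in> F"
   hence "\<not> norm b \<ge> A" using A[of b] by (auto simp: F_def)
   thus "b \<in> cball 0 A" by simp
  qed
  then obtain b where "b islimpt F" using nf compact_eq_Bolzano_Weierstrass[of "cball 0 A :: complex set"] by auto
  then obtain B where B: "B \<in> F" "B \<in> ball b (r b)" "B \<noteq> b" using r[of b] unfolding islimpt_def by (meson centre_in_ball open_ball)
  from ord0[OF B(2,3)] B(1) show False by (simp add: F_def)
 qed
 define Dp where "Dp = (\<lambda>G. \<Prod>b\<in>G. [:-b, 1:] ^ ord b :: complex poly)"
 define D where "D = Dp F"
 have Dp0: "Dp G \<noteq> 0" if "finite G" for G using that unfolding Dp_def by (simp add: prod_zero_iff)
 have pD: "poly (Dp G) B = (\<Prod>b\<in>G. (B - b) ^ ord b)" for G B unfolding Dp_def by (simp add: poly_prod)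
 have zD: "poly (Dp G) B = 0 \<longleftrightarrow> B \<in> G" if "G \<subseteq> F" for G B
 proof -
  have fG: "finite G" by (rule finite_subset[OF that fF])
  have "ord b \<noteq> 0" if "b \<in> G" for b using that \<open>G \<subseteq> F\<close> by (auto simp: F_def)
  thus ?thesis unfolding pD using fG by (auto simp: prod_zero_iff)
 qed
 have split: "poly D B = (B - b) ^ ord b * poly (Dp (F - {b})) B" for B b
 proof (cases "b \<in> F")
  case True
  thus ?thesis unfolding D_def pD using prod.remove[OF fF True, of "\<lambda>b. (B - b) ^ ord b"] by simp
 next
  case False
  thus ?thesis by (simp add: D_def F_def)
 qed
 have zb: "poly (Dp (F - {b})) b \<noteq> 0" for b using zD[of "F - {b}" b] by auto
 have poly_an: "poly p analytic_on S" for p :: "complex poly" and S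
  by (rule analytic_on_subset[where S = UNIV]) (auto simp: analytic_on_open intro!: holomorphic_onI_deriv[OF open_UNIV poly_DERIV])
 have inball: "eventually (\<lambda>B. B \<in> ball b (r b) \<and> B \<noteq> b) (at b)" for b
  using eventually_at_in_open[OF open_ball, of b b "r b"] r[of b] by (simp add: eventually_at_filter)
 have inball': "eventually (\<lambda>B. B \<in> ball b (r b)) (nhds b)" for b by (rule eventually_nhds_in_open) (use r in auto)
 \<comment> \<open>The product of \<open>R\<close> with the denominator is a polynomial.\<close>
 define f1 where "f1 = (\<lambda>B. R B * poly D B)"
 define h1 where "h1 = (\<lambda>b B. \<rho> b B * poly (Dp (F - {b})) B)"
 have h1a: "h1 b analytic_on {b}" for b unfolding h1_def by (intro analytic_intros poly_an analytic_at_of_ball[OF \<rho> r])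
 have f1h: "f1 B = h1 b B" if "B \<in> ball b (r b)" "B \<noteq> b" for b B
  unfolding f1_def h1_def split[of B b] R1[OF that, symmetric] by simp
 have "\<exists>h. h analytic_on {b} \<and> eventually (\<lambda>B. f1 B = h B) (at b)" for b
  by (rule exI[of _ "h1 b"]) (use h1a inball[of b] f1h in \<open>auto elim!: eventually_mono\<close>)
 note ex1 = this
 obtain g1 where g1: "g1 holomorphic_on UNIV" "\<And>a. f1 analytic_on {a} ==> g1 a = f1 a" "\<And>a. eventually (\<lambda>B. g1 B = f1 B) (at a)"
  using entire_extension_ex[of f1, OF ex1] by blast
 have g1h: "g1 b = h1 b b" for b
 proof -
  have "eventually (\<lambda>B. g1 B = h1 b B) (at b)" using g1(3)[of b] inball[of b] by eventually_elim (use f1h in auto)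
  moreover have "isCont g1 b" using holomorphic_derivI[OF g1(1) open_UNIV UNIV_I] by (rule DERIV_isCont)
  moreover have "isCont (h1 b) b" by (rule analytic_at_imp_isCont[OF h1a])
  ultimately show ?thesis unfolding isCont_def using tendsto_cong[of g1 "h1 b" "at b"] tendsto_unique[OF at_neq_bot] by blast
 qed
 have g1R: "g1 b = R b * poly D b" if "ord b = 0" for b
  unfolding g1h h1_def R2[OF that] split[of b b] using that by simp
 have g1n: "g1 b \<noteq> 0" if "ord b > 0" for b unfolding g1h h1_def using R3[OF that] zb by simp
 define d where "d = degree D"
 have lD: "coeff D d = 1"
 proof -
  have "lead_coeff (Dp F) = 1" unfolding Dp_def by (simp add: lead_coeff_prod lead_coeff_power)
  thus ?thesis by (simp add: D_def d_def)
 qed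
 have limD: "((\<lambda>B. poly D B / B ^ d) \<longlongrightarrow> 1) at_infinity"
 proof -
  have "degree D \<le> d" by (simp add: d_def)
  from poly_over_power_tendsto[OF this] show ?thesis unfolding lD .
 qed
 have "((\<lambda>B. (R B / B) * (poly D B / B ^ d)) \<longlongrightarrow> c * 1) at_infinity" by (intro tendsto_intros limR limD)
 moreover have ev1: "eventually (\<lambda>B. (R B / B) * (poly D B / B ^ d) = g1 B / B ^ (d + 1)) at_infinity"
  using inf by eventually_elim (simp add: g1R)
 ultimately have lim1: "((\<lambda>B. g1 B / B ^ (d + 1)) \<longlongrightarrow> c) at_infinity" using tendsto_cong[OF ev1] by simp
 obtain P where P: "\<And>B. g1 B = poly P B" "degree P \<le> d + 1" "coeff P (d + 1) = c"
  using entire_with_polynomial_limit[OF g1(1) lim1] by metis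
 have dP: "degree P = d + 1" using P(2,3) c le_degree[of P "d + 1"] by simp
 \<comment> \<open>The residues of \<open>T\<close> are minus half the logarithmic derivative of \<open>D\<close>.\<close>
 define f2 where "f2 = (\<lambda>B. T B + poly (pderiv D) B / (2 * poly D B))"
 define h2 where "h2 = (\<lambda>b B. t b B + poly (pderiv (Dp (F - {b}))) B / (2 * poly (Dp (F - {b})) B))"
 have h2a: "h2 b analytic_on {b}" for b unfolding h2_def
  by (intro analytic_intros poly_an analytic_at_of_ball[OF t r]) (use zb in auto)
 have f2h: "f2 B = h2 b B" if B: "B \<in> ball b (r b)" "B \<noteq> b" "B \<notin> Z" and G: "poly (Dp (F - {b})) B \<noteq> 0" for b B
 proof -
  have "DERIV (\<lambda>B. (B - b) ^ ord b * poly (Dp (F - {b})) B) B :>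
   (of_nat (ord b) * (B - b) ^ (ord b - 1)) * poly (Dp (F - {b})) B + poly (pderiv (Dp (F - {b}))) B * (B - b) ^ ord b"
   by (rule DERIV_mult[OF _ poly_DERIV]) (auto intro!: derivative_eq_intros)
  hence e: "poly (pderiv D) B = (of_nat (ord b) * (B - b) ^ (ord b - 1)) * poly (Dp (F - {b})) B + poly (pderiv (Dp (F - {b}))) B * (B - b) ^ ord b"
   unfolding split[symmetric] by (rule DERIV_unique[OF poly_DERIV])
  have e1: "of_nat (ord b) * (B - b) ^ ord b = of_nat (ord b) * (B - b) ^ (ord b - 1) * (B - b)" by (cases "ord b") auto
  have "poly (pderiv D) B * (B - b) = (of_nat (ord b) * (B - b) ^ (ord b - 1) * (B - b)) * poly (Dp (F - {b})) B + poly (pderiv (Dp (F - {b}))) B * (B - b) * (B - b) ^ ord b"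
   unfolding e by (simp add: algebra_simps)
  also have "\<dots> = (of_nat (ord b) * poly (Dp (F - {b})) B + poly (pderiv (Dp (F - {b}))) B * (B - b)) * (B - b) ^ ord b"
   unfolding e1[symmetric] by (simp add: algebra_simps)
  finally have "poly (pderiv D) B / (2 * ((B - b) ^ ord b * poly (Dp (F - {b})) B)) =
   of_nat (ord b) / (2 * (B - b)) + poly (pderiv (Dp (F - {b}))) B / (2 * poly (Dp (F - {b})) B)"
   by (intro log_deriv_product G) (use B in auto)
  thus ?thesis unfolding f2_def h2_def T1[OF B, symmetric] split[of B b] by simp
 qed
 have nz2: "eventually (\<lambda>B. poly (Dp (F - {b})) B \<noteq> 0) (nhds b)" for b
 proof -
  have "isCont (poly (Dp (F - {b}))) b" by (rule poly_isCont)
  from continuous_at_avoid[OF this zb] obtain e where "e > 0" "\<And>y. dist b y < e ==> poly (Dp (F - {b})) y \<noteq> 0" by blast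
  thus ?thesis unfolding eventually_nhds_metric by (metis dist_commute)
 qed
 have offZ: "eventually (\<lambda>B. B \<notin> Z - {b}) (nhds b)" for b
 proof -
  have "open (- (Z - {b}))" using Z by (intro open_Compl finite_imp_closed) simp
  hence "eventually (\<lambda>B. B \<in> - (Z - {b})) (nhds b)" by (rule eventually_nhds_in_open) simp
  thus ?thesis by (rule eventually_mono) blast
 qed
 have ex2: "\<exists>h. h analytic_on {b} \<and> eventually (\<lambda>B. f2 B = h B) (at b)" for b
 proof (rule exI[of _ "h2 b"], rule conjI[OF h2a])
  have "eventually (\<lambda>B. poly (Dp (F - {b})) B \<noteq> 0 \<and> B \<notin> Z - {b}) (nhds b)" using nz2[of b] offZ[of b] by eventually_elim blast
  hence "eventually (\<lambda>B. poly (Dp (F - {b})) B \<noteq> 0 \<and> B \<notin> Z - {b}) (at b)" by (auto simp: eventually_at_filter elim: eventually_mono)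
  thus "eventually (\<lambda>B. f2 B = h2 b B) (at b)" using inball[of b] by eventually_elim (use f2h in blast)
 qed
 obtain g2 where g2: "g2 holomorphic_on UNIV" "\<And>a. f2 analytic_on {a} ==> g2 a = f2 a" "\<And>a. eventually (\<lambda>B. g2 B = f2 B) (at a)"
  using entire_extension_ex[of f2, OF ex2] by blast
 have g2f: "g2 b = f2 b" if b: "b \<notin> Z" "ord b = 0" for b
 proof (rule g2(2), rule analytic_cong_at[OF h2a])
  have bF: "F - {b} = F" using b(2) by (auto simp: F_def)
  show "eventually (\<lambda>B. f2 B = h2 b B) (nhds b)" using nz2[of b] offZ[of b] inball'[of b]
  proof eventually_elim
   case (elim B)
   show ?case
   proof (cases "B = b")
    case True
    show ?thesis unfolding True f2_def h2_def bF T2[OF b(2,1)] D_def ..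
   next
    case False
    show ?thesis by (rule f2h) (use elim False in auto)
   qed
  qed
 qed
 have lim2: "((\<lambda>B. B * g2 B) \<longlongrightarrow> - of_nat M / 2 + of_nat d / (2 * 1)) at_infinity"
 proof -
  have "degree (pCons 0 (pderiv D)) \<le> d"
  proof (cases "d = 0")
   case True
   hence "pderiv D = 0" by (simp add: pderiv_eq_0_iff d_def)
   thus ?thesis by simp
  next
   case False
   have "degree (pCons 0 (pderiv D)) \<le> Suc (degree (pderiv D))" by (rule degree_pCons_le)
   thus ?thesis using False by (simp add: degree_pderiv d_def)
  qed
  from poly_over_power_tendsto[OF this]
  have "((\<lambda>B. poly (pCons 0 (pderiv D)) B / B ^ d) \<longlongrightarrow> of_nat d) at_infinity"
   using lD by (cases d) (simp_all add: coeff_pderiv)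
  hence "((\<lambda>B. B * T B + (poly (pCons 0 (pderiv D)) B / B ^ d) / (2 * (poly D B / B ^ d))) \<longlongrightarrow> - of_nat M / 2 + of_nat d / (2 * 1)) at_infinity"
   by (intro tendsto_intros limT limD) auto
  moreover have ev: "eventually (\<lambda>B. B * T B + (poly (pCons 0 (pderiv D)) B / B ^ d) / (2 * (poly D B / B ^ d)) = B * g2 B) at_infinity"
  proof -
   from finite_imp_bounded[OF Z] obtain A where A: "\<And>z. z \<in> Z ==> norm z \<le> A" unfolding bounded_iff by blast
   have "eventually (\<lambda>B. B \<notin> Z) at_infinity" unfolding eventually_at_infinity
    by (intro exI[of _ "A + 1"]) (use A in force)
   thus ?thesis using inf at_infinity_nonzero
   proof eventually_elim
    case (elim B)
    show ?case unfolding g2f[OF elim(1,2)] f2_def using elim(3) by (simp add: distrib_left)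
   qed
  qed
  ultimately show ?thesis using tendsto_cong[OF ev] by blast
 qed
 have "((\<lambda>B. 1 / B * (B * g2 B)) \<longlongrightarrow> 0 * (- of_nat M / 2 + of_nat d / (2 * 1))) at_infinity"
  by (intro tendsto_intros inverse_at_infinity lim2)
 moreover have ev3: "eventually (\<lambda>B. 1 / B * (B * g2 B) = g2 B) at_infinity" using at_infinity_nonzero by eventually_elim simp
 ultimately have "(g2 \<longlongrightarrow> 0) at_infinity" using tendsto_cong[OF ev3] by simp
 from Liouville_weak_0[OF g2(1) this] have "g2 = (\<lambda>_. 0)" by blast
 hence "((\<lambda>B::complex. 0::complex) \<longlongrightarrow> - of_nat M / 2 + of_nat d / (2 * 1)) at_infinity" using lim2 by simp
 hence "- of_nat M / 2 + of_nat d / (2 * 1) = (0::complex)"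
  by (rule tendsto_unique[OF trivial_limit_at_infinity _ tendsto_const])
 hence "(of_nat d :: complex) = of_nat M" by (simp add: field_simps)
 hence dM: "d = M" by (simp only: of_nat_eq_iff)
 show thesis
 proof (rule that)
  show "degree P = M + 1" using dP dM by simp
  show "degree D = M" using dM by (simp add: d_def)
  show "D \<noteq> 0" unfolding D_def by (rule Dp0[OF fF])
  show "poly D B = 0 \<longleftrightarrow> ord B > 0" for B using zD[of F B] by (simp add: D_def F_def)
  show "ord B = 0 ==> poly P B = R B * poly D B" for B using g1R[of B] P(1)[of B] by simp
  show "ord B > 0 ==> poly P B \<noteq> 0" for B using g1n[of B] P(1)[of B] by simp
 qed
qed

section \<open>The degree\<close>

context half_plane begin

lemma weierstrass_limits:
 shows "((\<lambda>z. z * wzeta z) \<longlongrightarrow> 1) (at 0)" "((\<lambda>z. z ^ 2 * wp \<tau> z) \<longlongrightarrow> 1) (at 0)"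
proof -
 obtain h where h: "h analytic_on {0}" "eventually (\<lambda>z. wzeta z = 1 / (z - 0) + h z) (at 0)"
  using wzeta_near_lattice[OF lattice_0] by blast
 obtain e where e: "e > 0" "h holomorphic_on ball 0 e" using h(1) unfolding analytic_on_def by auto
 obtain d where d: "d > 0" "\<And>z. z \<noteq> 0 ==> dist z 0 < d ==> wzeta z = 1 / (z - 0) + h z"
  using h(2) unfolding eventually_at by auto
 define k where "k = min d e"
 have k: "k > 0" using d e by (simp add: k_def)
 have hk: "h holomorphic_on ball 0 k" by (rule holomorphic_on_subset[OF e(2)]) (auto simp: k_def)
 have z1: "wzeta z = 1 / z + h z" if "z \<in> ball 0 k - {0}" for z using that d(2)[of z] by (simp add: k_def)
 have nl: "eventually (\<lambda>z. z \<notin> L) (at 0)" using lattice_sparse sparse_in_eventually_iff[OF open_UNIV] by blast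
 have ev: "eventually (\<lambda>z. z \<in> ball 0 k - {0}) (at 0)"
  using k by (auto simp: eventually_at dist_commute intro!: exI[of _ k])
 have c: "h \<midarrow>0\<rightarrow> h 0" "deriv h \<midarrow>0\<rightarrow> deriv h 0"
 proof -
  have "0 \<in> ball 0 k" using k by simp
  from DERIV_isCont[OF holomorphic_derivI[OF hk open_ball this]] DERIV_isCont[OF holomorphic_derivI[OF holomorphic_deriv[OF hk open_ball] open_ball this]]
  show "h \<midarrow>0\<rightarrow> h 0" "deriv h \<midarrow>0\<rightarrow> deriv h 0" by (simp_all only: isCont_def)
 qed
 have "((\<lambda>z. 1 + z * h z) \<longlongrightarrow> 1 + 0 * h 0) (at 0)" by (intro tendsto_intros c)
 hence l1: "((\<lambda>z. 1 + z * h z) \<longlongrightarrow> 1) (at 0)" by simp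
 have e1: "eventually (\<lambda>z. 1 + z * h z = z * wzeta z) (at 0)"
  using ev
 proof eventually_elim
  case (elim z)
  thus ?case unfolding z1[OF elim] by (simp add: distrib_left)
 qed
 show "((\<lambda>z. z * wzeta z) \<longlongrightarrow> 1) (at 0)" by (rule tendsto_cong[OF e1, THEN iffD1, OF l1])
 have "((\<lambda>z. 1 - z ^ 2 * deriv h z) \<longlongrightarrow> 1 - 0 ^ 2 * deriv h 0) (at 0)" by (intro tendsto_intros c)
 hence l2: "((\<lambda>z. 1 - z ^ 2 * deriv h z) \<longlongrightarrow> 1) (at 0)" by simp
 have e2: "eventually (\<lambda>z. 1 - z ^ 2 * deriv h z = z ^ 2 * wp \<tau> z) (at 0)"
  using ev nl
 proof eventually_elim
  case (elim z)
  have zk: "z \<in> ball 0 k" "z \<noteq> 0" using elim(1) by auto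
  have "DERIV (\<lambda>z. 1 / z + h z) z :> (0 * z - 1 * 1) / (z * z) + deriv h z"
   by (intro DERIV_add DERIV_divide DERIV_const DERIV_ident zk(2) holomorphic_derivI[OF hk open_ball zk(1)])
  moreover have "DERIV (\<lambda>z. 1 / z + h z) z :> - wp \<tau> z"
  proof (rule DERIV_transfer_ev[OF wzeta_deriv[OF elim(2)]])
   have "eventually (\<lambda>z. z \<in> ball 0 k - {0}) (nhds z)" by (rule eventually_nhds_in_open) (use elim(1) in auto)
   thus "eventually (\<lambda>z. wzeta z = 1 / z + h z) (nhds z)" by eventually_elim (rule z1)
  qed
  ultimately have "(0 * z - 1 * 1) / (z * z) + deriv h z = - wp \<tau> z" by (rule DERIV_unique)
  hence w: "wp \<tau> z = - ((0 * z - 1 * 1) / (z * z) + deriv h z)" by simp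
  show ?case unfolding w using zk(2) by (simp add: field_simps power2_eq_square)
 qed
 show "((\<lambda>z. z ^ 2 * wp \<tau> z) \<longlongrightarrow> 1) (at 0)" by (rule tendsto_cong[OF e2, THEN iffD1, OF l2])
qed

end

context lame begin

lemma gg_pos: assumes "DD \<ge> 1" shows "gg \<ge> 1"
proof -
 have "\<exists>k\<le>3. n k \<ge> 1"
 proof (rule ccontr)
  assume "\<not> ?thesis"
  hence "n k = 0" if "k \<le> 3" for k using that by (metis One_nat_def Suc_leI neq0_conv)
  hence "DD = 0" by (simp add: DD_def)
  thus False using assms by simp
 qed
 then obtain k where k: "k \<le> 3" "n k \<ge> 1" by blast
 hence "(k, 1) \<in> Sg" by (auto simp: Sg_def)
 from Cp_facts(3)[OF this] show ?thesis by simp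
qed

text \<open>Near infinity the lift is of the order of \<open>1/\<surd>B\<close>, so only the principal parts of \<open>\<wp>\<close> and \<open>\<zeta>\<close> matter.\<close>
lemma behaviour_at_infinity:
 assumes D: "DD \<ge> 1"
 shows "eventually (\<lambda>B. sB B \<notin> L) at_infinity"
  "((\<lambda>B. RR B / B) \<longlongrightarrow> 1 / of_nat DD ^ 2) at_infinity"
  "((\<lambda>B. B * TT B) \<longlongrightarrow> - of_nat (DD - 1) / 2) at_infinity"
proof -
 let ?N = "of_nat DD :: complex"
 have N0: "?N \<noteq> 0" using D by simp
 note g = gg_pos[OF D]
 from chart_at_infinity[OF g] obtain H K where lift: "eventually (\<lambda>B. \<forall>W s c. is_lift B W s c \<longrightarrow> (\<exists>a b::int. - W * H B = s + lat a b \<and> - W * K B = c + eta a b)) at_infinity"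
  and lH: "((\<lambda>B. B ^ (gg + 1) * H B) \<longlongrightarrow> ?N) at_infinity" and lK: "((\<lambda>B. B ^ gg * K B) \<longlongrightarrow> 1) at_infinity" by blast
 have lQ: "((\<lambda>B. poly Qp B / B ^ (2 * gg + 1)) \<longlongrightarrow> 1) at_infinity"
  using poly_over_power_tendsto[of Qp "2 * gg + 1"] Qp_degree by simp
 have lA: "((\<lambda>B. poly Ap B / B ^ (gg - 1)) \<longlongrightarrow> - ?N / 2) at_infinity"
  using poly_over_power_tendsto[OF Ap_degree(1)[OF g]] Ap_degree(2)[OF g] by simp
 define x where "x = (\<lambda>B. - Wr B * H B)"
 have p1: "B ^ (2 * gg + 1) * B = B ^ (gg + 1) * B ^ (gg + 1)" for B :: complex by (simp add: power_add[symmetric] mult_2)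
 have p2: "B ^ gg = B ^ (gg - 1) * B" for B :: complex using g by (cases gg) auto
 have x2: "x B ^ 2 = poly Qp B * H B ^ 2" for B by (simp add: x_def power_mult_distrib Wr)
 have "((\<lambda>B. (poly Qp B / B ^ (2 * gg + 1)) * (B ^ (gg + 1) * H B) ^ 2) \<longlongrightarrow> 1 * ?N ^ 2) at_infinity"
  by (intro tendsto_intros lQ lH)
 moreover have e: "eventually (\<lambda>B. (poly Qp B / B ^ (2 * gg + 1)) * (B ^ (gg + 1) * H B) ^ 2 = B * x B ^ 2) at_infinity"
  using at_infinity_nonzero
 proof eventually_elim
  case (elim B)
  have "(B ^ (gg + 1) * H B) ^ 2 = (B ^ (2 * gg + 1) * B) * H B ^ 2" unfolding p1 by (simp add: power2_eq_square)
  thus ?case unfolding x2 using elim by simp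
 qed
 ultimately have lx2: "((\<lambda>B. B * x B ^ 2) \<longlongrightarrow> ?N ^ 2) at_infinity" using tendsto_cong[OF e] by simp
 have xnz: "eventually (\<lambda>B. x B \<noteq> 0) at_infinity"
 proof -
  have "eventually (\<lambda>B. B * x B ^ 2 \<noteq> 0) at_infinity"
   by (rule tendsto_imp_eventually_ne[OF lx2]) (use N0 in simp)
  thus ?thesis by eventually_elim auto
 qed
 have "((\<lambda>B. 1 / B * (B * x B ^ 2)) \<longlongrightarrow> 0 * ?N ^ 2) at_infinity" by (intro tendsto_intros inverse_at_infinity lx2)
 moreover have e2: "eventually (\<lambda>B. 1 / B * (B * x B ^ 2) = x B ^ 2) at_infinity" using at_infinity_nonzero by eventually_elim simp
 ultimately have "((\<lambda>B. x B ^ 2) \<longlongrightarrow> 0) at_infinity" using tendsto_cong[OF e2] by simp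
 hence "(x \<longlongrightarrow> 0) at_infinity"
 proof -
  assume a: "((\<lambda>B. x B ^ 2) \<longlongrightarrow> 0) at_infinity"
  show ?thesis
  proof (rule tendstoI)
   fix e :: real assume e: "e > 0"
   hence "e ^ 2 > 0" by simp
   from tendstoD[OF a this] show "eventually (\<lambda>B. dist (x B) 0 < e) at_infinity"
   proof eventually_elim
    case (elim B)
    hence "norm (x B) ^ 2 < e ^ 2" by (simp add: norm_power)
    hence "norm (x B) < e" using e by (meson less_imp_le power_less_imp_less_base)
    thus ?case by simp
   qed
  qed
 qed
 hence fx: "filterlim x (at 0) at_infinity" using xnz by (simp add: filterlim_at)
 have nL: "eventually (\<lambda>z. z \<notin> L) (at 0)" using lattice_sparse sparse_in_eventually_iff[OF open_UNIV] by blast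
 have xL: "eventually (\<lambda>B. x B \<notin> L) at_infinity" by (rule eventually_compose_filterlim[OF nL fx])
 have tr: "eventually (\<lambda>B. sB B \<notin> L \<and> RR B = wp \<tau> (x B) \<and> cB B - wzeta (sB B) = - Wr B * K B - wzeta (x B)) at_infinity"
  using lift xL
 proof eventually_elim
  case (elim B)
  obtain a b :: int where ab: "x B = sB B + lat a b" "- Wr B * K B = cB B + eta a b"
   using elim(1) lift_B[of B] unfolding x_def by blast
  have s: "sB B \<notin> L" using lattice_translate(1)[OF ab] elim(2) by blast
  show ?case using lattice_translate(2,3)[OF ab s] s by (simp add: RR_def)
 qed
 show "eventually (\<lambda>B. sB B \<notin> L) at_infinity" using tr by eventually_elim blast
 have "((\<lambda>B. x B ^ 2 * wp \<tau> (x B)) \<longlongrightarrow> 1) at_infinity" by (rule filterlim_compose[OF weierstrass_limits(2) fx])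
 hence "((\<lambda>B. (x B ^ 2 * wp \<tau> (x B)) / (B * x B ^ 2)) \<longlongrightarrow> 1 / ?N ^ 2) at_infinity"
  by (intro tendsto_divide lx2) (use N0 in simp_all)
 moreover have e3: "eventually (\<lambda>B. (x B ^ 2 * wp \<tau> (x B)) / (B * x B ^ 2) = RR B / B) at_infinity"
  using tr xnz at_infinity_nonzero by eventually_elim (simp add: field_simps)
 ultimately show "((\<lambda>B. RR B / B) \<longlongrightarrow> 1 / ?N ^ 2) at_infinity" using tendsto_cong[OF e3] by blast
 have lz: "((\<lambda>B. x B * wzeta (x B)) \<longlongrightarrow> 1) at_infinity" by (rule filterlim_compose[OF weierstrass_limits(1) fx])
 have "((\<lambda>B. (B ^ gg * K B) * (poly Ap B / B ^ (gg - 1)) - (x B * wzeta (x B)) * ((poly Ap B / B ^ (gg - 1)) / ((poly Qp B / B ^ (2 * gg + 1)) * (B ^ (gg + 1) * H B))))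
  \<longlongrightarrow> 1 * (- ?N / 2) - 1 * ((- ?N / 2) / (1 * ?N))) at_infinity"
  by (intro tendsto_diff tendsto_mult tendsto_divide lK lA lz lQ lH) (use N0 in simp)
 moreover have "1 * (- ?N / 2) - 1 * ((- ?N / 2) / (1 * ?N)) = - of_nat (DD - 1) / 2"
  using N0 D by (simp add: of_nat_diff field_simps)
 moreover have e4: "eventually (\<lambda>B. (B ^ gg * K B) * (poly Ap B / B ^ (gg - 1)) - (x B * wzeta (x B)) * ((poly Ap B / B ^ (gg - 1)) / ((poly Qp B / B ^ (2 * gg + 1)) * (B ^ (gg + 1) * H B))) = B * TT B) at_infinity"
  using tr xnz at_infinity_nonzero
 proof eventually_elim
  case (elim B)
  define b where "b = B ^ (gg - 1)"
  have b0: "b \<noteq> 0" using elim(3) by (simp add: b_def)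
  have W0: "Wr B \<noteq> 0" and H0: "H B \<noteq> 0" using elim(2) by (auto simp: x_def)
  have q: "poly Qp B = Wr B * Wr B" using Wr[of B] by (simp add: power2_eq_square)
  have "B ^ (2 * gg + 1) = B ^ gg * B ^ (gg + 1)" by (simp add: power_add[symmetric] mult_2)
  hence "(poly Qp B / B ^ (2 * gg + 1)) * (B ^ (gg + 1) * H B) = Wr B * Wr B * H B / B ^ gg" using elim(3) by (simp add: q)
  hence d: "(poly Qp B / B ^ (2 * gg + 1)) * (B ^ (gg + 1) * H B) = Wr B * Wr B * H B / (b * B)" unfolding p2 b_def .
  have TB: "TT B = - (- Wr B * K B - wzeta (x B)) * poly Ap B / Wr B" unfolding TT_def using elim(1) by simp
  have "(B ^ gg * K B) * (poly Ap B / b) = B * (K B * poly Ap B)" unfolding p2 b_def[symmetric] using b0 by simp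
  moreover have "(x B * wzeta (x B)) * ((poly Ap B / b) / (Wr B * Wr B * H B / (b * B))) = - B * (wzeta (x B) * poly Ap B / Wr B)"
   using b0 W0 H0 by (simp add: x_def field_simps)
  moreover have "TT B = K B * poly Ap B + wzeta (x B) * poly Ap B / Wr B" unfolding TB using W0 by (simp add: field_simps)
  ultimately show ?case unfolding d b_def[symmetric] by (simp add: distrib_left)
 qed
 ultimately show "((\<lambda>B. B * TT B) \<longlongrightarrow> - of_nat (DD - 1) / 2) at_infinity" using tendsto_cong[OF e4] by simp
qed

lemma rational_RR:
 assumes D1: "DD \<ge> 1"
 shows "\<exists>P D :: complex poly. degree P = DD \<and> degree D < DD \<and> D \<noteq> 0 \<and> (\<forall>B. poly D B = 0 \<longleftrightarrow> sB B \<in> L) \<and>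
  (\<forall>B. sB B \<notin> L \<longrightarrow> poly P B = RR B * poly D B) \<and> (\<forall>B. sB B \<in> L \<longrightarrow> poly P B \<noteq> 0)"
proof -
 have A0: "Ap \<noteq> 0" using Ap_degree(2)[OF gg_pos[OF D1]] D1 by auto
 let ?P = "\<lambda>b q. case q of (o'::nat, r, \<rho>, t) => r > 0 \<and> \<rho> holomorphic_on ball b r \<and> t holomorphic_on ball b r \<and>
  (\<forall>B\<in>ball b r. B \<noteq> b \<longrightarrow> sB B \<notin> L \<and> RR B * (B - b) ^ o' = \<rho> B \<and>
   (poly Qp B \<noteq> 0 \<longrightarrow> TT B + of_nat o' / (2 * (B - b)) = t B)) \<and>
  (o' = 0 \<longleftrightarrow> sB b \<notin> L) \<and> (o' = 0 \<longrightarrow> RR b = \<rho> b) \<and> (o' > 0 \<longrightarrow> \<rho> b \<noteq> 0) \<and>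
  (o' = 0 \<longrightarrow> poly Qp b \<noteq> 0 \<longrightarrow> TT b = t b)"
 have "\<forall>b. \<exists>q. ?P b q" using local_orders[OF A0] by simp
 from choice[OF this] obtain q where q: "\<forall>b. ?P b (q b)" ..
 define ord r \<rho> t where "ord = (\<lambda>b. fst (q b))" and "r = (\<lambda>b. fst (snd (q b)))" and "\<rho> = (\<lambda>b. fst (snd (snd (q b))))" and "t = (\<lambda>b. snd (snd (snd (q b))))"
 have q': "r b > 0 \<and> \<rho> b holomorphic_on ball b (r b) \<and> t b holomorphic_on ball b (r b) \<and>
  (\<forall>B\<in>ball b (r b). B \<noteq> b \<longrightarrow> sB B \<notin> L \<and> RR B * (B - b) ^ ord b = \<rho> b B \<and>
   (poly Qp B \<noteq> 0 \<longrightarrow> TT B + of_nat (ord b) / (2 * (B - b)) = t b B)) \<and>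
  (ord b = 0 \<longleftrightarrow> sB b \<notin> L) \<and> (ord b = 0 \<longrightarrow> RR b = \<rho> b b) \<and> (ord b > 0 \<longrightarrow> \<rho> b b \<noteq> 0) \<and>
  (ord b = 0 \<longrightarrow> poly Qp b \<noteq> 0 \<longrightarrow> TT b = t b b)" for b
  using spec[OF q, of b] unfolding ord_def r_def \<rho>_def t_def case_prod_unfold .
 have oL: "ord b = 0 \<longleftrightarrow> sB b \<notin> L" for b using q'[of b] by simp
 have inf: "eventually (\<lambda>B. ord B = 0) at_infinity" using behaviour_at_infinity(1)[OF D1] by (simp only: oL)
 have c: "1 / of_nat DD ^ 2 \<noteq> (0::complex)" using D1 by simp
 have fZ: "finite {B. poly Qp B = 0}" by (rule poly_roots_finite[OF Qp_nonzero])
 have "\<exists>P D :: complex poly. degree P = (DD - 1) + 1 \<and> degree D = DD - 1 \<and> D \<noteq> 0 \<and> (\<forall>B. poly D B = 0 \<longleftrightarrow> ord B > 0) \<and>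
  (\<forall>B. ord B = 0 \<longrightarrow> poly P B = RR B * poly D B) \<and> (\<forall>B. ord B > 0 \<longrightarrow> poly P B \<noteq> 0)"
 proof (rule rational_from_local_orders[where r = r and \<rho> = \<rho> and t = t and ord = ord and R = RR and T = TT and Z = "{B. poly Qp B = 0}" and c = "1 / of_nat DD ^ 2" and M = "DD - 1"])
  fix b B
  show "r b > 0" "\<rho> b holomorphic_on ball b (r b)" "t b holomorphic_on ball b (r b)" using q'[of b] by simp_all
  show "ord B = 0" if "B \<in> ball b (r b)" "B \<noteq> b" using q'[of b] that oL by blast
  show "RR B * (B - b) ^ ord b = \<rho> b B" if "B \<in> ball b (r b)" "B \<noteq> b" using q'[of b] that by blast
  show "TT B + of_nat (ord b) / (2 * (B - b)) = t b B" if "B \<in> ball b (r b)" "B \<noteq> b" "B \<notin> {B. poly Qp B = 0}" using q'[of b] that by blast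
  show "RR b = \<rho> b b" if "ord b = 0" using q'[of b] that by blast
  show "\<rho> b b \<noteq> 0" if "ord b > 0" using q'[of b] that by blast
  show "TT b = t b b" if "ord b = 0" "b \<notin> {B. poly Qp B = 0}" using q'[of b] that by blast
 next
  show "((\<lambda>B. RR B / B) \<longlongrightarrow> 1 / of_nat DD ^ 2) at_infinity" by (rule behaviour_at_infinity(2)[OF D1])
  show "((\<lambda>B. B * TT B) \<longlongrightarrow> - of_nat (DD - 1) / 2) at_infinity" by (rule behaviour_at_infinity(3)[OF D1])
 qed (use inf c fZ in blast)+
 then obtain P D :: "complex poly" where PD: "degree P = (DD - 1) + 1" "degree D = DD - 1" "D \<noteq> 0" "\<And>B. poly D B = 0 \<longleftrightarrow> ord B > 0"
  "\<And>B. ord B = 0 ==> poly P B = RR B * poly D B" "\<And>B. ord B > 0 ==> poly P B \<noteq> 0" by blast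
 show ?thesis
 proof (rule exI[of _ P], rule exI[of _ D], intro conjI allI impI)
  show "degree P = DD" "degree D < DD" using PD(1,2) D1 by simp_all
  show "D \<noteq> 0" by (rule PD(3))
  fix B
  show "poly D B = 0 \<longleftrightarrow> sB B \<in> L" using PD(4)[of B] oL[of B] by auto
  show "poly P B = RR B * poly D B" if "sB B \<notin> L" using PD(5)[of B] that unfolding oL .
  show "poly P B \<noteq> 0" if "sB B \<in> L" using PD(6)[of B] oL[of B] that by auto
 qed
qed

text \<open>The lifts are \<open>s\<^sub>0 - WH\<close> and \<open>s\<^sub>0 + WH\<close>, and \<open>2s\<^sub>0\<close> is a period.\<close>
lemma opposite_lifts:
 assumes l: "is_lift B W s c" and l': "is_lift B (- W) s' c'"
 shows "s + s' \<in> L"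
proof -
 have "\<exists>r H K m1 m2. r > 0 \<and> (\<forall>B' W s c. B' \<in> ball B r \<longrightarrow> is_lift B' W s c \<longrightarrow> (\<exists>a b::int.
   halfs m1 m2 - W * H B' = s + lat a b \<and> halfc m1 m2 - W * K B' = c + eta a b))"
  by (rule chart[of B]) blast
 then obtain r H K m1 m2 where r: "r > 0" and lift: "\<And>B' W s c. B' \<in> ball B r ==> is_lift B' W s c ==> \<exists>a b::int.
   halfs m1 m2 - W * H B' = s + lat a b \<and> halfc m1 m2 - W * K B' = c + eta a b" by blast
 have B: "B \<in> ball B r" using r by simp
 obtain a b :: int where 1: "halfs m1 m2 - W * H B = s + lat a b" using lift[OF B l] by blast
 obtain a' b' :: int where 2: "halfs m1 m2 - (- W) * H B = s' + lat a' b'" using lift[OF B l'] by blast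
 have "s + s' = (halfs m1 m2 - W * H B) + (halfs m1 m2 - (- W) * H B) - lat a b - lat a' b'"
  unfolding 1 2 by simp
 also have "\<dots> = lat (m2 - a - a') (- m1 - b - b')" by (simp add: halfs_def algebra_simps)
 finally have e: "s + s' = lat (m2 - a - a') (- m1 - b - b')" .
 show ?thesis unfolding e by (rule lattice_I)
qed

lemma addition_map_lift: "is_lift B W s c ==> addition_map n \<tau> (Some (B, W)) = torus_class \<tau> s"
 by (simp add: finite_addition_map_lift)

lemma curve_iff: "Some (B, W) \<in> spectral_curve_closure n \<tau> \<longleftrightarrow> W ^ 2 = poly Qp B"
 by (auto simp: spectral_curve_closure_def spectral_curve_def Qp_def)

lemma addition_map_in_torus: "addition_map n \<tau> \<in> spectral_curve_closure n \<tau> \<rightarrow> torus \<tau>"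
proof
 fix x assume x: "x \<in> spectral_curve_closure n \<tau>"
 show "addition_map n \<tau> x \<in> torus \<tau>"
 proof (cases x)
  case None thus ?thesis by (simp add: torus_class_in)
 next
  case (Some p)
  obtain B W where p: "p = (B, W)" by (cases p)
  have "W ^ 2 = poly Qp B" using x curve_iff by (simp add: Some p)
  then obtain s c where l: "is_lift B W s c" using lift_exists by blast
  show ?thesis unfolding Some p addition_map_lift[OF l] by (rule torus_class_in)
 qed
qed

text \<open>The two points over a root \<open>B\<close> of \<open>\<wp>(s) = \<wp>(t)\<close> are mapped to \<open>[t]\<close> and \<open>[-t]\<close>, which are different.\<close>
lemma fibre_card:
 fixes P D :: "complex poly"
 assumes t: "2 * t \<notin> L" and PD: "\<And>B. poly D B = 0 \<longleftrightarrow> sB B \<in> L" "\<And>B. sB B \<notin> L ==> poly P B = RR B * poly D B" "\<And>B. sB B \<in> L ==> poly P B \<noteq> 0"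
 shows "bij_betw (\<lambda>x. fst (the x)) {x \<in> spectral_curve_closure n \<tau>. addition_map n \<tau> x = torus_class \<tau> t} {B. poly P B = wp \<tau> t * poly D B}"
  (is "bij_betw ?f ?X ?Y")
proof -
 have t0: "t \<notin> L"
 proof
  assume "t \<in> L"
  from lattice_add[OF this this] show False using t unfolding mult_2 by blast
 qed
 have X: "\<exists>B W s c. x = Some (B, W) \<and> W ^ 2 = poly Qp B \<and> is_lift B W s c \<and> s - t \<in> L" if x: "x \<in> ?X" for x
 proof (cases x)
  case None
  hence "0 - t \<in> L" using x torus_class_eq_iff by simp
  thus ?thesis using t0 lattice_uminus[of "0 - t"] by simp
 next
  case (Some p)
  obtain B W where p: "p = (B, W)" by (cases p)
  have W: "W ^ 2 = poly Qp B" using x curve_iff by (simp add: Some p)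
  then obtain s c where l: "is_lift B W s c" using lift_exists by blast
  have "torus_class \<tau> s = torus_class \<tau> t" using x addition_map_lift[OF l] unfolding Some p by simp
  thus ?thesis using Some p W l torus_class_eq_iff by blast
 qed
 have val: "poly P B = wp \<tau> t * poly D B" if W: "W ^ 2 = poly Qp B" and l: "is_lift B W s c" and st: "s - t \<in> L" for B W s c
 proof -
  have s0: "s \<notin> L" using lattice_add_iff[OF st, of t] t0 by simp
  have ws: "wp \<tau> s = wp \<tau> t" using wp_periodic[OF st t0] by simp
  have "W = Wr B \<or> W = - Wr B" using W Wr[of B] by (metis power2_eq_iff)
  hence "sB B \<notin> L \<and> RR B = wp \<tau> t"
  proof
   assume "W = Wr B"
   hence "is_lift B (Wr B) s c" using l by simp
   from lift_unique[OF this lift_B] obtain a b :: int where "sB B = s + lat a b" by metis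
   thus ?thesis unfolding RR_def using lattice_add_iff[OF lattice_I[of a b], of s] wp_periodic[OF lattice_I[of a b] s0] s0 ws by simp
  next
   assume "W = - Wr B"
   hence "is_lift B (- Wr B) s c" using l by simp
   from opposite_lifts[OF lift_B this] have o: "sB B + s \<in> L" .
   have m: "- s \<notin> L" using s0 lattice_uminus[of "- s"] by auto
   have e: "sB B = - s + (sB B + s)" by simp
   have "sB B \<notin> L" using lattice_add_iff[OF o, of "- s"] m by simp
   moreover have "wp \<tau> (sB B) = wp \<tau> s" using wp_periodic[OF o m] wp_even[of s] by simp
   ultimately show ?thesis using ws by (simp add: RR_def)
  qed
  thus ?thesis using PD(2) by simp
 qed
 have inj: "inj_on ?f ?X"
 proof (rule inj_onI)
  fix x y assume x: "x \<in> ?X" and y: "y \<in> ?X" and e: "?f x = ?f y"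
  obtain B W s c where x': "x = Some (B, W)" "W ^ 2 = poly Qp B" "is_lift B W s c" "s - t \<in> L" using X[OF x] by blast
  obtain B' W' s' c' where y': "y = Some (B', W')" "W' ^ 2 = poly Qp B'" "is_lift B' W' s' c'" "s' - t \<in> L" using X[OF y] by blast
  have BB: "B' = B" using e by (simp add: x'(1) y'(1))
  have "W' \<noteq> - W \<or> W' = W"
  proof (rule ccontr)
   assume "\<not> ?thesis"
   hence "is_lift B (- W) s' c'" using y'(3) BB by simp
   from opposite_lifts[OF x'(3) this] have "s + s' \<in> L" .
   moreover have "(s - t) + (s' - t) \<in> L" by (rule lattice_add[OF x'(4) y'(4)])
   ultimately have d: "(s + s') - ((s - t) + (s' - t)) \<in> L" by (rule lattice_diff)
   have "(s + s') - ((s - t) + (s' - t)) = 2 * t" by (simp add: algebra_simps)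
   thus False using t d by (simp only:)
  qed
  moreover have "W' = W \<or> W' = - W" using x'(2) y'(2) BB by (metis power2_eq_iff)
  ultimately show "x = y" using x'(1) y'(1) BB by auto
 qed
 have sub: "?f ` ?X \<subseteq> ?Y"
 proof
  fix B assume "B \<in> ?f ` ?X"
  then obtain x where x: "x \<in> ?X" "B = ?f x" by blast
  obtain B' W s c where x': "x = Some (B', W)" "W ^ 2 = poly Qp B'" "is_lift B' W s c" "s - t \<in> L" using X[OF x(1)] by blast
  have "B = B'" by (simp add: x(2) x'(1))
  thus "B \<in> ?Y" using val[OF x'(2,3,4)] by simp
 qed
 have sup: "?Y \<subseteq> ?f ` ?X"
 proof
  fix B assume "B \<in> ?Y"
  hence B: "poly P B = wp \<tau> t * poly D B" by simp
  have sL: "sB B \<notin> L" using B PD(1,3)[of B] by auto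
  have "poly D B \<noteq> 0" using PD(1)[of B] sL by blast
  hence "wp \<tau> t = wp \<tau> (sB B)" using PD(2)[OF sL] B by (simp add: RR_def)
  from wp_level_set(2)[OF this t0 sL t] have "\<exists>W s c. W ^ 2 = poly Qp B \<and> is_lift B W s c \<and> s - t \<in> L"
  proof
   assume "sB B - t \<in> L"
   thus ?thesis using Wr[of B] lift_B[of B] by blast
  next
   assume st: "sB B + t \<in> L"
   have W: "(- Wr B) ^ 2 = poly Qp B" using Wr[of B] by simp
   then obtain s c where l: "is_lift B (- Wr B) s c" using lift_exists by blast
   have d: "(sB B + s) - (sB B + t) \<in> L" by (rule lattice_diff[OF opposite_lifts[OF lift_B l] st])
   have "(sB B + s) - (sB B + t) = s - t" by simp
   hence "s - t \<in> L" using d by (simp only:)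
   thus ?thesis using W l by blast
  qed
  then obtain W s c where W: "W ^ 2 = poly Qp B" and l: "is_lift B W s c" and st: "s - t \<in> L" by blast
  have "addition_map n \<tau> (Some (B, W)) = torus_class \<tau> t"
   unfolding addition_map_lift[OF l] torus_class_eq_iff by (rule st)
  hence "Some (B, W) \<in> ?X" using W curve_iff by simp
  thus "B \<in> ?f ` ?X" by (rule rev_image_eqI) simp
 qed
 show ?thesis unfolding bij_betw_def using inj sub sup by blast
qed

lemma torus_fund: assumes "p \<in> torus \<tau>" obtains z where "z \<in> fund" "p = torus_class \<tau> z"
proof -
 obtain w where w: "p = torus_class \<tau> w" by (rule torus_E[OF assms])
 have "\<exists>!q. q \<in> UNIV \<inter> fund \<and> w - q \<in> L" by (rule fund_reps) simp_all
 then obtain q where "q \<in> fund" "w - q \<in> L" by blast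
 thus thesis using that[of q] w torus_class_eq_iff by blast
qed

text \<open>The exceptional points are the two-torsion points and those over the critical values of \<open>RR\<close>. If all \<open>n\<^sub>k\<close> vanish, the
 map is constant.\<close>
theorem degree_of_addition_map: "has_degree (addition_map n \<tau>) (spectral_curve_closure n \<tau>) (torus \<tau>) DD"
 unfolding has_degree_def
proof (rule conjI[OF addition_map_in_torus])
 let ?X = "\<lambda>p. {x \<in> spectral_curve_closure n \<tau>. addition_map n \<tau> x = p}"
 show "finite {p \<in> torus \<tau>. \<not> (finite (?X p) \<and> card (?X p) = DD)}"
 proof (cases "DD = 0")
  case True
  have n0: "n k = 0" if "k \<le> 3" for k
  proof -
   have "n k * (n k + 1) div 2 = 0" using True that by (simp add: DD_def)
   moreover have "2 dvd n k * (n k + 1)" by simp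
   ultimately have "n k * (n k + 1) = 0" by (metis dvd_div_eq_0_iff)
   thus ?thesis by simp
  qed
  have const: "addition_map n \<tau> x = torus_class \<tau> 0" if x: "x \<in> spectral_curve_closure n \<tau>" for x
  proof (cases x)
   case (Some p)
   obtain B W where p: "p = (B, W)" by (cases p)
   have "W ^ 2 = poly Qp B" using x curve_iff by (simp add: Some p)
   then obtain s c where l: "is_lift B W s c" using lift_exists by blast
   then obtain A where A: "size A = NN" "s = shift A" unfolding is_lift_def by blast
   have "A = {#}" using A(1) n0 by (simp add: NN_def)
   hence "s = 0" using A(2) n0 by (simp add: shift_def)
   thus ?thesis unfolding Some p addition_map_lift[OF l] by simp
  qed simp
  have "{p \<in> torus \<tau>. \<not> (finite (?X p) \<and> card (?X p) = DD)} \<subseteq> {torus_class \<tau> 0}"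
  proof
   fix p assume p: "p \<in> {p \<in> torus \<tau>. \<not> (finite (?X p) \<and> card (?X p) = DD)}"
   show "p \<in> {torus_class \<tau> 0}"
   proof (rule ccontr)
    assume "p \<notin> {torus_class \<tau> 0}"
    hence e: "?X p = {}" using const by auto
    show False using p unfolding mem_Collect_eq e True by simp
   qed
  qed
  thus ?thesis by (rule finite_subset) simp
 next
  case False
  hence D1: "DD \<ge> 1" by simp
  from rational_RR[OF D1] obtain P D :: "complex poly" where PD: "degree P = DD" "degree D < DD" "D \<noteq> 0"
   "\<And>B. poly D B = 0 \<longleftrightarrow> sB B \<in> L" "\<And>B. sB B \<notin> L ==> poly P B = RR B * poly D B" "\<And>B. sB B \<in> L ==> poly P B \<noteq> 0" by blast
  from generic_fibre_of_rational[of D P, unfolded PD(1), OF PD(2,3)] PD(4,6)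
  obtain V where V: "finite V" "\<And>v. v \<notin> V ==> finite {B. poly P B = v * poly D B} \<and> card {B. poly P B = v * poly D B} = DD" by auto
  define Bad where "Bad = (HL \<inter> fund) \<union> (\<Union>v\<in>V. {z. wp \<tau> z = v \<and> z \<notin> L} \<inter> fund)"
  have "finite (HL \<inter> fund)" by (rule fund_finite[OF half_lattice_sparse])
  moreover have "finite ({z. wp \<tau> z = v \<and> z \<notin> L} \<inter> fund)" for v using wp_level_set(1)[of v] by simp
  ultimately have fB: "finite Bad" unfolding Bad_def using V(1) by blast
  have "{p \<in> torus \<tau>. \<not> (finite (?X p) \<and> card (?X p) = DD)} \<subseteq> torus_class \<tau> ` Bad"
  proof
   fix p assume p: "p \<in> {p \<in> torus \<tau>. \<not> (finite (?X p) \<and> card (?X p) = DD)}"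
   obtain z where z: "z \<in> fund" "p = torus_class \<tau> z" by (rule torus_fund[of p]) (use p in auto)
   have "z \<in> Bad"
   proof (rule ccontr)
    assume nb: "z \<notin> Bad"
    have h: "z \<notin> HL" using nb z(1) by (simp add: Bad_def)
    have t: "2 * z \<notin> L" using h by (simp add: half_lattice_def)
    have "z \<notin> L" using half_lattice_not_lattice h by blast
    hence "wp \<tau> z \<notin> V" using nb z(1) by (auto simp: Bad_def)
    from V(2)[OF this] bij_betw_finite[OF fibre_card[OF t PD(4,5,6)]] bij_betw_same_card[OF fibre_card[OF t PD(4,5,6)]]
    show False using p z(2) by simp
   qed
   thus "p \<in> torus_class \<tau> ` Bad" using z(2) by blast
  qed
  thus ?thesis by (rule finite_subset) (rule finite_imageI[OF fB])
 qed
qed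

end

theorem theorem1p2:
 fixes \<tau> :: complex and n :: "nat \<Rightarrow> nat"
 assumes "Im \<tau> > 0"
 shows "has_degree (addition_map n \<tau>) (spectral_curve_closure n \<tau>) (torus \<tau>)
     (\<Sum>k\<le>3. n k * (n k + 1) div 2)"
proof -
 interpret lame \<tau> n by unfold_locales fact
 show ?thesis using degree_of_addition_map unfolding DD_def .
qed

end
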